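(* Let $T\in(0,\infty)$, $p\in(1,\infty)$, let $X_0,X_1$ be Banach spaces with $X_1\hookrightarrow X_0$ densely and continuously, and let $A\colon[0,T]\to\mathcal{L}(X_1,X_0)$ be strongly measurable in the strong operator topology. Assume: (1) $A$ has maximal $L^p(0,T;X_0)$-regularity and there is a constant $C_A$ with $\|Au\|_{L^p(0,T;X_0)}\le C_A\|u\|_{E_p(0,T)}$ for all $u\in E_p(0,T)$; (2) there is a closed operator $A_0$ on $X_0$ such that $-A_0$ generates an analytic $C_0$-semigroup on $X_0$ and $D(A_0)=X_1$; (3) $B\colon[0,T]\to\mathcal{L}(X_1,(X_0,X_1)_{1-1/p,p})$ is strongly measurable in the strong operator topology and $\|B(t)\|_{\mathcal{L}(X_1,(X_0,X_1)_{1-1/p,p})}\le b(t)$ for some $b\in L^{p'}(0,T)$, $\frac1p+\frac1{p'}=1$. Then for all $u_0\in(X_0,X_1)_{1-1/p,p}$ and $f\in F_p(0,T)$, the problem $u'+(A+B)u=f$, $u(0)=u_0$ has a unique strong solution $u\in E_p(0,T)$ and \[\|u\|_{E_p(0,T)}\le C\big(\|u_0\|_{(X_0,X_1)_{1-1/p,p}}+\|f\|_{F_p(0,T)}\big),\] where $C$ is independent of $u_0$ and $f$, depends only on $A_0,X_0,X_1,p$, and nondecreasingly on $\|b\|_{L^{p'}(0,T)}$, $T$, $C_A$ and $M_{p,0,A}(0,T)$.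
   Context: $(X_0,X_1)_{\theta,q}$ denotes real interpolation; $D(A_0)=X_1$ means equality as sets with equivalent norms (graph norm). $E_p(s,t):=L^p(s,t;X_1)\cap C([s,t];(X_0,X_1)_{1-1/p,p})$ and $F_p(s,t):=L^p(s,t;X_0)+L^1(s,t;(X_0,X_1)_{1-1/p,p})$, the sum taken in $L^1(s,t;X_0)$ with norm $\inf\{\|g\|+\|h\|: f=g+h\}$. A strong solution of $u'+\mathcal{A}u=f$ on $(0,\tau)$, $u(0)=u_0$ (for $\mathcal{A}\colon[0,T]\to\mathcal{L}(X_1,X_0)$, $f\in L^1(0,\tau;X_0)$) is $u\in L^1(0,\tau;X_1)\cap W^{1,1}(0,\tau;X_0)$ with $\mathcal{A}u\in L^1(0,\tau;X_0)$, $u(0)=u_0$, and $u'+\mathcal{A}u=f$ a.e. $\mathcal{A}$ has maximal $L^p(0,T;X_0)$-regularity if for every $f\in L^p(0,T;X_0)$ there is a unique strong solution $u\in L^p(0,T;X_1)\cap W^{1,p}(0,T;X_0)$ with $u(0)=0$, and there is $C$ such that for every $\tau\in(0,T]$ and every strong solution $v\in L^p(0,\tau;X_1)\cap W^{1,p}(0,\tau;X_0)$ on $(0,\tau)$ with $v(0)=0$, $\max\{\|v\|_{L^p(0,\tau;X_1)},\|v\|_{W^{1,p}(0,\tau;X_0)}\}\le C\|f\|_{L^p(0,\tau;X_0)}$; the infimum of such $C$ is $M_{p,0,\mathcal{A}}(0,T)$. *)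

theory Defs
  imports "HOL-Analysis.Analysis"
begin

text \<open>X0 is the real Banach space of type 'a; X1 is a subset of X0 carrying its own
norm n1 (only its values on X1 matter).\<close>

definition embedded_banach :: "'a::banach set \<Rightarrow> ('a \<Rightarrow> real) \<Rightarrow> bool" where
  "embedded_banach X1 n1 \<longleftrightarrow>
     subspace X1 \<and>
     (\<forall>x\<in>X1. 0 \<le> n1 x \<and> (n1 x = 0 \<longleftrightarrow> x = 0)) \<and>
     (\<forall>x\<in>X1. \<forall>y\<in>X1. n1 (x + y) \<le> n1 x + n1 y) \<and>
     (\<forall>x\<in>X1. \<forall>c. n1 (c *\<^sub>R x) = \<bar>c\<bar> * n1 x) \<and>
     (\<forall>s::nat \<Rightarrow> 'a. (\<forall>n. s n \<in> X1) \<longrightarrow>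
        (\<forall>e>0. \<exists>N. \<forall>m\<ge>N. \<forall>n\<ge>N. n1 (s m - s n) < e) \<longrightarrow>
        (\<exists>x\<in>X1. (\<lambda>n. n1 (s n - x)) \<longlonglongrightarrow> 0)) \<and>
     (\<exists>c>0. \<forall>x\<in>X1. norm x \<le> c * n1 x) \<and>
     closure X1 = UNIV"

definition bounded_lin_on ::
  "'a::real_vector set \<Rightarrow> ('a \<Rightarrow> real) \<Rightarrow> 'b::real_vector set \<Rightarrow> ('b \<Rightarrow> real) \<Rightarrow> ('a \<Rightarrow> 'b) \<Rightarrow> bool" where
  "bounded_lin_on S N1 R N2 L \<longleftrightarrow>
     (\<forall>x\<in>S. L x \<in> R) \<and>
     (\<forall>x\<in>S. \<forall>y\<in>S. L (x + y) = L x + L y) \<and>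
     (\<forall>x\<in>S. \<forall>c. L (c *\<^sub>R x) = c *\<^sub>R L x) \<and>
     (\<exists>K. \<forall>x\<in>S. N2 (L x) \<le> K * N1 x)"

definition Kfun :: "'a::real_normed_vector set \<Rightarrow> ('a \<Rightarrow> real) \<Rightarrow> real \<Rightarrow> 'a \<Rightarrow> real" where
  "Kfun X1 n1 t x = Inf {norm x0 + t * n1 x1 | x0 x1. x1 \<in> X1 \<and> x = x0 + x1}"

definition interp_int :: "'a::real_normed_vector set \<Rightarrow> ('a \<Rightarrow> real) \<Rightarrow> real \<Rightarrow> real \<Rightarrow> 'a \<Rightarrow> ennreal" where
  "interp_int X1 n1 \<theta> q x =
     (\<integral>\<^sup>+ s\<in>{0<..}. ennreal ((s powr (-\<theta>) * Kfun X1 n1 s x) powr q / s) \<partial>lebesgue)"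

definition interp_space :: "'a::real_normed_vector set \<Rightarrow> ('a \<Rightarrow> real) \<Rightarrow> real \<Rightarrow> real \<Rightarrow> 'a set" where
  "interp_space X1 n1 \<theta> q = {x. interp_int X1 n1 \<theta> q x < \<infinity>}"

definition interp_norm :: "'a::real_normed_vector set \<Rightarrow> ('a \<Rightarrow> real) \<Rightarrow> real \<Rightarrow> real \<Rightarrow> 'a \<Rightarrow> real" where
  "interp_norm X1 n1 \<theta> q x = enn2real (interp_int X1 n1 \<theta> q x) powr (1 / q)"

definition strongly_meas ::
  "('a::real_vector \<Rightarrow> real) \<Rightarrow> 'a set \<Rightarrow> real \<Rightarrow> real \<Rightarrow> (real \<Rightarrow> 'a) \<Rightarrow> bool" where
  "strongly_meas N S a b f \<longleftrightarrow>
     (AE t in lebesgue. t \<in> {a<..<b} \<longrightarrow> f t \<in> S) \<and>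
     (\<exists>s :: nat \<Rightarrow> real \<Rightarrow> 'a.
        (\<forall>n. finite (range (s n)) \<and> range (s n) \<subseteq> S \<and>
             (\<forall>y. s n -` {y} \<in> sets lebesgue)) \<and>
        (AE t in lebesgue. t \<in> {a<..<b} \<longrightarrow> (\<lambda>n. N (s n t - f t)) \<longlonglongrightarrow> 0))"

definition Lp_int :: "real \<Rightarrow> ('a \<Rightarrow> real) \<Rightarrow> real \<Rightarrow> real \<Rightarrow> (real \<Rightarrow> 'a) \<Rightarrow> ennreal" where
  "Lp_int p N a b f = (\<integral>\<^sup>+ t\<in>{a<..<b}. ennreal (N (f t) powr p) \<partial>lebesgue)"

definition in_Lp :: "real \<Rightarrow> ('a::real_vector \<Rightarrow> real) \<Rightarrow> 'a set \<Rightarrow> real \<Rightarrow> real \<Rightarrow> (real \<Rightarrow> 'a) \<Rightarrow> bool" where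
  "in_Lp p N S a b f \<longleftrightarrow> strongly_meas N S a b f \<and> Lp_int p N a b f < \<infinity>"

definition Lp_norm :: "real \<Rightarrow> ('a \<Rightarrow> real) \<Rightarrow> real \<Rightarrow> real \<Rightarrow> (real \<Rightarrow> 'a) \<Rightarrow> real" where
  "Lp_norm p N a b f = enn2real (Lp_int p N a b f) powr (1 / p)"

definition is_deriv :: "real \<Rightarrow> (real \<Rightarrow> 'a::banach) \<Rightarrow> (real \<Rightarrow> 'a) \<Rightarrow> bool" where
  "is_deriv \<tau> u g \<longleftrightarrow> in_Lp 1 norm UNIV 0 \<tau> g \<and>
     (\<forall>t\<in>{0..\<tau>}. (g has_integral (u t - u 0)) {0..t})"

definition strong_sol ::
  "'a::banach set \<Rightarrow> ('a \<Rightarrow> real) \<Rightarrow> real \<Rightarrow> (real \<Rightarrow> 'a \<Rightarrow> 'a) \<Rightarrow> (real \<Rightarrow> 'a) \<Rightarrow> 'a \<Rightarrow> (real \<Rightarrow> 'a) \<Rightarrow> bool" where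
  "strong_sol X1 n1 \<tau> Op f u0 u \<longleftrightarrow>
     in_Lp 1 n1 X1 0 \<tau> u \<and> in_Lp 1 norm UNIV 0 \<tau> u \<and>
     in_Lp 1 norm UNIV 0 \<tau> (\<lambda>t. Op t (u t)) \<and> u 0 = u0 \<and>
     (\<exists>g. is_deriv \<tau> u g \<and>
        (AE t in lebesgue. t \<in> {0<..<\<tau>} \<longrightarrow> g t + Op t (u t) = f t))"

definition MR_bound ::
  "'a::banach set \<Rightarrow> ('a \<Rightarrow> real) \<Rightarrow> real \<Rightarrow> real \<Rightarrow> (real \<Rightarrow> 'a \<Rightarrow> 'a) \<Rightarrow> real \<Rightarrow> bool" where
  "MR_bound X1 n1 p T A C \<longleftrightarrow>
     (\<forall>\<tau>\<in>{0<..T}. \<forall>f v g.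
        in_Lp p norm UNIV 0 \<tau> f \<longrightarrow> strong_sol X1 n1 \<tau> A f 0 v \<longrightarrow>
        in_Lp p n1 X1 0 \<tau> v \<longrightarrow> in_Lp p norm UNIV 0 \<tau> v \<longrightarrow>
        is_deriv \<tau> v g \<longrightarrow> in_Lp p norm UNIV 0 \<tau> g \<longrightarrow>
        max (Lp_norm p n1 0 \<tau> v) (Lp_norm p norm 0 \<tau> v + Lp_norm p norm 0 \<tau> g)
          \<le> C * Lp_norm p norm 0 \<tau> f)"

definition max_reg ::
  "'a::banach set \<Rightarrow> ('a \<Rightarrow> real) \<Rightarrow> real \<Rightarrow> real \<Rightarrow> (real \<Rightarrow> 'a \<Rightarrow> 'a) \<Rightarrow> bool" where
  "max_reg X1 n1 p T A \<longleftrightarrow>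
     (\<forall>f. in_Lp p norm UNIV 0 T f \<longrightarrow>
        (\<exists>u. strong_sol X1 n1 T A f 0 u \<and> in_Lp p n1 X1 0 T u \<and> in_Lp p norm UNIV 0 T u \<and>
             (\<exists>g. is_deriv T u g \<and> in_Lp p norm UNIV 0 T g) \<and>
           (\<forall>v. strong_sol X1 n1 T A f 0 v \<and> in_Lp p n1 X1 0 T v \<and> in_Lp p norm UNIV 0 T v \<and>
                (\<exists>g. is_deriv T v g \<and> in_Lp p norm UNIV 0 T g)
                \<longrightarrow> (\<forall>t\<in>{0..T}. v t = u t)))) \<and>
     (\<exists>C. MR_bound X1 n1 p T A C)"

definition MR_const ::
  "'a::banach set \<Rightarrow> ('a \<Rightarrow> real) \<Rightarrow> real \<Rightarrow> real \<Rightarrow> (real \<Rightarrow> 'a \<Rightarrow> 'a) \<Rightarrow> real" where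
  "MR_const X1 n1 p T A = Inf {C. MR_bound X1 n1 p T A C}"

definition in_Ep :: "'a::banach set \<Rightarrow> ('a \<Rightarrow> real) \<Rightarrow> real \<Rightarrow> real \<Rightarrow> (real \<Rightarrow> 'a) \<Rightarrow> bool" where
  "in_Ep X1 n1 p \<tau> u \<longleftrightarrow> in_Lp p n1 X1 0 \<tau> u \<and>
     (\<forall>t\<in>{0..\<tau>}. u t \<in> interp_space X1 n1 (1 - 1/p) p \<and>
        ((\<lambda>s. interp_norm X1 n1 (1 - 1/p) p (u s - u t)) \<longlongrightarrow> 0) (at t within {0..\<tau>}))"

definition Ep_norm :: "'a::banach set \<Rightarrow> ('a \<Rightarrow> real) \<Rightarrow> real \<Rightarrow> real \<Rightarrow> (real \<Rightarrow> 'a) \<Rightarrow> real" where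
  "Ep_norm X1 n1 p \<tau> u = Lp_norm p n1 0 \<tau> u +
     (SUP t\<in>{0..\<tau>}. interp_norm X1 n1 (1 - 1/p) p (u t))"

definition Fp_decomp ::
  "'a::banach set \<Rightarrow> ('a \<Rightarrow> real) \<Rightarrow> real \<Rightarrow> real \<Rightarrow> (real \<Rightarrow> 'a) \<Rightarrow> (real \<Rightarrow> 'a) \<Rightarrow> (real \<Rightarrow> 'a) \<Rightarrow> bool" where
  "Fp_decomp X1 n1 p \<tau> f g h \<longleftrightarrow> in_Lp p norm UNIV 0 \<tau> g \<and>
     in_Lp 1 (interp_norm X1 n1 (1 - 1/p) p) (interp_space X1 n1 (1 - 1/p) p) 0 \<tau> h \<and>
     (AE t in lebesgue. t \<in> {0<..<\<tau>} \<longrightarrow> f t = g t + h t)"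

definition in_Fp :: "'a::banach set \<Rightarrow> ('a \<Rightarrow> real) \<Rightarrow> real \<Rightarrow> real \<Rightarrow> (real \<Rightarrow> 'a) \<Rightarrow> bool" where
  "in_Fp X1 n1 p \<tau> f \<longleftrightarrow> (\<exists>g h. Fp_decomp X1 n1 p \<tau> f g h)"

definition Fp_norm :: "'a::banach set \<Rightarrow> ('a \<Rightarrow> real) \<Rightarrow> real \<Rightarrow> real \<Rightarrow> (real \<Rightarrow> 'a) \<Rightarrow> real" where
  "Fp_norm X1 n1 p \<tau> f = Inf {Lp_norm p norm 0 \<tau> g +
       Lp_norm 1 (interp_norm X1 n1 (1 - 1/p) p) 0 \<tau> h | g h. Fp_decomp X1 n1 p \<tau> f g h}"

definition closed_op :: "'a::real_normed_vector set \<Rightarrow> ('a \<Rightarrow> 'a) \<Rightarrow> bool" where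
  "closed_op D L \<longleftrightarrow> closed {(x, L x) | x. x \<in> D}"

definition graph_norm_equiv :: "'a::real_normed_vector set \<Rightarrow> ('a \<Rightarrow> real) \<Rightarrow> ('a \<Rightarrow> 'a) \<Rightarrow> bool" where
  "graph_norm_equiv X1 n1 L \<longleftrightarrow> (\<exists>c1>0. \<exists>c2>0. \<forall>x\<in>X1.
      n1 x \<le> c1 * (norm x + norm (L x)) \<and> norm x + norm (L x) \<le> c2 * n1 x)"

definition c0_semigroup :: "(real \<Rightarrow> 'a::real_normed_vector \<Rightarrow> 'a) \<Rightarrow> bool" where
  "c0_semigroup S \<longleftrightarrow> (\<forall>t\<ge>0. bounded_linear (S t)) \<and> S 0 = id \<and>
     (\<forall>t\<ge>0. \<forall>s\<ge>0. S (t + s) = S t \<circ> S s) \<and>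
     (\<forall>x. ((\<lambda>t. S t x) \<longlongrightarrow> x) (at_right 0))"

definition generates :: "'a::real_normed_vector set \<Rightarrow> ('a \<Rightarrow> 'a) \<Rightarrow> (real \<Rightarrow> 'a \<Rightarrow> 'a) \<Rightarrow> bool" where
  "generates D G S \<longleftrightarrow> c0_semigroup S \<and>
     D = {x. \<exists>y. ((\<lambda>h. (1 / h) *\<^sub>R (S h x - x)) \<longlongrightarrow> y) (at_right 0)} \<and>
     (\<forall>x\<in>D. ((\<lambda>h. (1 / h) *\<^sub>R (S h x - x)) \<longlongrightarrow> G x) (at_right 0))"

text \<open>Multiplication by complex scalars on the complexification X0 x X0 (pair (x,y) = x + iy).\<close>
definition cmul :: "complex \<Rightarrow> 'a::real_vector \<times> 'a \<Rightarrow> 'a \<times> 'a" where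
  "cmul c v = (Re c *\<^sub>R fst v - Im c *\<^sub>R snd v, Re c *\<^sub>R snd v + Im c *\<^sub>R fst v)"

definition sector :: "real \<Rightarrow> complex set" where
  "sector \<delta> = {z. z \<noteq> 0 \<and> \<bar>Arg z\<bar> < \<delta>}"

text \<open>Analytic C0-semigroup (Pazy, Def. 2.5.1), for real spaces via the complexification.\<close>
definition analytic_semigroup :: "(real \<Rightarrow> 'a::real_normed_vector \<Rightarrow> 'a) \<Rightarrow> bool" where
  "analytic_semigroup S \<longleftrightarrow> c0_semigroup S \<and>
     (\<exists>\<delta>. 0 < \<delta> \<and> \<delta> \<le> pi / 2 \<and>
       (\<exists>Tz :: complex \<Rightarrow> 'a \<times> 'a \<Rightarrow> 'a \<times> 'a.
          (\<forall>z\<in>sector \<delta>. bounded_linear (Tz z) \<and> (\<forall>c v. Tz z (cmul c v) = cmul c (Tz z v))) \<and>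
          (\<forall>t>0. \<forall>x y. Tz (complex_of_real t) (x, y) = (S t x, S t y)) \<and>
          (\<forall>z1\<in>sector \<delta>. \<forall>z2\<in>sector \<delta>. Tz (z1 + z2) = Tz z1 \<circ> Tz z2) \<and>
          (\<forall>v. ((\<lambda>z. Tz z v) \<longlongrightarrow> v) (at 0 within sector \<delta>)) \<and>
          (\<forall>v. \<forall>z\<in>sector \<delta>. \<exists>d. ((\<lambda>w. Tz w v) has_derivative (\<lambda>h. cmul h d)) (at z))))"

definition neg_generates_analytic :: "'a::real_normed_vector set \<Rightarrow> ('a \<Rightarrow> 'a) \<Rightarrow> bool" where
  "neg_generates_analytic D A0 \<longleftrightarrow>
     (\<exists>S. generates D (\<lambda>x. - A0 x) S \<and> analytic_semigroup S)"

end

theory Submission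
  imports Defs
begin

text \<open>
  The operator \<open>A + B\<close> is treated as a Volterra-type perturbation of \<open>A\<close>.

  Write \<open>X\<^sub>\<gamma>\<close> for the trace space \<open>(X\<^sub>0, X\<^sub>1)\<close> with parameters \<open>1 - 1/p, p\<close>. Splitting \<open>x \<in> X\<^sub>\<gamma>\<close>
  almost optimally for the K-functional at the times \<open>2\<^sup>-\<^sup>k\<close> and interpolating linearly gives a function \<open>u\<close>
  with \<open>u(0) = x\<close> such that \<open>n1 (u t)\<close> and \<open>\<parallel>u'(t)\<parallel>\<close> are at most a constant times \<open>K(t, x) / t\<close>,
  whose \<open>L\<^sup>p\<close> norm is the norm of \<open>x\<close>. For a source \<open>h = x 1\<^bsub>[a,a+l]\<^esub>\<close> the function
  \<open>w(t) = min (t - a) l u(t - a)\<close> then absorbs \<open>h\<close>: both \<open>w\<close> and \<open>w' - h\<close> are bounded by \<open>l\<close> times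
  the norm of \<open>x\<close> in the maximal regularity norms. By density every \<open>h \<in> L\<^sup>1(X\<^sub>\<gamma>)\<close> can be absorbed,
  and maximal regularity of \<open>A\<close> together with the trace embedding (Hardy's inequality) solves
  \<open>u' + A u = g + h\<close> with initial value in \<open>X\<^sub>\<gamma>\<close>.

  Since the solution operator is causal, \<open>u \<mapsto> - B u\<close> followed by it satisfies
  \<open>\<parallel>v\<parallel>\<^bsub>L\<^sup>p(0,t;X\<^sub>1)\<^esub> \<le> C \<integral>\<^sub>0\<^sup>t b n1(u)\<close>. In an equivalent norm, weighted over finitely many time intervals on
  which \<open>b\<close> is small, this is a contraction.
\<close>

section \<open>Norm bounds in scalar Lebesgue spaces\<close>

text \<open>The obstacle: \<open>B u\<close> lies only in L^1 with values in the trace space, since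
  \<open>b\<close> is in L^p' and \<open>u\<close> in L^p with values in \<open>X1\<close>; it
  cannot be fed to maximal regularity as an L^p source in X0. Taken as such a source, x 1_[a,a+l]
  would cost a multiple of l^(1/p), and these costs do not add up over many short intervals. The
  ramp min (t - a) l makes the cost linear in l, hence proportional to the L^1 norm of the source,
  and this is what permits superposition up to all L^1 sources. The extension is made from
  K-functional splittings, so its constants involve only the couple. The iteration is measured in
  L^p(0,T;X1), the norm that enters the bound for \<open>B u\<close>; the final E_p bound comes from
  one more solution of the unperturbed problem. No problem is ever solved on a short interval, so no
  constant depends on the length of one: sources are cut off in time, solved on (0,T), and causality
  gives the estimate on (0,\<tau>).\<close>

definition Lp_le :: "real \<Rightarrow> 'b measure \<Rightarrow> ('b \<Rightarrow> real) \<Rightarrow> real \<Rightarrow> bool" where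
  "Lp_le p M f C \<longleftrightarrow> 0 \<le> C \<and> f \<in> borel_measurable M \<and> (AE x in M. 0 \<le> f x) \<and>
     (\<integral>\<^sup>+ x. ennreal (f x powr p) \<partial>M) \<le> ennreal (C powr p)"

lemma Lp_leD:
  assumes "Lp_le p M f C"
  shows "0 \<le> C" "f \<in> borel_measurable M" "AE x in M. 0 \<le> f x"
    "(\<integral>\<^sup>+ x. ennreal (f x powr p) \<partial>M) \<le> ennreal (C powr p)"
  using assms unfolding Lp_le_def by auto

lemma Lp_le_mono:
  assumes g: "Lp_le p M g C" and f: "f \<in> borel_measurable M" "AE x in M. 0 \<le> f x \<and> f x \<le> g x"
    and "C \<le> D" "0 \<le> p"
  shows "Lp_le p M f D"
proof -
  have "(\<integral>\<^sup>+ x. ennreal (f x powr p) \<partial>M) \<le> (\<integral>\<^sup>+ x. ennreal (g x powr p) \<partial>M)"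
    by (rule nn_integral_mono_AE) (use f(2) assms(5) in \<open>auto intro!: ennreal_leI powr_mono2\<close>)
  also have "\<dots> \<le> ennreal (C powr p)" using Lp_leD(4)[OF g] .
  also have "\<dots> \<le> ennreal (D powr p)"
    using Lp_leD(1)[OF g] assms(4,5) by (intro ennreal_leI powr_mono2) auto
  finally show ?thesis using Lp_leD[OF g] assms unfolding Lp_le_def by auto
qed

lemma Lp_le_bound_mono: "Lp_le p M f C \<Longrightarrow> C \<le> D \<Longrightarrow> 0 \<le> p \<Longrightarrow> Lp_le p M f D"
  by (rule Lp_le_mono[of p M f C]) (auto dest: Lp_leD)

lemma Lp_le_cong_AE:
  assumes g: "Lp_le p M g C" and f: "f \<in> borel_measurable M" "AE x in M. f x = g x" "0 \<le> p"
  shows "Lp_le p M f C"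
  by (rule Lp_le_mono[OF g f(1)]) (use f Lp_leD(3)[OF g] in auto)

text \<open>Lets a proof replace its bounds by strictly larger, hence positive ones. Minkowski and
  Hoelder below divide by the bounds and use this to cover vanishing ones.\<close>

lemma Lp_le_closed:
  fixes D :: "real \<Rightarrow> real"
  assumes p: "0 < p" and C: "0 \<le> C"
    and lim: "(D \<longlongrightarrow> C) (at_right 0)" and *: "\<And>e. 0 < e \<Longrightarrow> Lp_le p M f (D e)"
  shows "Lp_le p M f C"
proof -
  have "((\<lambda>e. ennreal (D e powr p)) \<longlongrightarrow> ennreal (C powr p)) (at_right 0)"
  proof (intro tendsto_ennrealI tendsto_powr2 lim tendsto_const p)
    show "\<forall>\<^sub>F e in at_right 0. 0 \<le> D e"
      by (rule eventually_mono[OF eventually_at_right_less]) (use * in \<open>auto dest: Lp_leD(1)\<close>)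
  qed
  moreover have "\<forall>\<^sub>F e in at_right 0. (\<integral>\<^sup>+ x. ennreal (f x powr p) \<partial>M) \<le> ennreal (D e powr p)"
    by (rule eventually_mono[OF eventually_at_right_less]) (use * in \<open>auto dest: Lp_leD(4)\<close>)
  ultimately have "(\<integral>\<^sup>+ x. ennreal (f x powr p) \<partial>M) \<le> ennreal (C powr p)"
    by (rule tendsto_lowerbound) simp
  then show ?thesis using C Lp_leD[OF *[of 1]] unfolding Lp_le_def by auto
qed

lemma ennreal_lincomb:
  "0 \<le> a \<Longrightarrow> 0 \<le> b \<Longrightarrow> 0 \<le> c \<Longrightarrow> 0 \<le> d \<Longrightarrow>
    ennreal a * ennreal b + ennreal c * ennreal d = ennreal (a * b + c * d)"
  by (simp add: ennreal_mult)

text \<open>Convexity of \<open>x powr p\<close> at x / A and y / B with weights A / (A + B) and B /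
  (A + B). If A and B bound the norms of two functions, integrating the right-hand side gives at
  most (A + B) powr p, which is Minkowski's inequality without duality.\<close>

lemma powr_add_le_weighted:
  fixes x y A B p :: real
  assumes "1 \<le> p" "0 \<le> x" "0 \<le> y" "0 < A" "0 < B"
  shows "(x + y) powr p \<le> (A + B) powr (p - 1) * (A powr (1 - p) * x powr p + B powr (1 - p) * y powr p)"
proof -
  have *: "z powr p \<le> (A + B) powr (p - 1) * (D powr (1 - p) * z powr p)" if "0 < D" "D \<le> A + B" "0 \<le> z" for D z
  proof -
    have "1 = D powr (p - 1) * D powr (1 - p)" using that by (simp add: powr_add[symmetric])
    also have "\<dots> \<le> (A + B) powr (p - 1) * D powr (1 - p)"
      using that assms by (intro mult_right_mono powr_mono2) auto
    finally have "1 * z powr p \<le> ((A + B) powr (p - 1) * D powr (1 - p)) * z powr p"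
      by (rule mult_right_mono) simp
    then show ?thesis by (simp add: mult_ac)
  qed
  \<comment> \<open>Convexity is available on the open half-line, so vanishing arguments are treated
    apart.\<close>
  consider "x = 0" | "y = 0" | "0 < x" "0 < y" using assms by linarith
  then show ?thesis
  proof cases
    case 1 then show ?thesis using *[of B y] assms by simp
  next
    case 2 then show ?thesis using *[of A x] assms by simp
  next
    case 3
    define a b where "a = A / (A + B)" and "b = B / (A + B)"
    have ab: "0 \<le> a" "0 \<le> b" "a + b = 1" using assms by (auto simp: a_def b_def add_divide_distrib[symmetric])
    have "convex_on {0<..} (\<lambda>x::real. x powr p)" by (rule powr_convex) fact
    moreover have "a = 1 - b" using ab by simp
    ultimately have "(a *\<^sub>R (x / A) + b *\<^sub>R (y / B)) powr p \<le> a * (x / A) powr p + b * (y / B) powr p"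
      using convex_onD[of "{0<..}" "\<lambda>x::real. x powr p" b "x / A" "y / B"] ab(2) 3 assms by (simp add: a_def b_def)
    moreover have "a *\<^sub>R (x / A) + b *\<^sub>R (y / B) = (x + y) / (A + B)"
      using assms by (simp add: a_def b_def add_divide_distrib)
    ultimately have "((x + y) / (A + B)) powr p \<le> a * (x / A) powr p + b * (y / B) powr p" by simp
    then have "(x + y) powr p \<le> (A + B) powr p * (a * (x / A) powr p + b * (y / B) powr p)"
      using assms 3 by (simp add: powr_divide divide_le_eq mult.commute)
    also have "\<dots> = (A + B) powr (p - 1) * (A * (x / A) powr p + B * (y / B) powr p)"
      using assms by (simp add: a_def b_def powr_diff add_divide_distrib distrib_left)
    also have "A * (x / A) powr p = A powr (1 - p) * x powr p"
      using assms 3 by (simp add: powr_divide powr_diff)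
    also have "B * (y / B) powr p = B powr (1 - p) * y powr p"
      using assms 3 by (simp add: powr_divide powr_diff)
    finally show ?thesis .
  qed
qed

lemma Lp_le_add:
  assumes p: "1 \<le> p" and f: "Lp_le p M f A" and g: "Lp_le p M g B"
  shows "Lp_le p M (\<lambda>x. f x + g x) (A + B)"
proof (rule Lp_le_closed)
  note [measurable] = Lp_leD(2)[OF f] Lp_leD(2)[OF g]
  show "((\<lambda>e. (A + e) + (B + e)) \<longlongrightarrow> A + B) (at_right 0)" by (auto intro!: tendsto_eq_intros)
  fix e :: real assume e: "0 < e"
  define A' B' where "A' = A + e" and "B' = B + e"
  have AB: "0 < A'" "0 < B'" using e Lp_leD(1)[OF f] Lp_leD(1)[OF g] by (auto simp: A'_def B'_def)
  have f': "Lp_le p M f A'" and g': "Lp_le p M g B'"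
    using e p Lp_le_bound_mono[OF f, of A'] Lp_le_bound_mono[OF g, of B'] by (auto simp: A'_def B'_def)
  have "(\<integral>\<^sup>+ x. ennreal ((f x + g x) powr p) \<partial>M) \<le>
     (\<integral>\<^sup>+ x. ennreal ((A' + B') powr (p - 1)) * (ennreal (A' powr (1 - p)) * ennreal (f x powr p)
        + ennreal (B' powr (1 - p)) * ennreal (g x powr p)) \<partial>M)"
  proof (rule nn_integral_mono_AE)
    show "AE x in M. ennreal ((f x + g x) powr p) \<le> ennreal ((A' + B') powr (p - 1)) * (ennreal (A' powr (1 - p)) * ennreal (f x powr p)
        + ennreal (B' powr (1 - p)) * ennreal (g x powr p))"
      using Lp_leD(3)[OF f] Lp_leD(3)[OF g]
    proof eventually_elim
      case (elim x)
      show ?case using powr_add_le_weighted[OF p elim AB]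
        by (subst ennreal_lincomb; simp add: ennreal_mult[symmetric] ennreal_leI del: ennreal_plus)
    qed
  qed
  also have "\<dots> = ennreal ((A' + B') powr (p - 1)) * (ennreal (A' powr (1 - p)) * (\<integral>\<^sup>+ x. ennreal (f x powr p) \<partial>M)
        + ennreal (B' powr (1 - p)) * (\<integral>\<^sup>+ x. ennreal (g x powr p) \<partial>M))"
    by (simp add: nn_integral_cmult nn_integral_add)
  also have "\<dots> \<le> ennreal ((A' + B') powr (p - 1)) * (ennreal (A' powr (1 - p)) * ennreal (A' powr p)
        + ennreal (B' powr (1 - p)) * ennreal (B' powr p))"
    by (intro mult_left_mono add_mono Lp_leD(4)[OF f'] Lp_leD(4)[OF g']) auto
  also have "\<dots> = ennreal ((A' + B') powr (p - 1) * (A' + B'))"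
    using AB by (subst ennreal_lincomb; simp add: ennreal_mult[symmetric] powr_add[symmetric] del: ennreal_plus)
  also have "(A' + B') powr (p - 1) * (A' + B') = (A' + B') powr p"
    using AB by (simp add: powr_diff)
  finally show "Lp_le p M (\<lambda>x. f x + g x) ((A + e) + (B + e))"
    using AB Lp_leD(3)[OF f] Lp_leD(3)[OF g] unfolding Lp_le_def A'_def B'_def by auto
qed (use p Lp_leD(1)[OF f] Lp_leD(1)[OF g] in auto)

lemma Lp_le_zero: "0 \<le> C \<Longrightarrow> 0 < p \<Longrightarrow> Lp_le p M (\<lambda>x. 0) C"
  unfolding Lp_le_def by simp

lemma Lp_le_sum:
  assumes "1 \<le> p" "\<And>i. i \<in> I \<Longrightarrow> Lp_le p M (f i) (c i)"
  shows "Lp_le p M (\<lambda>x. \<Sum>i\<in>I. f i x) (\<Sum>i\<in>I. c i)"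
  using assms(2)
proof (induction I rule: infinite_finite_induct)
  case (insert x F)
  then show ?case using Lp_le_add[OF assms(1), of M "f x" "c x" "\<lambda>y. \<Sum>i\<in>F. f i y" "\<Sum>i\<in>F. c i"] by simp
qed (use assms(1) in \<open>auto intro: Lp_le_zero\<close>)

lemma Lp_le_cmult:
  assumes f: "Lp_le p M f C" and k: "0 \<le> k"
  shows "Lp_le p M (\<lambda>x. k * f x) (k * C)"
proof -
  note [measurable] = Lp_leD(2)[OF f]
  have "(\<integral>\<^sup>+ x. ennreal ((k * f x) powr p) \<partial>M) = (\<integral>\<^sup>+ x. ennreal (k powr p) * ennreal (f x powr p) \<partial>M)"
    by (rule nn_integral_cong_AE)
       (use Lp_leD(3)[OF f] k in \<open>auto simp: powr_mult ennreal_mult\<close>)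
  also have "\<dots> = ennreal (k powr p) * (\<integral>\<^sup>+ x. ennreal (f x powr p) \<partial>M)"
    by (simp add: nn_integral_cmult)
  also have "\<dots> \<le> ennreal (k powr p) * ennreal (C powr p)"
    by (intro mult_left_mono Lp_leD(4)[OF f]) auto
  also have "\<dots> = ennreal ((k * C) powr p)"
    using k Lp_leD(1)[OF f] by (simp add: powr_mult ennreal_mult)
  finally show ?thesis using Lp_leD[OF f] k unfolding Lp_le_def by auto
qed

text \<open>Fatou's lemma, with bounds that may vary along the sequence.\<close>

lemma Lp_le_lim:
  assumes p: "0 < p" and f: "\<And>n::nat. Lp_le p M (f n) (c n)" and "c \<longlonglongrightarrow> C"
    and g: "g \<in> borel_measurable M" and lim: "AE x in M. (\<lambda>n. f n x) \<longlonglongrightarrow> g x"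
  shows "Lp_le p M g C"
proof -
  have C: "0 \<le> C" by (rule LIMSEQ_le_const[OF assms(3)]) (use f in \<open>auto dest: Lp_leD(1)\<close>)
  have [measurable]: "\<And>n. f n \<in> borel_measurable M" using f by (auto dest: Lp_leD(2))
  have nn: "AE x in M. \<forall>n. 0 \<le> f n x" unfolding AE_all_countable using f by (auto dest: Lp_leD(3))
  have nng: "AE x in M. 0 \<le> g x" using nn lim by eventually_elim (auto intro: LIMSEQ_le_const)
  have "(\<integral>\<^sup>+ x. ennreal (g x powr p) \<partial>M) = (\<integral>\<^sup>+ x. liminf (\<lambda>n. ennreal (f n x powr p)) \<partial>M)"
  proof (rule nn_integral_cong_AE)
    show "AE x in M. ennreal (g x powr p) = liminf (\<lambda>n. ennreal (f n x powr p))"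
      using nn nng lim
    proof eventually_elim
      case (elim x)
      have "(\<lambda>n. ennreal (f n x powr p)) \<longlonglongrightarrow> ennreal (g x powr p)"
        by (intro tendsto_ennrealI tendsto_powr2 elim tendsto_const) (use p elim in auto)
      then show ?case by (rule lim_imp_Liminf[OF sequentially_bot, symmetric])
    qed
  qed
  also have "\<dots> \<le> liminf (\<lambda>n. \<integral>\<^sup>+ x. ennreal (f n x powr p) \<partial>M)"
    by (rule nn_integral_liminf) simp
  also have "\<dots> \<le> liminf (\<lambda>n. ennreal (c n powr p))"
    by (intro Liminf_mono always_eventually allI Lp_leD(4) f)
  also have "(\<lambda>n. ennreal (c n powr p)) \<longlonglongrightarrow> ennreal (C powr p)"
    by (intro tendsto_ennrealI tendsto_powr2 assms(3) tendsto_const p always_eventually allI Lp_leD(1)[OF f])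
  then have "liminf (\<lambda>n. ennreal (c n powr p)) = ennreal (C powr p)" by (rule lim_imp_Liminf[OF sequentially_bot])
  finally show ?thesis using C g nng unfolding Lp_le_def by auto
qed

text \<open>The partial sums have increasing p-th powers, so monotone convergence bounds the
  integral of their supremum; where the supremum is finite the series converges. The bound for the
  sum is then Fatou's lemma.\<close>

lemma Lp_le_suminf:
  assumes p: "1 \<le> p" and f: "\<And>n::nat. Lp_le p M (f n) (c n)" and c: "summable c"
  shows "AE x in M. summable (\<lambda>n. f n x)" "Lp_le p M (\<lambda>x. \<Sum>n. f n x) (suminf c)"
proof -
  have [measurable]: "\<And>n. f n \<in> borel_measurable M" using f by (auto dest: Lp_leD(2))
  have nn: "AE x in M. \<forall>n. 0 \<le> f n x" unfolding AE_all_countable using f by (auto dest: Lp_leD(3))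
  define S where "S n x = (\<Sum>i<n. f i x)" for n x
  have [measurable]: "\<And>n. S n \<in> borel_measurable M" unfolding S_def by measurable
  have S: "Lp_le p M (S n) (\<Sum>i<n. c i)" for n unfolding S_def by (rule Lp_le_sum) (use p f in auto)
  have c0: "0 \<le> c n" for n using f by (auto dest: Lp_leD(1))
  have inc: "AE x in M. \<forall>n. S n x powr p \<le> S (Suc n) x powr p \<and> 0 \<le> S n x"
    using nn
  proof eventually_elim
    case (elim x)
    show ?case using elim p by (auto simp: S_def intro!: powr_mono2 sum_nonneg)
  qed
  have "(\<integral>\<^sup>+ x. (SUP n. ennreal (S n x powr p)) \<partial>M) = (SUP n. \<integral>\<^sup>+ x. ennreal (S n x powr p) \<partial>M)"
    by (rule nn_integral_monotone_convergence_SUP_AE) (use inc in \<open>auto intro!: ennreal_leI\<close>)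
  also have "\<dots> \<le> ennreal (suminf c powr p)"
  proof (rule SUP_least)
    fix n
    have "(\<integral>\<^sup>+ x. ennreal (S n x powr p) \<partial>M) \<le> ennreal ((\<Sum>i<n. c i) powr p)" by (rule Lp_leD(4)[OF S])
    also have "\<dots> \<le> ennreal (suminf c powr p)"
      using p c0 c by (intro ennreal_leI powr_mono2 sum_nonneg sum_le_suminf) auto
    finally show "(\<integral>\<^sup>+ x. ennreal (S n x powr p) \<partial>M) \<le> ennreal (suminf c powr p)" .
  qed
  finally have "(\<integral>\<^sup>+ x. (SUP n. ennreal (S n x powr p)) \<partial>M) \<noteq> \<infinity>" by (auto simp: top_unique)
  then have "AE x in M. (SUP n. ennreal (S n x powr p)) \<noteq> \<infinity>"
    by (intro nn_integral_noteq_infinite) auto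
  then show sm: "AE x in M. summable (\<lambda>n. f n x)" using nn inc
  proof eventually_elim
    case (elim x)
    obtain r where r: "(SUP n. ennreal (S n x powr p)) = ennreal r" "0 \<le> r"
      using elim(1) by (cases "SUP n. ennreal (S n x powr p)") auto
    have "S n x \<le> r powr (1/p)" for n
    proof -
      have "ennreal (S n x powr p) \<le> ennreal r" unfolding r(1)[symmetric] by (rule SUP_upper) simp
      then have "S n x powr p \<le> r" using r by simp
      then have "(S n x powr p) powr (1/p) \<le> r powr (1/p)" using p by (intro powr_mono2) auto
      then show ?thesis using p elim by (simp add: powr_powr)
    qed
    then show ?case using elim by (intro bounded_imp_summable[of _ "r powr (1/p)"])
         (auto simp only: S_def lessThan_Suc_atMost[symmetric])
  qed
  show "Lp_le p M (\<lambda>x. \<Sum>n. f n x) (suminf c)"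
  proof (rule Lp_le_lim[OF _ S])
    show "(\<lambda>n. sum c {..<n}) \<longlonglongrightarrow> suminf c" using c by (rule summable_LIMSEQ)
    show "AE x in M. (\<lambda>n. S n x) \<longlonglongrightarrow> (\<Sum>n. f n x)"
      using sm by eventually_elim (auto simp: S_def intro: summable_LIMSEQ)
  qed (use p in auto)
qed

text \<open>Young's inequality for f / A' and g / B', integrated: the two terms contribute A' B' / p
  and A' B' / q.\<close>

lemma Lp_le_Hoelder:
  assumes p: "1 < p" "1 < q" "1/p + 1/q = 1" and f: "Lp_le p M f A" and g: "Lp_le q M g B"
  shows "Lp_le 1 M (\<lambda>x. f x * g x) (A * B)"
proof (rule Lp_le_closed)
  note [measurable] = Lp_leD(2)[OF f] Lp_leD(2)[OF g]
  show "((\<lambda>e. (A + e) * (B + e)) \<longlongrightarrow> A * B) (at_right 0)" by (auto intro!: tendsto_eq_intros)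
  fix e :: real assume e: "0 < e"
  define A' B' where "A' = A + e" and "B' = B + e"
  have AB: "0 < A'" "0 < B'" using e Lp_leD(1)[OF f] Lp_leD(1)[OF g] by (auto simp: A'_def B'_def)
  have f': "Lp_le p M f A'" and g': "Lp_le q M g B'"
    using e p Lp_le_bound_mono[OF f, of A'] Lp_le_bound_mono[OF g, of B'] by (auto simp: A'_def B'_def)
  have "(\<integral>\<^sup>+ x. ennreal ((f x * g x) powr 1) \<partial>M) \<le>
     (\<integral>\<^sup>+ x. ennreal (A' * B' / p * A' powr (-p)) * ennreal (f x powr p)
        + ennreal (A' * B' / q * B' powr (-q)) * ennreal (g x powr q) \<partial>M)"
  proof (rule nn_integral_mono_AE)
    show "AE x in M. ennreal ((f x * g x) powr 1) \<le> ennreal (A' * B' / p * A' powr (-p)) * ennreal (f x powr p)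
        + ennreal (A' * B' / q * B' powr (-q)) * ennreal (g x powr q)"
      using Lp_leD(3)[OF f] Lp_leD(3)[OF g]
    proof eventually_elim
      case (elim x)
      have "(f x / A') * (g x / B') \<le> (f x / A') powr p / p + (g x / B') powr q / q"
        using Youngs_inequality[of p q "f x / A'" "g x / B'"] p elim AB by simp
      then have "f x * g x \<le> A' * B' * ((f x / A') powr p / p + (g x / B') powr q / q)"
        using AB by (simp add: divide_le_eq mult_ac)
      also have "\<dots> = A' * B' / p * A' powr (-p) * (f x powr p) + A' * B' / q * B' powr (-q) * (g x powr q)"
        using AB elim by (simp add: powr_divide powr_minus_divide distrib_left mult.commute)
      finally show ?case using elim p AB
        by (subst ennreal_lincomb; simp add: ennreal_leI del: ennreal_plus)
    qed
  qed
  also have "\<dots> = ennreal (A' * B' / p * A' powr (-p)) * (\<integral>\<^sup>+ x. ennreal (f x powr p) \<partial>M)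
        + ennreal (A' * B' / q * B' powr (-q)) * (\<integral>\<^sup>+ x. ennreal (g x powr q) \<partial>M)"
    by (simp add: nn_integral_cmult nn_integral_add)
  also have "\<dots> \<le> ennreal (A' * B' / p * A' powr (-p)) * ennreal (A' powr p)
        + ennreal (A' * B' / q * B' powr (-q)) * ennreal (B' powr q)"
    by (intro mult_left_mono add_mono Lp_leD(4)[OF f'] Lp_leD(4)[OF g']) auto
  also have "\<dots> = ennreal (A' * B' / p * A' powr (-p) * A' powr p + A' * B' / q * B' powr (-q) * B' powr q)"
    using AB p by (subst ennreal_lincomb) auto
  also have "A' * B' / p * A' powr (-p) * A' powr p + A' * B' / q * B' powr (-q) * B' powr q = A' * B' * (1/p + 1/q)"
    using AB by (simp add: powr_minus field_simps)
  also have "ennreal (A' * B' * (1/p + 1/q)) = ennreal ((A' * B') powr 1)" using AB p by simp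
  finally show "Lp_le 1 M (\<lambda>x. f x * g x) ((A + e) * (B + e))"
    using AB Lp_leD(3)[OF f] Lp_leD(3)[OF g] unfolding Lp_le_def A'_def B'_def by auto
qed (use p Lp_leD(1)[OF f] Lp_leD(1)[OF g] in auto)

lemma Lp_le_0D:
  assumes "Lp_le p M f 0" "0 < p"
  shows "AE x in M. f x = 0"
proof -
  note [measurable] = Lp_leD(2)[OF assms(1)]
  have "(\<integral>\<^sup>+ x. ennreal (f x powr p) \<partial>M) = 0" using Lp_leD(4)[OF assms(1)] assms(2) by simp
  then have "AE x in M. ennreal (f x powr p) = 0" by (subst (asm) nn_integral_0_iff_AE) auto
  then show ?thesis by eventually_elim (simp add: ennreal_eq_0_iff powr_eq_0_iff)
qed

text \<open>Where f \<le> A' the constant A' is a majorant; elsewhere f = f^(1-p) f^p \<le> A'^(1-p)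
  f^p because 1 - p \<le> 0. The factor \<open>1 + T\<close> is cruder than Hoelder's T^(1-1/p) but
  free of powers.\<close>

lemma Lp_le_imp_L1:
  assumes p: "1 \<le> p" and f: "Lp_le p M f A" and M: "emeasure M (space M) \<le> ennreal T" and T: "0 \<le> T"
  shows "Lp_le 1 M f ((1 + T) * A)"
proof (rule Lp_le_closed)
  note [measurable] = Lp_leD(2)[OF f]
  show "((\<lambda>e. (1 + T) * (A + e)) \<longlongrightarrow> (1 + T) * A) (at_right 0)" by (auto intro!: tendsto_eq_intros)
  fix e :: real assume e: "0 < e"
  define A' where "A' = A + e"
  have AB: "0 < A'" using e Lp_leD(1)[OF f] by (auto simp: A'_def)
  have f': "Lp_le p M f A'" using e p Lp_le_bound_mono[OF f, of A'] by (auto simp: A'_def)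
  have "(\<integral>\<^sup>+ x. ennreal (f x powr 1) \<partial>M) \<le> (\<integral>\<^sup>+ x. ennreal A' + ennreal (A' powr (1 - p)) * ennreal (f x powr p) \<partial>M)"
  proof (rule nn_integral_mono_AE)
    show "AE x in M. ennreal (f x powr 1) \<le> ennreal A' + ennreal (A' powr (1 - p)) * ennreal (f x powr p)"
      using Lp_leD(3)[OF f]
    proof eventually_elim
      case (elim x)
      have "f x \<le> A' + A' powr (1 - p) * f x powr p"
      proof (cases "f x \<le> A'")
        case False
        then have "f x = f x powr (1 - p) * f x powr p" using AB by (simp add: powr_add[symmetric])
        also have "\<dots> \<le> A' powr (1 - p) * f x powr p"
          using False AB p by (intro mult_right_mono powr_mono2') auto
        finally show ?thesis using AB by simp
      next
        case True
        have "0 \<le> A' powr (1 - p) * f x powr p" by simp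
        then show ?thesis using True by linarith
      qed
      then show ?case using elim AB ennreal_lincomb[of A' 1 "A' powr (1 - p)" "f x powr p"]
        by (simp add: ennreal_leI flip: ennreal_plus)
    qed
  qed
  also have "\<dots> = ennreal A' * emeasure M (space M) + ennreal (A' powr (1 - p)) * (\<integral>\<^sup>+ x. ennreal (f x powr p) \<partial>M)"
    by (simp add: nn_integral_cmult nn_integral_add)
  also have "\<dots> \<le> ennreal A' * ennreal T + ennreal (A' powr (1 - p)) * ennreal (A' powr p)"
    by (intro add_mono mult_left_mono M Lp_leD(4)[OF f']) auto
  also have "\<dots> = ennreal (((1 + T) * A') powr 1)"
    using AB T by (subst ennreal_lincomb) (auto simp: algebra_simps simp flip: powr_add)
  finally show "Lp_le 1 M f ((1 + T) * (A + e))"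
    using AB Lp_leD(3)[OF f] T unfolding Lp_le_def A'_def by auto
qed (use T Lp_leD(1)[OF f] in auto)

section \<open>Strong measurability with values in a seminormed subspace\<close>

text \<open>Completeness of Lebesgue measure: preimages under the two functions differ within a null
  set.\<close>

lemma borel_measurable_lebesgue_AE_eq:
  fixes f g :: "real \<Rightarrow> real"
  assumes g: "g \<in> borel_measurable lebesgue" and "AE x in lebesgue. f x = g x"
  shows "f \<in> borel_measurable lebesgue"
proof (rule measurableI)
  fix A :: "real set" assume A: "A \<in> sets borel"
  show "f -` A \<inter> space lebesgue \<in> sets lebesgue"
  proof (rule completion.in_sets_AE)
    show "g -` A \<inter> space lebesgue \<in> sets lebesgue" using g A by (rule measurable_sets)
    show "AE x in lebesgue. (x \<in> g -` A \<inter> space lebesgue) = (x \<in> f -` A \<inter> space lebesgue)"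
      using assms(2) by eventually_elim auto
  qed auto
qed auto

lemma AE_lebesgue_on_iff:
  "S \<in> sets lebesgue \<Longrightarrow> (AE t in lebesgue_on S. P t) \<longleftrightarrow> (AE t in lebesgue. t \<in> S \<longrightarrow> P t)"
  by (subst AE_restrict_space_iff) auto

lemma open_interval_in_lebesgue: "{a<..<b::real} \<in> sets lebesgue" by simp

text \<open>Extended by zero, the functions live on the whole line, where \<open>lim\<close> is
  measurable as a total operation; its values off the set of convergence are harmless by
  completeness.\<close>

lemma borel_measurable_lebesgue_on_AE_lim:
  fixes f :: "nat \<Rightarrow> real \<Rightarrow> real"
  assumes S: "S \<in> sets lebesgue" and f: "\<And>n. f n \<in> borel_measurable (lebesgue_on S)"
    and lim: "AE x in lebesgue_on S. (\<lambda>n. f n x) \<longlonglongrightarrow> g x"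
  shows "g \<in> borel_measurable (lebesgue_on S)"
proof -
  have S': "S \<inter> space lebesgue \<in> sets lebesgue" using S by simp
  define F where "F n x = indicator S x *\<^sub>R f n x" for n x
  have [measurable]: "F n \<in> borel_measurable lebesgue" for n
    using f[of n] unfolding F_def borel_measurable_restrict_space_iff[OF S'] .
  have "(\<lambda>x. lim (\<lambda>n. F n x)) \<in> borel_measurable lebesgue" by measurable
  moreover have "AE x in lebesgue. indicator S x *\<^sub>R g x = lim (\<lambda>n. F n x)"
    using lim unfolding AE_lebesgue_on_iff[OF S]
  proof eventually_elim
    case (elim x)
    have "(\<lambda>n. F n x) \<longlonglongrightarrow> indicator S x *\<^sub>R g x" using elim by (auto simp: F_def indicator_def)
    then show ?case by (simp add: limI)
  qed
  ultimately have "(\<lambda>x. indicator S x *\<^sub>R g x) \<in> borel_measurable lebesgue"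
    by (rule borel_measurable_lebesgue_AE_eq)
  then show ?thesis unfolding borel_measurable_restrict_space_iff[OF S'] .
qed

section \<open>Simple functions and seminormed subspaces\<close>

definition simple_fun :: "(real \<Rightarrow> 'a) \<Rightarrow> bool" where
  "simple_fun s \<longleftrightarrow> finite (range s) \<and> (\<forall>y. s -` {y} \<in> sets lebesgue)"

lemma simple_fun_comp2:
  assumes "simple_fun s" "simple_fun r"
  shows "simple_fun (\<lambda>t. F (s t) (r t))"
proof -
  have fin: "finite ((\<lambda>(x, y). F x y) ` (range s \<times> range r))"
    using assms by (auto simp: simple_fun_def)
  have "range (\<lambda>t. F (s t) (r t)) \<subseteq> (\<lambda>(x, y). F x y) ` (range s \<times> range r)" by auto
  then have "finite (range (\<lambda>t. F (s t) (r t)))" using fin by (rule finite_subset)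
  moreover have "(\<lambda>t. F (s t) (r t)) -` {z} =
      (\<Union>(x, y)\<in>{(x, y) \<in> range s \<times> range r. F x y = z}. s -` {x} \<inter> r -` {y})" for z
    by auto
  moreover have "(\<Union>(x, y)\<in>{(x, y) \<in> range s \<times> range r. F x y = z}. s -` {x} \<inter> r -` {y}) \<in> sets lebesgue" for z
  proof (rule sets.finite_UN)
    have "finite (range s \<times> range r)" using assms by (auto simp: simple_fun_def)
    then show "finite {(x, y) \<in> range s \<times> range r. F x y = z}" by (rule rev_finite_subset) auto
  qed (use assms in \<open>auto simp: simple_fun_def\<close>)
  ultimately show ?thesis by (simp add: simple_fun_def)
qed

lemma simple_fun_const: "simple_fun (\<lambda>t. c)"
  by (auto simp: simple_fun_def vimage_def)

lemma simple_fun_comp: "simple_fun s \<Longrightarrow> simple_fun (\<lambda>t. F (s t))"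
  using simple_fun_comp2[of s s "\<lambda>x y. F x"] by simp

lemma simple_fun_measurable:
  fixes s :: "real \<Rightarrow> real"
  assumes "simple_fun s"
  shows "s \<in> borel_measurable lebesgue"
proof (rule borel_measurableI)
  fix A :: "real set"
  have "s -` A \<inter> space lebesgue = (\<Union>y\<in>A \<inter> range s. s -` {y})" by auto
  also have "\<dots> \<in> sets lebesgue" using assms by (intro sets.finite_UN) (auto simp: simple_fun_def)
  finally show "s -` A \<inter> space lebesgue \<in> sets lebesgue" .
qed

lemma simple_function_simple_fun:
  assumes "simple_function lebesgue f" shows "simple_fun f"
  using assms unfolding simple_function_def simple_fun_def
proof (intro conjI allI)
  assume *: "finite (f ` space lebesgue) \<and> (\<forall>x\<in>f ` space lebesgue. f -` {x} \<inter> space lebesgue \<in> sets lebesgue)"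
  then show "finite (range f)" by simp
  fix y show "f -` {y} \<in> sets lebesgue"
  proof (cases "y \<in> range f")
    case False
    then have "f -` {y} = {}" by auto
    then show ?thesis by simp
  qed (use * in auto)
qed

text \<open>Instantiated with \<open>X1\<close>, the trace space, all of X0, X0 under the
  K-functional at a fixed parameter, and the reals. Outside \<open>S\<close> the values of
  \<open>N\<close> are arbitrary, so estimates have to establish membership along the way.\<close>

locale nspace =
  fixes S :: "'a::real_vector set" and N :: "'a \<Rightarrow> real"
  assumes subsp: "subspace S"
    and N_nonneg: "x \<in> S \<Longrightarrow> 0 \<le> N x"
    and N_add: "x \<in> S \<Longrightarrow> y \<in> S \<Longrightarrow> N (x + y) \<le> N x + N y"
    and N_scale: "x \<in> S \<Longrightarrow> N (c *\<^sub>R x) = \<bar>c\<bar> * N x"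
begin

lemma S_0: "0 \<in> S" and S_add: "x \<in> S \<Longrightarrow> y \<in> S \<Longrightarrow> x + y \<in> S"
  and S_diff: "x \<in> S \<Longrightarrow> y \<in> S \<Longrightarrow> x - y \<in> S" and S_scale: "x \<in> S \<Longrightarrow> c *\<^sub>R x \<in> S"
  using subsp by (auto simp: subspace_0 subspace_add subspace_diff subspace_scale)

lemma S_sum: "(\<And>i. i \<in> I \<Longrightarrow> f i \<in> S) \<Longrightarrow> sum f I \<in> S"
  using subsp by (rule subspace_sum)

lemma N_0: "N 0 = 0" using N_scale[OF S_0, of 0] by simp

lemma N_minus: "x \<in> S \<Longrightarrow> N (- x) = N x" using N_scale[of x "-1"] by simp

lemma N_diff: "x \<in> S \<Longrightarrow> y \<in> S \<Longrightarrow> N (x - y) \<le> N x + N y"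
  using N_add[of x "- y"] N_minus[of y] S_scale[of y "-1"] by simp

lemma N_diff_commute: "x \<in> S \<Longrightarrow> y \<in> S \<Longrightarrow> N (x - y) = N (y - x)"
  using N_minus[of "x - y"] S_diff[of x y] by simp

lemma N_abs_diff: "x \<in> S \<Longrightarrow> y \<in> S \<Longrightarrow> \<bar>N x - N y\<bar> \<le> N (x - y)"
  using N_add[of "x - y" y] N_add[of "y - x" x] N_diff_commute[of x y] S_diff[of x y] S_diff[of y x] by auto

lemma N_triangle: "x \<in> S \<Longrightarrow> y \<in> S \<Longrightarrow> z \<in> S \<Longrightarrow> N (x - z) \<le> N (x - y) + N (y - z)"
  using N_add[of "x - y" "y - z"] S_diff[of x y] S_diff[of y z] by simp

lemma N_sum: "(\<And>i. i \<in> I \<Longrightarrow> f i \<in> S) \<Longrightarrow> N (sum f I) \<le> (\<Sum>i\<in>I. N (f i))"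
proof (induction I rule: infinite_finite_induct)
  case (insert x F)
  have "N (f x + sum f F) \<le> N (f x) + N (sum f F)" using insert by (intro N_add S_sum) auto
  then show ?case using insert by (simp add: order_trans)
qed (auto simp: N_0)

lemma tendsto_N:
  assumes "\<And>n. s n \<in> S" "x \<in> S" "(\<lambda>n. N (s n - x)) \<longlonglongrightarrow> 0"
  shows "(\<lambda>n::nat. N (s n)) \<longlonglongrightarrow> N x"
proof -
  have "(\<lambda>n. N (s n) - N x) \<longlonglongrightarrow> 0"
    by (rule Lim_null_comparison[OF _ assms(3)]) (use assms N_abs_diff in auto)
  then show ?thesis by (simp add: LIM_zero_iff)
qed

abbreviation (input) sm where "sm a b f \<equiv> strongly_meas N S a b f"

lemma sm_iff:
  "sm a b f \<longleftrightarrow> (AE t in lebesgue_on {a<..<b}. f t \<in> S) \<and>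
     (\<exists>s. (\<forall>n. simple_fun (s n) \<and> range (s n) \<subseteq> S) \<and>
        (AE t in lebesgue_on {a<..<b}. (\<lambda>n::nat. N (s n t - f t)) \<longlonglongrightarrow> 0))"
  unfolding strongly_meas_def simple_fun_def AE_lebesgue_on_iff[OF open_interval_in_lebesgue] by (simp only: conj_ac)

lemma sm_inS: "sm a b f \<Longrightarrow> AE t in lebesgue_on {a<..<b}. f t \<in> S"
  by (simp add: sm_iff)

lemma sm_meas:
  assumes f: "sm a b f" and d: "d \<in> S"
  shows "(\<lambda>t. N (f t - d)) \<in> borel_measurable (lebesgue_on {a<..<b})"
proof -
  obtain s where s: "\<And>n. simple_fun (s n)" "\<And>n. range (s n) \<subseteq> S"
     "AE t in lebesgue_on {a<..<b}. (\<lambda>n::nat. N (s n t - f t)) \<longlonglongrightarrow> 0"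
    using f unfolding sm_iff by auto
  show ?thesis
  proof (rule borel_measurable_lebesgue_on_AE_lim)
    show "(\<lambda>t. N (s n t - d)) \<in> borel_measurable (lebesgue_on {a<..<b})" for n
      using simple_fun_measurable[OF simple_fun_comp[OF s(1), of "\<lambda>x. N (x - d)" n]]
      by (simp add: measurable_restrict_space1)
    show "AE t in lebesgue_on {a<..<b}. (\<lambda>n. N (s n t - d)) \<longlonglongrightarrow> N (f t - d)"
      using s(3) sm_inS[OF f]
    proof eventually_elim
      case (elim t)
      have "N (s n t - d - (f t - d)) = N (s n t - f t)" for n by (simp add: algebra_simps)
      then show ?case using elim s(2) d by (intro tendsto_N) (auto intro!: S_diff)
    qed
  qed simp
qed

lemma sm_meas_N: "sm a b f \<Longrightarrow> (\<lambda>t. N (f t)) \<in> borel_measurable (lebesgue_on {a<..<b})"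
  using sm_meas[of a b f 0] S_0 by simp

lemma sm_simple: "simple_fun s \<Longrightarrow> range s \<subseteq> S \<Longrightarrow> sm a b s"
  unfolding sm_iff by (auto intro!: exI[of _ "\<lambda>n. s"] AE_I2 simp: N_0)

lemma sm_const: "y \<in> S \<Longrightarrow> sm a b (\<lambda>t. y)"
  by (rule sm_simple[OF simple_fun_const]) auto

text \<open>A Pettis-type criterion: the approximating simple functions pick the nearest among the first
  \<open>n\<close> points of a countable dense set.\<close>

lemma sm_dense:
  assumes inS: "AE t in lebesgue_on {a<..<b}. f t \<in> S" and d: "\<And>k::nat. d k \<in> S"
    and dense: "AE t in lebesgue_on {a<..<b}. \<forall>e>0. \<exists>k. N (f t - d k) < e"
    and meas: "\<And>k. (\<lambda>t. N (f t - d k)) \<in> borel_measurable (lebesgue_on {a<..<b})"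
  shows "sm a b f"
proof -
  define F where "F k t = indicator {a<..<b} t *\<^sub>R N (f t - d k)" for k t
  have [measurable]: "F k \<in> borel_measurable lebesgue" for k
    using meas[of k] unfolding F_def by (subst (asm) borel_measurable_restrict_space_iff) auto
  define P where "P n k t \<longleftrightarrow> k \<le> n \<and> (\<forall>i\<in>{..n}. F k t \<le> F i t)" for n k t
  \<comment> \<open>Taking the least among the nearest indices makes the choice measurable in
    t.\<close>
  define K where "K n t = (LEAST k. P n k t)" for n t
  have exP: "\<exists>k. P n k t" for n t
  proof -
    obtain k where "is_arg_min (\<lambda>i. F i t) (\<lambda>i. i \<in> {..n}) k"
      using ex_is_arg_min_if_finite[of "{..n}" "\<lambda>i. F i t"] by auto
    then show ?thesis by (auto simp: P_def is_arg_min_linorder intro!: exI[of _ k])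
  qed
  have PK: "P n (K n t) t" for n t unfolding K_def using exP by (rule LeastI_ex)
  have [measurable]: "Measurable.pred lebesgue (\<lambda>t. P n k t)" for n k unfolding P_def by measurable
  have Km: "K n \<in> lebesgue \<rightarrow>\<^sub>M count_space UNIV" for n unfolding K_def by measurable
  have simp: "simple_fun (\<lambda>t. d (K n t))" for n
    unfolding simple_fun_def
  proof (intro conjI allI)
    have "range (\<lambda>t. d (K n t)) \<subseteq> d ` {..n}" using PK by (auto simp: P_def)
    then show "finite (range (\<lambda>t. d (K n t)))" by (rule finite_subset) simp
    fix y
    have "(\<lambda>t. d (K n t)) -` {y} = K n -` (d -` {y}) \<inter> space lebesgue" by auto
    also have "\<dots> \<in> sets lebesgue" using Km by (rule measurable_sets) simp
    finally show "(\<lambda>t. d (K n t)) -` {y} \<in> sets lebesgue" .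
  qed
  have "AE t in lebesgue_on {a<..<b}. (\<lambda>n. N (d (K n t) - f t)) \<longlonglongrightarrow> 0"
    using inS dense AE_space
  proof eventually_elim
    case (elim t)
    then have t: "t \<in> {a<..<b}" by (simp add: space_restrict_space)
    have FK: "N (d (K n t) - f t) = F (K n t) t" for n
      using t d elim N_diff_commute[of "f t" "d (K n t)"] by (simp add: F_def)
    show ?case
    proof (rule LIMSEQ_I)
      fix e :: real assume "0 < e"
      then obtain k where k: "N (f t - d k) < e" using elim by auto
      have "norm (N (d (K n t) - f t) - 0) < e" if "n \<ge> k" for n
      proof -
        have "F (K n t) t \<le> F k t" using PK[of n t] that by (auto simp: P_def)
        moreover have "0 \<le> N (d (K n t) - f t)" using d elim by (intro N_nonneg S_diff) auto
        ultimately show ?thesis using k t unfolding FK by (simp add: F_def)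
      qed
      then show "\<exists>no. \<forall>n\<ge>no. norm (N (d (K n t) - f t) - 0) < e" by blast
    qed
  qed
  then show ?thesis unfolding sm_iff using inS simp d
    by (intro conjI exI[of _ "\<lambda>n t. d (K n t)"]) auto
qed

text \<open>The values of all approximating simple functions of all \<open>f n\<close> form a
  countable set that comes arbitrarily close to \<open>g t\<close> for almost every t. The criterion
  \<open>sm_dense\<close> then replaces a diagonal choice of approximations.\<close>

lemma sm_lim:
  assumes f: "\<And>n. sm a b (f n)" and inS: "AE t in lebesgue_on {a<..<b}. g t \<in> S"
    and lim: "AE t in lebesgue_on {a<..<b}. (\<lambda>n. N (f n t - g t)) \<longlonglongrightarrow> 0"
  shows "sm a b g"
proof -
  have "\<forall>n. \<exists>s. (\<forall>m::nat. simple_fun (s m) \<and> range (s m) \<subseteq> S) \<and>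
        (AE t in lebesgue_on {a<..<b}. (\<lambda>m::nat. N (s m t - f n t)) \<longlonglongrightarrow> 0)"
    using f unfolding sm_iff by auto
  from choice[OF this] obtain s where s: "\<And>n m::nat. simple_fun (s n m)" "\<And>n m. range (s n m) \<subseteq> S"
     "\<And>n. AE t in lebesgue_on {a<..<b}. (\<lambda>m::nat. N (s n m t - f n t)) \<longlonglongrightarrow> 0"
    by blast
  define D where "D = (\<Union>n. \<Union>m. range (s n m))"
  have "countable (range (s n m))" for n m using s(1)[of n m] by (simp add: simple_fun_def countable_finite)
  then have D: "countable D" unfolding D_def by (intro countable_UN) auto
  have "D \<noteq> {}" unfolding D_def by blast
  have "D \<subseteq> S" unfolding D_def using s(2) by blast
  note D = D \<open>D \<noteq> {}\<close> \<open>D \<subseteq> S\<close>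
  define d where "d = from_nat_into D"
  have rd: "range d = D" unfolding d_def using D by (intro range_from_nat_into)
  then have dS: "d k \<in> S" for k using D by auto
  have inS': "AE t in lebesgue_on {a<..<b}. \<forall>n. f n t \<in> S"
    unfolding AE_all_countable using f by (auto intro: sm_inS)
  have s3: "AE t in lebesgue_on {a<..<b}. \<forall>n. (\<lambda>m::nat. N (s n m t - f n t)) \<longlonglongrightarrow> 0"
    unfolding AE_all_countable using s(3) by auto
  show ?thesis
  proof (rule sm_dense[OF inS dS])
    show "AE t in lebesgue_on {a<..<b}. \<forall>e>0. \<exists>k. N (g t - d k) < e"
      using inS inS' s3 lim
    proof eventually_elim
      case (elim t)
      show ?case
      proof (intro allI impI)
        fix e :: real assume "0 < e"
        then have e2: "0 < e/2" by simp
        obtain n where n: "norm (N (f n t - g t)) < e/2"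
          using LIMSEQ_D[OF elim(4) e2] by auto
        obtain m where m: "norm (N (s n m t - f n t)) < e/2"
          using LIMSEQ_D[OF elim(3)[rule_format, of n] e2] by auto
        have "s n m t \<in> range d" unfolding rd D_def by auto
        then obtain k where k: "d k = s n m t" by auto
        have "N (g t - d k) \<le> N (g t - f n t) + N (f n t - d k)"
          using elim dS by (intro N_triangle) auto
        also have "\<dots> < e"
          using n m elim dS[of k] N_diff_commute[of "g t" "f n t"] N_diff_commute[of "f n t" "d k"] unfolding k by auto
        finally show "\<exists>k. N (g t - d k) < e" by blast
      qed
    qed
    fix k
    show "(\<lambda>t. N (g t - d k)) \<in> borel_measurable (lebesgue_on {a<..<b})"
    proof (rule borel_measurable_lebesgue_on_AE_lim[OF _ sm_meas[OF f dS]])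
      show "AE t in lebesgue_on {a<..<b}. (\<lambda>n. N (f n t - d k)) \<longlonglongrightarrow> N (g t - d k)"
        using inS inS' lim
      proof eventually_elim
        case (elim t)
        have "N (f n t - d k - (g t - d k)) = N (f n t - g t)" for n by (simp add: algebra_simps)
        then show ?case using elim dS by (intro tendsto_N) (auto intro!: S_diff)
      qed
    qed simp
  qed
qed

lemma sm_cong_AE:
  assumes "sm a b f" "AE t in lebesgue_on {a<..<b}. g t = f t"
  shows "sm a b g"
proof (rule sm_lim[of _ _ "\<lambda>n. f"])
  show "AE t in lebesgue_on {a<..<b}. g t \<in> S" using sm_inS[OF assms(1)] assms(2) by eventually_elim auto
  show "AE t in lebesgue_on {a<..<b}. (\<lambda>n. N (f t - g t)) \<longlonglongrightarrow> 0"
    using assms(2) by eventually_elim (auto simp: N_0)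
qed fact

lemma sm_add:
  assumes "sm a b f" "sm a b g"
  shows "sm a b (\<lambda>t. f t + g t)"
proof -
  obtain s where s: "\<And>n. simple_fun (s n)" "\<And>n. range (s n) \<subseteq> S"
     "AE t in lebesgue_on {a<..<b}. (\<lambda>n::nat. N (s n t - f t)) \<longlonglongrightarrow> 0"
    using assms(1) unfolding sm_iff by auto
  obtain r where r: "\<And>n. simple_fun (r n)" "\<And>n. range (r n) \<subseteq> S"
     "AE t in lebesgue_on {a<..<b}. (\<lambda>n::nat. N (r n t - g t)) \<longlonglongrightarrow> 0"
    using assms(2) unfolding sm_iff by auto
  show ?thesis unfolding sm_iff
  proof (intro conjI exI allI)
    show "AE t in lebesgue_on {a<..<b}. f t + g t \<in> S"
      using sm_inS[OF assms(1)] sm_inS[OF assms(2)] by eventually_elim (rule S_add)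
    show "simple_fun (\<lambda>t. s n t + r n t)" for n by (rule simple_fun_comp2[OF s(1) r(1)])
    show "range (\<lambda>t. s n t + r n t) \<subseteq> S" for n
      using s(2)[of n] r(2)[of n] by (auto intro!: S_add)
    show "AE t in lebesgue_on {a<..<b}. (\<lambda>n. N (s n t + r n t - (f t + g t))) \<longlonglongrightarrow> 0"
      using s(3) r(3) sm_inS[OF assms(1)] sm_inS[OF assms(2)]
    proof eventually_elim
      case (elim t)
      show ?case
      proof (rule Lim_null_comparison)
        show "(\<lambda>n. N (s n t - f t) + N (r n t - g t)) \<longlonglongrightarrow> 0" using tendsto_add[OF elim(1,2)] by simp
        have "norm (N (s n t + r n t - (f t + g t))) \<le> N (s n t - f t) + N (r n t - g t)" for n
        proof -
          have i: "s n t - f t \<in> S" "r n t - g t \<in> S" using s(2)[of n] r(2)[of n] elim by (auto intro!: S_diff)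
          have "s n t + r n t - (f t + g t) = (s n t - f t) + (r n t - g t)" by simp
          then show ?thesis using N_add[OF i] N_nonneg[OF S_add[OF i]] by (simp only: real_norm_def)
        qed
        then show "\<forall>\<^sub>F n in sequentially. norm (N (s n t + r n t - (f t + g t))) \<le> N (s n t - f t) + N (r n t - g t)"
          by simp
      qed
    qed
  qed
qed

lemma sm_scale_fun:
  assumes f: "sm a b f" and phi: "\<phi> \<in> borel_measurable (lebesgue_on {a<..<b})"
  shows "sm a b (\<lambda>t. \<phi> t *\<^sub>R f t)"
proof -
  obtain s where s: "\<And>n. simple_fun (s n)" "\<And>n. range (s n) \<subseteq> S"
     "AE t in lebesgue_on {a<..<b}. (\<lambda>n::nat. N (s n t - f t)) \<longlonglongrightarrow> 0"
    using assms(1) unfolding sm_iff by auto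
  have "(\<lambda>t. indicator {a<..<b} t *\<^sub>R \<phi> t) \<in> borel_measurable lebesgue"
    using phi by (subst (asm) borel_measurable_restrict_space_iff) auto
  from borel_measurable_implies_sequence_metric[OF this, of 0]
  obtain r where r: "\<And>i. simple_function lebesgue (r i)"
      "\<And>x. (\<lambda>i. r i x) \<longlonglongrightarrow> indicator {a<..<b} x *\<^sub>R \<phi> x"
    by auto
  show ?thesis unfolding sm_iff
  proof (intro conjI exI allI)
    show "AE t in lebesgue_on {a<..<b}. \<phi> t *\<^sub>R f t \<in> S"
      using sm_inS[OF assms(1)] by eventually_elim (rule S_scale)
    show "simple_fun (\<lambda>t. r n t *\<^sub>R s n t)" for n by (rule simple_fun_comp2[OF simple_function_simple_fun[OF r(1)] s(1)])
    show "range (\<lambda>t. r n t *\<^sub>R s n t) \<subseteq> S" for n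
      using s(2)[of n] by (auto intro!: S_scale)
    show "AE t in lebesgue_on {a<..<b}. (\<lambda>n. N (r n t *\<^sub>R s n t - \<phi> t *\<^sub>R f t)) \<longlonglongrightarrow> 0"
      using s(3) sm_inS[OF assms(1)] AE_space
    proof eventually_elim
      case (elim t)
      then have rt: "(\<lambda>n. r n t) \<longlonglongrightarrow> \<phi> t" using r(2)[of t] by (simp add: space_restrict_space)
      show ?case
      proof (rule Lim_null_comparison)
        show "(\<lambda>n. \<bar>r n t\<bar> * N (s n t - f t) + \<bar>r n t - \<phi> t\<bar> * N (f t)) \<longlonglongrightarrow> 0"
          by (rule tendsto_eq_intros rt elim refl | simp)+
        have "norm (N (r n t *\<^sub>R s n t - \<phi> t *\<^sub>R f t)) \<le> \<bar>r n t\<bar> * N (s n t - f t) + \<bar>r n t - \<phi> t\<bar> * N (f t)" for n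
        proof -
          have st: "s n t \<in> S" using s(2)[of n] by auto
          have i: "r n t *\<^sub>R (s n t - f t) \<in> S" "(r n t - \<phi> t) *\<^sub>R f t \<in> S"
            using st elim by (auto intro!: S_diff S_scale)
          have "r n t *\<^sub>R s n t - \<phi> t *\<^sub>R f t = r n t *\<^sub>R (s n t - f t) + (r n t - \<phi> t) *\<^sub>R f t"
            by (simp add: algebra_simps)
          then show ?thesis using N_add[OF i] N_nonneg[OF S_add[OF i]] N_scale[OF S_diff[OF st elim(2)]] N_scale[OF elim(2)]
            by simp
        qed
        then show "\<forall>\<^sub>F n in sequentially. norm (N (r n t *\<^sub>R s n t - \<phi> t *\<^sub>R f t)) \<le> \<bar>r n t\<bar> * N (s n t - f t) + \<bar>r n t - \<phi> t\<bar> * N (f t)"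
          by simp
      qed
    qed
  qed
qed

lemma sm_scale: "sm a b f \<Longrightarrow> sm a b (\<lambda>t. c *\<^sub>R f t)" by (rule sm_scale_fun) auto

lemma sm_diff: "sm a b f \<Longrightarrow> sm a b g \<Longrightarrow> sm a b (\<lambda>t. f t - g t)"
  using sm_add[OF _ sm_scale[of a b g "-1"], of f] by simp

lemma sm_sum: "(\<And>i. i \<in> I \<Longrightarrow> sm a b (f i)) \<Longrightarrow> sm a b (\<lambda>t. \<Sum>i\<in>I. f i t)"
  by (induction I rule: infinite_finite_induct) (auto intro: sm_const S_0 sm_add)

lemma sm_subinterval:
  assumes "sm a b f" "a \<le> a'" "b' \<le> b"
  shows "sm a' b' f"
proof -
  have *: "AE t in lebesgue_on {a'<..<b'}. P t" if "AE t in lebesgue_on {a<..<b}. P t" for P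
    using that unfolding AE_lebesgue_on_iff[OF open_interval_in_lebesgue]
    by eventually_elim (use assms in auto)
  obtain s where s: "\<And>n. simple_fun (s n) \<and> range (s n) \<subseteq> S"
     "AE t in lebesgue_on {a<..<b}. (\<lambda>n::nat. N (s n t - f t)) \<longlonglongrightarrow> 0"
    using assms(1) unfolding sm_iff by auto
  show ?thesis unfolding sm_iff
    using *[OF sm_inS[OF assms(1)]] *[OF s(2)] s(1) by (intro conjI exI[of _ s]) auto
qed

end

section \<open>Bochner integrability and Henstock-Kurzweil integrals\<close>

text \<open>A bound as a predicate instead of an inequality for \<open>Lp_norm\<close>: the latter
  is 0 for functions of infinite norm, so an inequality alone would say nothing about
  membership.\<close>

definition Lp_bd :: "real \<Rightarrow> ('a::real_vector \<Rightarrow> real) \<Rightarrow> 'a set \<Rightarrow> real \<Rightarrow> real \<Rightarrow> (real \<Rightarrow> 'a) \<Rightarrow> real \<Rightarrow> bool" where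
  "Lp_bd p N S a b f C \<longleftrightarrow> strongly_meas N S a b f \<and> Lp_le p (lebesgue_on {a<..<b}) (\<lambda>t. N (f t)) C"

lemma Lp_int_eq: "Lp_int p N a b f = (\<integral>\<^sup>+ t. ennreal (N (f t) powr p) \<partial>lebesgue_on {a<..<b})"
  unfolding Lp_int_def by (simp add: nn_integral_restrict_space)

lemma Lp_bd_0_le: "Lp_bd p N S a b f C \<Longrightarrow> 0 \<le> C"
  by (simp add: Lp_bd_def Lp_le_def)

lemma Lp_bd_in_Lp: assumes "Lp_bd p N S a b f C" shows "in_Lp p N S a b f"
proof -
  have "Lp_int p N a b f \<le> ennreal (C powr p)"
    using assms unfolding Lp_bd_def Lp_int_eq by (auto dest: Lp_leD(4))
  also have "\<dots> < \<infinity>" by simp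
  finally have "Lp_int p N a b f < \<infinity>" .
  then show ?thesis using assms unfolding in_Lp_def Lp_bd_def by auto
qed

lemma Lp_bd_norm_le:
  assumes "Lp_bd p N S a b f C" "0 < p" shows "Lp_norm p N a b f \<le> C"
proof -
  have C: "0 \<le> C" by (rule Lp_bd_0_le[OF assms(1)])
  have "Lp_int p N a b f \<le> ennreal (C powr p)"
    using assms unfolding Lp_bd_def Lp_int_eq by (auto dest: Lp_leD(4))
  then have "enn2real (Lp_int p N a b f) \<le> C powr p" by (intro enn2real_leI) auto
  then have "enn2real (Lp_int p N a b f) powr (1/p) \<le> (C powr p) powr (1/p)"
    using assms(2) by (intro powr_mono2) auto
  then show ?thesis using C assms(2) by (simp add: Lp_norm_def powr_powr)
qed

lemma Lp_norm_nonneg: "0 \<le> Lp_norm p N a b f" by (simp add: Lp_norm_def)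

lemma Lp_bd_bound_mono: "Lp_bd p N S a b f C \<Longrightarrow> C \<le> D \<Longrightarrow> 0 \<le> p \<Longrightarrow> Lp_bd p N S a b f D"
  unfolding Lp_bd_def using Lp_le_bound_mono by blast

lemma emeasure_lebesgue_on_box: "a \<le> b \<Longrightarrow> emeasure (lebesgue_on {a<..<b::real}) (space (lebesgue_on {a<..<b})) \<le> ennreal (b - a)"
  by (simp add: emeasure_restrict_space space_restrict_space)

lemma Lp_le_subset:
  assumes f: "Lp_le p (lebesgue_on B) f C" and AB: "A \<subseteq> B" "A \<in> sets lebesgue" "B \<in> sets lebesgue"
  shows "Lp_le p (lebesgue_on A) f C"
proof -
  have m: "f \<in> borel_measurable (lebesgue_on A)"
    by (rule measurable_restrict_mono[OF Lp_leD(2)[OF f] AB(1)])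
  have "AE x in lebesgue. x \<in> A \<longrightarrow> 0 \<le> f x"
    using Lp_leD(3)[OF f] unfolding AE_lebesgue_on_iff[OF AB(3)] by eventually_elim (use AB in auto)
  then have nn: "AE x in lebesgue_on A. 0 \<le> f x" unfolding AE_lebesgue_on_iff[OF AB(2)] .
  have "(\<integral>\<^sup>+ x. ennreal (f x powr p) \<partial>lebesgue_on A) \<le> (\<integral>\<^sup>+ x. ennreal (f x powr p) \<partial>lebesgue_on B)"
    using AB by (subst (1 2) nn_integral_restrict_space) (auto intro!: nn_integral_mono simp: indicator_def)
  also have "\<dots> \<le> ennreal (C powr p)" by (rule Lp_leD(4)[OF f])
  finally show ?thesis using m nn Lp_leD(1)[OF f] unfolding Lp_le_def by auto
qed

section \<open>Calculus of vector-valued L^p bounds\<close>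

context nspace
begin

lemma in_Lp_Lp_bd:
  assumes "in_Lp p N S a b f" "0 < p"
  shows "Lp_bd p N S a b f (Lp_norm p N a b f)"
proof -
  have f: "sm a b f" and fin: "Lp_int p N a b f < \<infinity>" using assms by (auto simp: in_Lp_def)
  have "Lp_int p N a b f = ennreal (enn2real (Lp_int p N a b f))" using fin by simp
  also have "enn2real (Lp_int p N a b f) = Lp_norm p N a b f powr p"
    using assms(2) by (simp add: Lp_norm_def powr_powr)
  finally have "(\<integral>\<^sup>+ t. ennreal (N (f t) powr p) \<partial>lebesgue_on {a<..<b}) \<le> ennreal (Lp_norm p N a b f powr p)"
    by (simp add: Lp_int_eq)
  moreover have "AE t in lebesgue_on {a<..<b}. 0 \<le> N (f t)"
    using sm_inS[OF f] by eventually_elim (rule N_nonneg)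
  ultimately show ?thesis unfolding Lp_bd_def Lp_le_def using f sm_meas_N[OF f] Lp_norm_nonneg by auto
qed

lemma Lp_bd_le:
  assumes g: "Lp_le p (lebesgue_on {a<..<b}) g C" and f: "sm a b f"
    and "AE t in lebesgue_on {a<..<b}. N (f t) \<le> g t" "0 \<le> p"
  shows "Lp_bd p N S a b f C"
  unfolding Lp_bd_def
proof (intro conjI f Lp_le_mono[OF g sm_meas_N[OF f]])
  show "AE t in lebesgue_on {a<..<b}. 0 \<le> N (f t) \<and> N (f t) \<le> g t"
    using sm_inS[OF f] assms(3) by eventually_elim (use N_nonneg in auto)
qed (use assms in auto)

lemma Lp_bd_cong_AE:
  assumes f: "Lp_bd p N S a b f C" and "AE t in lebesgue_on {a<..<b}. g t = f t" "0 \<le> p"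
  shows "Lp_bd p N S a b g C"
proof (rule Lp_bd_le)
  show "Lp_le p (lebesgue_on {a<..<b}) (\<lambda>t. N (f t)) C" using f by (simp add: Lp_bd_def)
  show "sm a b g" by (rule sm_cong_AE[of _ _ f]) (use assms in \<open>auto simp: Lp_bd_def\<close>)
  show "AE t in lebesgue_on {a<..<b}. N (g t) \<le> N (f t)" using assms(2) by eventually_elim simp
qed fact

lemma Lp_bd_add:
  assumes f: "Lp_bd p N S a b f C" and g: "Lp_bd p N S a b g D" and p: "1 \<le> p"
  shows "Lp_bd p N S a b (\<lambda>t. f t + g t) (C + D)"
proof (rule Lp_bd_le)
  show "Lp_le p (lebesgue_on {a<..<b}) (\<lambda>t. N (f t) + N (g t)) (C + D)"
    using f g p by (auto simp: Lp_bd_def intro: Lp_le_add)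
  have fg: "sm a b f" "sm a b g" using f g by (auto simp: Lp_bd_def)
  then show "sm a b (\<lambda>t. f t + g t)" by (rule sm_add)
  show "AE t in lebesgue_on {a<..<b}. N (f t + g t) \<le> N (f t) + N (g t)"
    using sm_inS[OF fg(1)] sm_inS[OF fg(2)] by eventually_elim (rule N_add)
qed (use p in auto)

lemma Lp_bd_scale:
  assumes f: "Lp_bd p N S a b f C" and p: "1 \<le> p"
  shows "Lp_bd p N S a b (\<lambda>t. c *\<^sub>R f t) (\<bar>c\<bar> * C)"
proof (rule Lp_bd_le)
  show "Lp_le p (lebesgue_on {a<..<b}) (\<lambda>t. \<bar>c\<bar> * N (f t)) (\<bar>c\<bar> * C)"
    using f p by (auto simp: Lp_bd_def intro: Lp_le_cmult)
  have ff: "sm a b f" using f by (auto simp: Lp_bd_def)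
  then show "sm a b (\<lambda>t. c *\<^sub>R f t)" by (rule sm_scale)
  show "AE t in lebesgue_on {a<..<b}. N (c *\<^sub>R f t) \<le> \<bar>c\<bar> * N (f t)"
    using sm_inS[OF ff] by eventually_elim (simp add: N_scale)
qed (use p in auto)

lemma Lp_bd_minus: "Lp_bd p N S a b f C \<Longrightarrow> 1 \<le> p \<Longrightarrow> Lp_bd p N S a b (\<lambda>t. - f t) C"
  using Lp_bd_scale[of p a b f C "-1"] by simp

lemma Lp_bd_diff:
  "Lp_bd p N S a b f C \<Longrightarrow> Lp_bd p N S a b g D \<Longrightarrow> 1 \<le> p \<Longrightarrow> Lp_bd p N S a b (\<lambda>t. f t - g t) (C + D)"
  using Lp_bd_add[OF _ Lp_bd_minus, of p a b f C g D] by simp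

lemma Lp_bd_zero: "0 < p \<Longrightarrow> 0 \<le> C \<Longrightarrow> Lp_bd p N S a b (\<lambda>t. 0) C"
  unfolding Lp_bd_def by (auto simp: N_0 intro!: sm_const S_0 Lp_le_zero)

lemma Lp_bd_subinterval:
  assumes f: "Lp_bd p N S a b f C" and "a \<le> a'" "b' \<le> b"
  shows "Lp_bd p N S a' b' f C"
  using f assms unfolding Lp_bd_def
  by (auto intro: sm_subinterval Lp_le_subset[of _ "{a<..<b}"])

lemma Lp_bd_imp_L1:
  assumes f: "Lp_bd p N S a b f C" and "1 \<le> p" "a \<le> b"
  shows "Lp_bd 1 N S a b f ((1 + (b - a)) * C)"
  using f assms unfolding Lp_bd_def
  by (auto intro!: Lp_le_imp_L1[where p=p] emeasure_lebesgue_on_box)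

lemma Lp_bd_sum:
  assumes "\<And>i. i \<in> I \<Longrightarrow> Lp_bd p N S a b (f i) (c i)" "1 \<le> p"
  shows "Lp_bd p N S a b (\<lambda>t. \<Sum>i\<in>I. f i t) (\<Sum>i\<in>I. c i)"
  using assms
proof (induction I rule: infinite_finite_induct)
  case (insert x F)
  then show ?case using Lp_bd_add[of p a b "f x" "c x" "\<lambda>t. \<Sum>i\<in>F. f i t" "\<Sum>i\<in>F. c i"] by simp
qed (auto intro: Lp_bd_zero)

lemma Lp_bd_suminf:
  assumes f: "\<And>n::nat. Lp_bd p N S a b (f n) (c n)" and c: "summable c" and p: "1 \<le> p"
    and inS: "AE t in lebesgue_on {a<..<b}. g t \<in> S"
    and lim: "AE t in lebesgue_on {a<..<b}. (\<lambda>n. N ((\<Sum>i<n. f i t) - g t)) \<longlonglongrightarrow> 0"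
  shows "Lp_bd p N S a b g (suminf c)"
proof -
  have P: "Lp_bd p N S a b (\<lambda>t. \<Sum>i<n. f i t) (\<Sum>i<n. c i)" for n
    by (rule Lp_bd_sum) (use f p in auto)
  have sm: "sm a b g"
    by (rule sm_lim[OF _ inS lim]) (use P in \<open>auto simp: Lp_bd_def\<close>)
  have "Lp_le p (lebesgue_on {a<..<b}) (\<lambda>t. N (g t)) (suminf c)"
  proof (rule Lp_le_lim)
    show "Lp_le p (lebesgue_on {a<..<b}) (\<lambda>t. N (\<Sum>i<n. f i t)) (\<Sum>i<n. c i)" for n
      using P by (auto simp: Lp_bd_def)
    show "(\<lambda>n. sum c {..<n}) \<longlonglongrightarrow> suminf c" using c by (rule summable_LIMSEQ)
    have "AE t in lebesgue_on {a<..<b}. \<forall>n. f n t \<in> S"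
      unfolding AE_all_countable using f by (auto intro: sm_inS simp: Lp_bd_def)
    then show "AE t in lebesgue_on {a<..<b}. (\<lambda>n. N (\<Sum>i<n. f i t)) \<longlonglongrightarrow> N (g t)"
      using inS lim by eventually_elim (rule tendsto_N; auto intro!: S_sum)
  qed (use p sm_meas_N[OF sm] in auto)
  then show ?thesis using sm by (simp add: Lp_bd_def)
qed

text \<open>The approximating simple functions are replaced by 0 wherever they are farther from
  \<open>f\<close> than 0 is. The error is then dominated by \<open>N (f t)\<close>, and dominated
  convergence applies.\<close>

lemma L1_simple_approx:
  assumes f: "Lp_bd 1 N S a b f C" and e: "0 < e"
  shows "\<exists>s. simple_fun s \<and> range s \<subseteq> S \<and> Lp_bd 1 N S a b (\<lambda>t. f t - s t) e"
proof -
  have sm: "sm a b f" and L: "Lp_le 1 (lebesgue_on {a<..<b}) (\<lambda>t. N (f t)) C" using f by (auto simp: Lp_bd_def)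
  obtain s where s: "\<And>n. simple_fun (s n)" "\<And>n. range (s n) \<subseteq> S"
     "AE t in lebesgue_on {a<..<b}. (\<lambda>n::nat. N (s n t - f t)) \<longlonglongrightarrow> 0"
    using sm unfolding sm_iff by auto
  let ?M = "lebesgue_on {a<..<b}"
  define \<phi> where "\<phi> n t = (if N (f t - s n t) \<le> N (f t) then N (f t - s n t) else N (f t))" for n t
  define E where "E n = {t \<in> {a<..<b}. N (f t - s n t) \<le> N (f t)}" for n
  have fs: "sm a b (\<lambda>t. f t - s n t)" for n by (intro sm_diff sm sm_simple s)
  note [measurable] = sm_meas_N[OF fs] sm_meas_N[OF sm]
  have E: "E n \<in> sets lebesgue" for n
  proof -
    have "{t \<in> space ?M. N (f t - s n t) \<le> N (f t)} \<in> sets ?M" by measurable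
    then show ?thesis by (simp add: E_def space_restrict_space sets_restrict_space_iff)
  qed
  define r where "r n t = (indicator (E n) t :: real) *\<^sub>R s n t" for n t
  have ind: "simple_fun (\<lambda>t. indicator (E n) t :: real)" for n
  proof -
    have "(\<lambda>t. indicator (E n) t :: real) -` {y} = (if y = 1 then E n else if y = 0 then - E n else {})" for y :: real
      by (auto simp: indicator_def)
    moreover have "finite (range (\<lambda>t. indicator (E n) t :: real))"
      by (rule finite_subset[of _ "{0, 1}"]) (auto simp: indicator_def)
    ultimately show ?thesis using E[of n] by (auto simp: simple_fun_def Compl_in_sets_lebesgue)
  qed
  have r: "simple_fun (r n)" "range (r n) \<subseteq> S" for n
    unfolding r_def using simple_fun_comp2[OF ind s(1)] s(2)[of n] by (auto intro!: S_scale)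
  have fr: "sm a b (\<lambda>t. f t - r n t)" for n by (intro sm_diff sm sm_simple r)
  note [measurable] = sm_meas_N[OF fr]
  have \<phi>: "N (f t - r n t) = \<phi> n t" if "t \<in> {a<..<b}" for n t
    using that by (auto simp: r_def \<phi>_def E_def indicator_def)
  have "(\<lambda>n. \<integral>\<^sup>+ t. ennreal (N (f t - r n t)) \<partial>?M) \<longlonglongrightarrow> (\<integral>\<^sup>+ t. 0 \<partial>?M)"
  proof (rule nn_integral_dominated_convergence[where w="\<lambda>t. ennreal (N (f t))"])
    have "(\<integral>\<^sup>+ t. ennreal (N (f t)) \<partial>?M) = (\<integral>\<^sup>+ t. ennreal (N (f t) powr 1) \<partial>?M)"
      by (rule nn_integral_cong_AE) (use Lp_leD(3)[OF L] in auto)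
    also have "\<dots> \<le> ennreal (C powr 1)" using Lp_leD(4)[OF L] .
    also have "\<dots> < \<infinity>" by simp
    finally show "(\<integral>\<^sup>+ t. ennreal (N (f t)) \<partial>?M) < \<infinity>" .
    show "AE t in ?M. ennreal (N (f t - r n t)) \<le> ennreal (N (f t))" for n
      using AE_space by eventually_elim (auto simp: \<phi> \<phi>_def space_restrict_space intro!: ennreal_leI)
    show "AE t in ?M. (\<lambda>n. ennreal (N (f t - r n t))) \<longlonglongrightarrow> 0"
      using AE_space s(3) sm_inS[OF sm]
    proof eventually_elim
      case (elim t)
      then have t: "t \<in> {a<..<b}" by (simp add: space_restrict_space)
      have st: "s n t \<in> S" for n using s(2)[of n] by auto
      have "(\<lambda>n. N (f t - r n t)) \<longlonglongrightarrow> 0"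
      proof (rule Lim_null_comparison[OF _ elim(2)])
        have "norm (N (f t - r n t)) \<le> N (s n t - f t)" for n
          using elim st[of n] N_diff_commute[of "f t" "s n t"] N_nonneg[of "f t"] N_nonneg[of "f t - s n t"] S_diff[of "f t" "s n t"]
          by (auto simp: \<phi>[OF t] \<phi>_def)
        then show "\<forall>\<^sub>F n in sequentially. norm (N (f t - r n t)) \<le> N (s n t - f t)" by simp
      qed
      then show ?case using tendsto_ennrealI by fastforce
    qed
  qed auto
  then have "\<forall>\<^sub>F n in sequentially. (\<integral>\<^sup>+ t. ennreal (N (f t - r n t)) \<partial>?M) < ennreal e"
    using e by (intro order_tendstoD(2)) auto
  then obtain n where n: "(\<integral>\<^sup>+ t. ennreal (N (f t - r n t)) \<partial>?M) < ennreal e"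
    by (meson eventually_sequentially order_refl)
  have nn: "AE t in ?M. 0 \<le> N (f t - r n t)"
    using sm_inS[OF fr[of n]] by eventually_elim (rule N_nonneg)
  have "(\<integral>\<^sup>+ t. ennreal (N (f t - r n t) powr 1) \<partial>?M) = (\<integral>\<^sup>+ t. ennreal (N (f t - r n t)) \<partial>?M)"
    by (rule nn_integral_cong_AE) (use nn in auto)
  then have "Lp_bd 1 N S a b (\<lambda>t. f t - r n t) e"
    unfolding Lp_bd_def Lp_le_def using n nn e fr[of n] by auto
  then show ?thesis using r by blast
qed

end

interpretation X0: nspace UNIV "norm :: 'a::real_normed_vector \<Rightarrow> real"
  by unfold_locales (auto simp: norm_triangle_ineq)

text \<open>The simple functions that approximate in the stronger norm also do so in the weaker one,
  so measurability passes along the embedding together with the bound.\<close>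

lemma Lp_bd_norm_embedding:
  fixes S :: "'a::real_normed_vector set"
  assumes "nspace S N" and le: "\<And>x. x \<in> S \<Longrightarrow> norm x \<le> k * N x" and k: "0 \<le> k" "0 \<le> p"
    and f: "Lp_bd p N S a b f C"
  shows "Lp_bd p norm UNIV a b f (k * C)"
proof (rule X0.Lp_bd_le)
  interpret nspace S N by fact
  have sm: "sm a b f" using f by (simp add: Lp_bd_def)
  show "Lp_le p (lebesgue_on {a<..<b}) (\<lambda>t. k * N (f t)) (k * C)"
    using f k by (intro Lp_le_cmult) (auto simp: Lp_bd_def)
  show "AE t in lebesgue_on {a<..<b}. norm (f t) \<le> k * N (f t)"
    using sm_inS[OF sm] by eventually_elim (rule le)
  obtain s where s: "\<And>n. simple_fun (s n)" "\<And>n. range (s n) \<subseteq> S"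
     "AE t in lebesgue_on {a<..<b}. (\<lambda>n::nat. N (s n t - f t)) \<longlonglongrightarrow> 0"
    using sm unfolding sm_iff by auto
  have "AE t in lebesgue_on {a<..<b}. (\<lambda>n::nat. norm (s n t - f t)) \<longlonglongrightarrow> 0"
    using s(3) sm_inS[OF sm]
  proof eventually_elim
    case (elim t)
    show ?case
    proof (rule Lim_null_comparison)
      show "(\<lambda>n. k * N (s n t - f t)) \<longlonglongrightarrow> 0" using tendsto_mult_right_zero[OF elim(1)] .
      have "norm (s n t - f t) \<le> k * N (s n t - f t)" for n
        using s(2)[of n] elim by (intro le S_diff) auto
      then show "\<forall>\<^sub>F n in sequentially. norm (norm (s n t - f t)) \<le> k * N (s n t - f t)" by simp
    qed
  qed
  then show "X0.sm a b f" unfolding X0.sm_iff using s(1) by (intro conjI exI[of _ s]) auto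
qed (use k in auto)

section \<open>Gauge integrals of Bochner integrable functions\<close>

lemma Lp_le_1_integrable:
  fixes f :: "real \<Rightarrow> real"
  assumes "Lp_le 1 (lebesgue_on {a<..<b}) f C" "a \<le> b"
  shows "f integrable_on {a..b}" "integral {a..b} f \<le> C" "integrable (lebesgue_on {a<..<b}) f"
proof -
  note [measurable] = Lp_leD(2)[OF assms(1)]
  have "(\<integral>\<^sup>+ t. ennreal (f t) \<partial>lebesgue_on {a<..<b}) = (\<integral>\<^sup>+ t. ennreal (f t powr 1) \<partial>lebesgue_on {a<..<b})"
    by (rule nn_integral_cong_AE) (use Lp_leD(3)[OF assms(1)] in auto)
  also have "\<dots> \<le> ennreal (C powr 1)" using Lp_leD(4)[OF assms(1)] .
  finally have le: "(\<integral>\<^sup>+ t. ennreal (f t) \<partial>lebesgue_on {a<..<b}) \<le> ennreal C" using Lp_leD(1)[OF assms(1)] by simp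
  show int: "integrable (lebesgue_on {a<..<b}) f"
    by (rule integrableI_nonneg) (use Lp_leD(3)[OF assms(1)] order.strict_trans1[OF le ennreal_less_top] in auto)
  have on: "f integrable_on {a<..<b}" by (rule integrable_on_lebesgue_on[OF int]) simp
  then show "f integrable_on {a..b}" by (simp add: integrable_on_open_interval_real)
  have "integral {a..b} f = integral {a<..<b} f" by (simp add: integral_open_interval_real)
  also have "\<dots> = integral\<^sup>L (lebesgue_on {a<..<b}) f"
    by (rule lebesgue_integral_eq_integral[symmetric, OF int]) simp
  also have "\<dots> = enn2real (\<integral>\<^sup>+ t. ennreal (f t) \<partial>lebesgue_on {a<..<b})"
    by (rule integral_eq_nn_integral) (use Lp_leD(3)[OF assms(1)] in auto)
  also have "\<dots> \<le> C" using le Lp_leD(1)[OF assms(1)] by (intro enn2real_leI) auto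
  finally show "integral {a..b} f \<le> C" .
qed

lemma simple_fun_integrable:
  fixes s :: "real \<Rightarrow> 'a::banach"
  assumes "simple_fun s"
  shows "s integrable_on {a..b}"
proof -
  have s: "s = (\<lambda>t. \<Sum>y\<in>range s. indicat_real (s -` {y}) t *\<^sub>R y)"
  proof
    fix t
    have "(\<Sum>y\<in>range s. indicat_real (s -` {y}) t *\<^sub>R y) = (\<Sum>y\<in>range s. if y = s t then y else 0)"
      by (rule sum.cong) (auto simp: indicator_def)
    then show "s t = (\<Sum>y\<in>range s. indicat_real (s -` {y}) t *\<^sub>R y)"
      using assms by (simp add: simple_fun_def)
  qed
  show ?thesis
  proof (subst s, rule integrable_sum)
    show "finite (range s)" using assms by (simp add: simple_fun_def)
    fix y
    have "s -` {y} \<inter> {a..b} \<in> lmeasurable"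
      using assms by (intro bounded_set_imp_lmeasurable) (auto simp: simple_fun_def bounded_Int)
    then have "indicat_real (s -` {y}) integrable_on {a..b}" by (simp add: integrable_on_indicator)
    then show "(\<lambda>t. indicat_real (s -` {y}) t *\<^sub>R y) integrable_on {a..b}"
      unfolding integrable_on_def using has_integral_scaleR_left by blast
  qed
qed

text \<open>The derivative in \<open>is_deriv\<close> is a gauge integral, so integrability in a
  Banach space is checked by the Cauchy criterion. A Riemann sum of f - s has norm at most the
  Riemann sum of the real function norm (f - s), which lies within e/6 of an integral that is at
  most e/6. With e/6 for s itself, every fine sum of f is within e/2 of the integral of s.\<close>

lemma integrable_L1_approx:
  fixes f :: "real \<Rightarrow> 'a::banach"
  assumes "\<And>e. 0 < e \<Longrightarrow> \<exists>s. s integrable_on {a..b} \<and> (\<lambda>t. norm (f t - s t)) integrable_on {a..b} \<and>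
     integral {a..b} (\<lambda>t. norm (f t - s t)) \<le> e"
  shows "f integrable_on {a..b}"
proof -
  have "f integrable_on cbox a b"
    unfolding integrable_Cauchy
  proof (intro allI impI)
    fix e :: real assume "0 < e"
    then have e: "0 < e/6" by simp
    obtain s where s: "s integrable_on {a..b}" "(\<lambda>t. norm (f t - s t)) integrable_on {a..b}"
     "integral {a..b} (\<lambda>t. norm (f t - s t)) \<le> e/6" using assms[OF e] by auto
    obtain g1 where g1: "gauge g1" "\<And>D. D tagged_division_of cbox a b \<Longrightarrow> g1 fine D \<Longrightarrow>
       norm ((\<Sum>(x,K)\<in>D. measure lborel K *\<^sub>R s x) - integral {a..b} s) < e/6"
      using has_integral[THEN iffD1, rule_format, OF integrable_integral[OF s(1), folded box_real(2)] e] by auto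
    obtain g2 where g2: "gauge g2" "\<And>D. D tagged_division_of cbox a b \<Longrightarrow> g2 fine D \<Longrightarrow>
       norm ((\<Sum>(x,K)\<in>D. measure lborel K *\<^sub>R norm (f x - s x)) - integral {a..b} (\<lambda>t. norm (f t - s t))) < e/6"
      using has_integral[THEN iffD1, rule_format, OF integrable_integral[OF s(2), folded box_real(2)] e] by auto
    have close: "norm ((\<Sum>(x,K)\<in>D. measure lborel K *\<^sub>R f x) - integral {a..b} s) < e/2"
      if D: "D tagged_division_of cbox a b" "(\<lambda>x. g1 x \<inter> g2 x) fine D" for D
    proof -
      have D12: "g1 fine D" "g2 fine D" using D(2) by (auto simp: fine_def)
      have "(\<Sum>(x,K)\<in>D. measure lborel K *\<^sub>R f x) - (\<Sum>(x,K)\<in>D. measure lborel K *\<^sub>R s x) = (\<Sum>(x,K)\<in>D. measure lborel K *\<^sub>R (f x - s x))"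
        by (simp add: sum_subtractf[symmetric] case_prod_unfold scaleR_diff_right)
      also have "norm \<dots> \<le> (\<Sum>(x,K)\<in>D. measure lborel K *\<^sub>R norm (f x - s x))"
        by (rule sum_norm_le) auto
      also have "\<dots> < e/6 + e/6" using g2(2)[OF D(1) D12(2)] s(3) by (simp add: abs_if split: if_splits)
      finally have "norm ((\<Sum>(x,K)\<in>D. measure lborel K *\<^sub>R f x) - (\<Sum>(x,K)\<in>D. measure lborel K *\<^sub>R s x)) < e/6 + e/6" .
      moreover have "norm ((\<Sum>(x,K)\<in>D. measure lborel K *\<^sub>R s x) - integral {a..b} s) < e/6" by (rule g1(2)[OF D(1) D12(1)])
      ultimately have "norm ((\<Sum>(x,K)\<in>D. measure lborel K *\<^sub>R f x) - integral {a..b} s) < (e/6 + e/6) + e/6"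
        by (rule norm_diff_triangle_less)
      then show ?thesis by simp
    qed
    show "\<exists>\<gamma>. gauge \<gamma> \<and> (\<forall>\<D>1 \<D>2. \<D>1 tagged_division_of (cbox a b) \<and> \<gamma> fine \<D>1 \<and>
            \<D>2 tagged_division_of (cbox a b) \<and> \<gamma> fine \<D>2 \<longrightarrow>
            norm ((\<Sum>(x,K)\<in>\<D>1. measure lborel K *\<^sub>R f x) - (\<Sum>(x,K)\<in>\<D>2. measure lborel K *\<^sub>R f x)) < e)"
    proof (intro exI[of _ "\<lambda>x. g1 x \<inter> g2 x"] conjI allI impI)
      show "gauge (\<lambda>x. g1 x \<inter> g2 x)" using g1(1) g2(1) by (rule gauge_Int)
      fix D1 D2 assume *: "D1 tagged_division_of cbox a b \<and> (\<lambda>x. g1 x \<inter> g2 x) fine D1 \<and>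
            D2 tagged_division_of cbox a b \<and> (\<lambda>x. g1 x \<inter> g2 x) fine D2"
      show "norm ((\<Sum>(x,K)\<in>D1. measure lborel K *\<^sub>R f x) - (\<Sum>(x,K)\<in>D2. measure lborel K *\<^sub>R f x)) < e"
        by (rule norm_triangle_half_l[of _ "integral {a..b} s"]) (use close * in \<open>auto simp: norm_minus_commute\<close>)
    qed
  qed
  then show ?thesis by simp
qed

lemma L1_integrable:
  fixes f :: "real \<Rightarrow> 'a::banach"
  assumes f: "Lp_bd 1 norm UNIV a b f C" and ab: "a \<le> b"
  shows "f integrable_on {a..b}" "norm (integral {a..b} f) \<le> C"
proof -
  show int: "f integrable_on {a..b}"
  proof (rule integrable_L1_approx)
    fix e :: real assume "0 < e"
    then obtain s where "simple_fun s" "Lp_bd 1 norm UNIV a b (\<lambda>t. f t - s t) e"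
      using X0.L1_simple_approx[OF f] by blast
    then show "\<exists>s. s integrable_on {a..b} \<and> (\<lambda>t. norm (f t - s t)) integrable_on {a..b} \<and>
     integral {a..b} (\<lambda>t. norm (f t - s t)) \<le> e"
      using ab by (intro exI[of _ s]) (auto simp: Lp_bd_def Lp_le_1_integrable simple_fun_integrable)
  qed
  have "norm (integral {a..b} f) \<le> integral {a..b} (\<lambda>t. norm (f t))"
    using int f ab by (intro integral_norm_bound_integral) (auto simp: Lp_bd_def Lp_le_1_integrable)
  also have "\<dots> \<le> C" using f ab by (auto simp: Lp_bd_def Lp_le_1_integrable)
  finally show "norm (integral {a..b} f) \<le> C" .
qed

text \<open>The remainder after n terms has L^1 norm at most the tail of \<open>c\<close>, and an
  integral is bounded by the L^1 norm.\<close>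

lemma L1_suminf:
  fixes f :: "nat \<Rightarrow> real \<Rightarrow> 'a::banach"
  assumes f: "\<And>n. Lp_bd 1 norm UNIV a b (f n) (c n)" and c: "summable c" and ab: "a \<le> b"
    and g: "AE t in lebesgue_on {a<..<b}. (\<lambda>n. f n t) sums g t"
  shows "(\<lambda>n. integral {a..b} (f n)) sums integral {a..b} g"
proof -
  have G: "Lp_bd 1 norm UNIV a b g (suminf c)"
    by (rule X0.Lp_bd_suminf[OF f c]) (use g in \<open>auto simp: sums_def tendsto_norm_zero_iff LIM_zero_iff\<close>)
  have "norm ((\<Sum>i<n. integral {a..b} (f i)) - integral {a..b} g) \<le> (\<Sum>i. c (i + n))" for n
  proof -
    have L: "Lp_bd 1 norm UNIV a b (\<lambda>t. g t - (\<Sum>i<n. f i t)) (\<Sum>i. c (i + n))"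
    proof (rule X0.Lp_bd_suminf[OF f])
      show "summable (\<lambda>i. c (i + n))" using c by (rule summable_ignore_initial_segment)
      show "AE t in lebesgue_on {a<..<b}. (\<lambda>m. norm ((\<Sum>i<m. f (i + n) t) - (g t - (\<Sum>i<n. f i t)))) \<longlonglongrightarrow> 0"
        using g
      proof eventually_elim
        case (elim t)
        show ?case using sums_split_initial_segment[OF elim, of n]
          by (simp add: sums_def tendsto_norm_zero_iff LIM_zero_iff)
      qed
    qed auto
    have "integral {a..b} (\<lambda>t. g t - (\<Sum>i<n. f i t)) = integral {a..b} g - (\<Sum>i<n. integral {a..b} (f i))"
      using L1_integrable(1)[OF f ab] L1_integrable(1)[OF G ab]
      by (subst integral_diff) (auto intro!: integrable_sum simp: integral_sum)
    then show ?thesis using L1_integrable(2)[OF L ab] by (simp add: norm_minus_commute)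
  qed
  moreover have "(\<lambda>n. \<Sum>i. c (i + n)) \<longlonglongrightarrow> 0"
    using suminf_exist_split2[OF c] .
  ultimately have "(\<lambda>n. (\<Sum>i<n. integral {a..b} (f i)) - integral {a..b} g) \<longlonglongrightarrow> 0"
    by (intro Lim_null_comparison[where f="\<lambda>n. (\<Sum>i<n. integral {a..b} (f i)) - integral {a..b} g"]) auto
  then show ?thesis by (simp add: sums_def LIM_zero_iff)
qed

section \<open>Real interpolation by the K-method\<close>

locale couple =
  fixes X1 :: "'a::banach set" and n1 :: "'a \<Rightarrow> real" and p :: real
  assumes p: "1 < p" and emb: "embedded_banach X1 n1"
begin

abbreviation (input) K where "K \<equiv> Kfun X1 n1"
abbreviation (input) Xg where "Xg \<equiv> interp_space X1 n1 (1 - 1/p) p"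
abbreviation (input) Ng where "Ng \<equiv> interp_norm X1 n1 (1 - 1/p) p"

sublocale N1: nspace X1 n1
  using emb unfolding embedded_banach_def by unfold_locales auto

lemma X1_complete:
  assumes "\<And>n::nat. s n \<in> X1" "\<And>e. 0 < e \<Longrightarrow> \<exists>N. \<forall>m\<ge>N. \<forall>n\<ge>N. n1 (s m - s n) < e"
  shows "\<exists>x\<in>X1. (\<lambda>n. n1 (s n - x)) \<longlonglongrightarrow> 0"
  using emb assms unfolding embedded_banach_def by blast

lemma n1_eq_0: "x \<in> X1 \<Longrightarrow> n1 x = 0 \<Longrightarrow> x = 0"
  using emb unfolding embedded_banach_def by blast

text \<open>An embedding constant fixed once for the couple, so that every later constant refers to
  the same one; \<open>1 \<le> c0\<close> allows it to absorb factors 1.\<close>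

definition c0 :: real where "c0 = (SOME c. 1 \<le> c \<and> (\<forall>x\<in>X1. norm x \<le> c * n1 x))"

lemma c0: "1 \<le> c0" "x \<in> X1 \<Longrightarrow> norm x \<le> c0 * n1 x"
proof -
  have "\<exists>c>0. \<forall>x\<in>X1. norm x \<le> c * n1 x"
    using emb unfolding embedded_banach_def by (elim conjE)
  then obtain c where c: "0 < c" "\<And>x. x \<in> X1 \<Longrightarrow> norm x \<le> c * n1 x" by blast
  have "norm x \<le> max 1 c * n1 x" if "x \<in> X1" for x
    using order_trans[OF c(2)[OF that] mult_right_mono[of c "max 1 c" "n1 x"]] N1.N_nonneg[OF that] by simp
  then have "\<exists>c. 1 \<le> c \<and> (\<forall>x\<in>X1. norm x \<le> c * n1 x)" by (intro exI[of _ "max 1 c"] conjI ballI) simp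
  from someI_ex[OF this] show "1 \<le> c0" "x \<in> X1 \<Longrightarrow> norm x \<le> c0 * n1 x" unfolding c0_def by auto
qed

lemma Kfun_alt: "K s x = (INF x1\<in>X1. norm (x - x1) + s * n1 x1)"
  unfolding Kfun_def
proof (rule arg_cong[where f=Inf], intro equalityI subsetI)
  fix z assume "z \<in> {norm x0 + s * n1 x1 |x0 x1. x1 \<in> X1 \<and> x = x0 + x1}"
  then show "z \<in> (\<lambda>x1. norm (x - x1) + s * n1 x1) ` X1" by force
next
  fix z assume "z \<in> (\<lambda>x1. norm (x - x1) + s * n1 x1) ` X1"
  then obtain y where "y \<in> X1" "z = norm (x - y) + s * n1 y" by auto
  then show "z \<in> {norm x0 + s * n1 x1 |x0 x1. x1 \<in> X1 \<and> x = x0 + x1}"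
    by (intro CollectI exI[of _ "x - y"] exI[of _ y]) auto
qed

lemma K_bdd: "0 \<le> s \<Longrightarrow> bdd_below ((\<lambda>x1. norm (x - x1) + s * n1 x1) ` X1)"
  by (rule bdd_belowI[of _ 0]) (auto intro!: add_nonneg_nonneg mult_nonneg_nonneg N1.N_nonneg)

lemma K_le: "0 \<le> s \<Longrightarrow> y \<in> X1 \<Longrightarrow> K s x \<le> norm (x - y) + s * n1 y"
  unfolding Kfun_alt by (rule cINF_lower[OF K_bdd])

lemma K_greatest: "(\<And>y. y \<in> X1 \<Longrightarrow> m \<le> norm (x - y) + s * n1 y) \<Longrightarrow> m \<le> K s x"
  unfolding Kfun_alt using N1.S_0 by (intro cINF_greatest) auto

lemma K_approx: "0 \<le> s \<Longrightarrow> K s x < m \<Longrightarrow> \<exists>y\<in>X1. norm (x - y) + s * n1 y < m"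
  unfolding Kfun_alt using N1.S_0 by (subst (asm) cINF_less_iff[OF _ K_bdd]) auto

lemma K_nonneg: "0 \<le> s \<Longrightarrow> 0 \<le> K s x"
  by (rule K_greatest) (auto intro!: add_nonneg_nonneg mult_nonneg_nonneg N1.N_nonneg)

lemma K_le_norm: "0 \<le> s \<Longrightarrow> K s x \<le> norm x"
  using K_le[of s 0 x] N1.S_0 by (simp add: N1.N_0)

lemma K_le_n1: "0 \<le> s \<Longrightarrow> x \<in> X1 \<Longrightarrow> K s x \<le> s * n1 x"
  using K_le[of s x x] by simp

lemma K_mono: "0 \<le> s \<Longrightarrow> s \<le> t \<Longrightarrow> K s x \<le> K t x"
proof (rule K_greatest)
  fix y assume "0 \<le> s" "s \<le> t" "y \<in> X1"
  then show "K s x \<le> norm (x - y) + t * n1 y"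
    using K_le[of s y x] mult_right_mono[of s t "n1 y"] N1.N_nonneg[of y] by simp
qed

text \<open>Scaling a splitting cost at t by s / t \<le> 1 turns t into s in the second term and
  only decreases the first. Together with \<open>K_mono\<close> this makes \<open>K\<close>
  comparable across a dyadic interval.\<close>

lemma K_quot: "0 < s \<Longrightarrow> s \<le> t \<Longrightarrow> K t x / t \<le> K s x / s"
proof -
  assume st: "0 < s" "s \<le> t"
  have "s / t * K t x \<le> K s x"
  proof (rule K_greatest)
    fix y assume y: "y \<in> X1"
    have "s / t * K t x \<le> s / t * (norm (x - y) + t * n1 y)"
      using st K_le[of t y x] y by (intro mult_left_mono) auto
    also have "\<dots> = s / t * norm (x - y) + s * n1 y" using st by (simp add: algebra_simps)
    also have "\<dots> \<le> 1 * norm (x - y) + s * n1 y"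
      using st by (intro add_right_mono mult_right_mono) auto
    finally show "s / t * K t x \<le> norm (x - y) + s * n1 y" by simp
  qed
  then show ?thesis using st by (simp add: field_simps)
qed

lemma K_double: "0 < s \<Longrightarrow> t \<le> 2 * s \<Longrightarrow> 0 < t \<Longrightarrow> K t x \<le> 2 * K s x"
  using K_mono[of t "2 * s" x] K_quot[of s "2 * s" x] by (simp add: field_simps)

lemma K_add: assumes "0 \<le> s" shows "K s (x + y) \<le> K s x + K s y"
proof -
  have "K s (x + y) - K s y \<le> K s x"
  proof (rule K_greatest)
    fix a assume a: "a \<in> X1"
    have "K s (x + y) - (norm (x - a) + s * n1 a) \<le> K s y"
    proof (rule K_greatest)
      fix b assume b: "b \<in> X1"
      have "K s (x + y) \<le> norm ((x - a) + (y - b)) + s * n1 (a + b)"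
        using K_le[OF assms N1.S_add[OF a b], of "x + y"] by (simp add: algebra_simps)
      also have "\<dots> \<le> (norm (x - a) + norm (y - b)) + s * (n1 a + n1 b)"
        using assms by (intro add_mono norm_triangle_ineq mult_left_mono N1.N_add a b)
      finally show "K s (x + y) - (norm (x - a) + s * n1 a) \<le> norm (y - b) + s * n1 b"
        by (simp add: algebra_simps)
    qed
    then show "K s (x + y) - K s y \<le> norm (x - a) + s * n1 a" by simp
  qed
  then show ?thesis by simp
qed

lemma K_scale_le: assumes "0 \<le> s" "c \<noteq> 0" shows "K s (c *\<^sub>R x) \<le> \<bar>c\<bar> * K s x"
proof -
  have "K s (c *\<^sub>R x) / \<bar>c\<bar> \<le> K s x"
  proof (rule K_greatest)
    fix a assume a: "a \<in> X1"
    have "K s (c *\<^sub>R x) \<le> norm (c *\<^sub>R (x - a)) + s * n1 (c *\<^sub>R a)"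
      using K_le[OF assms(1) N1.S_scale[OF a], of "c *\<^sub>R x" c] by (simp add: scaleR_diff_right)
    also have "\<dots> = \<bar>c\<bar> * (norm (x - a) + s * n1 a)" using a by (simp add: N1.N_scale distrib_left)
    finally show "K s (c *\<^sub>R x) / \<bar>c\<bar> \<le> norm (x - a) + s * n1 a" using assms by (simp add: field_simps)
  qed
  then show ?thesis using assms by (simp add: field_simps)
qed

lemma K_scale: assumes "0 \<le> s" shows "K s (c *\<^sub>R x) = \<bar>c\<bar> * K s x"
proof (cases "c = 0")
  case True
  then show ?thesis using K_le_norm[OF assms, of 0] K_nonneg[OF assms, of 0] by simp
next
  case False
  have "K s x = K s ((1/c) *\<^sub>R (c *\<^sub>R x))" using False by simp
  also have "\<dots> \<le> \<bar>1/c\<bar> * K s (c *\<^sub>R x)" by (rule K_scale_le) (use assms False in auto)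
  finally have "\<bar>c\<bar> * K s x \<le> K s (c *\<^sub>R x)" using False by (simp add: field_simps)
  then show ?thesis using K_scale_le[OF assms False, of x] by simp
qed

lemma nspace_K: "0 \<le> s \<Longrightarrow> nspace UNIV (K s)"
  by unfold_locales (auto simp: K_nonneg K_add K_scale)

lemma K_lip: "0 \<le> s \<Longrightarrow> \<bar>K s x - K s y\<bar> \<le> norm (x - y)"
  using nspace.N_abs_diff[OF nspace_K, of s x y] K_le_norm[of s "x - y"] by simp

text \<open>For s \<ge> 1 splitting gains nothing, as the embedding bounds the norm of each summand
  by c0 times its cost. This is why the extension below may start with the approximant 0 at scale
  1.\<close>

lemma norm_le_K: assumes "1 \<le> s" shows "norm x \<le> c0 * K s x"
proof -
  have "norm x / c0 \<le> K s x"
  proof (rule K_greatest)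
    fix y assume y: "y \<in> X1"
    have "norm x \<le> norm (x - y) + norm y" using norm_triangle_ineq[of "x - y" y] by simp
    also have "\<dots> \<le> c0 * norm (x - y) + c0 * n1 y"
      using c0(1) c0(2)[OF y] mult_right_mono[of 1 c0 "norm (x - y)"] by simp
    also have "\<dots> \<le> c0 * norm (x - y) + c0 * (s * n1 y)"
      using assms c0(1) N1.N_nonneg[OF y] mult_right_mono[of 1 s "n1 y"] by simp
    finally show "norm x / c0 \<le> norm (x - y) + s * n1 y" using c0(1) by (simp add: field_simps)
  qed
  then show ?thesis using c0(1) by (simp add: field_simps)
qed

lemma K_pos: assumes "0 < s" "x \<noteq> 0" shows "0 < K s x"
proof (cases "1 \<le> s")
  case True
  have "0 < norm x" using assms by simp
  also have "\<dots> \<le> c0 * K s x" by (rule norm_le_K[OF True])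
  finally show ?thesis using c0(1) by (simp add: zero_less_mult_iff)
next
  case False
  have "0 < norm x" using assms by simp
  also have "\<dots> \<le> c0 * K 1 x" by (rule norm_le_K) simp
  finally have "0 < K 1 x" using c0(1) by (simp add: zero_less_mult_iff)
  moreover have "K 1 x / 1 \<le> K s x / s" using False assms by (intro K_quot) auto
  ultimately have "0 < K s x / s" by simp
  then show ?thesis using assms by (simp add: zero_less_divide_iff)
qed

section \<open>The interpolation norm as an L^p norm of the K-functional\<close>

lemma K_borel: "(\<lambda>s. indicator {0<..} s *\<^sub>R K s x) \<in> borel_measurable borel"
proof -
  have "mono_on {0<..} (\<lambda>s. K s x)" by (auto intro!: mono_onI K_mono)
  then have "(\<lambda>s. K s x) \<in> borel_measurable (restrict_space borel {0<..})" by (rule borel_measurable_mono_on_fnc)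
  then show ?thesis by (subst (asm) borel_measurable_restrict_space_iff) auto
qed

lemma K_meas: "(\<lambda>s. K s x / s) \<in> borel_measurable (lebesgue_on {0<..})"
proof -
  have "(\<lambda>s. indicator {0<..} s *\<^sub>R K s x) \<in> borel_measurable lebesgue"
    using K_borel measurable_completion measurable_lborel2 by blast
  then have "(\<lambda>s. K s x) \<in> borel_measurable (lebesgue_on {0<..})"
    by (subst borel_measurable_restrict_space_iff) auto
  moreover have "(\<lambda>s. s) \<in> borel_measurable (lebesgue_on {0::real<..})"
    by (rule measurable_restrict_space1) (simp add: measurable_completion)
  ultimately show ?thesis by (rule borel_measurable_divide)
qed

text \<open>For \<theta> = 1 - 1/p and q = p the exponents of s combine to - \<theta> p - 1 = - p.
  The norm is the plain L^p norm of K(s, x) / s, so s can be read as time in the trace and extension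
  estimates.\<close>

lemma interp_int_eq:
  "interp_int X1 n1 (1 - 1/p) p x = (\<integral>\<^sup>+ s. ennreal ((K s x / s) powr p) \<partial>lebesgue_on {0<..})"
proof -
  have "((s powr (-(1 - 1/p)) * K s x) powr p / s) = (K s x / s) powr p" if "0 < s" for s
  proof -
    have "(s powr (-(1 - 1/p)) * K s x) powr p / s = s powr (-(1 - 1/p) * p) * K s x powr p * s powr (-1)"
      using that K_nonneg[of s x] by (simp add: powr_mult powr_powr powr_minus divide_inverse)
    also have "\<dots> = s powr (-(1 - 1/p) * p + -1) * K s x powr p"
      by (simp only: powr_add mult_ac)
    also have "-(1 - 1/p) * p + -1 = - p" using p by (simp add: field_simps)
    also have "s powr - p * K s x powr p = (K s x / s) powr p"
      using that K_nonneg[of s x] by (simp add: powr_divide powr_minus_divide)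
    finally show ?thesis .
  qed
  then show ?thesis unfolding interp_int_def
    by (subst nn_integral_restrict_space) (auto intro!: nn_integral_cong simp: indicator_def)
qed

lemma K_AE_nonneg: "AE s in lebesgue_on {0<..}. 0 \<le> K s x / s"
  by (rule AE_I2) (auto simp: space_restrict_space K_nonneg)

lemma Xg_Lp_le: assumes "x \<in> Xg" shows "Lp_le p (lebesgue_on {0<..}) (\<lambda>s. K s x / s) (Ng x)"
proof -
  have "interp_int X1 n1 (1 - 1/p) p x = ennreal (enn2real (interp_int X1 n1 (1 - 1/p) p x))"
    using assms by (simp add: interp_space_def)
  also have "enn2real (interp_int X1 n1 (1 - 1/p) p x) = Ng x powr p"
    using p by (simp add: interp_norm_def powr_powr)
  finally have "(\<integral>\<^sup>+ s. ennreal ((K s x / s) powr p) \<partial>lebesgue_on {0<..}) = ennreal (Ng x powr p)"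
    unfolding interp_int_eq .
  moreover have "0 \<le> Ng x" by (simp add: interp_norm_def)
  ultimately show ?thesis unfolding Lp_le_def using K_meas K_AE_nonneg by simp
qed

lemma Lp_le_Xg:
  assumes "Lp_le p (lebesgue_on {0<..}) (\<lambda>s. K s x / s) C"
  shows "x \<in> Xg" "Ng x \<le> C"
proof -
  have le: "interp_int X1 n1 (1 - 1/p) p x \<le> ennreal (C powr p)"
    using Lp_leD(4)[OF assms] by (simp add: interp_int_eq)
  also have "\<dots> < \<infinity>" by simp
  finally show "x \<in> Xg" by (simp add: interp_space_def)
  have "enn2real (interp_int X1 n1 (1 - 1/p) p x) \<le> C powr p" using le by (intro enn2real_leI) auto
  then have "Ng x \<le> (C powr p) powr (1/p)" unfolding interp_norm_def using p by (intro powr_mono2) auto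
  then show "Ng x \<le> C" using p Lp_leD(1)[OF assms] by (simp add: powr_powr)
qed

lemma Ng_nonneg: "0 \<le> Ng x" by (simp add: interp_norm_def)

lemma Xg_mono:
  assumes g: "Lp_le p (lebesgue_on {0<..}) g C" and "\<And>s. 0 < s \<Longrightarrow> K s x / s \<le> g s"
  shows "x \<in> Xg" "Ng x \<le> C"
proof -
  have "Lp_le p (lebesgue_on {0<..}) (\<lambda>s. K s x / s) C"
  proof (rule Lp_le_mono[OF g K_meas])
    show "AE s in lebesgue_on {0<..}. 0 \<le> K s x / s \<and> K s x / s \<le> g s"
      by (rule AE_I2) (auto simp: space_restrict_space K_nonneg assms)
  qed (use p in auto)
  then show "x \<in> Xg" "Ng x \<le> C" by (auto dest: Lp_le_Xg)
qed

lemma Xg_add: assumes "x \<in> Xg" "y \<in> Xg" shows "x + y \<in> Xg" "Ng (x + y) \<le> Ng x + Ng y"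
proof -
  have "Lp_le p (lebesgue_on {0<..}) (\<lambda>s. K s x / s + K s y / s) (Ng x + Ng y)"
    using p assms by (intro Lp_le_add Xg_Lp_le) auto
  moreover have "K s (x + y) / s \<le> K s x / s + K s y / s" if "0 < s" for s
    using that K_add[of s x y] by (simp add: add_divide_distrib[symmetric] divide_right_mono)
  ultimately show "x + y \<in> Xg" "Ng (x + y) \<le> Ng x + Ng y" using Xg_mono by blast+
qed

lemma Xg_scale_le: assumes "x \<in> Xg" shows "c *\<^sub>R x \<in> Xg" "Ng (c *\<^sub>R x) \<le> \<bar>c\<bar> * Ng x"
proof -
  have "Lp_le p (lebesgue_on {0<..}) (\<lambda>s. \<bar>c\<bar> * (K s x / s)) (\<bar>c\<bar> * Ng x)"
    using assms by (intro Lp_le_cmult Xg_Lp_le) auto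
  moreover have "K s (c *\<^sub>R x) / s \<le> \<bar>c\<bar> * (K s x / s)" if "0 < s" for s
    using that by (simp add: K_scale)
  ultimately show "c *\<^sub>R x \<in> Xg" "Ng (c *\<^sub>R x) \<le> \<bar>c\<bar> * Ng x" using Xg_mono by blast+
qed

lemma Xg_0: "0 \<in> Xg" "Ng 0 = 0"
proof -
  have "K s 0 / s \<le> 0" if "0 < s" for s using K_le_norm[of s 0] that by (simp add: divide_nonpos_pos)
  then have *: "0 \<in> Xg" "Ng 0 \<le> 0" using Xg_mono[OF Lp_le_zero[of 0 p], of 0] p by auto
  then show "0 \<in> Xg" "Ng 0 = 0" using Ng_nonneg[of 0] by auto
qed

sublocale NG: nspace Xg Ng
proof
  show "subspace Xg" by (auto simp: subspace_def Xg_0 Xg_add Xg_scale_le)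
  show "Ng (c *\<^sub>R x) = \<bar>c\<bar> * Ng x" if "x \<in> Xg" for x c
  proof (cases "c = 0")
    case False
    have "Ng ((1/c) *\<^sub>R (c *\<^sub>R x)) \<le> \<bar>1/c\<bar> * Ng (c *\<^sub>R x)" using that by (intro Xg_scale_le)
    then have "\<bar>c\<bar> * Ng x \<le> Ng (c *\<^sub>R x)" using False by (simp add: field_simps)
    then show ?thesis using Xg_scale_le(2)[OF that, of c] by simp
  qed (simp add: Xg_0)
qed (auto simp: Xg_add Ng_nonneg)

text \<open>On (t, 2t) monotonicity gives K(s) / s \<ge> K(t) / (2t); integrate the p-th power over
  this interval of length t.\<close>

lemma K_le_Ng: assumes x: "x \<in> Xg" and t: "0 < t" shows "K t x \<le> 2 * t powr (1 - 1/p) * Ng x"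
proof -
  have "ennreal ((K t x / (2 * t)) powr p) * ennreal t
      = (\<integral>\<^sup>+ s. ennreal ((K t x / (2 * t)) powr p) * indicator {t<..<2*t} s \<partial>lebesgue)"
    using t by (simp add: nn_integral_cmult_indicator)
  also have "\<dots> \<le> (\<integral>\<^sup>+ s. ennreal ((K s x / s) powr p) * indicator {0<..} s \<partial>lebesgue)"
  proof (rule nn_integral_mono)
    fix s :: real
    show "ennreal ((K t x / (2 * t)) powr p) * indicator {t<..<2*t} s \<le> ennreal ((K s x / s) powr p) * indicator {0<..} s"
    proof (cases "s \<in> {t<..<2*t}")
      case True
      then have s: "t < s" "s < 2 * t" by auto
      have "K t x / (2 * t) \<le> K s x / s"
        using s t K_mono[of t s x] K_nonneg[of t x] by (intro frac_le) auto
      then show ?thesis using s t p K_nonneg[of t x] by (auto intro!: ennreal_leI powr_mono2)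
    qed simp
  qed
  also have "\<dots> = (\<integral>\<^sup>+ s. ennreal ((K s x / s) powr p) \<partial>lebesgue_on {0<..})"
    by (simp add: nn_integral_restrict_space)
  also have "\<dots> \<le> ennreal (Ng x powr p)" by (rule Lp_leD(4)[OF Xg_Lp_le[OF x]])
  finally have "(K t x / (2 * t)) powr p * t \<le> Ng x powr p"
    using t by (simp add: ennreal_mult[symmetric])
  then have "((K t x / (2 * t)) powr p * t) powr (1/p) \<le> (Ng x powr p) powr (1/p)"
    using p t by (intro powr_mono2) auto
  then have "K t x / (2 * t) * t powr (1/p) \<le> Ng x"
    using p t K_nonneg[of t x] Ng_nonneg[of x] by (simp add: powr_mult powr_powr)
  then have "K t x * t powr (1/p) \<le> 2 * t * Ng x" using t by (simp add: field_simps)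
  then have "K t x \<le> 2 * (t / t powr (1/p)) * Ng x" using t by (simp add: field_simps)
  then show ?thesis using t by (simp add: powr_diff)
qed

lemma norm_le_Ng: assumes x: "x \<in> Xg" shows "norm x \<le> 2 * c0 * Ng x"
proof -
  have "norm x \<le> c0 * K 1 x" by (rule norm_le_K) simp
  also have "\<dots> \<le> c0 * (2 * Ng x)" using K_le_Ng[OF x, of 1] c0(1) by (intro mult_left_mono) auto
  finally show ?thesis by simp
qed

text \<open>Fatou's lemma in s, since K(s, .) is 1-Lipschitz for the norm of X0. Limits of series in
  the trace space are identified in this way from their convergence in X0, in place of an appeal to
  completeness of the trace space.\<close>

lemma Ng_lsc:
  assumes "\<And>n::nat. y n \<in> Xg" "\<And>n. Ng (y n) \<le> C n" "C \<longlonglongrightarrow> C'" "y \<longlonglongrightarrow> x"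
  shows "x \<in> Xg" "Ng x \<le> C'"
proof -
  have "Lp_le p (lebesgue_on {0<..}) (\<lambda>s. K s x / s) C'"
  proof (rule Lp_le_lim)
    show "Lp_le p (lebesgue_on {0<..}) (\<lambda>s. K s (y n) / s) (C n)" for n
      by (rule Lp_le_bound_mono[OF Xg_Lp_le[OF assms(1)] assms(2)]) (use p in auto)
    show "AE s in lebesgue_on {0<..}. (\<lambda>n. K s (y n) / s) \<longlonglongrightarrow> K s x / s"
    proof (rule AE_I2)
      fix s :: real assume "s \<in> space (lebesgue_on {0<..})"
      then have s: "0 < s" by (simp add: space_restrict_space)
      have "(\<lambda>n. K s (y n) - K s x) \<longlonglongrightarrow> 0"
      proof (rule Lim_null_comparison)
        show "(\<lambda>n. norm (y n - x)) \<longlonglongrightarrow> 0" using assms(4) by (simp add: LIM_zero_iff tendsto_norm_zero_iff)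
      qed (use K_lip[of s] s in auto)
      then have "(\<lambda>n. K s (y n)) \<longlonglongrightarrow> K s x" by (simp add: LIM_zero_iff)
      then show "(\<lambda>n. K s (y n) / s) \<longlonglongrightarrow> K s x / s" by (intro tendsto_divide) (use s in auto)
    qed
  qed (use p assms K_meas in auto)
  then show "x \<in> Xg" "Ng x \<le> C'" by (auto dest: Lp_le_Xg)
qed

text \<open>Dominated convergence in s: K(s, y n) \<le> norm (y n) tends to 0, and M K(s, x) is the
  majorant. It turns continuity in X0 into continuity in the trace norm.\<close>

lemma Ng_dominated:
  assumes x: "x \<in> Xg" and y: "\<And>n s. 0 < s \<Longrightarrow> K s (y n) \<le> M * K s x" "y \<longlonglongrightarrow> 0" and M: "0 \<le> M"
  shows "(\<lambda>n. Ng (y n)) \<longlonglongrightarrow> 0"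
proof -
  let ?L = "lebesgue_on {0::real<..}"
  note [measurable] = K_meas
  have "(\<lambda>n. \<integral>\<^sup>+ s. ennreal ((K s (y n) / s) powr p) \<partial>?L) \<longlonglongrightarrow> (\<integral>\<^sup>+ s. 0 \<partial>?L)"
  proof (rule nn_integral_dominated_convergence[where w="\<lambda>s. ennreal ((M * (K s x / s)) powr p)"])
    have "(\<integral>\<^sup>+ s. ennreal ((M * (K s x / s)) powr p) \<partial>?L) \<le> ennreal ((M * Ng x) powr p)"
      by (rule Lp_leD(4)[OF Lp_le_cmult[OF Xg_Lp_le[OF x] M]])
    also have "\<dots> < \<infinity>" by simp
    finally show "(\<integral>\<^sup>+ s. ennreal ((M * (K s x / s)) powr p) \<partial>?L) < \<infinity>" .
    show "AE s in ?L. ennreal ((K s (y n) / s) powr p) \<le> ennreal ((M * (K s x / s)) powr p)" for n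
      by (rule AE_I2) (use p y(1) K_nonneg in \<open>auto simp: space_restrict_space intro!: ennreal_leI powr_mono2 divide_right_mono\<close>)
    show "AE s in ?L. (\<lambda>n. ennreal ((K s (y n) / s) powr p)) \<longlonglongrightarrow> 0"
    proof (rule AE_I2)
      fix s assume "s \<in> space ?L"
      then have s: "0 < s" by (simp add: space_restrict_space)
      have "(\<lambda>n. K s (y n)) \<longlonglongrightarrow> 0"
      proof (rule Lim_null_comparison)
        show "(\<lambda>n. norm (y n)) \<longlonglongrightarrow> 0" using y(2) by (simp add: tendsto_norm_zero_iff)
      qed (use K_le_norm[of s] K_nonneg[of s] s in auto)
      then have "(\<lambda>n. K s (y n) / s) \<longlonglongrightarrow> 0 / s" by (intro tendsto_divide) (use s in auto)
      then have "(\<lambda>n. (K s (y n) / s) powr p) \<longlonglongrightarrow> 0 powr p"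
        using p s by (intro tendsto_powr2) (auto simp: K_nonneg)
      then have "(\<lambda>n. ennreal ((K s (y n) / s) powr p)) \<longlonglongrightarrow> ennreal (0 powr p)" by (rule tendsto_ennrealI)
      then show "(\<lambda>n. ennreal ((K s (y n) / s) powr p)) \<longlonglongrightarrow> 0" using p by simp
    qed
  qed (auto simp del: times_divide_eq_right)
  then have "(\<lambda>n. interp_int X1 n1 (1 - 1/p) p (y n)) \<longlonglongrightarrow> 0" by (simp add: interp_int_eq)
  then have "(\<lambda>n. enn2real (interp_int X1 n1 (1 - 1/p) p (y n))) \<longlonglongrightarrow> enn2real 0"
    by (intro tendsto_enn2real) auto
  then have "(\<lambda>n. enn2real (interp_int X1 n1 (1 - 1/p) p (y n)) powr (1/p)) \<longlonglongrightarrow> 0 powr (1/p)"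
    using p by (intro tendsto_powr2) auto
  then show ?thesis using p by (simp add: interp_norm_def)
qed

text \<open>A single constant bounds both parts of the E_p norm separately, which keeps sums and
  series simple and costs the factor 2 in \<open>Ep_bd_norm_le\<close>.\<close>

definition Ep_bd :: "real \<Rightarrow> (real \<Rightarrow> 'a) \<Rightarrow> real \<Rightarrow> bool" where
  "Ep_bd T u C \<longleftrightarrow> Lp_bd p n1 X1 0 T u C \<and> (\<forall>t\<in>{0..T}. u t \<in> Xg \<and> Ng (u t) \<le> C \<and>
     ((\<lambda>s. Ng (u s - u t)) \<longlongrightarrow> 0) (at t within {0..T}))"

lemma Ep_bd_in_Ep: "Ep_bd T u C \<Longrightarrow> in_Ep X1 n1 p T u"
  unfolding Ep_bd_def in_Ep_def by (auto intro: Lp_bd_in_Lp)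

lemma Ep_bd_norm_le: assumes "Ep_bd T u C" "0 < T" shows "Ep_norm X1 n1 p T u \<le> 2 * C"
proof -
  have "Lp_norm p n1 0 T u \<le> C" by (rule Lp_bd_norm_le) (use assms p in \<open>auto simp: Ep_bd_def\<close>)
  moreover have "(SUP t\<in>{0..T}. Ng (u t)) \<le> C" by (rule cSUP_least) (use assms in \<open>auto simp: Ep_bd_def\<close>)
  ultimately show ?thesis unfolding Ep_norm_def by simp
qed

lemma Ep_bd_mono: "Ep_bd T u C \<Longrightarrow> C \<le> D \<Longrightarrow> Ep_bd T u D"
  using p unfolding Ep_bd_def by (auto intro: Lp_bd_bound_mono)

lemma Ng_cont_add:
  assumes u: "\<forall>s\<in>{0..T}. u s \<in> Xg" "((\<lambda>s. Ng (u s - u t)) \<longlongrightarrow> 0) (at t within {0..T})"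
    and v: "\<forall>s\<in>{0..T}. v s \<in> Xg" "((\<lambda>s. Ng (v s - v t)) \<longlongrightarrow> 0) (at t within {0..T})" and t: "t \<in> {0..T}"
  shows "((\<lambda>s. Ng ((u s + v s) - (u t + v t))) \<longlongrightarrow> 0) (at t within {0..T})"
proof (rule Lim_null_comparison)
  show "((\<lambda>s. Ng (u s - u t) + Ng (v s - v t)) \<longlongrightarrow> 0) (at t within {0..T})"
    using tendsto_add[OF u(2) v(2)] by simp
  have "norm (Ng ((u s + v s) - (u t + v t))) \<le> Ng (u s - u t) + Ng (v s - v t)" if "s \<in> {0..T}" for s
  proof -
    have eq: "(u s + v s) - (u t + v t) = (u s - u t) + (v s - v t)" by simp
    have "u s - u t \<in> Xg" "v s - v t \<in> Xg" using u v t that by (auto intro!: NG.S_diff)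
    then show ?thesis unfolding eq using NG.N_add Ng_nonneg by simp
  qed
  then show "\<forall>\<^sub>F s in at t within {0..T}. norm (Ng ((u s + v s) - (u t + v t))) \<le> Ng (u s - u t) + Ng (v s - v t)"
    by (auto simp: eventually_at_filter intro!: always_eventually)
qed

lemma Ep_bd_add:
  assumes "Ep_bd T u C" "Ep_bd T v D"
  shows "Ep_bd T (\<lambda>t. u t + v t) (C + D)"
  unfolding Ep_bd_def
proof (intro conjI ballI)
  show "Lp_bd p n1 X1 0 T (\<lambda>t. u t + v t) (C + D)"
    by (rule N1.Lp_bd_add) (use assms p in \<open>auto simp: Ep_bd_def\<close>)
  fix t assume t: "t \<in> {0..T}"
  then have uv: "u t \<in> Xg" "v t \<in> Xg" "Ng (u t) \<le> C" "Ng (v t) \<le> D" using assms by (auto simp: Ep_bd_def)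
  then show "u t + v t \<in> Xg" "Ng (u t + v t) \<le> C + D" using Xg_add[of "u t" "v t"] by auto
  show "((\<lambda>s. Ng ((u s + v s) - (u t + v t))) \<longlongrightarrow> 0) (at t within {0..T})"
    by (rule Ng_cont_add) (use assms t in \<open>auto simp: Ep_bd_def\<close>)
qed

lemma Ep_bd_uminus:
  assumes "Ep_bd T u C"
  shows "Ep_bd T (\<lambda>t. - u t) C"
  unfolding Ep_bd_def
proof (intro conjI ballI)
  show "Lp_bd p n1 X1 0 T (\<lambda>t. - u t) C"
    by (rule N1.Lp_bd_minus) (use assms p in \<open>auto simp: Ep_bd_def\<close>)
  fix t assume t: "t \<in> {0..T}"
  then have u: "\<And>s. s \<in> {0..T} \<Longrightarrow> u s \<in> Xg" "Ng (u t) \<le> C" using assms by (auto simp: Ep_bd_def)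
  then show "- u t \<in> Xg" "Ng (- u t) \<le> C"
    using t Xg_scale_le[of "u t" "-1"] NG.N_minus[of "u t"] by auto
  have "((\<lambda>s. Ng (u s - u t)) \<longlongrightarrow> 0) (at t within {0..T})" using assms t by (auto simp: Ep_bd_def)
  moreover have "Ng (u s - u t) = Ng (- u s - - u t)" if "s \<in> {0..T}" for s
    using NG.N_diff_commute[of "u s" "u t"] u(1) t that by simp
  ultimately show "((\<lambda>s. Ng (- u s - - u t)) \<longlongrightarrow> 0) (at t within {0..T})"
    by (subst tendsto_cong[where g="\<lambda>s. Ng (u s - u t)"]) (auto simp: eventually_at_filter intro!: always_eventually)
qed

lemma Ep_bd_0: "0 \<le> C \<Longrightarrow> Ep_bd T (\<lambda>t. 0) C"
  unfolding Ep_bd_def using p by (auto simp: Xg_0 N1.Lp_bd_zero)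

text \<open>Three limits have to agree: the sum in X0 for every t, the limit in \<open>X1\<close>
  for almost every t, and the limit in the trace space for every t. Absolute summability and
  completeness of \<open>X1\<close> give the second, the continuous embedding identifies it with the
  first, and \<open>Ng_lsc\<close> bounds the remainders in the trace space by tails of
  \<open>c\<close>, uniformly in t. That uniformity carries over continuity.\<close>

lemma Ep_suminf:
  assumes w: "\<And>n::nat. Ep_bd T (w n) (c n)" and c: "summable c"
  defines "W \<equiv> \<lambda>t. \<Sum>n. w n t"
  shows "Ep_bd T W (suminf c)"
    "\<And>t. t \<in> {0..T} \<Longrightarrow> (\<lambda>n. w n t) sums W t"
    "AE t in lebesgue_on {0<..<T}. W t \<in> X1 \<and> (\<forall>n. w n t \<in> X1) \<and> (\<lambda>n. n1 ((\<Sum>i<n. w i t) - W t)) \<longlonglongrightarrow> 0"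
proof -
  have wX: "w n t \<in> Xg" "Ng (w n t) \<le> c n" if "t \<in> {0..T}" for n t
    using w[of n] that by (auto simp: Ep_bd_def)
  have c0': "0 \<le> c n" for n using w[of n] by (auto simp: Ep_bd_def intro: Lp_bd_0_le)
  show sums: "(\<lambda>n. w n t) sums W t" if "t \<in> {0..T}" for t
    unfolding W_def
  proof (rule summable_sums, rule summable_comparison_test)
    show "\<exists>N. \<forall>n\<ge>N. norm (w n t) \<le> 2 * c0 * c n"
    proof (intro exI allI impI)
      fix n
      have "norm (w n t) \<le> 2 * c0 * Ng (w n t)" by (rule norm_le_Ng[OF wX(1)[OF that]])
      also have "\<dots> \<le> 2 * c0 * c n" using wX(2)[OF that, of n] c0(1) by (intro mult_left_mono) auto
      finally show "norm (w n t) \<le> 2 * c0 * c n" .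
    qed
    show "summable (\<lambda>n. 2 * c0 * c n)" using c by (intro summable_mult)
  qed
  have tail: "W t - (\<Sum>i<n. w i t) \<in> Xg \<and> Ng (W t - (\<Sum>i<n. w i t)) \<le> (\<Sum>i. c (i + n))" if "t \<in> {0..T}" for t n
  proof -
    have s: "(\<lambda>m. \<Sum>i<m. w (i + n) t) \<longlonglongrightarrow> W t - (\<Sum>i<n. w i t)"
      using sums_split_initial_segment[OF sums[OF that], of n] by (simp add: sums_def)
    have cl: "(\<lambda>m. \<Sum>i<m. c (i + n)) \<longlonglongrightarrow> (\<Sum>i. c (i + n))"
      using c by (intro summable_LIMSEQ summable_ignore_initial_segment)
    have b: "(\<Sum>i<m. w (i + n) t) \<in> Xg" "Ng (\<Sum>i<m. w (i + n) t) \<le> (\<Sum>i<m. c (i + n))" for m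
    proof -
      show "(\<Sum>i<m. w (i + n) t) \<in> Xg" using wX[OF that] by (intro NG.S_sum) auto
      have "Ng (\<Sum>i<m. w (i + n) t) \<le> (\<Sum>i<m. Ng (w (i + n) t))" using wX[OF that] by (intro NG.N_sum) auto
      also have "\<dots> \<le> (\<Sum>i<m. c (i + n))" using wX[OF that] by (intro sum_mono) auto
      finally show "Ng (\<Sum>i<m. w (i + n) t) \<le> (\<Sum>i<m. c (i + n))" .
    qed
    show ?thesis using Ng_lsc[OF b cl s] by auto
  qed
  have L: "Lp_bd p n1 X1 0 T (w n) (c n)" for n using w[of n] by (auto simp: Ep_bd_def)
  have inX1: "AE t in lebesgue_on {0<..<T}. \<forall>n. w n t \<in> X1"
    unfolding AE_all_countable using L by (auto simp: Lp_bd_def intro: N1.sm_inS)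
  have "AE t in lebesgue_on {0<..<T}. summable (\<lambda>n. n1 (w n t))"
    by (rule Lp_le_suminf(1)[where c=c and p=p]) (use p L c in \<open>auto simp: Lp_bd_def\<close>)
  then show conv: "AE t in lebesgue_on {0<..<T}. W t \<in> X1 \<and> (\<forall>n. w n t \<in> X1) \<and> (\<lambda>n. n1 ((\<Sum>i<n. w i t) - W t)) \<longlonglongrightarrow> 0"
    using inX1 AE_space
  proof eventually_elim
    case (elim t)
    then have t: "t \<in> {0..T}" by (simp add: space_restrict_space)
    define S where "S n = (\<Sum>i<n. w i t)" for n
    have SX: "S n \<in> X1" for n unfolding S_def using elim by (intro N1.S_sum) auto
    have "\<exists>x\<in>X1. (\<lambda>n. n1 (S n - x)) \<longlonglongrightarrow> 0"
    proof (rule X1_complete[OF SX])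
      fix e :: real assume "0 < e"
      then obtain N where N: "\<And>m n. m \<ge> N \<Longrightarrow> norm (\<Sum>i\<in>{m..<n}. n1 (w i t)) < e"
        using elim(1) unfolding summable_Cauchy by blast
      have *: "n1 (S n - S m) < e" if "N \<le> m" "m \<le> n" for m n
      proof -
        have "S n - S m = (\<Sum>i\<in>{m..<n}. w i t)"
          unfolding S_def using that by (simp add: lessThan_atLeast0 sum_diff_nat_ivl)
        also have "n1 \<dots> \<le> (\<Sum>i\<in>{m..<n}. n1 (w i t))" using elim by (intro N1.N_sum) auto
        also have "\<dots> < e" using N[OF that(1), of n] by simp
        finally show ?thesis .
      qed
      have "n1 (S m - S n) < e" if "N \<le> m" "N \<le> n" for m n
        using *[of m n] *[of n m] that N1.N_diff_commute[OF SX SX, of m n] by (cases "m \<le> n") auto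
      then show "\<exists>N. \<forall>m\<ge>N. \<forall>n\<ge>N. n1 (S m - S n) < e" by blast
    qed
    then obtain x where x: "x \<in> X1" "(\<lambda>n. n1 (S n - x)) \<longlonglongrightarrow> 0" by blast
    have "(\<lambda>n. S n - x) \<longlonglongrightarrow> 0"
    proof (rule Lim_null_comparison)
      show "(\<lambda>n. c0 * n1 (S n - x)) \<longlonglongrightarrow> 0" using tendsto_mult_right_zero[OF x(2)] .
      show "\<forall>\<^sub>F n in sequentially. norm (S n - x) \<le> c0 * n1 (S n - x)"
        using SX x by (intro always_eventually allI c0(2) N1.S_diff)
    qed
    then have "S \<longlonglongrightarrow> x" by (simp add: LIM_zero_iff)
    moreover have "S \<longlonglongrightarrow> W t" using sums[OF t] by (simp add: S_def[abs_def] sums_def)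
    ultimately have "x = W t" by (rule LIMSEQ_unique)
    then show ?case using x elim by (simp add: S_def)
  qed
  show "Ep_bd T W (suminf c)"
    unfolding Ep_bd_def
  proof (intro conjI ballI)
    show "Lp_bd p n1 X1 0 T W (suminf c)"
      by (rule N1.Lp_bd_suminf[OF L c]) (use conv p in \<open>auto elim!: eventually_mono\<close>)
    fix t assume t: "t \<in> {0..T}"
    show "W t \<in> Xg" "Ng (W t) \<le> suminf c" using tail[OF t, of 0] by auto
    show "((\<lambda>s. Ng (W s - W t)) \<longlongrightarrow> 0) (at t within {0..T})"
    proof (rule tendstoI)
      fix e :: real assume e: "0 < e"
      have "(\<lambda>n. \<Sum>i. c (i + n)) \<longlonglongrightarrow> 0" using suminf_exist_split2[OF c] .
      then have "\<forall>\<^sub>F n in sequentially. (\<Sum>i. c (i + n)) < e/3" using e by (intro order_tendstoD) auto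
      then obtain n where n: "(\<Sum>i. c (i + n)) < e/3" by (meson eventually_sequentially order_refl)
      have "((\<lambda>s. Ng ((\<Sum>i<n. w i s) - (\<Sum>i<n. w i t))) \<longlongrightarrow> 0) (at t within {0..T})"
      proof (induction n)
        case (Suc n)
        show ?case unfolding sum.lessThan_Suc
          by (rule Ng_cont_add) (use Suc wX t w[of n] in \<open>auto simp: Ep_bd_def intro!: NG.S_sum\<close>)
      qed (simp add: Xg_0)
      then have "\<forall>\<^sub>F s in at t within {0..T}. Ng ((\<Sum>i<n. w i s) - (\<Sum>i<n. w i t)) < e/3"
        using e by (intro order_tendstoD) auto
      moreover have "\<forall>\<^sub>F s in at t within {0..T}. s \<in> {0..T}" by (simp add: eventually_at_filter)
      ultimately show "\<forall>\<^sub>F s in at t within {0..T}. dist (Ng (W s - W t)) 0 < e"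
      proof eventually_elim
        case (elim s)
        let ?a = "W s - (\<Sum>i<n. w i s)" and ?b = "W t - (\<Sum>i<n. w i t)" and ?d = "(\<Sum>i<n. w i s) - (\<Sum>i<n. w i t)"
        have ab: "?a \<in> Xg" "Ng ?a \<le> (\<Sum>i. c (i + n))" "?b \<in> Xg" "Ng ?b \<le> (\<Sum>i. c (i + n))"
          using tail[OF elim(2), of n] tail[OF t, of n] by auto
        have d: "?d \<in> Xg" using wX t elim by (intro NG.S_diff NG.S_sum) auto
        have "Ng (W s - W t) = Ng ((?a - ?b) + ?d)" by (simp add: algebra_simps)
        also have "\<dots> \<le> (Ng ?a + Ng ?b) + Ng ?d"
          using NG.N_add[OF NG.S_diff[OF ab(1,3)] d] NG.N_diff[OF ab(1,3)] by linarith
        finally show ?case using ab n elim Ng_nonneg[of "W s - W t"] by simp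
      qed
    qed
  qed
qed

end

section \<open>Hardy's inequality\<close>

lemma sigma_finite_lebesgue: "sigma_finite_measure (lebesgue :: real measure)"
proof
  obtain A :: "real set set" where A: "countable A" "A \<subseteq> sets lborel" "\<Union>A = space lborel" "\<forall>a\<in>A. emeasure lborel a \<noteq> \<infinity>"
    using lborel.sigma_finite_countable by blast
  then show "\<exists>A::real set set. countable A \<and> A \<subseteq> sets lebesgue \<and> \<Union>A = space lebesgue \<and> (\<forall>a\<in>A. emeasure lebesgue a \<noteq> \<infinity>)"
    by (intro exI[of _ A]) (auto simp: subset_eq)
qed

lemma borel_measurable_ident_lebesgue: "(\<lambda>x::real. x) \<in> borel_measurable lebesgue"
  by (simp add: measurable_completion)

lemma nn_integral_reflected_powr:
  assumes a: "-1 < a" and s: "0 \<le> s"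
  shows "(\<integral>\<^sup>+ r. ennreal ((t - r) powr a) * indicator {t - s<..<t} r \<partial>lebesgue) = ennreal (s powr (a + 1) / (a + 1))"
proof -
  have "(\<integral>\<^sup>+ r. ennreal ((t - r) powr a) * indicator {t - s<..<t} r \<partial>lebesgue)
     = (\<integral>\<^sup>+ r. ennreal ((t - r) powr a) * indicator {t - s<..<t} r \<partial>lborel)" by (rule nn_integral_completion)
  also have "\<dots> = (\<integral>\<^sup>+ x. ennreal ((t - (t + -1 * x)) powr a) * indicator {t - s<..<t} (t + -1 * x) \<partial>lborel)"
    by (subst nn_integral_real_affine[where c="-1" and t=t]) auto
  also have "\<dots> = (\<integral>\<^sup>+ x. ennreal (x powr a) * indicator {0..s} x \<partial>lborel)"
  proof (rule nn_integral_cong_AE)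
    have "AE x in lborel. x \<noteq> 0 \<and> x \<noteq> s" using AE_lborel_singleton[of 0] AE_lborel_singleton[of s] by eventually_elim auto
    then show "AE x in lborel. ennreal ((t - (t + -1 * x)) powr a) * indicator {t - s<..<t} (t + -1 * x) = ennreal (x powr a) * indicator {0..s} x"
      by eventually_elim (auto simp: indicator_def)
  qed
  also have "\<dots> = ennreal (s powr (a + 1) / (a + 1))"
    by (rule nn_integral_has_integral_lebesgue') (use has_integral_powr_from_0[OF a s] in auto)
  finally show ?thesis .
qed

lemma nn_integral_powr_tail:
  assumes a: "a < -1" and s: "0 < s"
  shows "(\<integral>\<^sup>+ x. ennreal (x powr a) * indicator {s<..} x \<partial>lebesgue) = ennreal (s powr (a + 1) / (- a - 1))"
proof -
  have "(\<integral>\<^sup>+ x. ennreal (x powr a) * indicator {s<..} x \<partial>lebesgue)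
     = (\<integral>\<^sup>+ x. ennreal (x powr a) * indicator {s<..} x \<partial>lborel)" by (rule nn_integral_completion)
  also have "\<dots> = (\<integral>\<^sup>+ x. ennreal (x powr a) * indicator {s..} x \<partial>lborel)"
  proof (rule nn_integral_cong_AE)
    show "AE x in lborel. ennreal (x powr a) * indicator {s<..} x = ennreal (x powr a) * indicator {s..} x"
      using AE_lborel_singleton[of s] by eventually_elim (auto simp: indicator_def)
  qed
  also have "\<dots> = ennreal (- (s powr (a + 1)) / (a + 1))"
    by (rule nn_integral_has_integral_lebesgue') (use has_integral_powr_to_inf[OF a s] in auto)
  also have "- (s powr (a + 1)) / (a + 1) = s powr (a + 1) / (- a - 1)"
    using a by (simp add: divide_simps) (simp add: algebra_simps)
  finally show ?thesis .
qed

text \<open>Hardy's inequality, by Hoelder with the weights \<open>(t - r) powr (\<plusminus> 1 / (p q))\<close> and Tonelli.\<close>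

lemma Hardy:
  fixes \<phi> G :: "real \<Rightarrow> real"
  assumes p: "1 < p" and q: "q = p / (p - 1)"
    and \<phi>: "\<phi> \<in> borel_measurable lebesgue" "\<And>r. 0 \<le> \<phi> r"
    and G: "(\<lambda>s. G s / s) \<in> borel_measurable (lebesgue_on {0<..})" "\<And>s. 0 < s \<Longrightarrow> 0 \<le> G s"
      "\<And>s. 0 < s \<Longrightarrow> ennreal (G s) \<le> (\<integral>\<^sup>+ r. ennreal (\<phi> r) * indicator {t - s<..<t} r \<partial>lebesgue)"
    and A: "0 \<le> A" "(\<integral>\<^sup>+ r. ennreal (\<phi> r powr p) * indicator {..<t} r \<partial>lebesgue) \<le> ennreal (A powr p)"
  shows "Lp_le p (lebesgue_on {0<..}) (\<lambda>s. G s / s) (q * A)"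
proof -
  have q1: "1 < q" "1/p + 1/q = 1" "p / q = p - 1" "(p - 1) * q = p" using p by (auto simp: q field_simps)
  \<comment> \<open>This exponent serves both factors: \<alpha> p = 1/q is the weight kept in
    \<open>F\<close>, and \<alpha> q = 1/p < 1 makes the q-th power of (t - r)^(-\<alpha>)
    integrable.\<close>
  define \<alpha> where "\<alpha> = 1 / (p * q)"
  have \<alpha>: "\<alpha> * p = 1 / q" "\<alpha> * q = 1 / p" using p q1 by (auto simp: \<alpha>_def)
  have id[measurable]: "(\<lambda>x::real. x) \<in> borel_measurable lebesgue" by (rule borel_measurable_ident_lebesgue)
  note [measurable] = \<phi>(1)
  define F where "F s = (\<integral>\<^sup>+ r. ennreal (\<phi> r powr p * (t - r) powr (1/q)) * indicator {t - s<..<t} r \<partial>lebesgue)" for s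
  have bound: "ennreal ((G s / s) powr p) \<le> F s * ennreal (q powr (p - 1) * s powr (-1 - 1/q))" if s: "0 < s" for s
  proof (cases "F s = \<infinity>")
    case True
    have "0 < q powr (p - 1) * s powr (-1 - 1/q)" using s q1 by simp
    then show ?thesis using True q1 by (auto simp: ennreal_top_mult)
  next
    case False
    let ?M = "lebesgue_on {t - s<..<t}"
    have idr: "(\<lambda>r. r) \<in> borel_measurable ?M" "\<phi> \<in> borel_measurable ?M"
      by (auto intro: measurable_restrict_space1)
    note [measurable] = idr
    define C where "C = enn2real (F s)"
    have C: "F s = ennreal C" "0 \<le> C" using False by (auto simp: C_def less_top)
    have f: "Lp_le p ?M (\<lambda>r. \<phi> r * (t - r) powr \<alpha>) (C powr (1/p))"
    proof -
      have "(\<integral>\<^sup>+ r. ennreal ((\<phi> r * (t - r) powr \<alpha>) powr p) \<partial>?M) = F s"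
        unfolding F_def by (subst nn_integral_restrict_space)
          (auto intro!: nn_integral_cong simp: indicator_def powr_mult powr_powr \<alpha> \<phi>)
      also have "\<dots> = ennreal ((C powr (1/p)) powr p)" using C p by (simp add: powr_powr)
      finally show ?thesis unfolding Lp_le_def using \<phi>(2) by auto
    qed
    have g: "Lp_le q ?M (\<lambda>r. (t - r) powr - \<alpha>) ((q * s powr (1/q)) powr (1/q))"
    proof -
      have "(\<integral>\<^sup>+ r. ennreal (((t - r) powr - \<alpha>) powr q) \<partial>?M) =
         (\<integral>\<^sup>+ r. ennreal ((t - r) powr (-1/p)) * indicator {t - s<..<t} r \<partial>lebesgue)"
        by (subst nn_integral_restrict_space) (auto simp: powr_powr \<alpha>)
      also have "\<dots> = ennreal (s powr (-1/p + 1) / (-1/p + 1))"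
        using p s by (intro nn_integral_reflected_powr) (auto simp: field_simps)
      also have "-1/p + 1 = 1/q" using q1 by (simp add: field_simps)
      also have "s powr (1/q) / (1/q) = ((q * s powr (1/q)) powr (1/q)) powr q"
        using q1 by (simp add: powr_powr)
      finally show ?thesis unfolding Lp_le_def by auto
    qed
    have "Lp_le 1 ?M (\<lambda>r. (\<phi> r * (t - r) powr \<alpha>) * (t - r) powr - \<alpha>) (C powr (1/p) * (q * s powr (1/q)) powr (1/q))"
      by (rule Lp_le_Hoelder[OF p q1(1,2) f g])
    then have "(\<integral>\<^sup>+ r. ennreal (((\<phi> r * (t - r) powr \<alpha>) * (t - r) powr - \<alpha>) powr 1) \<partial>?M)
        \<le> ennreal ((C powr (1/p) * (q * s powr (1/q)) powr (1/q)) powr 1)" by (rule Lp_leD(4))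
    moreover have "(\<integral>\<^sup>+ r. ennreal (((\<phi> r * (t - r) powr \<alpha>) * (t - r) powr - \<alpha>) powr 1) \<partial>?M) =
       (\<integral>\<^sup>+ r. ennreal (\<phi> r) * indicator {t - s<..<t} r \<partial>lebesgue)"
      by (subst nn_integral_restrict_space) (auto intro!: nn_integral_cong simp: indicator_def \<phi> mult.assoc powr_add[symmetric])
    ultimately have "(\<integral>\<^sup>+ r. ennreal (\<phi> r) * indicator {t - s<..<t} r \<partial>lebesgue) \<le> ennreal (C powr (1/p) * (q * s powr (1/q)) powr (1/q))"
      by simp
    from order_trans[OF G(3)[OF s] this] have "G s \<le> C powr (1/p) * (q * s powr (1/q)) powr (1/q)" by (subst (asm) ennreal_le_iff) auto
    then have "G s / s \<le> C powr (1/p) * (q * s powr (1/q)) powr (1/q) / s" using s by (simp add: divide_right_mono)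
    then have "(G s / s) powr p \<le> (C powr (1/p) * (q * s powr (1/q)) powr (1/q) / s) powr p"
      using s p G(2)[OF s] by (intro powr_mono2) auto
    also have "\<dots> = C * (q * s powr (1/q)) powr (p - 1) / s powr p"
    proof -
      define D where "D = q * s powr (1/q)"
      have "0 \<le> D" using q1 by (simp add: D_def)
      then have "(C powr (1/p) * D powr (1/q) / s) powr p = C * D powr (p - 1) / s powr p"
        using C s p q1 by (simp add: powr_mult powr_divide powr_powr)
      then show ?thesis by (simp add: D_def)
    qed
    also have "\<dots> = C * (q powr (p - 1) * s powr ((p - 1) / q - p))"
      using s q1 powr_diff[of s "(p - 1) / q" p] by (simp add: powr_mult powr_powr)
    also have "(p - 1) / q - p = -1 - 1/q" using p by (simp add: q field_simps)
    finally show ?thesis using C s q1 by (simp add: ennreal_mult[symmetric] ennreal_leI)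
  qed
  interpret L: sigma_finite_measure "lebesgue :: real measure" by (rule sigma_finite_lebesgue)
  interpret LL: pair_sigma_finite "lebesgue :: real measure" "lebesgue :: real measure" ..
  define H where "H s r = ennreal (\<phi> r powr p * (t - r) powr (1/q)) * ennreal (q powr (p - 1) * s powr (-1 - 1/q))
      * indicator {(s, r). 0 < s \<and> t - s < r \<and> r < t} (s, r)" for s r
  have "(\<lambda>x. fst x) \<in> borel_measurable ((lebesgue :: real measure) \<Otimes>\<^sub>M (lebesgue :: real measure))"
    by (rule measurable_compose[OF measurable_fst id])
  moreover have "(\<lambda>x. snd x) \<in> borel_measurable ((lebesgue :: real measure) \<Otimes>\<^sub>M (lebesgue :: real measure))"
    by (rule measurable_compose[OF measurable_snd id])
  moreover have "(\<lambda>x. \<phi> (snd x)) \<in> borel_measurable ((lebesgue :: real measure) \<Otimes>\<^sub>M (lebesgue :: real measure))"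
    by (rule measurable_compose[OF measurable_snd \<phi>(1)])
  ultimately have fs: "fst \<in> borel_measurable ((lebesgue :: real measure) \<Otimes>\<^sub>M (lebesgue :: real measure))"
    "snd \<in> borel_measurable ((lebesgue :: real measure) \<Otimes>\<^sub>M (lebesgue :: real measure))"
    "(\<lambda>x. \<phi> (snd x)) \<in> borel_measurable ((lebesgue :: real measure) \<Otimes>\<^sub>M (lebesgue :: real measure))" by auto
  have Hm: "(\<lambda>x. H (fst x) (snd x)) \<in> borel_measurable (lebesgue \<Otimes>\<^sub>M lebesgue)"
  proof -
    note [measurable] = fs
    have "{x \<in> space (lebesgue \<Otimes>\<^sub>M lebesgue). 0 < fst x \<and> t - fst x < snd x \<and> snd x < t} \<in> sets ((lebesgue :: real measure) \<Otimes>\<^sub>M (lebesgue :: real measure))"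
      by measurable
    then have [measurable]: "{(s, r). 0 < s \<and> t - s < r \<and> r < t} \<in> sets ((lebesgue :: real measure) \<Otimes>\<^sub>M (lebesgue :: real measure))"
      by (simp add: space_pair_measure case_prod_unfold)
    show ?thesis unfolding H_def by simp
  qed
  have "(\<integral>\<^sup>+ s. ennreal ((G s / s) powr p) \<partial>lebesgue_on {0<..}) = (\<integral>\<^sup>+ s. ennreal ((G s / s) powr p) * indicator {0<..} s \<partial>lebesgue)"
    by (simp add: nn_integral_restrict_space)
  also have "\<dots> \<le> (\<integral>\<^sup>+ s. (\<integral>\<^sup>+ r. H s r \<partial>lebesgue) \<partial>lebesgue)"
  proof (rule nn_integral_mono)
    fix s :: real
    show "ennreal ((G s / s) powr p) * indicator {0<..} s \<le> (\<integral>\<^sup>+ r. H s r \<partial>lebesgue)"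
    proof (cases "0 < s")
      case True
      have "(\<integral>\<^sup>+ r. H s r \<partial>lebesgue) = F s * ennreal (q powr (p - 1) * s powr (-1 - 1/q))"
        unfolding F_def H_def using True
        by (subst nn_integral_multc[symmetric]) (auto intro!: nn_integral_cong simp: indicator_def)
      then show ?thesis using bound[OF True] True by simp
    qed simp
  qed
  also have "\<dots> = (\<integral>\<^sup>+ r. (\<integral>\<^sup>+ s. H s r \<partial>lebesgue) \<partial>lebesgue)"
    using Hm by (intro LL.Fubini'[symmetric]) (simp add: case_prod_unfold)
  \<comment> \<open>After Tonelli the integral of s^(-1 - 1/q) over s > t - r is q (t - r)^(-1/q),
    which cancels the weight in r. The q^(p-1) from Hoelder times this q is the constant
    q^p.\<close>
  also have "\<dots> \<le> (\<integral>\<^sup>+ r. ennreal (q powr p) * (ennreal (\<phi> r powr p) * indicator {..<t} r) \<partial>lebesgue)"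
  proof (rule nn_integral_mono)
    fix r :: real
    show "(\<integral>\<^sup>+ s. H s r \<partial>lebesgue) \<le> ennreal (q powr p) * (ennreal (\<phi> r powr p) * indicator {..<t} r)"
    proof (cases "r < t")
      case True
      have "(\<integral>\<^sup>+ s. H s r \<partial>lebesgue) = (\<integral>\<^sup>+ s. ennreal (\<phi> r powr p * (t - r) powr (1/q) * q powr (p - 1)) *
          (ennreal (s powr (-1 - 1/q)) * indicator {t - r<..} s) \<partial>lebesgue)"
        unfolding H_def using True
        by (intro nn_integral_cong) (auto simp: indicator_def ennreal_mult mult_ac)
      also have "\<dots> = ennreal (\<phi> r powr p * (t - r) powr (1/q) * q powr (p - 1)) *
          (\<integral>\<^sup>+ s. (ennreal (s powr (-1 - 1/q)) * indicator {t - r<..} s) \<partial>lebesgue)"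
        by (rule nn_integral_cmult) measurable
      also have "(\<integral>\<^sup>+ s. (ennreal (s powr (-1 - 1/q)) * indicator {t - r<..} s) \<partial>lebesgue) =
         ennreal ((t - r) powr (-1 - 1/q + 1) / (- (-1 - 1/q) - 1))"
        using True q1 by (intro nn_integral_powr_tail) auto
      also have "(t - r) powr (-1 - 1/q + 1) / (- (-1 - 1/q) - 1) = q * (t - r) powr (- (1/q))"
        using q1 by (simp add: field_simps)
      also have "ennreal (\<phi> r powr p * (t - r) powr (1/q) * q powr (p - 1)) * ennreal (q * (t - r) powr (- (1/q)))
         = ennreal ((\<phi> r powr p * (t - r) powr (1/q) * q powr (p - 1)) * (q * (t - r) powr (- (1/q))))"
        using q1 by (intro ennreal_mult[symmetric]) auto
      also have "(\<phi> r powr p * (t - r) powr (1/q) * q powr (p - 1)) * (q * (t - r) powr (- (1/q)))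
          = (q powr (p - 1) * q) * \<phi> r powr p * ((t - r) powr (1/q) * (t - r) powr (- (1/q)))" by (simp add: mult_ac)
      also have "(t - r) powr (1/q) * (t - r) powr (- (1/q)) = 1" using True by (simp add: powr_add[symmetric])
      also have "q powr (p - 1) * q = q powr p" using q1 by (simp add: powr_diff)
      finally show ?thesis using True by (simp add: ennreal_mult)
    qed (auto simp: H_def indicator_def)
  qed
  also have "\<dots> = ennreal (q powr p) * (\<integral>\<^sup>+ r. (ennreal (\<phi> r powr p) * indicator {..<t} r) \<partial>lebesgue)"
    by (rule nn_integral_cmult) measurable
  also have "\<dots> \<le> ennreal (q powr p) * ennreal (A powr p)" by (intro mult_left_mono A) auto
  also have "\<dots> = ennreal ((q * A) powr p)" using q1 A by (simp add: powr_mult ennreal_mult)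
  finally have le: "(\<integral>\<^sup>+ s. ennreal ((G s / s) powr p) \<partial>lebesgue_on {0<..}) \<le> ennreal ((q * A) powr p)" .
  have "AE s in lebesgue_on {0<..}. 0 \<le> G s / s"
    by (rule AE_I2) (use G(2) in \<open>auto simp: space_restrict_space\<close>)
  then show ?thesis unfolding Lp_le_def using le G(1) A q1 by auto
qed

section \<open>The trace embedding\<close>

lemma L1_norm_le_nn_integral:
  fixes g :: "real \<Rightarrow> 'a::banach"
  assumes g: "in_Lp 1 norm UNIV a b g" and ab: "a \<le> b"
  shows "ennreal (norm (integral {a..b} g)) \<le> (\<integral>\<^sup>+ r. ennreal (norm (g r)) * indicator {a<..<b} r \<partial>lebesgue)"
proof -
  have L: "Lp_bd 1 norm UNIV a b g (Lp_norm 1 norm a b g)" by (rule X0.in_Lp_Lp_bd[OF g]) simp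
  have "ennreal (norm (integral {a..b} g)) \<le> ennreal (Lp_norm 1 norm a b g)"
    by (rule ennreal_leI) (rule L1_integrable(2)[OF L ab])
  also have "\<dots> = Lp_int 1 norm a b g" using g by (simp add: Lp_norm_def in_Lp_def)
  also have "\<dots> = (\<integral>\<^sup>+ r. ennreal (norm (g r)) * indicator {a<..<b} r \<partial>lebesgue)" by (simp add: Lp_int_def)
  finally show ?thesis .
qed

text \<open>If it failed, integration would give 2 I \<le> I for the integral I, so I = 0 and \<psi>
  = 0 almost everywhere, where the inequality is trivial. With the factor 2, a weak inequality
  between the integrals suffices.\<close>

lemma exists_le_twice_mean:
  fixes \<psi> :: "real \<Rightarrow> real"
  assumes st: "a < t" and \<psi>: "Lp_le 1 (lebesgue_on {a<..<t}) \<psi> C"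
    and P: "AE r in lebesgue_on {a<..<t}. P r"
  shows "\<exists>r\<in>{a<..<t}. P r \<and> ennreal ((t - a) * \<psi> r) \<le> 2 * (\<integral>\<^sup>+ r. ennreal (\<psi> r) * indicator {a<..<t} r \<partial>lebesgue)"
proof (rule ccontr)
  let ?L = "lebesgue_on {a<..<t}"
  define I where "I = (\<integral>\<^sup>+ r. ennreal (\<psi> r) \<partial>?L)"
  have I': "(\<integral>\<^sup>+ r. ennreal (\<psi> r) * indicator {a<..<t} r \<partial>lebesgue) = I"
    unfolding I_def by (simp add: nn_integral_restrict_space)
  have "I = (\<integral>\<^sup>+ r. ennreal (\<psi> r powr 1) \<partial>?L)" unfolding I_def
    by (rule nn_integral_cong_AE) (use Lp_leD(3)[OF \<psi>] in auto)
  also have "\<dots> \<le> ennreal (C powr 1)" by (rule Lp_leD(4)[OF \<psi>])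
  also have "\<dots> < \<infinity>" by simp
  finally obtain i where i: "I = ennreal i" "0 \<le> i" by (cases I) auto
  assume no: "\<not> ?thesis"
  have big: "AE r in ?L. ennreal (2 * i / (t - a)) \<le> ennreal (\<psi> r) \<and> \<psi> r \<noteq> 0"
    using P AE_space
  proof eventually_elim
    case (elim r)
    then have "\<not> ennreal ((t - a) * \<psi> r) \<le> 2 * I" using no I' by (auto simp: space_restrict_space)
    moreover have "2 * I = ennreal (2 * i)" using i by (simp add: ennreal_mult)
    ultimately have "\<not> ennreal ((t - a) * \<psi> r) \<le> ennreal (2 * i)" by simp
    then have "2 * i < (t - a) * \<psi> r" using ennreal_leI[of "(t - a) * \<psi> r" "2 * i"] by force
    then show ?case using st i by (auto simp: field_simps intro!: ennreal_leI)
  qed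
  have "ennreal (2 * i) = ennreal (2 * i / (t - a)) * ennreal (t - a)"
    using st i by (simp add: ennreal_mult[symmetric])
  also have "\<dots> = (\<integral>\<^sup>+ r. ennreal (2 * i / (t - a)) \<partial>?L)"
    using st by (simp add: emeasure_restrict_space space_restrict_space)
  also have "\<dots> \<le> I" unfolding I_def by (rule nn_integral_mono_AE) (use big in \<open>auto elim: eventually_mono\<close>)
  finally have "i = 0" using i by simp
  then have "Lp_le 1 ?L \<psi> 0"
    using \<psi> \<open>I = (\<integral>\<^sup>+ r. ennreal (\<psi> r powr 1) \<partial>?L)\<close> i unfolding Lp_le_def by simp
  from Lp_le_0D[OF this] have "AE r in ?L. \<psi> r = 0" by simp
  with big have "AE r in ?L. False" by eventually_elim auto
  then have "emeasure ?L (space ?L) = 0" by (subst (asm) AE_iff_measurable[OF sets.top]) auto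
  then show False using st by (simp add: emeasure_restrict_space space_restrict_space)
qed

context couple
begin

definition q where "q = p / (p - 1)"

lemma q: "1 < q" using p by (simp add: q_def)

context
  fixes T :: real and v g :: "real \<Rightarrow> 'a" and V G :: real
  assumes T: "0 < T" and v: "Lp_bd p n1 X1 0 T v V" and g: "Lp_bd p norm UNIV 0 T g G" and v0: "v 0 = 0"
    and vg: "\<And>t. t \<in> {0..T} \<Longrightarrow> (g has_integral v t) {0..t}"
begin

text \<open>The integrand over (t - s, t) that dominates K(s, v(t)). Extension by zero allows
  intervals that stick out of (0, T), and \<open>max 0\<close> guards against values of
  \<open>n1\<close> off \<open>X1\<close>.\<close>

definition trace_density where "trace_density r = indicator {0<..<T} r *\<^sub>R (norm (g r) + 2 * max 0 (n1 (v r)))"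

lemma trace_density_Lp: "Lp_le p (lebesgue_on {0<..<T}) trace_density (G + 2 * V)"
proof (rule Lp_le_cong_AE)
  show *: "Lp_le p (lebesgue_on {0<..<T}) (\<lambda>r. norm (g r) + 2 * n1 (v r)) (G + 2 * V)"
    using v g p by (intro Lp_le_add Lp_le_cmult) (auto simp: Lp_bd_def)
  have "(\<lambda>r. n1 (v r)) \<in> borel_measurable (lebesgue_on {0<..<T})" "(\<lambda>r. norm (g r)) \<in> borel_measurable (lebesgue_on {0<..<T})"
    using v g by (auto simp: Lp_bd_def dest: Lp_leD(2))
  moreover have "indicat_real {0<..<T} \<in> borel_measurable (lebesgue_on {0<..<T})"
    by (intro measurable_restrict_space1 borel_measurable_indicator) auto
  ultimately show "trace_density \<in> borel_measurable (lebesgue_on {0<..<T})" unfolding trace_density_def by measurable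
  have "AE r in lebesgue_on {0<..<T}. 0 \<le> n1 (v r)" using v by (auto simp: Lp_bd_def dest: Lp_leD(3))
  then show "AE r in lebesgue_on {0<..<T}. trace_density r = norm (g r) + 2 * n1 (v r)"
    using AE_space by eventually_elim (auto simp: trace_density_def space_restrict_space)
qed (use p in auto)

lemma trace_density_meas: "trace_density \<in> borel_measurable lebesgue" "0 \<le> trace_density r"
proof -
  have "(\<lambda>r. indicator {0<..<T} r *\<^sub>R trace_density r) \<in> borel_measurable lebesgue"
    using Lp_leD(2)[OF trace_density_Lp] by (subst (asm) borel_measurable_restrict_space_iff) auto
  moreover have "(\<lambda>r. indicator {0<..<T} r *\<^sub>R trace_density r) = trace_density" by (auto simp: trace_density_def indicator_def)
  ultimately show "trace_density \<in> borel_measurable lebesgue" by simp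
  show "0 \<le> trace_density r" by (auto simp: trace_density_def indicator_def)
qed

lemma trace_density_int: "(\<integral>\<^sup>+ r. ennreal (trace_density r powr p) \<partial>lebesgue) \<le> ennreal ((G + 2 * V) powr p)"
proof -
  have "(\<integral>\<^sup>+ r. ennreal (trace_density r powr p) \<partial>lebesgue) = (\<integral>\<^sup>+ r. ennreal (trace_density r powr p) \<partial>lebesgue_on {0<..<T})"
    using p by (subst nn_integral_restrict_space) (auto intro!: nn_integral_cong simp: indicator_def trace_density_def)
  then show ?thesis using Lp_leD(4)[OF trace_density_Lp] by simp
qed

lemma trace_deriv_L1: "0 \<le> a \<Longrightarrow> b \<le> T \<Longrightarrow> in_Lp 1 norm UNIV a b g"
  using Lp_bd_in_Lp[OF X0.Lp_bd_subinterval[OF X0.Lp_bd_imp_L1[OF g]]] p T by simp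

lemma trace_diff_le:
  assumes "0 \<le> r" "r \<le> t" "t \<le> T"
  shows "ennreal (norm (v t - v r)) \<le> (\<integral>\<^sup>+ x. ennreal (norm (g x)) * indicator {r<..<t} x \<partial>lebesgue)"
proof -
  have "g integrable_on {0..t}" using vg[of t] assms by (auto simp: integrable_on_def)
  then have "integral {0..r} g + integral {r..t} g = integral {0..t} g" using assms by (intro Henstock_Kurzweil_Integration.integral_combine) auto
  then have "integral {r..t} g = v t - v r"
    using integral_unique[OF vg[of r]] integral_unique[OF vg[of t]] assms by (simp add: algebra_simps)
  then show ?thesis using L1_norm_le_nn_integral[OF trace_deriv_L1, of r t] assms by simp
qed

text \<open>Split v(t) = (v(t) - v(r)) + v(r) at some r in (t - s, t) where s n1(v(r)) is at most
  twice the integral of n1(v); the first summand is an integral of g. If t - s \<le> 0, the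
  splitting v(t) = v(t) - v(0) with \<open>X1\<close> part 0 is used, and here v(0) = 0
  enters.\<close>

lemma K_trace_le:
  assumes t: "t \<in> {0..T}" and s: "0 < s"
  shows "ennreal (K s (v t)) \<le> (\<integral>\<^sup>+ r. ennreal (trace_density r) * indicator {t - s<..<t} r \<partial>lebesgue)"
proof (cases "t - s \<le> 0")
  case True
  have "ennreal (K s (v t)) \<le> ennreal (norm (v t - v 0))" using K_le_norm[of s "v t"] s v0 by (intro ennreal_leI) auto
  also have "\<dots> \<le> (\<integral>\<^sup>+ x. ennreal (norm (g x)) * indicator {0<..<t} x \<partial>lebesgue)" by (rule trace_diff_le) (use t in auto)
  also have "\<dots> \<le> (\<integral>\<^sup>+ r. ennreal (trace_density r) * indicator {t - s<..<t} r \<partial>lebesgue)"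
    using True t by (intro nn_integral_mono) (auto simp: trace_density_def indicator_def intro!: ennreal_leI)
  finally show ?thesis .
next
  case False
  define a where "a = t - s"
  have a: "0 < a" "a < t" "t - a = s" using False s by (auto simp: a_def)
  have "Lp_bd 1 n1 X1 a t v ((1 + (T - 0)) * V)"
    by (rule N1.Lp_bd_subinterval[OF N1.Lp_bd_imp_L1[OF v]]) (use p T a t in auto)
  then have L: "Lp_le 1 (lebesgue_on {a<..<t}) (\<lambda>r. n1 (v r)) ((1 + (T - 0)) * V)" and
      "AE r in lebesgue_on {a<..<t}. v r \<in> X1" by (auto simp: Lp_bd_def intro: N1.sm_inS)
  from exists_le_twice_mean[OF a(2) this]
  obtain r where r: "r \<in> {a<..<t}" "v r \<in> X1"
     "ennreal (s * n1 (v r)) \<le> 2 * (\<integral>\<^sup>+ r. ennreal (n1 (v r)) * indicator {a<..<t} r \<partial>lebesgue)" unfolding a(3) by blast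
  have meas: "(\<lambda>r. ennreal (norm (g r)) * indicator {a<..<t} r) \<in> borel_measurable lebesgue"
     "(\<lambda>r. ennreal (n1 (v r)) * indicator {a<..<t} r) \<in> borel_measurable lebesgue"
  proof -
    have "Lp_bd p norm UNIV a t g G" by (rule X0.Lp_bd_subinterval[OF g]) (use a t in auto)
    then have "(\<lambda>r. ennreal (norm (g r))) \<in> borel_measurable (lebesgue_on {a<..<t})"
      by (auto simp: Lp_bd_def dest: Lp_leD(2))
    then show "(\<lambda>r. ennreal (norm (g r)) * indicator {a<..<t} r) \<in> borel_measurable lebesgue"
      by (subst (asm) borel_measurable_restrict_space_iff_ennreal) auto
    have "(\<lambda>r. ennreal (n1 (v r))) \<in> borel_measurable (lebesgue_on {a<..<t})" using Lp_leD(2)[OF L] by simp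
    then show "(\<lambda>r. ennreal (n1 (v r)) * indicator {a<..<t} r) \<in> borel_measurable lebesgue"
      by (subst (asm) borel_measurable_restrict_space_iff_ennreal) auto
  qed
  have "ennreal (K s (v t)) \<le> ennreal (norm (v t - v r) + s * n1 (v r))"
    using K_le[OF _ r(2), of s "v t"] s by (intro ennreal_leI) auto
  also have "\<dots> = ennreal (norm (v t - v r)) + ennreal (s * n1 (v r))"
    using s N1.N_nonneg[OF r(2)] by simp
  also have "\<dots> \<le> (\<integral>\<^sup>+ x. ennreal (norm (g x)) * indicator {a<..<t} x \<partial>lebesgue)
       + 2 * (\<integral>\<^sup>+ r. ennreal (n1 (v r)) * indicator {a<..<t} r \<partial>lebesgue)"
  proof (rule add_mono[OF _ r(3)])
    have "ennreal (norm (v t - v r)) \<le> (\<integral>\<^sup>+ x. ennreal (norm (g x)) * indicator {r<..<t} x \<partial>lebesgue)"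
      by (rule trace_diff_le) (use r a t in auto)
    also have "\<dots> \<le> (\<integral>\<^sup>+ x. ennreal (norm (g x)) * indicator {a<..<t} x \<partial>lebesgue)"
      using r by (intro nn_integral_mono) (auto simp: indicator_def)
    finally show "ennreal (norm (v t - v r)) \<le> (\<integral>\<^sup>+ x. ennreal (norm (g x)) * indicator {a<..<t} x \<partial>lebesgue)" .
  qed
  also have "\<dots> = (\<integral>\<^sup>+ x. ennreal (norm (g x)) * indicator {a<..<t} x + 2 * (ennreal (n1 (v x)) * indicator {a<..<t} x) \<partial>lebesgue)"
    using meas by (simp add: nn_integral_add nn_integral_cmult)
  also have "\<dots> \<le> (\<integral>\<^sup>+ r. ennreal (trace_density r) * indicator {t - s<..<t} r \<partial>lebesgue)"
  proof (rule nn_integral_mono)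
    fix x
    show "ennreal (norm (g x)) * indicator {a<..<t} x + 2 * (ennreal (n1 (v x)) * indicator {a<..<t} x)
       \<le> ennreal (trace_density x) * indicator {t - s<..<t} x"
    proof (cases "x \<in> {a<..<t}")
      case True
      then have "x \<in> {0<..<T}" using a t by auto
      then have "ennreal (trace_density x) = ennreal (norm (g x)) + 2 * ennreal (max 0 (n1 (v x)))"
        by (simp add: trace_density_def ennreal_mult)
      moreover have "ennreal (n1 (v x)) \<le> ennreal (max 0 (n1 (v x)))" by (rule ennreal_leI) simp
      ultimately show ?thesis using True by (auto simp: a_def intro!: mult_left_mono)
    qed simp
  qed
  finally show ?thesis .
qed

lemma Ng_trace_le: assumes t: "t \<in> {0..T}" shows "v t \<in> Xg" "Ng (v t) \<le> q * (G + 2 * V)"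
proof -
  have "Lp_le p (lebesgue_on {0<..}) (\<lambda>s. K s (v t) / s) (q * (G + 2 * V))"
  proof (rule Hardy[OF p q_def trace_density_meas K_meas _ K_trace_le[OF t]])
    show "(\<integral>\<^sup>+ r. ennreal (trace_density r powr p) * indicator {..<t} r \<partial>lebesgue) \<le> ennreal ((G + 2 * V) powr p)"
      by (rule order_trans[OF nn_integral_mono trace_density_int]) (auto simp: indicator_def)
  qed (use K_nonneg Lp_bd_0_le[OF v] Lp_bd_0_le[OF g] in auto)
  then show "v t \<in> Xg" "Ng (v t) \<le> q * (G + 2 * V)" by (auto dest: Lp_le_Xg)
qed

text \<open>For s < \<delta> only the density on (t - \<delta>, t) matters, so Hardy's inequality
  applies to the truncated density. This isolates the part of the trace norm that is small uniformly
  in t.\<close>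

lemma K_trace_local:
  assumes t: "t \<in> {0..T}" and A: "0 \<le> A"
    "(\<integral>\<^sup>+ r. ennreal (trace_density r powr p) * indicator {t - \<delta><..<t} r \<partial>lebesgue) \<le> ennreal (A powr p)"
  shows "Lp_le p (lebesgue_on {0<..}) (\<lambda>s. (indicator {..<\<delta>} s * K s (v t)) / s) (q * A)"
proof (rule Hardy[OF p q_def, where \<phi>="\<lambda>r. indicator {t - \<delta><..<t} r * trace_density r" and t=t])
  have "(\<lambda>s. indicator {..<\<delta>} s * (K s (v t) / s)) \<in> borel_measurable (lebesgue_on {0<..})"
    by (intro borel_measurable_times K_meas measurable_restrict_space1) (auto intro: measurable_completion)
  then show "(\<lambda>s. (indicator {..<\<delta>} s * K s (v t)) / s) \<in> borel_measurable (lebesgue_on {0<..})" by simp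
  show "(\<lambda>r. indicator {t - \<delta><..<t} r * trace_density r) \<in> borel_measurable lebesgue"
    using trace_density_meas(1) by (intro borel_measurable_times borel_measurable_indicator) auto
  show "ennreal (indicator {..<\<delta>} s * K s (v t)) \<le>
     (\<integral>\<^sup>+ r. ennreal (indicator {t - \<delta><..<t} r * trace_density r) * indicator {t - s<..<t} r \<partial>lebesgue)" if s: "0 < s" for s
  proof (cases "s < \<delta>")
    case True
    have "ennreal (K s (v t)) \<le> (\<integral>\<^sup>+ r. ennreal (trace_density r) * indicator {t - s<..<t} r \<partial>lebesgue)" by (rule K_trace_le[OF t s])
    also have "\<dots> \<le> (\<integral>\<^sup>+ r. ennreal (indicator {t - \<delta><..<t} r * trace_density r) * indicator {t - s<..<t} r \<partial>lebesgue)"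
      using True by (intro nn_integral_mono) (auto simp: indicator_def)
    finally show ?thesis using True by simp
  qed simp
  have "(\<integral>\<^sup>+ r. ennreal ((indicator {t - \<delta><..<t} r * trace_density r) powr p) * indicator {..<t} r \<partial>lebesgue) =
     (\<integral>\<^sup>+ r. ennreal (trace_density r powr p) * indicator {t - \<delta><..<t} r \<partial>lebesgue)"
    using p by (intro nn_integral_cong) (auto simp: indicator_def)
  then show "(\<integral>\<^sup>+ r. ennreal ((indicator {t - \<delta><..<t} r * trace_density r) powr p) * indicator {..<t} r \<partial>lebesgue) \<le> ennreal (A powr p)"
    using A by simp
qed (use A trace_density_meas K_nonneg in auto)

text \<open>Uniform absolute continuity of the integral, read off from the uniform continuity of the
  indefinite integral on a compact interval.\<close>

lemma trace_density_small:
  assumes e: "0 < e"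
  obtains \<delta> where "0 < \<delta>" "\<And>t. t \<in> {0..T} \<Longrightarrow> (\<integral>\<^sup>+ r. ennreal (trace_density r powr p) * indicator {t - \<delta><..<t} r \<partial>lebesgue) \<le> ennreal (e powr p)"
proof -
  define \<psi> where "\<psi> r = trace_density r powr p" for r
  have [measurable]: "trace_density \<in> borel_measurable lebesgue" by (rule trace_density_meas)
  have \<psi>L: "Lp_le 1 (lebesgue_on {0<..<T}) \<psi> ((G + 2 * V) powr p)"
    using trace_density_Lp powr_real_measurable[OF Lp_leD(2)[OF trace_density_Lp] borel_measurable_const, of p]
    unfolding Lp_le_def \<psi>_def by simp
  have int: "\<psi> integrable_on {0..T}" using Lp_le_1_integrable(1)[OF \<psi>L] T by simp
  then have "continuous_on {0..T} (\<lambda>x. integral {0..x} \<psi>)" by (rule indefinite_integral_continuous_1)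
  then have "uniformly_continuous_on {0..T} (\<lambda>x. integral {0..x} \<psi>)" by (rule compact_uniformly_continuous) simp
  moreover have "0 < e powr p" using e by simp
  ultimately obtain d where d: "0 < d" "\<And>x y. x \<in> {0..T} \<Longrightarrow> y \<in> {0..T} \<Longrightarrow> dist y x < d \<Longrightarrow>
      dist (integral {0..y} \<psi>) (integral {0..x} \<psi>) < e powr p"
    unfolding uniformly_continuous_on_def by blast
  show ?thesis
  proof (rule that[of "d/2"])
    fix t assume t: "t \<in> {0..T}"
    define a where "a = max 0 (t - d/2)"
    have a: "0 \<le> a" "a \<le> t" "a \<in> {0..T}" "dist t a < d" using t d by (auto simp: a_def dist_real_def max_def)
    have \<psi>a: "Lp_le 1 (lebesgue_on {a<..<t}) \<psi> ((G + 2 * V) powr p)"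
      by (rule Lp_le_subset[OF \<psi>L]) (use a t in auto)
    have "(\<integral>\<^sup>+ r. ennreal (trace_density r powr p) * indicator {t - d/2<..<t} r \<partial>lebesgue) = (\<integral>\<^sup>+ r. ennreal (\<psi> r) * indicator {a<..<t} r \<partial>lebesgue)"
      using p by (intro nn_integral_cong) (auto simp: indicator_def \<psi>_def a_def trace_density_def)
    also have "\<dots> = (\<integral>\<^sup>+ r. ennreal (\<psi> r) \<partial>lebesgue_on {a<..<t})" by (simp add: nn_integral_restrict_space)
    also have "\<dots> = ennreal (integral\<^sup>L (lebesgue_on {a<..<t}) \<psi>)"
      by (rule nn_integral_eq_integral[OF Lp_le_1_integrable(3)[OF \<psi>a]]) (use a in \<open>auto simp: \<psi>_def\<close>)
    also have "integral\<^sup>L (lebesgue_on {a<..<t}) \<psi> = integral {a..t} \<psi>"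
      by (subst lebesgue_integral_eq_integral[OF Lp_le_1_integrable(3)[OF \<psi>a]])
         (use a in \<open>auto simp: integral_open_interval_real\<close>)
    also have "\<dots> = integral {0..t} \<psi> - integral {0..a} \<psi>"
      using Henstock_Kurzweil_Integration.integral_combine[of 0 a t \<psi>] a t integrable_on_subinterval[OF int, of 0 t] by auto
    also have "\<dots> \<le> e powr p" using d(2)[OF a(3) t a(4)] by (simp add: dist_real_def)
    finally show "(\<integral>\<^sup>+ r. ennreal (trace_density r powr p) * indicator {t - d/2<..<t} r \<partial>lebesgue) \<le> ennreal (e powr p)"
      by (simp add: ennreal_leI)
  qed (use d in simp)
qed

text \<open>The trace norm of v(r) - v(t) is split in the parameter of the K-functional. Below
  \<delta> both terms are small separately and uniformly; above it K is at most the norm in X0, in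
  which v is continuous as an indefinite integral.\<close>

lemma Ng_trace_cont: assumes t: "t \<in> {0..T}" shows "((\<lambda>s. Ng (v s - v t)) \<longlongrightarrow> 0) (at t within {0..T})"
proof (rule tendstoI)
  fix e :: real assume e: "0 < e"
  \<comment> \<open>Each of the two local terms costs q \<eta> = e/4, which leaves e/2 for the
    difference measured in X0.\<close>
  define \<eta> where "\<eta> = e / (4 * q)"
  have \<eta>: "0 < \<eta>" "q * \<eta> = e/4" using e q by (auto simp: \<eta>_def)
  obtain \<delta> where \<delta>: "0 < \<delta>" "\<And>t. t \<in> {0..T} \<Longrightarrow>
      (\<integral>\<^sup>+ r. ennreal (trace_density r powr p) * indicator {t - \<delta><..<t} r \<partial>lebesgue) \<le> ennreal (\<eta> powr p)"
    using trace_density_small[OF \<eta>(1)] by blast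
  define B where "B = (((\<delta>/2) powr (- p + 1) / (p - 1))) powr (1/p)"
  have tail: "Lp_le p (lebesgue_on {0<..}) (\<lambda>s. indicator {\<delta>/2<..} s / s) B"
  proof -
    have "(\<integral>\<^sup>+ s. ennreal ((indicator {\<delta>/2<..} s / s) powr p) \<partial>lebesgue_on {0<..})
       = (\<integral>\<^sup>+ s. ennreal (s powr (-p)) * indicator {\<delta>/2<..} s \<partial>lebesgue)"
      using p \<delta> by (subst nn_integral_restrict_space)
        (auto intro!: nn_integral_cong simp: indicator_def powr_divide powr_minus_divide)
    also have "\<dots> = ennreal ((\<delta>/2) powr (- p + 1) / (- (-p) - 1))"
      by (rule nn_integral_powr_tail) (use p \<delta> in auto)
    also have "\<dots> = ennreal (B powr p)" using p by (simp add: B_def powr_powr)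
    finally have "(\<integral>\<^sup>+ s. ennreal ((indicator {\<delta>/2<..} s / s) powr p) \<partial>lebesgue_on {0<..}) \<le> ennreal (B powr p)" by simp
    moreover have "(\<lambda>s. indicator {\<delta>/2<..} s / s) \<in> borel_measurable (lebesgue_on {0<..})"
      by (intro borel_measurable_divide measurable_restrict_space1) (auto intro: measurable_completion)
    moreover have "AE s in lebesgue_on {0<..}. 0 \<le> indicator {\<delta>/2<..} s / s"
      by (rule AE_I2) (auto simp: space_restrict_space)
    ultimately show ?thesis unfolding Lp_le_def by (auto simp: B_def)
  qed
  have bound: "Ng (v r - v t) \<le> e/2 + norm (v r - v t) * B" if r: "r \<in> {0..T}" for r
  proof (rule Xg_mono(2))
    have "Lp_le p (lebesgue_on {0<..}) (\<lambda>s. (indicator {..<\<delta>} s * K s (v r)) / s + (indicator {..<\<delta>} s * K s (v t)) / s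
          + norm (v r - v t) * (indicator {\<delta>/2<..} s / s)) (q * \<eta> + q * \<eta> + norm (v r - v t) * B)"
      using p \<eta> t r \<delta> by (intro Lp_le_add K_trace_local Lp_le_cmult tail) auto
    then show "Lp_le p (lebesgue_on {0<..}) (\<lambda>s. (indicator {..<\<delta>} s * K s (v r)) / s + (indicator {..<\<delta>} s * K s (v t)) / s
          + norm (v r - v t) * (indicator {\<delta>/2<..} s / s)) (e/2 + norm (v r - v t) * B)" using \<eta> by simp
    fix s :: real assume s: "0 < s"
    show "K s (v r - v t) / s \<le> (indicator {..<\<delta>} s * K s (v r)) / s + (indicator {..<\<delta>} s * K s (v t)) / s
          + norm (v r - v t) * (indicator {\<delta>/2<..} s / s)"
    proof (cases "s < \<delta>")
      case True
      have "K s (v r - v t) / s \<le> K s (v r) / s + K s (v t) / s"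
        using nspace.N_diff[OF nspace_K, of s "v r" "v t"] s by (simp add: add_divide_distrib[symmetric] divide_right_mono)
      moreover have "0 \<le> norm (v r - v t) * (indicator {\<delta>/2<..} s / s)" using s by simp
      ultimately show ?thesis using True by simp
    next
      case False
      then have "K s (v r - v t) / s \<le> norm (v r - v t) * (indicator {\<delta>/2<..} s / s)"
        using K_le_norm[of s "v r - v t"] s \<delta> by (simp add: divide_right_mono)
      then show ?thesis using False by simp
    qed
  qed
  have "continuous_on {0..T} (\<lambda>x. integral {0..x} g)"
    by (rule indefinite_integral_continuous_1) (use vg[of T] T in \<open>auto simp: integrable_on_def\<close>)
  then have "continuous_on {0..T} v"
    by (rule continuous_on_cong[THEN iffD1, rotated 2]) (use vg in \<open>auto intro: integral_unique\<close>)
  then have "(v \<longlongrightarrow> v t) (at t within {0..T})" using t by (auto simp: continuous_on)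
  then have "((\<lambda>r. e/2 + norm (v r - v t) * B) \<longlongrightarrow> e/2 + norm (v t - v t) * B) (at t within {0..T})"
    by (intro tendsto_intros)
  then have "\<forall>\<^sub>F r in at t within {0..T}. e/2 + norm (v r - v t) * B < e" by (rule order_tendstoD(2)) (use e in simp)
  moreover have "\<forall>\<^sub>F s in at t within {0..T}. s \<in> {0..T}" by (simp add: eventually_at_filter)
  ultimately show "\<forall>\<^sub>F s in at t within {0..T}. dist (Ng (v s - v t)) 0 < e"
  proof eventually_elim
    case (elim r)
    then show ?case using bound[of r] Ng_nonneg[of "v r - v t"] by simp
  qed
qed

lemma trace_Ep: "Ep_bd T v (q * (G + 2 * V))"
  unfolding Ep_bd_def
proof (intro conjI ballI Ng_trace_le Ng_trace_cont)
  have "0 \<le> V" "0 \<le> G" using Lp_bd_0_le[OF v] Lp_bd_0_le[OF g] by auto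
  then have "V \<le> 1 * (G + 2 * V)" by simp
  also have "\<dots> \<le> q * (G + 2 * V)" using q \<open>0 \<le> V\<close> \<open>0 \<le> G\<close> by (intro mult_right_mono) auto
  finally show "Lp_bd p n1 X1 0 T v (q * (G + 2 * V))" using p by (intro Lp_bd_bound_mono[OF v]) auto
qed

end

end

section \<open>Extensions of trace space elements\<close>

text \<open>In \<open>hat (2 ^ k * t)\<close> the drop from 1 to 0 takes place on the dyadic
  interval [2^(-k-1), 2^(-k)], so that in the series below only one term moves at a time.\<close>

definition hat :: "real \<Rightarrow> real" where "hat s = max 0 (min 1 (2 - 2 * s))"
definition hat' :: "real \<Rightarrow> real" where "hat' s = (if 1/2 < s \<and> s < 1 then -2 else 0)"

lemma hat_bounds: "0 \<le> hat s" "hat s \<le> 1" by (auto simp: hat_def)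
lemma hat_eq_1: "s \<le> 1/2 \<Longrightarrow> hat s = 1" by (auto simp: hat_def)
lemma hat_eq_0: "1 \<le> s \<Longrightarrow> hat s = 0" by (auto simp: hat_def)
lemma continuous_hat: "continuous_on A hat" unfolding hat_def[abs_def] by (intro continuous_intros)

lemma hat_deriv:
  assumes "s \<noteq> 1/2" "s \<noteq> 1"
  shows "(hat has_real_derivative hat' s) (at s)"
proof -
  consider "s < 1/2" | "1/2 < s" "s < 1" | "1 < s" using assms by linarith
  then show ?thesis
  proof cases
    case 1
    have "((\<lambda>s. 1) has_real_derivative 0) (at s)" by simp
    then have "(hat has_real_derivative 0) (at s)"
      by (rule has_field_derivative_transform_within_open[where S="{..<1/2}"]) (use 1 in \<open>auto simp: hat_def\<close>)
    then show ?thesis using 1 by (simp add: hat'_def)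
  next
    case 2
    have "((\<lambda>s. 2 - 2 * s) has_real_derivative (-2)) (at s)" by (auto intro!: derivative_eq_intros)
    then have "(hat has_real_derivative (-2)) (at s)"
      by (rule has_field_derivative_transform_within_open[where S="{1/2<..<1}"]) (use 2 in \<open>auto simp: hat_def\<close>)
    then show ?thesis using 2 by (simp add: hat'_def)
  next
    case 3
    have "((\<lambda>s. 0) has_real_derivative 0) (at s)" by simp
    then have "(hat has_real_derivative 0) (at s)"
      by (rule has_field_derivative_transform_within_open[where S="{1<..}"]) (use 3 in \<open>auto simp: hat_def\<close>)
    then show ?thesis using 3 by (simp add: hat'_def)
  qed
qed

lemma dyadic_index:
  fixes t :: real assumes "0 < t" "t < 1"
  obtains m where "(1/2) ^ Suc m \<le> t" "t \<le> (1/2) ^ m"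
proof -
  have ex: "\<exists>n. (1/2) ^ n \<le> t" using real_arch_pow_inv[of t "1/2"] assms by (auto intro: less_imp_le)
  define n where "n = (LEAST n. (1/2) ^ n \<le> t)"
  have n: "(1/2) ^ n \<le> t" unfolding n_def using ex by (rule LeastI_ex)
  then obtain m where m: "n = Suc m" using assms by (cases n) auto
  have "\<not> (1/2) ^ m \<le> t" using not_less_Least[of m "\<lambda>n. (1/2) ^ n \<le> t"] m by (simp add: n_def)
  then show ?thesis using that[of m] n m by auto
qed

context couple
begin

text \<open>At k = 0 the approximant 0 is admissible because norm x \<le> c0 K(1, x). For k > 0 and
  x \<noteq> 0 the K-functional is positive, and the factor 2 c0 \<ge> 2 leaves strict room above
  the infimum.\<close>

lemma approximants_exist:
  "\<exists>b::nat \<Rightarrow> 'a. b 0 = 0 \<and> (\<forall>k. b k \<in> X1 \<and> norm (x - b k) + (1/2) ^ k * n1 (b k) \<le> 2 * c0 * K ((1/2) ^ k) x)"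
proof -
  have "\<exists>z. (k = 0 \<longrightarrow> z = 0) \<and> z \<in> X1 \<and> norm (x - z) + (1/2) ^ k * n1 z \<le> 2 * c0 * K ((1/2) ^ k) x" for k :: nat
  proof (cases "k = 0 \<or> x = 0")
    case True
    then have "norm x \<le> 2 * c0 * K ((1/2) ^ k) x"
    proof
      assume "k = 0"
      moreover have "norm x \<le> c0 * K 1 x" by (rule norm_le_K) simp
      moreover have "0 \<le> c0 * K 1 x" using c0(1) K_nonneg[of 1 x] by simp
      ultimately show ?thesis by simp
    next
      assume "x = 0"
      then show ?thesis using c0(1) K_nonneg[of "(1/2) ^ k" x] by simp
    qed
    then show ?thesis using N1.S_0 N1.N_0 by (intro exI[of _ 0]) auto
  next
    case False
    let ?s = "(1/2) ^ k :: real"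
    have "0 < K ?s x" using False by (intro K_pos) auto
    moreover have "1 * K ?s x \<le> c0 * K ?s x" using c0(1) K_nonneg[of ?s x] by (intro mult_right_mono) auto
    ultimately have "K ?s x < 2 * c0 * K ?s x" by simp
    then show ?thesis using K_approx[of ?s x "2 * c0 * K ?s x"] False by (auto intro: less_imp_le)
  qed
  then have "\<exists>b. \<forall>k. (k = 0 \<longrightarrow> b k = 0) \<and> b k \<in> X1 \<and> norm (x - b k) + (1/2) ^ k * n1 (b k) \<le> 2 * c0 * K ((1/2) ^ k) x"
    by (intro choice allI) 
  then show ?thesis by blast
qed

context
  fixes x :: 'a and b :: "nat \<Rightarrow> 'a"
  assumes x: "x \<in> Xg" and b0: "b 0 = 0" and bX: "\<And>k. b k \<in> X1"
    and bb: "\<And>k. norm (x - b k) + (1/2) ^ k * n1 (b k) \<le> 2 * c0 * K ((1/2) ^ k) x"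
begin

definition ext_step where "ext_step k = b (Suc k) - b k"
definition ext_part where "ext_part n t = (\<Sum>k<n. hat (2 ^ k * t) *\<^sub>R ext_step k)"
definition ext_part' where "ext_part' n t = (\<Sum>k<n. (2 ^ k * hat' (2 ^ k * t)) *\<^sub>R ext_step k)"
text \<open>Since b(0) = 0 the series telescopes: on [2^(-m-1), 2^(-m)] it is a convex combination
  of b(m) and b(m+1), and it vanishes for t \<ge> 1. The value x for t \<le> 0 is its limit at
  0.\<close>

definition ext_fun where "ext_fun t = (if t \<le> 0 then x else \<Sum>k. hat (2 ^ k * t) *\<^sub>R ext_step k)"
definition ext_deriv where "ext_deriv t = (if t \<le> 0 then 0 else \<Sum>k. (2 ^ k * hat' (2 ^ k * t)) *\<^sub>R ext_step k)"

lemma ext_step_in_X1: "ext_step k \<in> X1" unfolding ext_step_def by (intro N1.S_diff bX)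

lemma sum_ext_step: "(\<Sum>k<n. ext_step k) = b n"
  unfolding ext_step_def using sum_lessThan_telescope[of b n] b0 by simp

lemma pow2_mono: "0 < t \<Longrightarrow> 1 \<le> 2 ^ n * t \<Longrightarrow> n \<le> k \<Longrightarrow> 1 \<le> (2::real) ^ k * t"
  using mult_right_mono[of "2 ^ n" "2 ^ k" t] by (simp add: power_increasing order_trans)

text \<open>Away from 0 only finitely many terms survive, so measurability and differentiation are
  matters of finite sums.\<close>

lemma ext_fun_eq_part: assumes "0 < t" "1 \<le> 2 ^ n * t" shows "ext_fun t = ext_part n t" "ext_deriv t = ext_part' n t"
proof -
  have "(\<Sum>k. hat (2 ^ k * t) *\<^sub>R ext_step k) = ext_part n t" unfolding ext_part_def
    by (rule suminf_finite) (use pow2_mono[OF assms] in \<open>auto simp: hat_eq_0 not_less\<close>)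
  then show "ext_fun t = ext_part n t" using assms by (simp add: ext_fun_def)
  have "(\<Sum>k. (2 ^ k * hat' (2 ^ k * t)) *\<^sub>R ext_step k) = ext_part' n t" unfolding ext_part'_def
  proof (rule suminf_finite)
    fix k assume "k \<notin> {..<n}"
    then have "1 \<le> 2 ^ k * t" using pow2_mono[OF assms, of k] by auto
    then show "(2 ^ k * hat' (2 ^ k * t)) *\<^sub>R ext_step k = 0" by (simp add: hat'_def)
  qed simp
  then show "ext_deriv t = ext_part' n t" using assms by (simp add: ext_deriv_def)
qed

lemma ex_level: assumes "0 < (t::real)" shows "\<exists>n. 1 \<le> 2 ^ n * t"
proof -
  obtain n where "1 / t < 2 ^ n" using real_arch_pow[of 2 "1/t"] by auto
  then have "1 < 2 ^ n * t" using assms by (simp add: divide_simps)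
  then show ?thesis by (intro exI[of _ n]) simp
qed

lemma ext_fun_piece:
  assumes "(1/2) ^ Suc m \<le> t" "t \<le> (1/2) ^ m"
  shows "ext_fun t = b m + hat (2 ^ m * t) *\<^sub>R ext_step m" "ext_deriv t = (2 ^ m * hat' (2 ^ m * t)) *\<^sub>R ext_step m"
proof -
  have "0 < (1/2::real) ^ Suc m" by simp
  then have t: "0 < t" using assms by linarith
  have "2 ^ Suc m * (1/2) ^ Suc m \<le> 2 ^ Suc m * t" using assms by (intro mult_left_mono) auto
  then have l: "1 \<le> 2 ^ Suc m * t" by (simp add: power_divide)
  have small: "2 ^ k * t \<le> 1/2" if "k < m" for k
  proof -
    have "2 ^ k * t \<le> 2 ^ k * (1/2) ^ m" using assms by (intro mult_left_mono) auto
    also have "\<dots> \<le> 2 ^ k * (1/2) ^ Suc k" using that by (intro mult_left_mono power_decreasing) auto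
    also have "\<dots> = 1/2" by (simp add: power_divide)
    finally show ?thesis .
  qed
  have "ext_part m t = (\<Sum>k<m. ext_step k)" unfolding ext_part_def by (intro sum.cong refl) (simp add: hat_eq_1[OF small])
  then show "ext_fun t = b m + hat (2 ^ m * t) *\<^sub>R ext_step m"
    using ext_fun_eq_part(1)[OF t l] by (simp add: ext_part_def sum_ext_step)
  have "ext_part' m t = 0" unfolding ext_part'_def
  proof (rule sum.neutral, safe)
    fix k assume "k < m"
    then show "(2 ^ k * hat' (2 ^ k * t)) *\<^sub>R ext_step k = 0" using small[of k] by (simp add: hat'_def)
  qed
  then show "ext_deriv t = (2 ^ m * hat' (2 ^ m * t)) *\<^sub>R ext_step m"
    using ext_fun_eq_part(2)[OF t l] by (simp add: ext_part'_def)
qed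

lemma ext_fun_ge_1: assumes "1 \<le> t" shows "ext_fun t = 0" "ext_deriv t = 0"
  using ext_fun_eq_part[of t 0] assms by (auto simp: ext_part_def ext_part'_def)

lemma b_bounds: "norm (x - b k) \<le> 2 * c0 * K ((1/2) ^ k) x" "n1 (b k) \<le> 2 * c0 * (2 ^ k * K ((1/2) ^ k) x)"
proof -
  have "0 \<le> (1/2) ^ k * n1 (b k)" using N1.N_nonneg[OF bX] by simp
  then show "norm (x - b k) \<le> 2 * c0 * K ((1/2) ^ k) x" using bb[of k] by simp
  have "(1/2) ^ k * n1 (b k) \<le> 2 * c0 * K ((1/2) ^ k) x"
    using bb[of k] norm_ge_zero[of "x - b k"] by linarith
  then have "2 ^ k * ((1/2) ^ k * n1 (b k)) \<le> 2 ^ k * (2 * c0 * K ((1/2) ^ k) x)" by (intro mult_left_mono) auto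
  then show "n1 (b k) \<le> 2 * c0 * (2 ^ k * K ((1/2) ^ k) x)"
    by (simp add: power_divide mult_ac)
qed

text \<open>K(s) increases and K(s) / s decreases, so at both ends of the dyadic interval around t
  they are comparable with their values at t. The derivative is a difference of consecutive
  approximants, of norm at most 8 c0 K(t, x), times a slope of at most 2 * 2^m \<le> 2 / t; hence
  the 16.\<close>

lemma ext_fun_bounds:
  assumes t: "0 < t"
  shows "ext_fun t \<in> X1" "norm (x - ext_fun t) \<le> 4 * c0 * K t x" "n1 (ext_fun t) \<le> 4 * c0 * (K t x / t)" "norm (ext_deriv t) \<le> 16 * c0 * (K t x / t)"
proof -
  have *: "ext_fun t \<in> X1 \<and> norm (x - ext_fun t) \<le> 4 * c0 * K t x \<and> n1 (ext_fun t) \<le> 4 * c0 * (K t x / t) \<and> norm (ext_deriv t) \<le> 16 * c0 * (K t x / t)"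
  proof (cases "1 \<le> t")
    case True
    have nn: "0 \<le> c0 * K t x" using c0(1) t K_nonneg[of t x] by simp
    have "norm x \<le> c0 * K t x" by (rule norm_le_K[OF True])
    then have "norm x \<le> 4 * c0 * K t x" using nn by simp
    then show ?thesis using ext_fun_ge_1[OF True] N1.S_0 N1.N_0 c0(1) t K_nonneg[of t x] by simp
  next
    case False
    then obtain m where m: "(1/2) ^ Suc m \<le> t" "t \<le> (1/2) ^ m" using dyadic_index[OF t] by (auto simp: not_le)
    define h where "h = hat (2 ^ m * t)"
    have h: "0 \<le> h" "h \<le> 1" by (auto simp: h_def hat_bounds)
    have ext_fun: "ext_fun t = (1 - h) *\<^sub>R b m + h *\<^sub>R b (Suc m)"
      using ext_fun_piece(1)[OF m] by (simp add: h_def ext_step_def algebra_simps)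
    have K1: "K ((1/2) ^ m) x \<le> 2 * K t x" using m t by (intro K_double) auto
    have K2: "K ((1/2) ^ Suc m) x \<le> K t x" using m by (intro K_mono) auto
    have Kt: "0 \<le> K t x" using t by (intro K_nonneg) auto
    have uX: "ext_fun t \<in> X1" unfolding ext_fun by (intro N1.S_add N1.S_scale bX)
    have n1': "norm (x - b m) \<le> 4 * c0 * K t x"
    proof -
      have "norm (x - b m) \<le> 2 * c0 * K ((1/2) ^ m) x" by (rule b_bounds)
      also have "\<dots> \<le> 2 * c0 * (2 * K t x)" using c0(1) K1 by (intro mult_left_mono) auto
      finally show ?thesis by simp
    qed
    have n2: "norm (x - b (Suc m)) \<le> 4 * c0 * K t x"
    proof -
      have "norm (x - b (Suc m)) \<le> 2 * c0 * K ((1/2) ^ Suc m) x" by (rule b_bounds)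
      also have "\<dots> \<le> 2 * c0 * K t x" using c0(1) K2 by (intro mult_left_mono) auto
      also have "\<dots> \<le> 4 * c0 * K t x" using c0(1) Kt by (intro mult_right_mono) auto
      finally show ?thesis by simp
    qed
    have "x - ext_fun t = (1 - h) *\<^sub>R (x - b m) + h *\<^sub>R (x - b (Suc m))" unfolding ext_fun by (simp add: algebra_simps)
    then have "norm (x - ext_fun t) \<le> (1 - h) * norm (x - b m) + h * norm (x - b (Suc m))"
      using norm_triangle_ineq[of "(1 - h) *\<^sub>R (x - b m)" "h *\<^sub>R (x - b (Suc m))"] h by simp
    also have "\<dots> \<le> (1 - h) * (4 * c0 * K t x) + h * (4 * c0 * K t x)"
      using h n1' n2 by (intro add_mono mult_left_mono) auto
    finally have c1: "norm (x - ext_fun t) \<le> 4 * c0 * K t x" by (simp add: algebra_simps)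
    have p2: "2 ^ m * (1/2::real) ^ m = 1" "2 ^ Suc m * (1/2::real) ^ Suc m = 1" by (simp_all add: power_divide)
    have "2 ^ m * t \<le> 2 ^ m * (1/2) ^ m" using m by (intro mult_left_mono) auto
    then have pm: "2 ^ m * t \<le> 1" using p2 by simp
    have le2: "2 ^ m \<le> 1 / t" using pm t by (simp add: field_simps)
    have e1: "n1 (b m) \<le> 4 * c0 * (K t x / t)"
    proof -
      have "K ((1/2) ^ m) x / (1/2) ^ m \<le> K t x / t" using m t by (intro K_quot) auto
      moreover have "K ((1/2) ^ m) x / (1/2) ^ m = 2 ^ m * K ((1/2) ^ m) x" by (simp add: power_divide)
      ultimately have "2 ^ m * K ((1/2) ^ m) x \<le> K t x / t" by simp
      then have "2 * c0 * (2 ^ m * K ((1/2) ^ m) x) \<le> 2 * c0 * (K t x / t)"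
        using c0(1) by (intro mult_left_mono) auto
      also have "\<dots> \<le> 4 * c0 * (K t x / t)" using c0(1) Kt t by (intro mult_right_mono) auto
      finally show ?thesis using b_bounds(2)[of m] by simp
    qed
    have e2: "n1 (b (Suc m)) \<le> 4 * c0 * (K t x / t)"
    proof -
      have "2 ^ Suc m * K ((1/2) ^ Suc m) x \<le> (2 * (1/t)) * K t x"
        using le2 K2 Kt t K_nonneg[of "(1/2) ^ Suc m" x] by (intro mult_mono) auto
      then have "2 * c0 * (2 ^ Suc m * K ((1/2) ^ Suc m) x) \<le> 2 * c0 * ((2 * (1/t)) * K t x)"
        using c0(1) by (intro mult_left_mono) auto
      then show ?thesis using b_bounds(2)[of "Suc m"] by simp
    qed
    have "n1 (ext_fun t) \<le> n1 ((1 - h) *\<^sub>R b m) + n1 (h *\<^sub>R b (Suc m))"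
      unfolding ext_fun by (intro N1.N_add N1.S_scale bX)
    also have "\<dots> = (1 - h) * n1 (b m) + h * n1 (b (Suc m))" using h bX by (simp add: N1.N_scale)
    also have "\<dots> \<le> (1 - h) * (4 * c0 * (K t x / t)) + h * (4 * c0 * (K t x / t))"
      using h e1 e2 by (intro add_mono mult_left_mono) auto
    also have "\<dots> = 4 * c0 * (K t x / t)" by (simp only: distrib_right[symmetric]) simp
    finally have c2: "n1 (ext_fun t) \<le> 4 * c0 * (K t x / t)" .
    have "norm (ext_step m) \<le> norm (x - b m) + norm (x - b (Suc m))"
      unfolding ext_step_def using norm_triangle_ineq4[of "x - b m" "x - b (Suc m)"] by simp
    then have ym: "norm (ext_step m) \<le> 8 * c0 * K t x" using n1' n2 by simp
    have "norm (ext_deriv t) = \<bar>2 ^ m * hat' (2 ^ m * t)\<bar> * norm (ext_step m)" using ext_fun_piece(2)[OF m] by simp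
    also have "\<dots> \<le> (2 * (1/t)) * (8 * c0 * K t x)"
    proof (intro mult_mono ym)
      have "\<bar>2 ^ m * hat' (2 ^ m * t)\<bar> \<le> 2 ^ m * 2" by (simp add: abs_mult hat'_def)
      also have "\<dots> \<le> 2 * (1/t)" using le2 by simp
      finally show "\<bar>2 ^ m * hat' (2 ^ m * t)\<bar> \<le> 2 * (1/t)" .
    qed (use t in auto)
    finally have "norm (ext_deriv t) \<le> 16 * c0 * (K t x / t)" by simp
    then show ?thesis using uX c1 c2 by blast
  qed
  then show "ext_fun t \<in> X1" "norm (x - ext_fun t) \<le> 4 * c0 * K t x" "n1 (ext_fun t) \<le> 4 * c0 * (K t x / t)" "norm (ext_deriv t) \<le> 16 * c0 * (K t x / t)"
    by blast+
qed

text \<open>For t \<le> s the value is within 4 c0 K(t, x) \<le> 4 c0 K(s, x) of x; for s < t its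
  \<open>X1\<close> bound gives s K(t, x) / t \<le> K(s, x) up to a constant. Uniformity in t is
  what later allows \<open>Ng_dominated\<close> to give continuity in the trace norm.\<close>

lemma K_ext_fun: assumes s: "0 < s" shows "K s (ext_fun t) \<le> 5 * c0 * K s x"
proof -
  have Ks: "0 \<le> K s x" using s by (intro K_nonneg) auto
  have one: "K s x \<le> c0 * K s x" using c0(1) Ks mult_right_mono[of 1 c0 "K s x"] by simp
  have nn: "0 \<le> c0 * K s x" using c0(1) Ks by simp
  consider "t \<le> 0" | "0 < t" "t \<le> s" | "0 < t" "s < t" by linarith
  then show ?thesis
  proof cases
    case 1 then show ?thesis using one nn by (simp add: ext_fun_def)
  next
    case 2
    have "K s (ext_fun t) = K s (x - (x - ext_fun t))" by simp
    also have "\<dots> \<le> K s x + K s (x - ext_fun t)" using s by (intro nspace.N_diff[OF nspace_K]) auto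
    also have "K s (x - ext_fun t) \<le> norm (x - ext_fun t)" using s by (intro K_le_norm) auto
    also have "norm (x - ext_fun t) \<le> 4 * c0 * K t x" by (rule ext_fun_bounds) fact
    also have "\<dots> \<le> 4 * c0 * K s x" using 2 c0(1) K_mono[of t s x] by (intro mult_left_mono) auto
    finally show ?thesis using one by simp
  next
    case 3
    have "K s (ext_fun t) \<le> s * n1 (ext_fun t)" using s ext_fun_bounds(1)[OF 3(1)] by (intro K_le_n1) auto
    also have "\<dots> \<le> s * (4 * c0 * (K t x / t))" using s ext_fun_bounds(3)[OF 3(1)] by (intro mult_left_mono) auto
    also have "\<dots> \<le> s * (4 * c0 * (K s x / s))" using s c0(1) 3 K_quot[of s t x] by (intro mult_left_mono) auto
    also have "\<dots> \<le> 5 * c0 * K s x" using s nn by simp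
    finally show ?thesis .
  qed
qed

lemma Ng_ext_fun: "ext_fun t \<in> Xg" "Ng (ext_fun t) \<le> 5 * c0 * Ng x"
proof -
  have L: "Lp_le p (lebesgue_on {0<..}) (\<lambda>s. (5 * c0) * (K s x / s)) ((5 * c0) * Ng x)"
    using c0(1) by (intro Lp_le_cmult Xg_Lp_le x) auto
  have "K s (ext_fun t) / s \<le> (5 * c0) * (K s x / s)" if "0 < s" for s
    using K_ext_fun[OF that, of t] that by (simp add: divide_right_mono)
  then show "ext_fun t \<in> Xg" "Ng (ext_fun t) \<le> 5 * c0 * Ng x" using Xg_mono[OF L] by auto
qed

lemma K_tendsto_0: "((\<lambda>t. K t x) \<longlongrightarrow> 0) (at_right 0)"
proof (rule Lim_null_comparison)
  show "\<forall>\<^sub>F t in at_right 0. norm (K t x) \<le> 2 * t powr (1 - 1/p) * Ng x"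
    by (rule eventually_mono[OF eventually_at_right_less]) (use K_le_Ng[OF x] K_nonneg[OF less_imp_le, of _ x] in auto)
  have "((\<lambda>t. 2 * t powr (1 - 1/p) * Ng x) \<longlongrightarrow> 2 * 0 powr (1 - 1/p) * Ng x) (at_right 0)"
    using p by (intro tendsto_intros tendsto_powr2) (auto intro: eventually_mono[OF eventually_at_right_less])
  then show "((\<lambda>t. 2 * t powr (1 - 1/p) * Ng x) \<longlongrightarrow> 0) (at_right 0)" by simp
qed

lemma continuous_part: "continuous_on A (ext_part n)"
  unfolding ext_part_def
  by (intro continuous_intros continuous_on_compose2[OF continuous_hat[of UNIV]]) auto

lemma ext_fun_cont: "isCont ext_fun t"
proof -
  consider "t < 0" | "t = 0" | "0 < t" by linarith
  then show ?thesis
  proof cases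
    case 1
    have "isCont (\<lambda>t. x) t" by simp
    moreover have "\<forall>\<^sub>F s in nhds t. ext_fun s = x"
      using eventually_nhds_in_open[of "{..<0}" t] 1 by (auto elim!: eventually_mono simp: ext_fun_def)
    ultimately show ?thesis by (simp add: isCont_cong)
  next
    case 3
    obtain n where n: "1 \<le> 2 ^ n * (t/2)" using ex_level[of "t/2"] 3 by auto
    have "ext_fun s = ext_part n s" if "t/2 < s" for s
    proof (rule ext_fun_eq_part)
      show "0 < s" using that 3 by simp
      have "2 ^ n * (t/2) \<le> 2 ^ n * s" using that by (intro mult_left_mono) auto
      then show "1 \<le> 2 ^ n * s" using n by linarith
    qed
    then have "\<forall>\<^sub>F s in nhds t. ext_fun s = ext_part n s"
      using eventually_nhds_in_open[of "{t/2<..}" t] 3 by (auto elim!: eventually_mono)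
    moreover have "isCont (ext_part n) t" using continuous_part[of UNIV n] by (simp add: continuous_on_eq_continuous_at)
    ultimately show ?thesis by (simp add: isCont_cong)
  next
    case 2
    have "((\<lambda>t. x - ext_fun t) \<longlongrightarrow> 0) (at_right 0)"
    proof (rule Lim_null_comparison)
      show "\<forall>\<^sub>F t in at_right 0. norm (x - ext_fun t) \<le> 4 * c0 * K t x"
        by (rule eventually_mono[OF eventually_at_right_less]) (rule ext_fun_bounds)
      show "((\<lambda>t. 4 * c0 * K t x) \<longlongrightarrow> 0) (at_right 0)" by (intro tendsto_mult_right_zero K_tendsto_0)
    qed
    from tendsto_diff[OF tendsto_const[of x] this] have r: "(ext_fun \<longlongrightarrow> x) (at_right 0)" by simp
    have "\<forall>\<^sub>F s in at_left 0. x = ext_fun s"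
      by (simp add: eventually_at_filter ext_fun_def)
    then have "(ext_fun \<longlongrightarrow> x) (at_left 0)" by (rule Lim_transform_eventually[OF tendsto_const])
    with r have "(ext_fun \<longlongrightarrow> x) (at 0)" by (rule filterlim_split_at_real[rotated])
    then show ?thesis using 2 by (simp add: isCont_def ext_fun_def)
  qed
qed

text \<open>K(\<tau>, x) / \<tau> extended by zero, so that it may be translated by a; its L^p norm
  is the trace norm of x.\<close>

definition ext_weight where "ext_weight \<tau> = (if 0 < \<tau> then K \<tau> x / \<tau> else 0)"

lemma ext_weight_nonneg: "0 \<le> ext_weight \<tau>" by (simp add: ext_weight_def K_nonneg)

lemma ext_weight_borel: "ext_weight \<in> borel_measurable borel"
proof -
  have "ext_weight = (\<lambda>\<tau>. (indicator {0<..} \<tau> *\<^sub>R K \<tau> x) / \<tau>)" by (auto simp: ext_weight_def indicator_def)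
  also have "\<dots> \<in> borel_measurable borel" by (intro borel_measurable_divide K_borel) auto
  finally show ?thesis .
qed

lemma ext_weight_Lp: "Lp_le p (lebesgue_on {0<..<T}) (\<lambda>t. ext_weight (t - a)) (Ng x)"
proof -
  note [measurable] = ext_weight_borel
  have "(\<integral>\<^sup>+ t. ennreal (ext_weight (t - a) powr p) \<partial>lebesgue_on {0<..<T}) \<le> (\<integral>\<^sup>+ t. ennreal (ext_weight (t - a) powr p) \<partial>lebesgue)"
    by (subst nn_integral_restrict_space) (auto intro!: nn_integral_mono simp: indicator_def)
  also have "\<dots> = (\<integral>\<^sup>+ t. ennreal (ext_weight (t - a) powr p) \<partial>lborel)" by (rule nn_integral_completion)
  also have "\<dots> = (\<integral>\<^sup>+ t. ennreal (ext_weight t powr p) \<partial>lborel)"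
    by (subst nn_integral_real_affine[where c=1 and t=a]) auto
  also have "\<dots> = (\<integral>\<^sup>+ t. ennreal (ext_weight t powr p) \<partial>lebesgue)" by (rule nn_integral_completion[symmetric])
  also have "\<dots> = (\<integral>\<^sup>+ s. ennreal ((K s x / s) powr p) \<partial>lebesgue_on {0<..})"
    using p by (subst nn_integral_restrict_space) (auto intro!: nn_integral_cong simp: indicator_def ext_weight_def)
  also have "\<dots> \<le> ennreal (Ng x powr p)" by (rule Lp_leD(4)[OF Xg_Lp_le[OF x]])
  finally have "(\<integral>\<^sup>+ t. ennreal (ext_weight (t - a) powr p) \<partial>lebesgue_on {0<..<T}) \<le> ennreal (Ng x powr p)" .
  moreover have "(\<lambda>t. ext_weight (t - a)) \<in> borel_measurable (lebesgue_on {0<..<T})"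
    by (intro measurable_restrict_space1 measurable_completion) simp
  ultimately show ?thesis unfolding Lp_le_def by (auto simp: ext_weight_nonneg Ng_nonneg)
qed

text \<open>With u the shifted extension, (\<mu> u)' = \<mu>' u + \<mu> u' = \<mu>' x + r. Taking x
  out leaves |\<mu>'| norm (u - x), at most a multiple of (|\<mu>'| \<tau>) K(\<tau>, x) / \<tau>,
  so the hypothesis |\<mu>'| \<tau> \<le> L is just what puts r into L^p at cost L. The constant 20
  is 4 + 16 from \<open>ext_fun_bounds\<close>. It serves twice: with a ramp for sources on an
  interval, and with \<mu> = 1, \<mu>' = 0 for initial values.\<close>

lemma multiplied_extension:
  fixes \<mu> \<mu>' :: "real \<Rightarrow> real"
  assumes T: "0 < T" and a: "0 \<le> a" and L: "0 \<le> L"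
    and \<mu>'_meas: "\<mu>' \<in> borel_measurable borel" and \<mu>_cont: "continuous_on UNIV \<mu>"
    and \<mu>: "\<And>\<tau>. 0 \<le> \<mu> \<tau>" "\<And>\<tau>. \<mu> \<tau> \<le> L"
    and \<mu>': "\<And>\<tau>. \<bar>\<mu>' \<tau>\<bar> \<le> 1" "\<And>\<tau>. 0 < \<tau> \<Longrightarrow> \<bar>\<mu>' \<tau>\<bar> * \<tau> \<le> L"
    and F: "finite F" "\<And>\<tau>. \<tau> \<notin> F \<Longrightarrow> (\<mu> has_real_derivative \<mu>' \<tau>) (at \<tau>)"
    and neg: "\<And>t. 0 < t \<Longrightarrow> t \<le> a \<Longrightarrow> \<mu> (t - a) = 0 \<and> \<mu>' (t - a) = 0"
  defines "w \<equiv> \<lambda>t. \<mu> (t - a) *\<^sub>R ext_fun (t - a)"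
    and "r \<equiv> \<lambda>t. if t \<le> a then 0 else \<mu>' (t - a) *\<^sub>R (ext_fun (t - a) - x) + \<mu> (t - a) *\<^sub>R ext_deriv (t - a)"
  shows "Ep_bd T w (20 * c0 * L * Ng x)" "Lp_bd p norm UNIV 0 T r (20 * c0 * L * Ng x)"
    "\<And>t. t \<in> {0..T} \<Longrightarrow> ((\<lambda>s. \<mu>' (s - a) *\<^sub>R x + r s) has_integral (w t - w 0)) {0..t}"
proof -
  let ?M = "lebesgue_on {0<..<T}"
  have \<mu>_meas: "\<mu> \<in> borel_measurable borel" using \<mu>_cont by (rule borel_measurable_continuous_onI)
  have hat_meas: "hat \<in> borel_measurable borel" by (rule borel_measurable_continuous_onI[OF continuous_hat])
  have hat'_meas: "hat' \<in> borel_measurable borel" unfolding hat'_def[abs_def] by measurable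
  note [measurable] = \<mu>_meas \<mu>'_meas hat_meas hat'_meas
  have scal: "\<phi> \<in> borel_measurable ?M" if "\<phi> \<in> borel_measurable borel" for \<phi> :: "real \<Rightarrow> real"
    using that by (intro measurable_restrict_space1 measurable_completion) simp
  have wn: "AE t in ?M. (\<lambda>n. n1 (\<mu> (t - a) *\<^sub>R ext_part n (t - a) - w t)) \<longlonglongrightarrow> 0"
  proof (rule AE_I2)
    fix t assume "t \<in> space ?M"
    then have t: "0 < t" by (simp add: space_restrict_space)
    show "(\<lambda>n. n1 (\<mu> (t - a) *\<^sub>R ext_part n (t - a) - w t)) \<longlonglongrightarrow> 0"
    proof (cases "t \<le> a")
      case True then show ?thesis using neg[OF t True] by (simp add: w_def N1.N_0)
    next
      case False
      then obtain m where m: "1 \<le> 2 ^ m * (t - a)" using ex_level[of "t - a"] by auto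
      have "\<forall>n\<ge>m. n1 (\<mu> (t - a) *\<^sub>R ext_part n (t - a) - w t) = 0"
        using ext_fun_eq_part(1)[of "t - a", OF _ pow2_mono[OF _ m]] False by (simp add: w_def N1.N_0)
      then show ?thesis by (intro tendsto_eventually) (auto simp: eventually_sequentially)
    qed
  qed
  have wX: "AE t in ?M. w t \<in> X1"
  proof (rule AE_I2)
    fix t assume "t \<in> space ?M"
    then have t: "0 < t" by (simp add: space_restrict_space)
    show "w t \<in> X1"
      using neg[OF t] ext_fun_bounds(1)[of "t - a"] by (cases "t \<le> a") (auto simp: w_def N1.S_0 intro!: N1.S_scale)
  qed
  have wsm: "N1.sm 0 T w"
  proof (rule N1.sm_lim[OF _ wX wn])
    fix n
    have "N1.sm 0 T (\<lambda>t. \<Sum>k<n. (\<mu> (t - a) * hat (2 ^ k * (t - a))) *\<^sub>R ext_step k)"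
      by (intro N1.sm_sum N1.sm_scale_fun N1.sm_const ext_step_in_X1 scal) measurable
    then show "N1.sm 0 T (\<lambda>t. \<mu> (t - a) *\<^sub>R ext_part n (t - a))"
      by (simp add: ext_part_def scaleR_sum_right)
  qed
  have wb: "n1 (w t) \<le> (4 * c0 * L) * ext_weight (t - a)" if t: "0 < t" for t
  proof (cases "t \<le> a")
    case True then show ?thesis using neg[OF t True] c0(1) L ext_weight_nonneg[of "t - a"] by (simp add: w_def N1.N_0)
  next
    case False
    have "n1 (w t) = \<mu> (t - a) * n1 (ext_fun (t - a))" using ext_fun_bounds(1)[of "t - a"] False \<mu>(1) by (simp add: w_def N1.N_scale)
    also have "\<dots> \<le> L * (4 * c0 * ext_weight (t - a))"
      using \<mu> ext_fun_bounds(3)[of "t - a"] False L N1.N_nonneg[OF ext_fun_bounds(1)] by (intro mult_mono) (auto simp: ext_weight_def)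
    finally show ?thesis by (simp add: mult_ac)
  qed
  have C: "0 \<le> c0 * L * Ng x" using c0(1) L Ng_nonneg[of x] by simp
  have wL: "Lp_bd p n1 X1 0 T w (20 * c0 * L * Ng x)"
  proof (rule Lp_bd_bound_mono[OF N1.Lp_bd_le[OF Lp_le_cmult[OF ext_weight_Lp, where k="4 * c0 * L"] wsm]])
    show "AE t in ?M. n1 (w t) \<le> (4 * c0 * L) * ext_weight (t - a)" by (rule AE_I2) (auto simp: space_restrict_space wb)
  qed (use p c0(1) L C Ng_nonneg[of x] in auto)
  have u_cont': "continuous_on UNIV ext_fun" using ext_fun_cont by (simp add: continuous_on_eq_continuous_at)
  have w_cont: "continuous_on UNIV w" unfolding w_def
    by (intro continuous_intros continuous_on_compose2[OF \<mu>_cont] continuous_on_compose2[OF u_cont']) auto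
  have K_w: "K s (w t) \<le> (5 * c0 * L) * K s x" if s: "0 < s" for s t
  proof -
    have "K s (w t) = \<mu> (t - a) * K s (ext_fun (t - a))" using s \<mu>(1) by (simp add: w_def K_scale)
    also have "\<dots> \<le> L * (5 * c0 * K s x)" using \<mu> K_ext_fun[OF s] L K_nonneg[of s] s by (intro mult_mono) auto
    finally show ?thesis by (simp add: mult_ac)
  qed
  have Ng_w: "w t \<in> Xg" "Ng (w t) \<le> 20 * c0 * L * Ng x" for t
  proof -
    show "w t \<in> Xg" unfolding w_def by (intro NG.S_scale Ng_ext_fun)
    have "Ng (w t) = \<mu> (t - a) * Ng (ext_fun (t - a))" using \<mu>(1) Ng_ext_fun(1) by (simp add: w_def NG.N_scale)
    also have "\<dots> \<le> L * (5 * c0 * Ng x)" using \<mu> Ng_ext_fun(2) L Ng_nonneg by (intro mult_mono) auto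
    also have "\<dots> \<le> 20 * c0 * L * Ng x" using C by (simp add: mult_ac)
    finally show "Ng (w t) \<le> 20 * c0 * L * Ng x" .
  qed
  show "Ep_bd T w (20 * c0 * L * Ng x)"
    unfolding Ep_bd_def
  proof (intro conjI ballI wL Ng_w)
    fix t assume t: "t \<in> {0..T}"
    show "((\<lambda>s. Ng (w s - w t)) \<longlongrightarrow> 0) (at t within {0..T})"
      unfolding tendsto_at_iff_sequentially comp_def
    proof (intro allI impI)
      fix X :: "nat \<Rightarrow> real" assume X: "X \<longlonglongrightarrow> t"
      show "(\<lambda>n. Ng (w (X n) - w t)) \<longlonglongrightarrow> 0"
      proof (rule Ng_dominated[OF x, where M="10 * c0 * L"])
        fix n s assume s: "0 < (s::real)"
        have "K s (w (X n) - w t) \<le> K s (w (X n)) + K s (w t)" using s by (intro nspace.N_diff[OF nspace_K]) auto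
        then show "K s (w (X n) - w t) \<le> (10 * c0 * L) * K s x" using K_w[OF s, of "X n"] K_w[OF s, of t] by simp
      next
        have "(\<lambda>n. w (X n)) \<longlonglongrightarrow> w t"
          using w_cont X by (simp add: continuous_on_eq_continuous_at continuous_at_sequentially comp_def)
        then show "(\<lambda>n. w (X n) - w t) \<longlonglongrightarrow> 0" by (simp add: LIM_zero)
      qed (use c0(1) L in auto)
    qed
  qed
  have rb: "norm (r t) \<le> (20 * c0 * L) * ext_weight (t - a)" for t
  proof (cases "t \<le> a")
    case True then show ?thesis using c0(1) L ext_weight_nonneg[of "t - a"] by (simp add: r_def)
  next
    case False
    define \<tau> where "\<tau> = t - a"
    have \<tau>: "0 < \<tau>" using False by (simp add: \<tau>_def)
    have "norm (r t) \<le> \<bar>\<mu>' \<tau>\<bar> * norm (x - ext_fun \<tau>) + \<mu> \<tau> * norm (ext_deriv \<tau>)"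
      using False \<mu>(1)[of \<tau>] norm_triangle_ineq[of "\<mu>' \<tau> *\<^sub>R (ext_fun \<tau> - x)" "\<mu> \<tau> *\<^sub>R ext_deriv \<tau>"]
      by (simp add: r_def \<tau>_def norm_minus_commute)
    also have "\<dots> \<le> \<bar>\<mu>' \<tau>\<bar> * (4 * c0 * K \<tau> x) + L * (16 * c0 * (K \<tau> x / \<tau>))"
      using ext_fun_bounds[OF \<tau>] \<mu>[of \<tau>] L by (intro add_mono mult_left_mono mult_mono) auto
    also have "\<bar>\<mu>' \<tau>\<bar> * (4 * c0 * K \<tau> x) = (\<bar>\<mu>' \<tau>\<bar> * \<tau>) * (4 * c0 * (K \<tau> x / \<tau>))" using \<tau> by simp
    also have "\<dots> \<le> L * (4 * c0 * (K \<tau> x / \<tau>))" using \<mu>'(2)[OF \<tau>] c0(1) K_nonneg[of \<tau> x] \<tau> by (intro mult_right_mono) auto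
    also have "L * (4 * c0 * (K \<tau> x / \<tau>)) + L * (16 * c0 * (K \<tau> x / \<tau>)) = (20 * c0 * L) * (K \<tau> x / \<tau>)"
      by (simp add: algebra_simps)
    finally show ?thesis using \<tau> by (simp add: ext_weight_def \<tau>_def)
  qed
  have r_lim: "AE t in ?M. (\<lambda>n. norm ((\<mu>' (t - a) *\<^sub>R (ext_part n (t - a) - x) + \<mu> (t - a) *\<^sub>R ext_part' n (t - a)) - r t)) \<longlonglongrightarrow> 0"
  proof (rule AE_I2)
    fix t assume "t \<in> space ?M"
    then have t: "0 < t" by (simp add: space_restrict_space)
    show "(\<lambda>n. norm ((\<mu>' (t - a) *\<^sub>R (ext_part n (t - a) - x) + \<mu> (t - a) *\<^sub>R ext_part' n (t - a)) - r t)) \<longlonglongrightarrow> 0"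
    proof (cases "t \<le> a")
      case True then show ?thesis using neg[OF t True] by (simp add: r_def)
    next
      case False
      then obtain m where m: "1 \<le> 2 ^ m * (t - a)" using ex_level[of "t - a"] by auto
      have "\<forall>n\<ge>m. norm ((\<mu>' (t - a) *\<^sub>R (ext_part n (t - a) - x) + \<mu> (t - a) *\<^sub>R ext_part' n (t - a)) - r t) = 0"
        using ext_fun_eq_part[of "t - a", OF _ pow2_mono[OF _ m]] False by (simp add: r_def)
      then show ?thesis by (intro tendsto_eventually) (auto simp: eventually_sequentially)
    qed
  qed
  have rsm: "X0.sm 0 T r"
  proof (rule X0.sm_lim[OF _ _ r_lim])
    fix n
    have part_sm: "X0.sm 0 T (\<lambda>t. ext_part n (t - a))" "X0.sm 0 T (\<lambda>t. ext_part' n (t - a))" unfolding ext_part_def ext_part'_def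
      by (intro X0.sm_sum X0.sm_scale_fun X0.sm_const scal UNIV_I; measurable)+
    show "X0.sm 0 T (\<lambda>t. \<mu>' (t - a) *\<^sub>R (ext_part n (t - a) - x) + \<mu> (t - a) *\<^sub>R ext_part' n (t - a))"
      by (intro X0.sm_add X0.sm_diff X0.sm_scale_fun part_sm X0.sm_const scal UNIV_I; measurable)
  qed auto
  show rL: "Lp_bd p norm UNIV 0 T r (20 * c0 * L * Ng x)"
    by (rule X0.Lp_bd_le[OF Lp_le_cmult[OF ext_weight_Lp, where k="20 * c0 * L"] rsm])
       (use p c0(1) L in \<open>auto intro!: AE_I2 rb\<close>)
  define d where "d s = \<mu>' (s - a) *\<^sub>R x + r s" for s
  have dL: "\<exists>C. Lp_bd 1 norm UNIV 0 T d C"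
  proof -
    have "Lp_bd 1 norm UNIV 0 T r ((1 + (T - 0)) * (20 * c0 * L * Ng x))"
      using p T by (intro X0.Lp_bd_imp_L1[OF rL]) auto
    moreover have "Lp_bd 1 norm UNIV 0 T (\<lambda>s. \<mu>' (s - a) *\<^sub>R x) (norm x * T)"
    proof (rule X0.Lp_bd_le)
      have "(\<integral>\<^sup>+ s. ennreal (norm x) \<partial>?M) = ennreal (norm x) * ennreal T"
        using T by (simp add: emeasure_restrict_space space_restrict_space)
      then show "Lp_le 1 ?M (\<lambda>s. norm x) (norm x * T)" unfolding Lp_le_def using T by (simp add: ennreal_mult)
      show "X0.sm 0 T (\<lambda>s. \<mu>' (s - a) *\<^sub>R x)" by (intro X0.sm_scale_fun X0.sm_const scal UNIV_I; measurable)
      show "AE s in ?M. norm (\<mu>' (s - a) *\<^sub>R x) \<le> norm x"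
        by (rule AE_I2) (use \<mu>'(1) in \<open>auto intro!: mult_left_le_one_le\<close>)
    qed simp
    ultimately show ?thesis unfolding d_def using X0.Lp_bd_add by fastforce
  qed
  have int: "d integrable_on {0..T}" using dL L1_integrable(1) T by (metis less_imp_le)
  \<comment> \<open>To the right of a the series is finite on [z, t], and the fundamental theorem
    applies to each coefficient off a finite set of kinks. The point a itself is reached by a limit
    below.\<close>
  have local: "(d has_integral (w t - w z)) {z..t}" if z: "a < z" "z \<le> t" for z t
  proof -
    obtain n where n: "1 \<le> 2 ^ n * (z - a)" using ex_level[of "z - a"] z by auto
    have lev: "1 \<le> 2 ^ n * (s - a)" if "z \<le> s" for s
      by (rule order_trans[OF n]) (use that in \<open>auto intro!: mult_left_mono\<close>)
    define h where "h k s = \<mu> (s - a) * hat (2 ^ k * (s - a))" for k s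
    define h' where "h' k s = \<mu>' (s - a) * hat (2 ^ k * (s - a)) + \<mu> (s - a) * (2 ^ k * hat' (2 ^ k * (s - a)))" for k s
    have "((\<lambda>s. \<Sum>k<n. h' k s *\<^sub>R ext_step k) has_integral (\<Sum>k<n. (h k t - h k z) *\<^sub>R ext_step k)) {z..t}"
    proof (intro has_integral_sum has_integral_scaleR_left finite_lessThan)
      fix k
      define E where "E = (\<lambda>\<tau>. \<tau> + a) ` F \<union> {a + 1 / (2 * 2 ^ k), a + 1 / 2 ^ k}"
      show "(h' k has_integral (h k t - h k z)) {z..t}"
      proof (rule fundamental_theorem_of_calculus_strong[of E])
        show "finite E" using F by (simp add: E_def)
        show "continuous_on {z..t} (h k)" unfolding h_def
          by (intro continuous_intros continuous_on_compose2[OF \<mu>_cont] continuous_on_compose2[OF continuous_hat[of UNIV]]) auto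
        fix s assume s: "s \<in> {z..t} - E"
        then have sF: "s - a \<notin> F" by (force simp: E_def image_iff)
        have s1: "2 ^ k * (s - a) \<noteq> 1/2" "2 ^ k * (s - a) \<noteq> 1" using s by (auto simp: E_def field_simps)
        have "(h k has_real_derivative h' k s) (at s)" unfolding h_def h'_def
          using F(2)[OF sF] hat_deriv[OF s1]
          by (auto intro!: derivative_eq_intros DERIV_chain2[where f=\<mu>] DERIV_chain2[where f=hat])
        then show "(h k has_vector_derivative h' k s) (at s)"
          by (simp add: has_real_derivative_iff_has_vector_derivative)
      qed (use z in auto)
    qed
    moreover have "(\<Sum>k<n. h' k s *\<^sub>R ext_step k) = d s" if s: "s \<in> {z..t}" for s
    proof -
      have "0 < s - a" "1 \<le> 2 ^ n * (s - a)" using s z lev by auto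
      note up = ext_fun_eq_part[OF this]
      have "d s = \<mu>' (s - a) *\<^sub>R ext_part n (s - a) + \<mu> (s - a) *\<^sub>R ext_part' n (s - a)"
        using s z up by (simp add: d_def r_def scaleR_diff_right)
      then show ?thesis
        by (simp add: h'_def ext_part_def ext_part'_def scaleR_sum_right sum.distrib[symmetric] scaleR_add_left)
    qed
    moreover have "(\<Sum>k<n. (h k t - h k z) *\<^sub>R ext_step k) = w t - w z"
    proof -
      have *: "w s = (\<Sum>k<n. h k s *\<^sub>R ext_step k)" if "z \<le> s" for s
        using ext_fun_eq_part(1)[OF _ lev[OF that]] that z by (simp add: w_def h_def ext_part_def scaleR_sum_right)
      show ?thesis using z by (simp add: * scaleR_diff_left sum_subtractf)
    qed
    ultimately show ?thesis using has_integral_eq[of "{z..t}" "\<lambda>s. \<Sum>k<n. h' k s *\<^sub>R ext_step k" d] by auto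
  qed
  have zero: "integral {0..t} d = 0 \<and> w t = w 0" if t: "t \<in> {0..T}" "t \<le> a" for t
  proof
    have *: "d s = 0" if "s \<in> {0..t} - {0}" for s using neg[of s] that t by (auto simp: d_def r_def)
    have "(d has_integral 0) {0..t}"
      by (rule has_integral_spike_finite[of "{0}" _ _ "\<lambda>_. 0"]) (use * in auto)
    then show "integral {0..t} d = 0" by (rule integral_unique)
    show "w t = w 0"
    proof (cases "t = 0")
      case False
      have "w t = 0" using neg[of t] t False by (simp add: w_def)
      moreover have "w 0 = 0"
      proof -
        have wz: "w s = 0" if "0 < s" "s \<le> a" for s using neg[OF that] by (simp add: w_def)
        have "((\<lambda>s. w s) \<longlongrightarrow> w 0) (at_right 0)"
          using w_cont by (auto simp: continuous_on_eq_continuous_at isCont_def intro: tendsto_within_subset)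
        moreover have "\<forall>\<^sub>F s in at_right 0. w s = 0"
          using eventually_at_right_real[of 0 a] t False by (auto elim!: eventually_mono intro!: wz)
        then have "((\<lambda>s. w s) \<longlongrightarrow> 0) (at_right 0)" by (rule tendsto_eventually)
        ultimately show ?thesis by (intro tendsto_unique[of "at_right 0" w]) auto
      qed
      ultimately show ?thesis by simp
    qed simp
  qed
  have main: "integral {0..t} d = w t - w 0" if t: "t \<in> {0..T}" for t
  proof (cases "t \<le> a")
    case True then show ?thesis using zero[OF t True] by simp
  next
    case False
    then have a': "a \<in> {0..T}" using t a by auto
    \<comment> \<open>By \<open>local\<close> this is constant on (a, t), and it is continuous at a;
      so the integral identity extends to the left endpoint, near which only integrability of the
      derivative is known.\<close>
    define D where "D z = integral {0..z} d - w z" for z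
    have "continuous_on {0..T} (\<lambda>z. integral {0..z} d)" by (rule indefinite_integral_continuous_1[OF int])
    then have "continuous_on {0..T} D" unfolding D_def
      by (intro continuous_on_diff continuous_on_subset[OF w_cont]) auto
    then have "(D \<longlongrightarrow> D a) (at a within {0..T})" using a' by (simp add: continuous_on)
    then have "(D \<longlongrightarrow> D a) (at a within {a<..<t})" by (rule tendsto_within_subset) (use a t in auto)
    moreover have "D z = D t" if z: "z \<in> {a<..<t}" for z
    proof -
      have "integral {0..z} d + integral {z..t} d = integral {0..t} d"
        using z a t integrable_on_subinterval[OF int, of 0 t]
        by (intro Henstock_Kurzweil_Integration.integral_combine) auto
      moreover have "integral {z..t} d = w t - w z" using local[of z t] z by (intro integral_unique) auto
      ultimately show ?thesis by (simp add: D_def algebra_simps)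
    qed
    then have "(D \<longlongrightarrow> D t) (at a within {a<..<t})"
      by (intro tendsto_eventually) (simp add: eventually_at_filter)
    moreover have "at a within {a<..<t} \<noteq> bot"
      using False by (simp add: at_within_eq_bot_iff)
    ultimately have "D t = D a" by (metis tendsto_unique)
    then show ?thesis using zero[OF a'] by (simp add: D_def diff_eq_eq)
  qed
  show "((\<lambda>s. \<mu>' (s - a) *\<^sub>R x + r s) has_integral (w t - w 0)) {0..t}" if t: "t \<in> {0..T}" for t
  proof -
    have "d integrable_on {0..t}" using t by (intro integrable_on_subinterval[OF int]) auto
    then have "(d has_integral integral {0..t} d) {0..t}" by (rule integrable_integral)
    then show ?thesis using main[OF t] by (simp add: d_def[abs_def])
  qed
qed

end

end

section \<open>Absorbing integrable sources\<close>

lemma has_integral_AE_cong: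
  fixes f g :: "real \<Rightarrow> 'a::banach"
  assumes ae: "AE t in lebesgue_on {0<..<T}. f t = g t" and f: "(f has_integral I) {0..t}" and t: "t \<le> T"
  shows "(g has_integral I) {0..t}"
proof -
  have "AE t in lebesgue. t \<in> {0<..<T} \<longrightarrow> f t = g t" using ae by (simp add: AE_lebesgue_on_iff)
  then obtain N where N: "N \<in> null_sets lebesgue" "{t. \<not> (t \<in> {0<..<T} \<longrightarrow> f t = g t)} \<subseteq> N"
    by (elim AE_E3) (auto simp: subset_eq)
  have "negligible N" using N(1) by (simp add: negligible_iff_null_sets)
  then have "negligible (N \<union> {0, T})" by (rule negligible_Un) (rule negligible_finite, simp)
  moreover have "g s = f s" if "s \<in> {0..t} - (N \<union> {0, T})" for s
  proof -
    have "s \<in> {0<..<T}" using that t by auto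
    then show ?thesis using N(2) that by auto
  qed
  ultimately show ?thesis by (rule has_integral_spike[OF _ _ f])
qed

context couple
begin

lemma L1_Ng_norm: "Lp_bd 1 Ng Xg a b h c \<Longrightarrow> Lp_bd 1 norm UNIV a b h (2 * c0 * c)"
  using c0(1) norm_le_Ng by (intro Lp_bd_norm_embedding[OF NG.nspace_axioms]) auto

text \<open>The relation \<open>absorbable T h c\<close>: the source term \<open>h\<close> can be absorbed by some \<open>w \<in> E\<^sub>p\<close> with
  \<open>w(0) = 0\<close> such that \<open>w' - h \<in> L\<^sup>p(X\<^sub>0)\<close>, at cost \<open>c\<close> in all norms.\<close>

definition absorbable :: "real \<Rightarrow> (real \<Rightarrow> 'a) \<Rightarrow> real \<Rightarrow> bool" where
  "absorbable T h c \<longleftrightarrow> Lp_bd 1 Ng Xg 0 T h c \<and> (\<exists>w r. w 0 = 0 \<and> Ep_bd T w c \<and> Lp_bd p norm UNIV 0 T r c \<and>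
     (\<forall>t\<in>{0..T}. ((\<lambda>s. h s + r s) has_integral w t) {0..t}))"

lemma absorbable_mono: "absorbable T h c \<Longrightarrow> c \<le> d \<Longrightarrow> absorbable T h d"
  unfolding absorbable_def using p Lp_bd_bound_mono[of 1] Lp_bd_bound_mono[of p] Ep_bd_mono
  by (meson less_imp_le order_trans zero_le_one)

lemma absorbable_cong:
  assumes "absorbable T h c" and ae: "AE t in lebesgue_on {0<..<T}. h' t = h t"
  shows "absorbable T h' c"
proof -
  obtain w r where wr: "w 0 = 0" "Ep_bd T w c" "Lp_bd p norm UNIV 0 T r c"
      "\<And>t. t \<in> {0..T} \<Longrightarrow> ((\<lambda>s. h s + r s) has_integral w t) {0..t}" and h: "Lp_bd 1 Ng Xg 0 T h c"
    using assms unfolding absorbable_def by blast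
  have "AE t in lebesgue_on {0<..<T}. h t + r t = h' t + r t" using ae by eventually_elim simp
  then have "((\<lambda>s. h' s + r s) has_integral w t) {0..t}" if "t \<in> {0..T}" for t
    using has_integral_AE_cong[OF _ wr(4)[OF that]] that by auto
  moreover have "Lp_bd 1 Ng Xg 0 T h' c" by (rule NG.Lp_bd_cong_AE[OF h ae]) simp
  ultimately show ?thesis unfolding absorbable_def using wr by blast
qed

lemma absorbable_add: assumes "absorbable T h c" "absorbable T h' c'" shows "absorbable T (\<lambda>t. h t + h' t) (c + c')"
proof -
  obtain w r where 1: "w 0 = 0" "Ep_bd T w c" "Lp_bd p norm UNIV 0 T r c"
      "\<And>t. t \<in> {0..T} \<Longrightarrow> ((\<lambda>s. h s + r s) has_integral w t) {0..t}" "Lp_bd 1 Ng Xg 0 T h c"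
    using assms(1) unfolding absorbable_def by blast
  obtain w' r' where 2: "w' 0 = 0" "Ep_bd T w' c'" "Lp_bd p norm UNIV 0 T r' c'"
      "\<And>t. t \<in> {0..T} \<Longrightarrow> ((\<lambda>s. h' s + r' s) has_integral w' t) {0..t}" "Lp_bd 1 Ng Xg 0 T h' c'"
    using assms(2) unfolding absorbable_def by blast
  have "((\<lambda>s. (h s + h' s) + (r s + r' s)) has_integral w t + w' t) {0..t}" if "t \<in> {0..T}" for t
    using has_integral_add[OF 1(4)[OF that] 2(4)[OF that]] by (simp add: algebra_simps)
  then show ?thesis unfolding absorbable_def
    using 1 2 p Ep_bd_add[OF 1(2) 2(2)] X0.Lp_bd_add[OF 1(3) 2(3)] NG.Lp_bd_add[OF 1(5) 2(5)]
    by (intro conjI exI[of _ "\<lambda>t. w t + w' t"] exI[of _ "\<lambda>t. r t + r' t"]) auto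
qed

lemma absorbable_uminus: assumes "absorbable T h c" shows "absorbable T (\<lambda>t. - h t) c"
proof -
  obtain w r where 1: "w 0 = 0" "Ep_bd T w c" "Lp_bd p norm UNIV 0 T r c"
      "\<And>t. t \<in> {0..T} \<Longrightarrow> ((\<lambda>s. h s + r s) has_integral w t) {0..t}" "Lp_bd 1 Ng Xg 0 T h c"
    using assms(1) unfolding absorbable_def by blast
  have "((\<lambda>s. - h s + - r s) has_integral - w t) {0..t}" if "t \<in> {0..T}" for t
    using has_integral_neg[OF 1(4)[OF that]] by (simp add: algebra_simps)
  then show ?thesis unfolding absorbable_def
    using 1 p Ep_bd_uminus[OF 1(2)] X0.Lp_bd_minus[OF 1(3)] NG.Lp_bd_minus[OF 1(5)]
    by (intro conjI exI[of _ "\<lambda>t. - w t"] exI[of _ "\<lambda>t. - r t"]) auto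
qed

lemma absorbable_zero: "absorbable T (\<lambda>t. 0) 0"
  unfolding absorbable_def using p
  by (intro conjI exI[of _ "\<lambda>t. 0"]) (auto intro: NG.Lp_bd_zero X0.Lp_bd_zero Ep_bd_0)

lemma absorbable_sum:
  assumes "\<And>i. i \<in> I \<Longrightarrow> absorbable T (h i) (c i)"
  shows "absorbable T (\<lambda>t. \<Sum>i\<in>I. h i t) (\<Sum>i\<in>I. c i)"
  using assms
proof (induction I rule: infinite_finite_induct)
  case (insert i I)
  then show ?case using absorbable_add[of T "h i" "c i" "\<lambda>t. \<Sum>i\<in>I. h i t" "\<Sum>i\<in>I. c i"] by simp
qed (auto intro: absorbable_zero)

lemma norm_suminf_AE:
  assumes f: "\<And>n::nat. Lp_bd p norm UNIV a b (f n) (c n)" and c: "summable c"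
  shows "AE t in lebesgue_on {a<..<b}. (\<lambda>n. f n t) sums (\<Sum>n. f n t :: 'a)"
    "Lp_bd p norm UNIV a b (\<lambda>t. \<Sum>n. f n t) (suminf c)"
proof -
  have "AE t in lebesgue_on {a<..<b}. summable (\<lambda>n. norm (f n t))"
    by (rule Lp_le_suminf(1)[where c=c and p=p]) (use p f c in \<open>auto simp: Lp_bd_def\<close>)
  then show s: "AE t in lebesgue_on {a<..<b}. (\<lambda>n. f n t) sums (\<Sum>n. f n t)"
    by eventually_elim (auto intro: summable_sums summable_norm_cancel)
  show "Lp_bd p norm UNIV a b (\<lambda>t. \<Sum>n. f n t) (suminf c)"
    by (rule X0.Lp_bd_suminf[OF f c]) (use s p in \<open>auto simp: sums_def tendsto_norm_zero_iff LIM_zero_iff\<close>)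
qed

text \<open>The witnesses are summed along with the costs. Convergence of the sources in
  \<open>Ng\<close> implies convergence in X0, and summable L^1 bounds carry the integral identity
  to the limit.\<close>

lemma absorbable_suminf:
  assumes T: "0 < T" and H: "\<And>n::nat. absorbable T (h n) (c n)" and c: "summable c"
    and inX: "AE t in lebesgue_on {0<..<T}. g t \<in> Xg"
    and lim: "AE t in lebesgue_on {0<..<T}. (\<lambda>n. Ng ((\<Sum>i<n. h i t) - g t)) \<longlonglongrightarrow> 0"
  shows "absorbable T g (suminf c)"
proof -
  have "\<forall>n. \<exists>w r. w 0 = 0 \<and> Ep_bd T w (c n) \<and> Lp_bd p norm UNIV 0 T r (c n) \<and>
     (\<forall>t\<in>{0..T}. ((\<lambda>s. h n s + r s) has_integral w t) {0..t})" using H unfolding absorbable_def by blast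
  then obtain w r where w0: "\<And>n. w n 0 = 0" and w: "\<And>n. Ep_bd T (w n) (c n)" and r: "\<And>n. Lp_bd p norm UNIV 0 T (r n) (c n)"
    and wr: "\<And>n t. t \<in> {0..T} \<Longrightarrow> ((\<lambda>s. h n s + r n s) has_integral w n t) {0..t}"
    by metis
  have h: "Lp_bd 1 Ng Xg 0 T (h n) (c n)" for n using H unfolding absorbable_def by blast
  define W R where "W t = (\<Sum>n. w n t)" and "R t = (\<Sum>n. r n t)" for t
  have W: "Ep_bd T W (suminf c)" "\<And>t. t \<in> {0..T} \<Longrightarrow> (\<lambda>n. w n t) sums W t"
    using Ep_suminf[OF w c] unfolding W_def by auto
  have R: "AE t in lebesgue_on {0<..<T}. (\<lambda>n. r n t) sums R t" "Lp_bd p norm UNIV 0 T R (suminf c)"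
    unfolding R_def by (rule norm_suminf_AE[OF r c])+
  have g: "Lp_bd 1 Ng Xg 0 T g (suminf c)" by (rule NG.Lp_bd_suminf[OF h c _ inX lim]) simp
  have hX: "AE t in lebesgue_on {0<..<T}. \<forall>n. h n t \<in> Xg"
    unfolding AE_all_countable using h by (auto simp: Lp_bd_def intro: NG.sm_inS)
  have "AE t in lebesgue_on {0<..<T}. (\<lambda>n. h n t) sums g t"
    using lim inX hX
  proof eventually_elim
    case (elim t)
    have "(\<lambda>n. (\<Sum>i<n. h i t) - g t) \<longlonglongrightarrow> 0"
    proof (rule Lim_null_comparison)
      show "(\<lambda>n. 2 * c0 * Ng ((\<Sum>i<n. h i t) - g t)) \<longlonglongrightarrow> 0" using tendsto_mult_right_zero[OF elim(1)] .
      have "norm ((\<Sum>i<n. h i t) - g t) \<le> 2 * c0 * Ng ((\<Sum>i<n. h i t) - g t)" for n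
        using elim by (intro norm_le_Ng NG.S_diff NG.S_sum) auto
      then show "\<forall>\<^sub>F n in sequentially. norm ((\<Sum>i<n. h i t) - g t) \<le> 2 * c0 * Ng ((\<Sum>i<n. h i t) - g t)" by simp
    qed
    then show ?case by (simp add: sums_def LIM_zero_iff)
  qed
  with R(1) have hr: "AE t in lebesgue_on {0<..<T}. (\<lambda>n. h n t + r n t) sums (g t + R t)"
    by eventually_elim (rule sums_add)
  have L1: "Lp_bd 1 norm UNIV 0 T (\<lambda>t. h n t + r n t) (2 * c0 * c n + (1 + T) * c n)" for n
    using X0.Lp_bd_add[OF L1_Ng_norm[OF h] X0.Lp_bd_imp_L1[OF r]] p T by simp
  have sc: "summable (\<lambda>n. 2 * c0 * c n + (1 + T) * c n)" using c by (intro summable_add summable_mult)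
  have L1g: "Lp_bd 1 norm UNIV 0 T (\<lambda>t. g t + R t) (2 * c0 * suminf c + (1 + T) * suminf c)"
    using X0.Lp_bd_add[OF L1_Ng_norm[OF g] X0.Lp_bd_imp_L1[OF R(2)]] p T by simp
  have "((\<lambda>s. g s + R s) has_integral W t) {0..t}" if t: "t \<in> {0..T}" for t
  proof -
    have "(\<lambda>n. integral {0..t} (\<lambda>s. h n s + r n s)) sums integral {0..t} (\<lambda>s. g s + R s)"
    proof (rule L1_suminf[OF X0.Lp_bd_subinterval[OF L1] sc])
      show "AE s in lebesgue_on {0<..<t}. (\<lambda>n. h n s + r n s) sums (g s + R s)"
        using hr unfolding AE_lebesgue_on_iff[OF open_interval_in_lebesgue] by eventually_elim (use t in auto)
    qed (use t in auto)
    moreover have "integral {0..t} (\<lambda>s. h n s + r n s) = w n t" for n using wr[OF t] by (rule integral_unique)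
    ultimately have "integral {0..t} (\<lambda>s. g s + R s) = W t" using W(2)[OF t] by (simp add: sums_unique2)
    moreover have "(\<lambda>s. g s + R s) integrable_on {0..t}"
      using t by (intro L1_integrable(1)[OF X0.Lp_bd_subinterval[OF L1g]]) auto
    ultimately show ?thesis using integrable_integral by metis
  qed
  moreover have "W 0 = 0" unfolding W_def using w0 by simp
  ultimately show ?thesis unfolding absorbable_def using g W(1) R(2) by blast
qed

lemma Lp_bd_indicator:
  assumes x: "x \<in> Xg" and E: "E \<in> sets lebesgue" "E \<subseteq> {0..T}" and c: "measure lebesgue E * Ng x \<le> c"
  shows "Lp_bd 1 Ng Xg 0 T (\<lambda>t. indicat_real E t *\<^sub>R x) c"
proof (rule NG.Lp_bd_le)
  have Em: "E \<in> lmeasurable" using E by (intro bounded_set_imp_lmeasurable) (auto intro: bounded_subset[of "{0..T}"])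
  have "(\<integral>\<^sup>+ t. ennreal ((indicat_real E t * Ng x) powr 1) \<partial>lebesgue_on {0<..<T}) \<le> (\<integral>\<^sup>+ t. ennreal (Ng x) * indicator E t \<partial>lebesgue)"
    using Ng_nonneg[of x] by (subst nn_integral_restrict_space) (auto intro!: nn_integral_mono simp: indicator_def)
  also have "\<dots> = ennreal (Ng x) * ennreal (measure lebesgue E)"
    using E Em by (simp add: nn_integral_cmult_indicator emeasure_eq_measure2)
  also have "\<dots> \<le> ennreal (c powr 1)" using c Ng_nonneg[of x]
    by (simp add: ennreal_mult[symmetric] ennreal_leI mult.commute abs_of_nonneg[OF order_trans[OF _ c]])
  finally show "Lp_le 1 (lebesgue_on {0<..<T}) (\<lambda>t. indicat_real E t * Ng x) c"
    unfolding Lp_le_def using Ng_nonneg[of x] E order_trans[OF _ c, of 0]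
    by (auto intro!: borel_measurable_times measurable_restrict_space1 borel_measurable_indicator)
  show "NG.sm 0 T (\<lambda>t. indicat_real E t *\<^sub>R x)" using E
    by (intro NG.sm_scale_fun NG.sm_const x measurable_restrict_space1 borel_measurable_indicator)
qed (use x in \<open>auto simp: NG.N_scale\<close>)

text \<open>The ramp rises with slope 1 for the duration L = b - a of the source and satisfies
  |\<mu>'| \<tau> \<le> L, so the cost is linear in L. After time b it stays at L, and the extension
  itself brings w back to 0.\<close>

lemma absorbable_interval:
  assumes T: "0 < T" and x: "x \<in> Xg" and ab: "0 \<le> a" "a \<le> b" "b \<le> T"
  shows "absorbable T (\<lambda>t. indicat_real {a..b} t *\<^sub>R x) (20 * c0 * ((b - a) * Ng x))"
proof -
  obtain \<beta> :: "nat \<Rightarrow> 'a" where \<beta>: "\<beta> 0 = 0" "\<And>k. \<beta> k \<in> X1"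
      "\<And>k. norm (x - \<beta> k) + (1/2) ^ k * n1 (\<beta> k) \<le> 2 * c0 * K ((1/2) ^ k) x"
    using approximants_exist[of x] by blast
  define L where "L = b - a"
  define \<mu> :: "real \<Rightarrow> real" where "\<mu> \<tau> = max 0 (min \<tau> L)" for \<tau>
  define \<mu>' :: "real \<Rightarrow> real" where "\<mu>' \<tau> = (if 0 < \<tau> \<and> \<tau> < L then 1 else 0)" for \<tau>
  have L: "0 \<le> L" using ab by (simp add: L_def)
  have deriv: "(\<mu> has_real_derivative \<mu>' \<tau>) (at \<tau>)" if \<tau>: "\<tau> \<notin> {0, L}" for \<tau>
  proof -
    consider "\<tau> < 0" | "0 < \<tau>" "\<tau> < L" | "L < \<tau>" "0 < \<tau>" using \<tau> L by force
    then show ?thesis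
    proof cases
      case 1
      have "((\<lambda>s. 0) has_real_derivative 0) (at \<tau>)" by simp
      then have "(\<mu> has_real_derivative 0) (at \<tau>)"
        by (rule has_field_derivative_transform_within_open[where S="{..<0}"]) (use 1 in \<open>auto simp: \<mu>_def\<close>)
      then show ?thesis using 1 by (simp add: \<mu>'_def)
    next
      case 2
      have "((\<lambda>s. s) has_real_derivative 1) (at \<tau>)" by simp
      then have "(\<mu> has_real_derivative 1) (at \<tau>)"
        by (rule has_field_derivative_transform_within_open[where S="{0<..<L}"]) (use 2 in \<open>auto simp: \<mu>_def\<close>)
      then show ?thesis using 2 by (simp add: \<mu>'_def)
    next
      case 3
      have "((\<lambda>s. L) has_real_derivative 0) (at \<tau>)" by simp
      then have "(\<mu> has_real_derivative 0) (at \<tau>)"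
        by (rule has_field_derivative_transform_within_open[where S="{L<..}"]) (use 3 L in \<open>auto simp: \<mu>_def\<close>)
      then show ?thesis using 3 by (simp add: \<mu>'_def)
    qed
  qed
  have m1: "\<mu>' \<in> borel_measurable borel" unfolding \<mu>'_def[abs_def] by measurable
  have m2: "continuous_on UNIV \<mu>" unfolding \<mu>_def[abs_def] by (intro continuous_intros)
  have m3: "0 \<le> \<mu> \<tau>" "\<mu> \<tau> \<le> L" "\<bar>\<mu>' \<tau>\<bar> \<le> 1" for \<tau> using L by (auto simp: \<mu>_def \<mu>'_def)
  have m4: "\<bar>\<mu>' \<tau>\<bar> * \<tau> \<le> L" if "0 < \<tau>" for \<tau> using that L by (auto simp: \<mu>'_def)
  have m5: "\<mu> (t - a) = 0 \<and> \<mu>' (t - a) = 0" if "t \<le> a" for t using that L by (auto simp: \<mu>_def \<mu>'_def)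
  note ext = multiplied_extension[OF x \<beta> T ab(1) L m1 m2 m3(1,2,3) m4 finite.insertI[OF finite.insertI[OF finite.emptyI]] deriv m5]
  define w where "w = (\<lambda>t. \<mu> (t - a) *\<^sub>R ext_fun x \<beta> (t - a))"
  define r where "r = (\<lambda>t. if t \<le> a then 0 else \<mu>' (t - a) *\<^sub>R (ext_fun x \<beta> (t - a) - x) + \<mu> (t - a) *\<^sub>R ext_deriv \<beta> (t - a))"
  have w: "Ep_bd T w (20 * c0 * L * Ng x)" and r: "Lp_bd p norm UNIV 0 T r (20 * c0 * L * Ng x)"
    and wr: "\<And>t. t \<in> {0..T} \<Longrightarrow> ((\<lambda>s. \<mu>' (s - a) *\<^sub>R x + r s) has_integral (w t - w 0)) {0..t}"
    unfolding w_def r_def by (rule ext; simp)+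
  have w0: "w 0 = 0" using m5[of 0] ab by (simp add: w_def)
  have "((\<lambda>s. indicat_real {a..b} s *\<^sub>R x + r s) has_integral w t) {0..t}" if t: "t \<in> {0..T}" for t
  proof (rule has_integral_spike_finite[of "{a, b}" "{0..t}"])
    show "((\<lambda>s. \<mu>' (s - a) *\<^sub>R x + r s) has_integral w t) {0..t}" using wr[OF t] w0 by simp
    show "indicat_real {a..b} s *\<^sub>R x + r s = \<mu>' (s - a) *\<^sub>R x + r s" if "s \<in> {0..t} - {a, b}" for s
      using that by (auto simp: \<mu>'_def L_def indicator_def)
  qed simp
  moreover have "Lp_bd 1 Ng Xg 0 T (\<lambda>t. indicat_real {a..b} t *\<^sub>R x) (20 * c0 * L * Ng x)"
  proof (rule Lp_bd_indicator[OF x])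
    have "measure lebesgue {a..b} * Ng x = 1 * (L * Ng x)" using ab by (simp add: L_def)
    also have "\<dots> \<le> (20 * c0) * (L * Ng x)" using c0(1) L Ng_nonneg[of x] by (intro mult_right_mono) auto
    finally show "measure lebesgue {a..b} * Ng x \<le> 20 * c0 * L * Ng x" by (simp add: mult_ac)
  qed (use ab in auto)
  ultimately have "absorbable T (\<lambda>t. indicat_real {a..b} t *\<^sub>R x) (20 * c0 * L * Ng x)"
    unfolding absorbable_def using w r w0 by blast
  then show ?thesis by (simp add: L_def mult_ac)
qed

text \<open>Successive approximation: sources that are approximable up to half their norm by absorbable ones
  are absorbable.\<close>

lemma absorbable_successive:
  assumes T: "0 < T"
    and step: "\<And>h c. P h \<Longrightarrow> Lp_bd 1 Ng Xg 0 T h c \<Longrightarrow> 0 < c \<Longrightarrow>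
      \<exists>q. absorbable T q (C * c) \<and> P (\<lambda>t. h t - q t) \<and> Lp_bd 1 Ng Xg 0 T (\<lambda>t. h t - q t) (c/2)"
    and h: "P h" "Lp_bd 1 Ng Xg 0 T h c" "0 < c"
  shows "absorbable T h (2 * C * c)"
proof -
  define Q where "Q h c = (SOME q. absorbable T q (C * c) \<and> P (\<lambda>t. h t - q t) \<and>
      Lp_bd 1 Ng Xg 0 T (\<lambda>t. h t - q t) (c/2))" for h c
  have Q: "absorbable T (Q h c) (C * c) \<and> P (\<lambda>t. h t - Q h c t) \<and> Lp_bd 1 Ng Xg 0 T (\<lambda>t. h t - Q h c t) (c/2)"
    if "P h" "Lp_bd 1 Ng Xg 0 T h c" "0 < c" for h c
    unfolding Q_def by (rule someI_ex[OF step[OF that]])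
  \<comment> \<open>The residuals: what is left of h after n approximations, with bound c 2^(-n).
    The invariant \<open>P\<close> keeps them in the class to which \<open>step\<close>
    applies.\<close>
  define H where "H = rec_nat h (\<lambda>n h' t. h' t - Q h' (c * (1/2) ^ n) t)"
  have H0: "H 0 = h" and HS: "\<And>n. H (Suc n) = (\<lambda>t. H n t - Q (H n) (c * (1/2) ^ n) t)" by (simp_all add: H_def)
  have inv: "P (H n) \<and> Lp_bd 1 Ng Xg 0 T (H n) (c * (1/2) ^ n)" for n
  proof (induction n)
    case (Suc n)
    then show ?case using Q[of "H n" "c * (1/2) ^ n"] h by (simp add: HS)
  qed (use h H0 in auto)
  define q where "q n = Q (H n) (c * (1/2) ^ n)" for n
  have good: "absorbable T (q n) (C * (c * (1/2) ^ n))" for n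
    unfolding q_def using Q[of "H n" "c * (1/2) ^ n"] inv[of n] h by simp
  have geo: "(\<lambda>n. (1/2::real) ^ n) sums 2" using geometric_sums[of "1/2::real"] by simp
  have sums: "(\<lambda>n. C * (c * (1/2) ^ n)) sums (C * (c * 2))" "(\<lambda>n. c * (1/2) ^ n) sums (c * 2)"
    by (intro sums_mult geo)+
  have tel: "(\<Sum>i<n. q i t) - h t = - H n t" for n t
    by (induction n) (auto simp: H0 HS q_def algebra_simps)
  have HX: "AE t in lebesgue_on {0<..<T}. \<forall>n. H n t \<in> Xg"
    unfolding AE_all_countable using inv by (auto simp: Lp_bd_def intro: NG.sm_inS)
  have "AE t in lebesgue_on {0<..<T}. summable (\<lambda>n. Ng (H n t))"
    by (rule Lp_le_suminf(1)[where c="\<lambda>n. c * (1/2) ^ n" and p=1])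
       (use inv sums in \<open>auto simp: Lp_bd_def sums_iff\<close>)
  with HX have "AE t in lebesgue_on {0<..<T}. (\<lambda>n. Ng ((\<Sum>i<n. q i t) - h t)) \<longlonglongrightarrow> 0"
    unfolding tel by eventually_elim (simp add: NG.N_minus summable_LIMSEQ_zero)
  moreover have "AE t in lebesgue_on {0<..<T}. h t \<in> Xg" using h by (auto simp: Lp_bd_def intro: NG.sm_inS)
  ultimately have "absorbable T h (\<Sum>n. C * (c * (1/2) ^ n))"
    using sums by (intro absorbable_suminf[OF T good]) (auto simp: sums_iff)
  then show ?thesis using sums by (simp add: sums_iff mult_ac)
qed

end

section \<open>From intervals to measurable sets, simple functions and integrable functions\<close>

context couple
begin

text \<open>Costs are proportional to lengths, and the lengths add up to the measure of the union.
  Overlaps are null, so almost every t lies in at most one interval and the indicators sum to that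
  of the union.\<close>

lemma absorbable_nonoverlapping:
  assumes T: "0 < T" and x: "x \<in> Xg"
    and D: "\<And>n::nat. D n = {} \<or> (\<exists>c d. D n = {c..d} \<and> c \<le> d)" "\<And>n. D n \<subseteq> {0..T}"
    and disj: "\<And>m n. m \<noteq> n \<Longrightarrow> negligible (D m \<inter> D n)"
  shows "absorbable T (\<lambda>t. indicat_real (\<Union>n. D n) t *\<^sub>R x) (20 * c0 * (measure lebesgue (\<Union>n. D n) * Ng x))"
proof -
  have Dm: "D n \<in> lmeasurable" for n using D(1)[of n] by (elim disjE exE conjE) simp_all
  have "(\<Union>n. D n) \<subseteq> {0..T}" using D(2) by blast
  then have "bounded (\<Union>n. D n)" by (rule bounded_subset[rotated]) simp
  then have sums: "(\<lambda>n. measure lebesgue (D n)) sums measure lebesgue (\<Union>n. D n)"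
    using disj by (intro measure_countable_negligible_Union_bounded Dm) (auto simp: pairwise_def)
  have sums': "(\<lambda>n. 20 * c0 * (measure lebesgue (D n) * Ng x)) sums (20 * c0 * (measure lebesgue (\<Union>n. D n) * Ng x))"
    by (intro sums_mult sums_mult2 sums)
  have good: "absorbable T (\<lambda>t. indicat_real (D n) t *\<^sub>R x) (20 * c0 * (measure lebesgue (D n) * Ng x))" for n
  proof (cases "D n = {}")
    case True then show ?thesis using absorbable_zero by simp
  next
    case False
    then obtain c d where cd: "D n = {c..d}" "c \<le> d" using D(1)[of n] by auto
    then have "0 \<le> c" "d \<le> T" using D(2)[of n] by auto
    then show ?thesis using absorbable_interval[OF T x _ cd(2)] cd by simp
  qed
  have "negligible (\<Union>(m, n)\<in>{(m, n). m \<noteq> n}. D m \<inter> D n)"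
    by (rule negligible_countable_Union) (use disj in auto)
  then have "AE t in lebesgue. t \<notin> (\<Union>(m, n)\<in>{(m, n). m \<noteq> n}. D m \<inter> D n)"
    unfolding negligible_iff_null_sets by (rule AE_not_in)
  then have one: "AE t in lebesgue_on {0<..<T}. \<forall>m n. t \<in> D m \<longrightarrow> t \<in> D n \<longrightarrow> m = n"
    unfolding AE_lebesgue_on_iff[OF open_interval_in_lebesgue] by eventually_elim auto
  have "absorbable T (\<lambda>t. indicat_real (\<Union>n. D n) t *\<^sub>R x) (\<Sum>n. 20 * c0 * (measure lebesgue (D n) * Ng x))"
  proof (rule absorbable_suminf[OF T good])
    show "summable (\<lambda>n. 20 * c0 * (measure lebesgue (D n) * Ng x))" using sums' by (rule sums_summable)
    show "AE t in lebesgue_on {0<..<T}. indicat_real (\<Union>n. D n) t *\<^sub>R x \<in> Xg" using x by (auto intro!: NG.S_scale)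
    show "AE t in lebesgue_on {0<..<T}. (\<lambda>n. Ng ((\<Sum>i<n. indicat_real (D i) t *\<^sub>R x) - indicat_real (\<Union>n. D n) t *\<^sub>R x)) \<longlonglongrightarrow> 0"
      using one
    proof eventually_elim
      case (elim t)
      show ?case
      proof (cases "t \<in> (\<Union>n. D n)")
        case True
        then obtain m where m: "t \<in> D m" by auto
        have "(\<Sum>i<n. indicat_real (D i) t *\<^sub>R x) = x" if "m < n" for n
        proof -
          have "(\<Sum>i<n. indicat_real (D i) t *\<^sub>R x) = (\<Sum>i<n. if i = m then x else 0)"
            using elim m by (intro sum.cong) (auto simp: indicator_def)
          then show ?thesis using that by simp
        qed
        then have "\<forall>n\<ge>Suc m. Ng ((\<Sum>i<n. indicat_real (D i) t *\<^sub>R x) - indicat_real (\<Union>n. D n) t *\<^sub>R x) = 0"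
          using True by (auto simp: Xg_0)
        then show ?thesis by (intro tendsto_eventually) (auto simp: eventually_sequentially)
      qed (auto simp: Xg_0)
    qed
  qed
  then show ?thesis using sums' by (simp add: sums_iff)
qed

text \<open>The countable family of intervals is turned into a sequence padded with empty sets. Two
  members with disjoint interiors meet in a convex set without interior, which is
  negligible.\<close>

lemma outer_cover:
  assumes T: "0 < T" and E: "E \<in> sets lebesgue" "E \<subseteq> {0..T}" and e: "0 < e"
  obtains D :: "nat \<Rightarrow> real set" where "\<And>n. D n = {} \<or> (\<exists>c d. D n = {c..d} \<and> c \<le> d)" "\<And>n. D n \<subseteq> {0..T}"
    "\<And>m n. m \<noteq> n \<Longrightarrow> negligible (D m \<inter> D n)" "E \<subseteq> (\<Union>n. D n)" "(\<Union>n. D n) \<in> lmeasurable"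
    "measure lebesgue (\<Union>n. D n) \<le> measure lebesgue E + e"
proof -
  have Em: "E \<in> lmeasurable" using E by (intro bounded_set_imp_lmeasurable) (auto intro: bounded_subset[of "{0..T}"])
  have Ec: "E \<subseteq> cbox 0 T" using E by simp
  obtain \<D> where D: "countable \<D>" "\<And>K. K \<in> \<D> \<Longrightarrow> K \<subseteq> cbox 0 T \<and> K \<noteq> {} \<and> (\<exists>c d. K = cbox c d)"
        "pairwise (\<lambda>A B. interior A \<inter> interior B = {}) \<D>"
        "E \<subseteq> \<Union>\<D>" "\<Union>\<D> \<in> lmeasurable" "measure lebesgue (\<Union>\<D>) \<le> measure lebesgue E + e"
    by (rule measurable_outer_intervals_bounded[OF Em Ec e]) blast
  define F where "F n = (if n \<in> to_nat_on \<D> ` \<D> then from_nat_into \<D> n else {})" for n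
  have F: "F n = {} \<or> (F n \<in> \<D> \<and> to_nat_on \<D> (F n) = n)" for n
    using D(1) by (auto simp: F_def)
  have U: "(\<Union>n. F n) = \<Union>\<D>"
  proof (intro equalityI subsetI)
    fix t assume "t \<in> (\<Union>n. F n)"
    then show "t \<in> \<Union>\<D>" using F by auto
  next
    fix t assume "t \<in> \<Union>\<D>"
    then obtain K where K: "K \<in> \<D>" "t \<in> K" by auto
    then have "F (to_nat_on \<D> K) = K" using D(1) by (simp add: F_def)
    then show "t \<in> (\<Union>n. F n)" using K by blast
  qed
  show ?thesis
  proof (rule that[of F])
    show "F n = {} \<or> (\<exists>c d. F n = {c..d} \<and> c \<le> d)" for n
      using F[of n] D(2)[of "F n"] by (auto simp: box_real)
    show "F n \<subseteq> {0..T}" for n using F[of n] D(2)[of "F n"] by (auto simp: box_real)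
    show "negligible (F m \<inter> F n)" if mn: "m \<noteq> n" for m n
    proof (cases "F m = {} \<or> F n = {}")
      case False
      then have mem: "F m \<in> \<D>" "F n \<in> \<D>" "F m \<noteq> F n" using F[of m] F[of n] mn by auto
      then have "interior (F m) \<inter> interior (F n) = {}" using D(3) by (auto simp: pairwise_def)
      then have "interior (F m \<inter> F n) = {}" by simp
      moreover have "convex (F m \<inter> F n)" using D(2)[OF mem(1)] D(2)[OF mem(2)] by (auto intro!: convex_Int)
      ultimately show ?thesis by (simp add: negligible_convex_interior)
    qed auto
  qed (use D U in auto)
qed

text \<open>In the successive approximation a residual is known through an L^1 bound and a sign;
  this recovers the measure of its set.\<close>

lemma L1_indicator_measure:
  assumes x: "x \<in> Xg" and E: "E \<in> sets lebesgue" "E \<subseteq> {0..T}" and L: "Lp_bd 1 Ng Xg 0 T (\<lambda>t. \<sigma> *\<^sub>R indicat_real E t *\<^sub>R x) c"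
    and \<sigma>: "\<bar>\<sigma>\<bar> = 1"
  shows "measure lebesgue E * Ng x \<le> c"
proof -
  have Em: "E \<in> lmeasurable" using E by (intro bounded_set_imp_lmeasurable) (auto intro: bounded_subset[of "{0..T}"])
  have "ennreal (Ng x) * ennreal (measure lebesgue E) = (\<integral>\<^sup>+ t. ennreal (Ng x) * indicator E t \<partial>lebesgue)"
    using E Em by (simp add: nn_integral_cmult_indicator emeasure_eq_measure2)
  also have "\<dots> = (\<integral>\<^sup>+ t. ennreal (Ng (\<sigma> *\<^sub>R indicat_real E t *\<^sub>R x) powr 1) * indicator {0<..<T} t \<partial>lebesgue)"
  proof (rule nn_integral_cong_AE)
    have "AE t in lebesgue. t \<notin> {0, T}" by (rule AE_not_in) (simp add: negligible_iff_null_sets[symmetric])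
    then show "AE t in lebesgue. ennreal (Ng x) * indicator E t = ennreal (Ng (\<sigma> *\<^sub>R indicat_real E t *\<^sub>R x) powr 1) * indicator {0<..<T} t"
      using x \<sigma> E Ng_nonneg[of x] by (elim eventually_mono) (auto simp: indicator_def NG.N_scale NG.S_scale Xg_0)
  qed
  also have "\<dots> = (\<integral>\<^sup>+ t. ennreal (Ng (\<sigma> *\<^sub>R indicat_real E t *\<^sub>R x) powr 1) \<partial>lebesgue_on {0<..<T})"
    by (simp add: nn_integral_restrict_space)
  also have "\<dots> \<le> ennreal (c powr 1)" using L unfolding Lp_bd_def by (auto dest: Lp_leD(4))
  finally show ?thesis using Ng_nonneg[of x] Lp_bd_0_le[OF L] by (simp add: ennreal_mult[symmetric] mult.commute)
qed

text \<open>Cover E by intervals with union U of slightly larger measure. What remains is minus the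
  indicator of U - E, again an indicator up to sign, now with bound c/2, so
  \<open>absorbable_successive\<close> applies to signed indicators. The cover has cost at most 20
  c0 (2 c); the geometric series doubles this.\<close>

lemma absorbable_measurable:
  assumes T: "0 < T" and x: "x \<in> Xg" and E: "E \<in> sets lebesgue" "E \<subseteq> {0..T}"
    and c: "measure lebesgue E * Ng x \<le> c" "0 < c"
  shows "absorbable T (\<lambda>t. indicat_real E t *\<^sub>R x) (80 * c0 * c)"
proof -
  define P where "P h \<longleftrightarrow> (\<exists>E \<sigma>. E \<in> sets lebesgue \<and> E \<subseteq> {0..T} \<and> \<sigma> \<in> {1, -1::real} \<and>
     h = (\<lambda>t. \<sigma> *\<^sub>R indicat_real E t *\<^sub>R x))" for h
  have "absorbable T (\<lambda>t. indicat_real E t *\<^sub>R x) (2 * (40 * c0) * c)"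
  proof (rule absorbable_successive[OF T, of P])
    show "P (\<lambda>t. indicat_real E t *\<^sub>R x)" unfolding P_def using E by (intro exI[of _ E] exI[of _ 1]) auto
    show "Lp_bd 1 Ng Xg 0 T (\<lambda>t. indicat_real E t *\<^sub>R x) c" by (rule Lp_bd_indicator[OF x E c(1)])
    fix h c assume "P h" and L: "Lp_bd 1 Ng Xg 0 T h c" and c: "0 < (c::real)"
    then obtain E \<sigma> where E: "E \<in> sets lebesgue" "E \<subseteq> {0..T}" and \<sigma>: "\<sigma> \<in> {1, -1::real}"
      and h: "h = (\<lambda>t. \<sigma> *\<^sub>R indicat_real E t *\<^sub>R x)" unfolding P_def by blast
    have Em: "E \<in> lmeasurable" using E by (intro bounded_set_imp_lmeasurable) (auto intro: bounded_subset[of "{0..T}"])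
    have meas: "measure lebesgue E * Ng x \<le> c"
      by (rule L1_indicator_measure[OF x E L[unfolded h]]) (use \<sigma> in auto)
    \<comment> \<open>Chosen so that e * Ng x \<le> c/2; the added 1 covers the case Ng x =
      0.\<close>
    define e where "e = c / (2 * (Ng x + 1))"
    have N: "0 < Ng x + 1" using Ng_nonneg[of x] by simp
    have e: "0 < e" using c N by (simp add: e_def)
    have eN: "e * Ng x \<le> c / 2"
    proof -
      have "e * Ng x \<le> e * (Ng x + 1)" using e by simp
      also have "\<dots> = c / 2" using N by (simp add: e_def divide_simps)
      finally show ?thesis .
    qed
    obtain D where D: "\<And>n::nat. D n = {} \<or> (\<exists>c d. D n = {c..d} \<and> c \<le> d)" "\<And>n. D n \<subseteq> {0..T}"
      "\<And>m n. m \<noteq> n \<Longrightarrow> negligible (D m \<inter> D n)" "E \<subseteq> (\<Union>n. D n)" "(\<Union>n. D n) \<in> lmeasurable"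
      "measure lebesgue (\<Union>n. D n) \<le> measure lebesgue E + e" using outer_cover[OF T E e] by blast
    define U where "U = (\<Union>n. D n)"
    define q where "q t = \<sigma> *\<^sub>R indicat_real U t *\<^sub>R x" for t
    have UT: "U \<subseteq> {0..T}" "U \<in> sets lebesgue" using D by (auto simp: U_def)
    have g: "absorbable T (\<lambda>t. indicat_real U t *\<^sub>R x) (20 * c0 * (measure lebesgue U * Ng x))"
      unfolding U_def by (rule absorbable_nonoverlapping[OF T x D(1-3)])
    have "measure lebesgue U * Ng x \<le> (measure lebesgue E + e) * Ng x"
      using D(6) Ng_nonneg[of x] by (intro mult_right_mono) (auto simp: U_def)
    also have "\<dots> \<le> 2 * c" using meas eN c by (simp add: algebra_simps)
    finally have "20 * c0 * (measure lebesgue U * Ng x) \<le> 20 * c0 * (2 * c)" using c0(1) by (intro mult_left_mono) auto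
    then have "absorbable T (\<lambda>t. indicat_real U t *\<^sub>R x) (40 * c0 * c)" by (intro absorbable_mono[OF g]) simp
    then have 1: "absorbable T q (40 * c0 * c)" unfolding q_def[abs_def] using \<sigma> absorbable_uminus by auto
    have diff: "(\<lambda>t. h t - q t) = (\<lambda>t. (- \<sigma>) *\<^sub>R indicat_real (U - E) t *\<^sub>R x)"
      using D(4) by (auto simp: h q_def U_def[symmetric] indicator_def fun_eq_iff)
    have UE: "U - E \<in> sets lebesgue" "U - E \<subseteq> {0..T}" using UT E by auto
    have 2: "P (\<lambda>t. h t - q t)" unfolding P_def diff using UE \<sigma> by (intro exI[of _ "U - E"] exI[of _ "- \<sigma>"]) auto
    have "measure lebesgue (U - E) = measure lebesgue U - measure lebesgue E"
      using D(4,5) Em by (intro measurable_measure_Diff) (auto simp: U_def)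
    then have "measure lebesgue (U - E) * Ng x \<le> e * Ng x"
      using D(6) Ng_nonneg[of x] by (intro mult_right_mono) (auto simp: U_def)
    then have "Lp_bd 1 Ng Xg 0 T (\<lambda>t. indicat_real (U - E) t *\<^sub>R x) (c/2)"
      using eN by (intro Lp_bd_indicator[OF x UE]) simp
    from NG.Lp_bd_scale[OF this, of "- \<sigma>"] have 3: "Lp_bd 1 Ng Xg 0 T (\<lambda>t. h t - q t) (c/2)"
      unfolding diff using \<sigma> by auto
    show "\<exists>q. absorbable T q (40 * c0 * c) \<and> P (\<lambda>t. h t - q t) \<and> Lp_bd 1 Ng Xg 0 T (\<lambda>t. h t - q t) (c/2)"
      using 1 2 3 by blast
  qed fact
  then show ?thesis by simp
qed

text \<open>The costs of the level sets add up to the L^1 norm. The slack e is shared among the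
  finitely many values because \<open>absorbable_measurable\<close> asks for a positive cost on each
  of them.\<close>

lemma absorbable_simple:
  assumes T: "0 < T" and s: "simple_fun s" "range s \<subseteq> Xg" and c: "Lp_bd 1 Ng Xg 0 T s c" and e: "0 < e"
  shows "absorbable T s (80 * c0 * (c + e))"
proof -
  define R where "R = range s"
  have R: "finite R" "R \<subseteq> Xg" "R \<noteq> {}" using s by (auto simp: R_def simple_fun_def)
  define E where "E y = s -` {y} \<inter> {0..T}" for y
  have E: "E y \<in> sets lebesgue" "E y \<subseteq> {0..T}" for y using s by (auto simp: E_def simple_fun_def)
  have Em: "E y \<in> lmeasurable" for y
    using E[of y] by (intro bounded_set_imp_lmeasurable) (auto intro: bounded_subset[of "{0..T}"])
  define \<epsilon> where "\<epsilon> = e / card R"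
  have \<epsilon>: "0 < \<epsilon>" "(\<Sum>y\<in>R. \<epsilon>) = e" using e R by (auto simp: \<epsilon>_def card_gt_0_iff)
  have g: "absorbable T (\<lambda>t. \<Sum>y\<in>R. indicat_real (E y) t *\<^sub>R y) (\<Sum>y\<in>R. 80 * c0 * (measure lebesgue (E y) * Ng y + \<epsilon>))"
  proof (rule absorbable_sum, rule absorbable_measurable[OF T])
    fix y assume "y \<in> R"
    then show "y \<in> Xg" using R by auto
    have "0 \<le> measure lebesgue (E y) * Ng y" using Ng_nonneg[of y] by simp
    then show "0 < measure lebesgue (E y) * Ng y + \<epsilon>" "measure lebesgue (E y) * Ng y \<le> measure lebesgue (E y) * Ng y + \<epsilon>"
      using \<epsilon> by auto
  qed (use E in auto)
  have eq: "(\<Sum>y\<in>R. indicat_real (E y) t *\<^sub>R y) = s t" if "t \<in> {0<..<T}" for t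
  proof -
    have "(\<Sum>y\<in>R. indicat_real (E y) t *\<^sub>R y) = (\<Sum>y\<in>R. if y = s t then y else 0)"
      using that by (intro sum.cong) (auto simp: E_def indicator_def)
    then show ?thesis using R by (simp add: R_def)
  qed
  have eq': "(\<Sum>y\<in>R. ennreal (Ng y) * indicator (E y) t) = ennreal (Ng (s t) powr 1)" if "t \<in> {0<..<T}" for t
  proof -
    have "(\<Sum>y\<in>R. ennreal (Ng y) * indicator (E y) t) = (\<Sum>y\<in>R. if y = s t then ennreal (Ng y) else 0)"
      using that by (intro sum.cong) (auto simp: E_def indicator_def)
    then show ?thesis using R Ng_nonneg[of "s t"] by (simp add: R_def)
  qed
  have "ennreal (\<Sum>y\<in>R. measure lebesgue (E y) * Ng y) = (\<Sum>y\<in>R. ennreal (Ng y) * emeasure lebesgue (E y))"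
    using Em Ng_nonneg by (subst sum_ennreal[symmetric]) (auto simp: emeasure_eq_measure2 ennreal_mult mult.commute)
  also have "\<dots> = (\<integral>\<^sup>+ t. (\<Sum>y\<in>R. ennreal (Ng y) * indicator (E y) t) \<partial>lebesgue)"
    using E by (subst nn_integral_sum) (auto simp: nn_integral_cmult_indicator)
  also have "\<dots> = (\<integral>\<^sup>+ t. ennreal (Ng (s t) powr 1) * indicator {0<..<T} t \<partial>lebesgue)"
  proof (rule nn_integral_cong_AE)
    have "AE t in lebesgue. t \<notin> {0, T}" by (rule AE_not_in) (simp add: negligible_iff_null_sets[symmetric])
    then show "AE t in lebesgue. (\<Sum>y\<in>R. ennreal (Ng y) * indicator (E y) t) = ennreal (Ng (s t) powr 1) * indicator {0<..<T} t"
    proof eventually_elim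
      case (elim t)
      show ?case
      proof (cases "t \<in> {0<..<T}")
        case False
        then have "indicator (E y) t = (0::ennreal)" for y using elim by (auto simp: E_def indicator_def)
        then show ?thesis using False by simp
      qed (simp add: eq')
    qed
  qed
  also have "\<dots> = (\<integral>\<^sup>+ t. ennreal (Ng (s t) powr 1) \<partial>lebesgue_on {0<..<T})" by (simp add: nn_integral_restrict_space)
  also have "\<dots> \<le> ennreal (c powr 1)" using c unfolding Lp_bd_def by (auto dest: Lp_leD(4))
  finally have le: "(\<Sum>y\<in>R. measure lebesgue (E y) * Ng y) \<le> c" using Lp_bd_0_le[OF c] by simp
  have "(\<Sum>y\<in>R. 80 * c0 * (measure lebesgue (E y) * Ng y + \<epsilon>)) = 80 * c0 * ((\<Sum>y\<in>R. measure lebesgue (E y) * Ng y) + e)"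
    using \<epsilon> by (simp only: sum_distrib_left[symmetric] sum.distrib)
  also have "\<dots> \<le> 80 * c0 * (c + e)" using le c0(1) by (intro mult_left_mono) auto
  finally have "absorbable T (\<lambda>t. \<Sum>y\<in>R. indicat_real (E y) t *\<^sub>R y) (80 * c0 * (c + e))" by (rule absorbable_mono[OF g])
  then show ?thesis
    by (rule absorbable_cong) (auto intro!: AE_I2 simp: space_restrict_space eq)
qed

text \<open>A simple function within c/2 of h has norm at most 3c/2; with slack c it costs 80 c0
  (5/2) c = 200 c0 c, doubled by the geometric series. The case c = 0 is apart because successive
  approximation starts from a positive bound.\<close>

lemma absorbable_L1:
  assumes T: "0 < T" and h: "Lp_bd 1 Ng Xg 0 T h c"
  shows "absorbable T h (400 * c0 * c)"
proof (cases "c = 0")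
  case True
  have "AE t in lebesgue_on {0<..<T}. Ng (h t) = 0"
    using h True by (intro Lp_le_0D[of 1]) (auto simp: Lp_bd_def)
  moreover have "AE t in lebesgue_on {0<..<T}. h t \<in> Xg" using h by (auto simp: Lp_bd_def intro: NG.sm_inS)
  ultimately have "AE t in lebesgue_on {0<..<T}. h t = 0"
    by eventually_elim (use norm_le_Ng in fastforce)
  then have "absorbable T h 0" by (intro absorbable_cong[OF absorbable_zero])
  then show ?thesis using True by simp
next
  case False
  then have c: "0 < c" using Lp_bd_0_le[OF h] by simp
  have "absorbable T h (2 * (200 * c0) * c)"
  proof (rule absorbable_successive[OF T, of "\<lambda>_. True"])
    fix h c assume h: "Lp_bd 1 Ng Xg 0 T h c" and c: "0 < (c::real)"
    then obtain s where s: "simple_fun s" "range s \<subseteq> Xg" "Lp_bd 1 Ng Xg 0 T (\<lambda>t. h t - s t) (c/2)"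
      using NG.L1_simple_approx[OF h, of "c/2"] by auto
    have "Lp_bd 1 Ng Xg 0 T (\<lambda>t. h t - (h t - s t)) (c + c/2)" using NG.Lp_bd_diff[OF h s(3)] by simp
    then have "Lp_bd 1 Ng Xg 0 T s (3/2 * c)" by simp
    from absorbable_simple[OF T s(1,2) this c] have "absorbable T s (200 * c0 * c)" by (simp add: algebra_simps)
    then show "\<exists>q. absorbable T q (200 * c0 * c) \<and> True \<and> Lp_bd 1 Ng Xg 0 T (\<lambda>t. h t - q t) (c/2)" using s by blast
  qed (use h c in auto)
  then show ?thesis by simp
qed

text \<open>The sum of an absorbing function for h, starting at 0, and of the extension of x, which
  is \<open>multiplied_extension\<close> with \<mu> = 1, L = 1 and a = 0.\<close>

lemma extension_exists:
  assumes T: "0 < T" and x: "x \<in> Xg" and h: "Lp_bd 1 Ng Xg 0 T h c"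
  shows "\<exists>w r. w 0 = x \<and> Ep_bd T w (400 * c0 * (Ng x + c)) \<and> Lp_bd p norm UNIV 0 T r (400 * c0 * (Ng x + c)) \<and>
     (\<forall>t\<in>{0..T}. ((\<lambda>s. h s + r s) has_integral w t - x) {0..t})"
proof -
  obtain w r where w: "w 0 = 0" "Ep_bd T w (400 * c0 * c)" "Lp_bd p norm UNIV 0 T r (400 * c0 * c)"
     "\<And>t. t \<in> {0..T} \<Longrightarrow> ((\<lambda>s. h s + r s) has_integral w t) {0..t}"
    using absorbable_L1[OF T h] unfolding absorbable_def by blast
  obtain \<beta> :: "nat \<Rightarrow> 'a" where \<beta>: "\<beta> 0 = 0" "\<And>k. \<beta> k \<in> X1"
      "\<And>k. norm (x - \<beta> k) + (1/2) ^ k * n1 (\<beta> k) \<le> 2 * c0 * K ((1/2) ^ k) x"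
    using approximants_exist[of x] by blast
  note ext = multiplied_extension[OF x \<beta> T order.refl zero_le_one, of "\<lambda>_. 0" "\<lambda>_. 1" "{}", simplified]
  define v where "v = ext_fun x \<beta>"
  define z where "z = (\<lambda>t. if t \<le> 0 then 0 else 0 *\<^sub>R (ext_fun x \<beta> (t - 0) - x) + 1 *\<^sub>R ext_deriv \<beta> (t - 0))"
  have v: "Ep_bd T v (20 * c0 * Ng x)" "Lp_bd p norm UNIV 0 T z (20 * c0 * Ng x)"
     "\<And>t. t \<in> {0..T} \<Longrightarrow> (z has_integral v t - v 0) {0..t}"
    using ext unfolding v_def z_def by simp_all
  have v0: "v 0 = x" by (simp add: v_def ext_fun_def[OF x \<beta>])
  have le: "400 * c0 * c + 20 * c0 * Ng x \<le> 400 * c0 * (Ng x + c)"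
    using c0(1) Ng_nonneg[of x] by (simp add: algebra_simps)
  show ?thesis
  proof (intro exI conjI ballI)
    show "w 0 + v 0 = x" using w v0 by simp
    show "Ep_bd T (\<lambda>t. w t + v t) (400 * c0 * (Ng x + c))" by (rule Ep_bd_mono[OF Ep_bd_add[OF w(2) v(1)] le])
    show "Lp_bd p norm UNIV 0 T (\<lambda>t. r t + z t) (400 * c0 * (Ng x + c))"
      by (rule Lp_bd_bound_mono[OF X0.Lp_bd_add[OF w(3) v(2)] le]) (use p in auto)
    fix t assume t: "t \<in> {0..T}"
    show "((\<lambda>s. h s + (r s + z s)) has_integral (w t + v t) - x) {0..t}"
      using has_integral_add[OF w(4)[OF t] v(3)[OF t]] v0 by (simp add: algebra_simps)
  qed
qed

end

section \<open>Volterra iteration\<close>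

lemma Lp_le_1_combine:
  fixes s t :: real
  assumes f: "Lp_le 1 (lebesgue_on {0<..<t}) f D" and c: "Lp_le 1 (lebesgue_on {0<..<s}) f c"
    and d: "Lp_le 1 (lebesgue_on {s<..<t}) f d" and st: "0 \<le> s" "s \<le> t"
  shows "Lp_le 1 (lebesgue_on {0<..<t}) f (c + d)"
proof -
  have c0: "0 \<le> c" "0 \<le> d" using Lp_leD(1)[OF c] Lp_leD(1)[OF d] by auto
  have meas: "(\<lambda>x. ennreal (f x powr 1) * indicator {0<..<s} x) \<in> borel_measurable lebesgue"
     "(\<lambda>x. ennreal (f x powr 1) * indicator {s<..<t} x) \<in> borel_measurable lebesgue"
    using Lp_leD(2)[OF c] Lp_leD(2)[OF d]
    by (subst borel_measurable_restrict_space_iff_ennreal[symmetric]; simp)+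
  have "(\<integral>\<^sup>+ x. ennreal (f x powr 1) \<partial>lebesgue_on {0<..<t}) = (\<integral>\<^sup>+ x. ennreal (f x powr 1) * indicator {0<..<t} x \<partial>lebesgue)"
    by (simp add: nn_integral_restrict_space)
  also have "\<dots> = (\<integral>\<^sup>+ x. ennreal (f x powr 1) * indicator {0<..<s} x + ennreal (f x powr 1) * indicator {s<..<t} x \<partial>lebesgue)"
  proof (rule nn_integral_cong_AE)
    have "AE x in lebesgue. x \<notin> {s}" by (rule AE_not_in) (simp add: negligible_iff_null_sets[symmetric])
    then show "AE x in lebesgue. ennreal (f x powr 1) * indicator {0<..<t} x =
        ennreal (f x powr 1) * indicator {0<..<s} x + ennreal (f x powr 1) * indicator {s<..<t} x"
      using st by (elim eventually_mono) (auto simp: indicator_def)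
  qed
  also have "\<dots> = (\<integral>\<^sup>+ x. ennreal (f x powr 1) \<partial>lebesgue_on {0<..<s}) + (\<integral>\<^sup>+ x. ennreal (f x powr 1) \<partial>lebesgue_on {s<..<t})"
    using meas by (simp add: nn_integral_add nn_integral_restrict_space)
  also have "\<dots> \<le> ennreal (c powr 1) + ennreal (d powr 1)" by (intro add_mono Lp_leD(4)[OF c] Lp_leD(4)[OF d])
  also have "\<dots> = ennreal ((c + d) powr 1)" using c0 by simp
  finally show ?thesis using Lp_leD[OF f] c0 unfolding Lp_le_def by auto
qed

lemma Lp_le_empty:
  fixes s T :: real
  assumes f: "Lp_le p (lebesgue_on {0<..<T}) f C" and T: "0 < T" and c: "0 \<le> c" and s: "s \<le> 0"
  shows "Lp_le r (lebesgue_on {0<..<s}) f c"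
proof -
  have "Lp_le p (lebesgue_on {0<..<s}) f C" by (rule Lp_le_subset[OF f]) (use T s in auto)
  moreover have "(\<integral>\<^sup>+ x. ennreal (f x powr r) \<partial>lebesgue_on {0<..<s}) = 0"
    using s by (subst nn_integral_restrict_space) auto
  ultimately show ?thesis using c unfolding Lp_le_def by auto
qed

text \<open>The time interval is cut into \<open>m\<close> pieces on each of which \<open>b\<close> has norm at most \<open>1/(4C)\<close>; in the
  norm \<open>max\<^sub>j 2\<^sup>-\<^sup>j \<parallel>\<cdot>\<parallel>\<close> over the pieces the Volterra-type iteration is then a contraction with
  factor \<open>1/2\<close>.\<close>

lemma Volterra_iteration:
  fixes \<phi> :: "nat \<Rightarrow> real \<Rightarrow> real" and b :: "real \<Rightarrow> real"
  assumes p: "1 < p" and q: "q = p / (p - 1)" and T: "0 < T" and C: "0 < C"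
    and b: "Lp_le q (lebesgue_on {0<..<T}) (\<lambda>t. \<bar>b t\<bar>) \<beta>"
    and \<phi>: "\<And>n. Lp_le p (lebesgue_on {0<..<T}) (\<phi> n) (A n)"
    and step: "\<And>n \<tau> c. 0 < \<tau> \<Longrightarrow> \<tau> \<le> T \<Longrightarrow> Lp_le 1 (lebesgue_on {0<..<\<tau>}) (\<lambda>t. \<bar>b t\<bar> * \<phi> n t) c \<Longrightarrow>
       Lp_le p (lebesgue_on {0<..<\<tau>}) (\<phi> (Suc n)) (C * c)"
  shows "Lp_le p (lebesgue_on {0<..<T}) (\<phi> n) ((1/2) ^ n * 2 ^ (nat \<lceil>(4 * C * \<beta>) powr q\<rceil> + 1) * A 0)"
proof -
  \<comment> \<open>On each of m pieces carrying equal shares of the integral of |b|^q, the share is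
    at most \<beta>^q / m \<le> (1 / (4C))^q. The added 1 keeps m positive when \<beta> = 0.\<close>
  define m where "m = nat \<lceil>(4 * C * \<beta>) powr q\<rceil> + 1"
  have q1: "1 < q" "1/p + 1/q = 1" using p by (auto simp: q field_simps)
  have \<beta>: "0 \<le> \<beta>" by (rule Lp_leD(1)[OF b])
  have m: "(4 * C * \<beta>) powr q \<le> real m" "0 < m" by (auto simp: m_def) linarith
  define \<psi> where "\<psi> t = \<bar>b t\<bar> powr q" for t
  have \<psi>: "Lp_le 1 (lebesgue_on {0<..<T}) \<psi> (\<beta> powr q)"
    using b powr_real_measurable[OF Lp_leD(2)[OF b] borel_measurable_const, of q] unfolding Lp_le_def \<psi>_def by simp
  have int: "\<psi> integrable_on {0..T}" using Lp_le_1_integrable(1)[OF \<psi>] T by simp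
  define \<Psi> where "\<Psi> t = integral {0..t} \<psi>" for t
  have cont: "continuous_on {0..T} \<Psi>" unfolding \<Psi>_def by (rule indefinite_integral_continuous_1[OF int])
  have \<Psi>0: "\<Psi> 0 = 0" by (simp add: \<Psi>_def)
  have \<Psi>T: "0 \<le> \<Psi> T" "\<Psi> T \<le> \<beta> powr q"
    using Lp_le_1_integrable(2)[OF \<psi>] T int by (auto simp: \<Psi>_def \<psi>_def intro!: integral_nonneg)
  have small: "\<Psi> T / m \<le> (1 / (4 * C)) powr q"
  proof -
    have "\<Psi> T * (4 * C) powr q \<le> \<beta> powr q * (4 * C) powr q" using \<Psi>T by (intro mult_right_mono) auto
    also have "\<dots> = (4 * C * \<beta>) powr q" using C \<beta> by (simp add: powr_mult mult_ac)
    also have "\<dots> \<le> m" by (rule m)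
    finally show ?thesis using C m by (simp add: powr_divide field_simps)
  qed
  have "\<exists>s. s \<in> {0..T} \<and> \<Psi> s = real j * \<Psi> T / m \<and> (j = 0 \<longrightarrow> s = 0) \<and> (j = m \<longrightarrow> s = T)" if j: "j \<le> m" for j
  proof -
    consider "j = 0" | "j = m" | "0 < j" "j < m" using j by linarith
    then show ?thesis
    proof cases
      case 1 then show ?thesis using \<Psi>0 T m by (intro exI[of _ 0]) auto
    next
      case 2 then show ?thesis using T m by (intro exI[of _ T]) auto
    next
      case 3
      have "real j * \<Psi> T \<le> real m * \<Psi> T" using 3 \<Psi>T by (intro mult_right_mono) auto
      then have "real j * \<Psi> T / m \<le> \<Psi> T" using m by (simp add: divide_simps mult.commute)
      moreover have "\<Psi> 0 \<le> real j * \<Psi> T / m" using \<Psi>0 \<Psi>T by simp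
      ultimately obtain s where "0 \<le> s" "s \<le> T" "\<Psi> s = real j * \<Psi> T / m" using IVT'[OF _ _ _ cont] T by (metis less_imp_le)
      then show ?thesis using 3 by auto
    qed
  qed
  then have "\<forall>j. \<exists>s. j \<le> m \<longrightarrow> s \<in> {0..T} \<and> \<Psi> s = real j * \<Psi> T / m \<and> (j = 0 \<longrightarrow> s = 0) \<and> (j = m \<longrightarrow> s = T)"
    by blast
  from choice[OF this] obtain s where s': "\<And>j. j \<le> m \<Longrightarrow> s j \<in> {0..T} \<and> \<Psi> (s j) = real j * \<Psi> T / m \<and>
      (j = 0 \<longrightarrow> s j = 0) \<and> (j = m \<longrightarrow> s j = T)" by blast
  have s: "\<And>j. j \<le> m \<Longrightarrow> s j \<in> {0..T}" "\<And>j. j \<le> m \<Longrightarrow> \<Psi> (s j) = real j * \<Psi> T / m" "s 0 = 0" "s m = T"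
    using s' s'[of 0] s'[of m] by auto
  have piece: "Lp_le q (lebesgue_on {s j<..<s (Suc j)}) (\<lambda>t. \<bar>b t\<bar>) (1 / (4 * C))"
    if j: "j < m" "s j \<le> s (Suc j)" for j
  proof -
    have sj: "s j \<in> {0..T}" "s (Suc j) \<in> {0..T}" using s(1)[of j] s(1)[of "Suc j"] j by auto
    have \<psi>j: "Lp_le 1 (lebesgue_on {s j<..<s (Suc j)}) \<psi> (\<beta> powr q)" by (rule Lp_le_subset[OF \<psi>]) (use sj in auto)
    have "(\<integral>\<^sup>+ t. ennreal (\<bar>b t\<bar> powr q) \<partial>lebesgue_on {s j<..<s (Suc j)}) = (\<integral>\<^sup>+ t. ennreal (\<psi> t) \<partial>lebesgue_on {s j<..<s (Suc j)})"
      by (simp add: \<psi>_def)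
    also have "\<dots> = ennreal (integral\<^sup>L (lebesgue_on {s j<..<s (Suc j)}) \<psi>)"
      by (rule nn_integral_eq_integral[OF Lp_le_1_integrable(3)[OF \<psi>j j(2)]]) (auto simp: \<psi>_def)
    also have "integral\<^sup>L (lebesgue_on {s j<..<s (Suc j)}) \<psi> = integral {s j..s (Suc j)} \<psi>"
      by (subst lebesgue_integral_eq_integral[OF Lp_le_1_integrable(3)[OF \<psi>j j(2)]])
         (auto simp: integral_open_interval_real)
    also have "\<dots> = \<Psi> (s (Suc j)) - \<Psi> (s j)"
      using Henstock_Kurzweil_Integration.integral_combine[of 0 "s j" "s (Suc j)" \<psi>] sj j integrable_on_subinterval[OF int, of 0 "s (Suc j)"]
      by (auto simp: \<Psi>_def)
    also have "\<dots> = \<Psi> T / m" using s(2)[of j] s(2)[of "Suc j"] j by (simp add: diff_divide_distrib[symmetric] algebra_simps)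
    finally have "(\<integral>\<^sup>+ t. ennreal (\<bar>b t\<bar> powr q) \<partial>lebesgue_on {s j<..<s (Suc j)}) \<le> ennreal ((1 / (4 * C)) powr q)"
      using small by (simp add: ennreal_leI)
    moreover have "Lp_le q (lebesgue_on {s j<..<s (Suc j)}) (\<lambda>t. \<bar>b t\<bar>) \<beta>" by (rule Lp_le_subset[OF b]) (use sj in auto)
    ultimately show ?thesis using C unfolding Lp_le_def by auto
  qed
  have bphi: "Lp_le 1 (lebesgue_on {0<..<T}) (\<lambda>t. \<bar>b t\<bar> * \<phi> n t) (A n * \<beta>)" for n
    using Lp_le_Hoelder[OF p q1 \<phi> b] by (simp add: mult.commute)
  have accumulate: "Lp_le 1 (lebesgue_on {0<..<s j}) (\<lambda>t. \<bar>b t\<bar> * \<phi> n t) (\<Sum>i<j. Y (Suc i) / (4 * C))"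
    if "j \<le> m" and Y: "\<And>i. i \<le> m \<Longrightarrow> Lp_le p (lebesgue_on {0<..<s i}) (\<phi> n) (Y i)" for j n Y
    using that(1)
  proof (induction j)
    case 0
    then show ?case using Lp_le_empty[OF bphi T, of 0 "s 0"] s(3) by simp
  next
    case (Suc j)
    then have IH: "Lp_le 1 (lebesgue_on {0<..<s j}) (\<lambda>t. \<bar>b t\<bar> * \<phi> n t) (\<Sum>i<j. Y (Suc i) / (4 * C))" by simp
    have Y0: "0 \<le> Y (Suc j) / (4 * C)" using Lp_leD(1)[OF Y[OF Suc.prems]] C by simp
    have sj: "s j \<in> {0..T}" "s (Suc j) \<in> {0..T}" using s(1)[of j] s(1)[of "Suc j"] Suc.prems by auto
    show ?case
    \<comment> \<open>The breakpoints come from the intermediate value theorem and are not known to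
      increase; a step backwards is covered by the bound accumulated so far.\<close>
    proof (cases "s (Suc j) \<le> s j")
      case True
      have "Lp_le 1 (lebesgue_on {0<..<s (Suc j)}) (\<lambda>t. \<bar>b t\<bar> * \<phi> n t) (\<Sum>i<j. Y (Suc i) / (4 * C))"
        by (rule Lp_le_subset[OF IH]) (use True in auto)
      then show ?thesis by (rule Lp_le_bound_mono) (use Y0 in auto)
    next
      case False
      have "Lp_le p (lebesgue_on {s j<..<s (Suc j)}) (\<phi> n) (Y (Suc j))"
        by (rule Lp_le_subset[OF Y[OF Suc.prems]]) (use sj in auto)
      from Lp_le_Hoelder[OF p q1 this piece[of j]]
      have "Lp_le 1 (lebesgue_on {s j<..<s (Suc j)}) (\<lambda>t. \<bar>b t\<bar> * \<phi> n t) (Y (Suc j) / (4 * C))"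
        using Suc.prems False by (simp add: mult.commute)
      moreover have "Lp_le 1 (lebesgue_on {0<..<s (Suc j)}) (\<lambda>t. \<bar>b t\<bar> * \<phi> n t) (A n * \<beta>)"
        by (rule Lp_le_subset[OF bphi]) (use sj in auto)
      ultimately show ?thesis using Lp_le_1_combine[OF _ IH] False sj by simp
    qed
  qed
  have A0: "0 \<le> A 0" by (rule Lp_leD(1)[OF \<phi>])
  \<comment> \<open>The weights 2^j make the sum geometric: adding 2^(i+1) / 4 over i < j gives (2^j
    - 1) / 2, so one iteration halves the bound at every breakpoint. At the last one, s m = T, the
    factor 2^m remains.\<close>
  have main: "\<forall>j\<le>m. Lp_le p (lebesgue_on {0<..<s j}) (\<phi> n) ((1/2) ^ n * 2 ^ j * A 0)" for n
  proof (induction n)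
    case 0
    show ?case
    proof (intro allI impI)
      fix j assume "j \<le> m"
      have "Lp_le p (lebesgue_on {0<..<s j}) (\<phi> 0) (A 0)"
        by (rule Lp_le_subset[OF \<phi>]) (use s(1)[OF \<open>j \<le> m\<close>] in auto)
      moreover have "1 * A 0 \<le> 2 ^ j * A 0" using A0 by (intro mult_right_mono) auto
      ultimately show "Lp_le p (lebesgue_on {0<..<s j}) (\<phi> 0) ((1/2) ^ 0 * 2 ^ j * A 0)"
        using p Lp_le_bound_mono[of p _ "\<phi> 0" "A 0" "2 ^ j * A 0"] by simp
    qed
  next
    case (Suc n)
    show ?case
    proof (intro allI impI)
      fix j assume j: "j \<le> m"
      show "Lp_le p (lebesgue_on {0<..<s j}) (\<phi> (Suc n)) ((1/2) ^ Suc n * 2 ^ j * A 0)"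
      proof (cases "s j \<le> 0")
        case True
        then show ?thesis using A0 by (intro Lp_le_empty[OF \<phi> T]) auto
      next
        case False
        have "Lp_le 1 (lebesgue_on {0<..<s j}) (\<lambda>t. \<bar>b t\<bar> * \<phi> n t) (\<Sum>i<j. ((1/2) ^ n * 2 ^ Suc i * A 0) / (4 * C))"
          by (rule accumulate[OF j]) (use Suc.IH in auto)
        from step[OF _ _ this] have *: "Lp_le p (lebesgue_on {0<..<s j}) (\<phi> (Suc n))
           (C * (\<Sum>i<j. ((1/2) ^ n * 2 ^ Suc i * A 0) / (4 * C)))" using False s(1)[OF j] by auto
        have "C * (((1/2) ^ n * 2 ^ Suc i * A 0) / (4 * C)) = ((1/2) ^ Suc n * A 0) * 2 ^ i" for i
          using C by simp
        then have "C * (\<Sum>i<j. ((1/2) ^ n * 2 ^ Suc i * A 0) / (4 * C)) = (\<Sum>i<j. ((1/2) ^ Suc n * A 0) * 2 ^ i)"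
          by (simp only: sum_distrib_left)
        also have "\<dots> = ((1/2) ^ Suc n * A 0) * (2 ^ j - 1)"
          using geometric_sum[of "2::real" j] unfolding sum_distrib_left[symmetric] by simp
        also have "\<dots> \<le> ((1/2) ^ Suc n * A 0) * 2 ^ j" using A0 by (intro mult_left_mono) auto
        also have "\<dots> = (1/2) ^ Suc n * 2 ^ j * A 0" by simp
        finally show ?thesis using p by (intro Lp_le_bound_mono[OF *]) auto
      qed
    qed
  qed
  from main[of n] s(4) show ?thesis unfolding m_def[symmetric] by auto
qed

text \<open>Division by the norm of the source shows that the infimum is itself admissible. If a
  negative constant is admissible, the left-hand sides are at most 0 and the set need not be bounded
  below; \<open>max 0\<close> covers this.\<close>

lemma MR_bound_MR_const:
  assumes "max_reg X1 n1 p T A"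
  shows "MR_bound X1 n1 p T A (max 0 (MR_const X1 n1 p T A))"
proof -
  define S where "S = {C. MR_bound X1 n1 p T A C}"
  obtain C1 where C1: "C1 \<in> S" using assms by (auto simp: max_reg_def S_def)
  show ?thesis unfolding MR_bound_def
  proof (intro ballI allI impI)
    fix \<tau> f v g
    assume asm: "\<tau> \<in> {0<..T}" "in_Lp p norm UNIV 0 \<tau> f" "strong_sol X1 n1 \<tau> A f 0 v" "in_Lp p n1 X1 0 \<tau> v"
      "in_Lp p norm UNIV 0 \<tau> v" "is_deriv \<tau> v g" "in_Lp p norm UNIV 0 \<tau> g"
    define l where "l = max (Lp_norm p n1 0 \<tau> v) (Lp_norm p norm 0 \<tau> v + Lp_norm p norm 0 \<tau> g)"
    define e where "e = Lp_norm p norm 0 \<tau> f"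
    have le: "l \<le> C * e" if "C \<in> S" for C
      using that asm unfolding S_def MR_bound_def l_def e_def by blast
    have e0: "0 \<le> e" by (simp add: e_def Lp_norm_nonneg)
    have "l \<le> max 0 (Inf S) * e"
    proof (cases "\<exists>C\<in>S. C < 0")
      case True
      then obtain C where C: "C \<in> S" "C < 0" by auto
      have "l \<le> C * e" by (rule le[OF C(1)])
      also have "\<dots> \<le> 0" using C e0 by (simp add: mult_nonpos_nonneg)
      also have "\<dots> \<le> max 0 (Inf S) * e" using e0 by simp
      finally show ?thesis .
    next
      case False
      show ?thesis
      proof (cases "e = 0")
        case True then show ?thesis using le[OF C1] by simp
      next
        case e: False
        have "l / e \<le> Inf S" by (rule cInf_greatest) (use C1 le e e0 in \<open>auto simp: divide_le_eq\<close>)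
        also have "\<dots> \<le> max 0 (Inf S)" by simp
        finally show ?thesis using e e0 by (simp add: divide_le_eq)
      qed
    qed
    then show "max (Lp_norm p n1 0 \<tau> v) (Lp_norm p norm 0 \<tau> v + Lp_norm p norm 0 \<tau> g)
          \<le> max 0 (MR_const X1 n1 p T A) * Lp_norm p norm 0 \<tau> f"
      by (simp add: l_def e_def MR_const_def S_def)
  qed
qed

section \<open>The unperturbed problem\<close>

context nspace
begin

lemma in_Lp_iff: "0 < p \<Longrightarrow> in_Lp p N S a b f \<longleftrightarrow> (\<exists>C. Lp_bd p N S a b f C)"
  using in_Lp_Lp_bd Lp_bd_in_Lp by blast

lemma in_Lp_add: "1 \<le> p \<Longrightarrow> in_Lp p N S a b f \<Longrightarrow> in_Lp p N S a b g \<Longrightarrow> in_Lp p N S a b (\<lambda>t. f t + g t)"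
  by (simp add: in_Lp_iff) (blast intro: Lp_bd_add)

lemma in_Lp_uminus: "1 \<le> p \<Longrightarrow> in_Lp p N S a b f \<Longrightarrow> in_Lp p N S a b (\<lambda>t. - f t)"
  by (simp add: in_Lp_iff) (blast intro: Lp_bd_minus)

lemma in_Lp_cong: "0 < p \<Longrightarrow> in_Lp p N S a b f \<Longrightarrow> AE t in lebesgue_on {a<..<b}. g t = f t \<Longrightarrow> in_Lp p N S a b g"
  by (simp add: in_Lp_iff) (blast intro: Lp_bd_cong_AE less_imp_le)

lemma in_Lp_L1: "1 \<le> p \<Longrightarrow> a \<le> b \<Longrightarrow> in_Lp p N S a b f \<Longrightarrow> in_Lp 1 N S a b f"
  by (simp add: in_Lp_iff) (blast intro: Lp_bd_imp_L1)

end

lemma is_deriv_add: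
  assumes "is_deriv T u g" "is_deriv T v h"
  shows "is_deriv T (\<lambda>t. u t + v t) (\<lambda>t. g t + h t)"
  unfolding is_deriv_def
proof (intro conjI ballI)
  show "in_Lp 1 norm UNIV 0 T (\<lambda>t. g t + h t)"
    using assms by (intro X0.in_Lp_add) (auto simp: is_deriv_def)
  fix t assume "t \<in> {0..T}"
  then have "(g has_integral (u t - u 0)) {0..t}" "(h has_integral (v t - v 0)) {0..t}"
    using assms by (auto simp: is_deriv_def)
  from has_integral_add[OF this] show "((\<lambda>t. g t + h t) has_integral (u t + v t - (u 0 + v 0))) {0..t}"
    by (simp add: algebra_simps)
qed

lemma is_deriv_uminus:
  assumes "is_deriv T u g"
  shows "is_deriv T (\<lambda>t. - u t) (\<lambda>t. - g t)"
  unfolding is_deriv_def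
proof (intro conjI ballI)
  show "in_Lp 1 norm UNIV 0 T (\<lambda>t. - g t)"
    using assms by (intro X0.in_Lp_uminus) (auto simp: is_deriv_def)
  fix t assume "t \<in> {0..T}"
  then have "(g has_integral (u t - u 0)) {0..t}"
    using assms by (auto simp: is_deriv_def)
  from has_integral_neg[OF this] show "((\<lambda>t. - g t) has_integral (- u t - - u 0)) {0..t}"
    by (simp add: algebra_simps)
qed

lemma strong_sol_cong:
  assumes "strong_sol X1 n1 T L f u0 u" "AE t in lebesgue_on {0<..<T}. f t = f' t"
  shows "strong_sol X1 n1 T L f' u0 u"
proof -
  obtain g where g: "is_deriv T u g" "AE t in lebesgue. t \<in> {0<..<T} \<longrightarrow> g t + L t (u t) = f t"
    using assms unfolding strong_sol_def by blast
  have "AE t in lebesgue. t \<in> {0<..<T} \<longrightarrow> g t + L t (u t) = f' t"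
    using g(2) assms(2) unfolding AE_lebesgue_on_iff[OF open_interval_in_lebesgue] by eventually_elim auto
  then show ?thesis using assms(1) g(1) unfolding strong_sol_def by blast
qed

context couple
begin

text \<open>Continuity on the compact interval bounds the trace norm; this is what passes from
  membership in E_p to an explicit bound, as needed to apply the uniqueness result to arbitrary
  solutions.\<close>

lemma in_Ep_Ep_bd: assumes T: "0 < T" and u: "in_Ep X1 n1 p T u" shows "\<exists>C. Ep_bd T u C"
proof -
  have uX: "u t \<in> Xg" and lim: "((\<lambda>s. Ng (u s - u t)) \<longlongrightarrow> 0) (at t within {0..T})" if "t \<in> {0..T}" for t
    using u that unfolding in_Ep_def by blast+
  have "continuous_on {0..T} (\<lambda>t. Ng (u t))"
    unfolding continuous_on
  proof
    fix t assume t: "t \<in> {0..T}"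
    have "((\<lambda>s. Ng (u s) - Ng (u t)) \<longlongrightarrow> 0) (at t within {0..T})"
    proof (rule Lim_null_comparison[OF _ lim[OF t]])
      show "\<forall>\<^sub>F s in at t within {0..T}. norm (Ng (u s) - Ng (u t)) \<le> Ng (u s - u t)"
        using NG.N_abs_diff uX t by (auto simp: eventually_at_filter intro!: always_eventually)
    qed
    then show "((\<lambda>s. Ng (u s)) \<longlongrightarrow> Ng (u t)) (at t within {0..T})" by (simp add: LIM_zero_iff)
  qed
  then have "bounded ((\<lambda>t. Ng (u t)) ` {0..T})" by (intro compact_imp_bounded compact_continuous_image) auto
  then obtain B where "\<forall>t\<in>{0..T}. \<bar>Ng (u t)\<bar> \<le> B" by (auto simp: bounded_iff)
  then have B: "Ng (u t) \<le> B" if "t \<in> {0..T}" for t using that by force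
  have "Lp_bd p n1 X1 0 T u (Lp_norm p n1 0 T u)" using u p by (intro N1.in_Lp_Lp_bd) (auto simp: in_Ep_def)
  then have "Ep_bd T u (max B (Lp_norm p n1 0 T u))"
    unfolding Ep_bd_def using uX lim B p by (auto intro: Lp_bd_bound_mono le_max_iff_disj[THEN iffD2])
  then show ?thesis by blast
qed

lemma Ep_norm_nonneg: assumes "Ep_bd T u C" "0 < T" shows "0 \<le> Ep_norm X1 n1 p T u"
proof -
  have "bdd_above ((\<lambda>t. Ng (u t)) ` {0..T})" using assms by (auto simp: Ep_bd_def intro!: bdd_aboveI[of _ C])
  then have "Ng (u 0) \<le> (SUP t\<in>{0..T}. Ng (u t))" by (rule cSUP_upper[rotated]) (use assms in auto)
  then show ?thesis unfolding Ep_norm_def using Ng_nonneg[of "u 0"] Lp_norm_nonneg[of p n1 0 T u] by linarith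
qed

lemma Lp_bd_n1_norm: "Lp_bd p n1 X1 a b u C \<Longrightarrow> Lp_bd p norm UNIV a b u (c0 * C)"
  using c0 p by (intro Lp_bd_norm_embedding[OF N1.nspace_axioms]) auto

end

text \<open>The factor 2 in \<open>A_Lp\<close> reflects that \<open>Ep_bd\<close> with C bounds the
  E_p norm by 2 C.\<close>

locale mr_problem = couple X1 n1 p for X1 :: "'a::banach set" and n1 p +
  fixes T :: real and A :: "real \<Rightarrow> 'a \<Rightarrow> 'a" and CA M :: real
  assumes T: "0 < T" and A_lin: "\<And>t. t \<in> {0..T} \<Longrightarrow> bounded_lin_on X1 n1 UNIV norm (A t)"
    and mr: "max_reg X1 n1 p T A" and MR: "MR_bound X1 n1 p T A M" and M: "0 \<le> M" and CA: "0 \<le> CA"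
    and A_Lp: "\<And>u C. Ep_bd T u C \<Longrightarrow> Lp_bd p norm UNIV 0 T (\<lambda>t. A t (u t)) (2 * CA * C)"
begin

text \<open>Assembled in \<open>solve\<close>: 400 c0 is the cost of the extension w, the bracket
  bounds the source left for maximal regularity, M is the maximal regularity constant, and 3 q = q
  (1 + 2) comes from the trace embedding.\<close>

definition C2 where "C2 = 400 * c0 + 3 * q * M * (1 + 400 * c0 + 800 * c0 * CA)"

lemma C2: "400 * c0 \<le> C2" "0 < C2"
proof -
  have "0 \<le> 3 * q * M * (1 + 400 * c0 + 800 * c0 * CA)" using q M CA c0(1) by (intro mult_nonneg_nonneg add_nonneg_nonneg) auto
  then show "400 * c0 \<le> C2" unfolding C2_def by linarith
  then show "0 < C2" using c0(1) by linarith
qed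

lemma A_add: "t \<in> {0..T} \<Longrightarrow> x \<in> X1 \<Longrightarrow> y \<in> X1 \<Longrightarrow> A t (x + y) = A t x + A t y"
  and A_scale: "t \<in> {0..T} \<Longrightarrow> x \<in> X1 \<Longrightarrow> A t (c *\<^sub>R x) = c *\<^sub>R A t x"
  using A_lin[of t] unfolding bounded_lin_on_def by blast+

lemma A_minus: "t \<in> {0..T} \<Longrightarrow> x \<in> X1 \<Longrightarrow> A t (- x) = - A t x"
  using A_scale[of t x "-1"] by simp

lemma strong_solI:
  assumes u: "Ep_bd T u C" and g: "is_deriv T u g" "AE t in lebesgue_on {0<..<T}. g t + A t (u t) = f t" and u0: "u 0 = u0"
  shows "strong_sol X1 n1 T A f u0 u"
proof -
  have 1: "Lp_bd p n1 X1 0 T u C" using u by (simp add: Ep_bd_def)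
  have "in_Lp 1 n1 X1 0 T u" using Lp_bd_in_Lp[OF N1.Lp_bd_imp_L1[OF 1]] p T by simp
  moreover have "in_Lp 1 norm UNIV 0 T u" using Lp_bd_in_Lp[OF X0.Lp_bd_imp_L1[OF Lp_bd_n1_norm[OF 1]]] p T by simp
  moreover have "in_Lp 1 norm UNIV 0 T (\<lambda>t. A t (u t))" using Lp_bd_in_Lp[OF X0.Lp_bd_imp_L1[OF A_Lp[OF u]]] p T by simp
  ultimately show ?thesis unfolding strong_sol_def using g u0
    by (auto simp: AE_lebesgue_on_iff)
qed

lemma strong_solD:
  assumes "strong_sol X1 n1 T A f u0 u"
  obtains g where "is_deriv T u g" "AE t in lebesgue_on {0<..<T}. g t + A t (u t) = f t"
  using assms unfolding strong_sol_def by (auto simp: AE_lebesgue_on_iff)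

lemma Ep_AE_X1: "Ep_bd T u C \<Longrightarrow> AE t in lebesgue_on {0<..<T}. u t \<in> X1"
  unfolding Ep_bd_def Lp_bd_def by (auto intro: N1.sm_inS)

lemma strong_sol_add:
  assumes u: "Ep_bd T u C" "strong_sol X1 n1 T A f u0 u" and v: "Ep_bd T v D" "strong_sol X1 n1 T A h v0 v"
  shows "strong_sol X1 n1 T A (\<lambda>t. f t + h t) (u0 + v0) (\<lambda>t. u t + v t)"
proof -
  obtain g where g: "is_deriv T u g" "AE t in lebesgue_on {0<..<T}. g t + A t (u t) = f t" using u(2) by (rule strong_solD)
  obtain k where k: "is_deriv T v k" "AE t in lebesgue_on {0<..<T}. k t + A t (v t) = h t" using v(2) by (rule strong_solD)
  show ?thesis
  proof (rule strong_solI[OF Ep_bd_add[OF u(1) v(1)] is_deriv_add[OF g(1) k(1)]])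
    show "AE t in lebesgue_on {0<..<T}. g t + k t + A t (u t + v t) = f t + h t"
      using g(2) k(2) Ep_AE_X1[OF u(1)] Ep_AE_X1[OF v(1)] AE_space
    proof eventually_elim
      case (elim t)
      then have "t \<in> {0..T}" by (simp add: space_restrict_space)
      then have "A t (u t + v t) = A t (u t) + A t (v t)" using elim by (intro A_add)
      then show ?case using elim(1,2) by (simp add: algebra_simps flip: elim(1,2))
    qed
    show "u 0 + v 0 = u0 + v0" using u(2) v(2) by (simp add: strong_sol_def)
  qed
qed

lemma strong_sol_uminus:
  assumes u: "Ep_bd T u C" "strong_sol X1 n1 T A f u0 u"
  shows "strong_sol X1 n1 T A (\<lambda>t. - f t) (- u0) (\<lambda>t. - u t)"
proof -
  obtain g where g: "is_deriv T u g" "AE t in lebesgue_on {0<..<T}. g t + A t (u t) = f t" using u(2) by (rule strong_solD)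
  show ?thesis
  proof (rule strong_solI[OF Ep_bd_uminus[OF u(1)] is_deriv_uminus[OF g(1)]])
    show "AE t in lebesgue_on {0<..<T}. - g t + A t (- u t) = - f t"
      using g(2) Ep_AE_X1[OF u(1)] AE_space
    proof eventually_elim
      case (elim t)
      then have "t \<in> {0..T}" by (simp add: space_restrict_space)
      then have "A t (- u t) = - A t (u t)" using elim by (intro A_minus)
      then show ?case using elim(1) by (simp flip: elim(1))
    qed
    show "- u 0 = - u0" using u(2) by (simp add: strong_sol_def)
  qed
qed

lemma strong_sol_diff:
  assumes u: "Ep_bd T u C" "strong_sol X1 n1 T A f u0 u" and v: "Ep_bd T v D" "strong_sol X1 n1 T A h v0 v"
  shows "Ep_bd T (\<lambda>t. u t - v t) (C + D)" "strong_sol X1 n1 T A (\<lambda>t. f t - h t) (u0 - v0) (\<lambda>t. u t - v t)"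
  using strong_sol_add[OF u Ep_bd_uminus[OF v(1)] strong_sol_uminus[OF v]] Ep_bd_add[OF u(1) Ep_bd_uminus[OF v(1)]] by auto

text \<open>Subtracting a function w that has the initial value u0 and absorbs h leaves zero initial
  value and the source F = g - r - A w. The bound of A by the E_p norm puts F into L^p, so maximal
  regularity applies to the remainder.\<close>

lemma solve:
  assumes u0: "u0 \<in> Xg" and g: "Lp_bd p norm UNIV 0 T g \<gamma>" and h: "Lp_bd 1 Ng Xg 0 T h c"
  shows "\<exists>u. Ep_bd T u (C2 * (Ng u0 + \<gamma> + c)) \<and> strong_sol X1 n1 T A (\<lambda>t. g t + h t) u0 u"
proof -
  define D where "D = Ng u0 + c"
  have c: "0 \<le> c" "0 \<le> \<gamma>" "0 \<le> D" using Lp_bd_0_le[OF h] Lp_bd_0_le[OF g] Ng_nonneg[of u0] by (auto simp: D_def)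
  obtain w r where w: "w 0 = u0" "Ep_bd T w (400 * c0 * D)" and r: "Lp_bd p norm UNIV 0 T r (400 * c0 * D)"
     and wr: "\<And>t. t \<in> {0..T} \<Longrightarrow> ((\<lambda>s. h s + r s) has_integral w t - u0) {0..t}"
    using extension_exists[OF T u0 h] unfolding D_def by blast
  define F where "F t = g t - r t - A t (w t)" for t
  define \<Phi> where "\<Phi> = \<gamma> + 400 * c0 * D + 2 * CA * (400 * c0 * D)"
  have F: "Lp_bd p norm UNIV 0 T F \<Phi>" unfolding F_def \<Phi>_def
    by (intro X0.Lp_bd_diff g r A_Lp w) (use p in auto)
  obtain v g2 where v: "strong_sol X1 n1 T A F 0 v" "in_Lp p n1 X1 0 T v" "in_Lp p norm UNIV 0 T v"
      and g2: "is_deriv T v g2" "in_Lp p norm UNIV 0 T g2"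
    using mr Lp_bd_in_Lp[OF F] unfolding max_reg_def by blast
  have "max (Lp_norm p n1 0 T v) (Lp_norm p norm 0 T v + Lp_norm p norm 0 T g2) \<le> M * Lp_norm p norm 0 T F"
    using MR T Lp_bd_in_Lp[OF F] v g2 unfolding MR_bound_def by (meson greaterThanAtMost_iff order.refl)
  also have "\<dots> \<le> M * \<Phi>" using M p by (intro mult_left_mono Lp_bd_norm_le[OF F]) auto
  finally have le: "Lp_norm p n1 0 T v \<le> M * \<Phi>" "Lp_norm p norm 0 T g2 \<le> M * \<Phi>"
    using Lp_norm_nonneg[of p norm 0 T v] by auto
  have vL: "Lp_bd p n1 X1 0 T v (M * \<Phi>)" using p le by (intro Lp_bd_bound_mono[OF N1.in_Lp_Lp_bd[OF v(2)]]) auto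
  have gL: "Lp_bd p norm UNIV 0 T g2 (M * \<Phi>)" using p le by (intro Lp_bd_bound_mono[OF X0.in_Lp_Lp_bd[OF g2(2)]]) auto
  have v0: "v 0 = 0" using v(1) by (simp add: strong_sol_def)
  have "Ep_bd T v (q * (M * \<Phi> + 2 * (M * \<Phi>)))"
    by (rule trace_Ep[OF T vL gL v0]) (use g2(1) v0 in \<open>auto simp: is_deriv_def\<close>)
  then have vE: "Ep_bd T v (3 * q * M * \<Phi>)" by (simp add: algebra_simps)
  have uE: "Ep_bd T (\<lambda>t. w t + v t) (400 * c0 * D + 3 * q * M * \<Phi>)" by (rule Ep_bd_add[OF w(2) vE])
  have "400 * c0 * D + 3 * q * M * \<Phi> \<le> C2 * (D + \<gamma>)"
  proof -
    have "\<Phi> \<le> (1 + 400 * c0 + 800 * c0 * CA) * (D + \<gamma>)"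
    proof -
      have "0 \<le> (400 * c0 + 800 * c0 * CA) * \<gamma>" "0 \<le> D" using c CA c0(1) by auto
      then show ?thesis by (simp add: \<Phi>_def algebra_simps)
    qed
    then have "3 * q * M * \<Phi> \<le> 3 * q * M * ((1 + 400 * c0 + 800 * c0 * CA) * (D + \<gamma>))"
      using q M by (intro mult_left_mono) auto
    moreover have "400 * c0 * D \<le> 400 * c0 * (D + \<gamma>)" using c c0(1) by (intro mult_left_mono) auto
    ultimately show ?thesis by (simp add: C2_def distrib_right mult.assoc)
  qed
  then have "Ep_bd T (\<lambda>t. w t + v t) (C2 * (Ng u0 + \<gamma> + c))" by (intro Ep_bd_mono[OF uE]) (simp add: D_def algebra_simps)
  moreover have "strong_sol X1 n1 T A (\<lambda>t. g t + h t) u0 (\<lambda>t. w t + v t)"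
  proof -
    obtain g1 where g1: "is_deriv T v g1" "AE t in lebesgue_on {0<..<T}. g1 t + A t (v t) = F t" using v(1) by (rule strong_solD)
    have "Lp_bd 1 norm UNIV 0 T (\<lambda>t. h t + r t) (2 * c0 * c + (1 + (T - 0)) * (400 * c0 * D))"
      by (intro X0.Lp_bd_add L1_Ng_norm h X0.Lp_bd_imp_L1[OF r]) (use p T in auto)
    then have "is_deriv T w (\<lambda>t. h t + r t)" unfolding is_deriv_def using wr w(1) by (auto dest: Lp_bd_in_Lp)
    from is_deriv_add[OF this g1(1)] have d: "is_deriv T (\<lambda>t. w t + v t) (\<lambda>t. h t + r t + g1 t)" .
    show ?thesis
    proof (rule strong_solI[OF uE d])
      show "AE t in lebesgue_on {0<..<T}. h t + r t + g1 t + A t (w t + v t) = g t + h t"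
        using g1(2) Ep_AE_X1[OF w(2)] Ep_AE_X1[OF vE] AE_space
      proof eventually_elim
        case (elim t)
        then have "t \<in> {0..T}" by (simp add: space_restrict_space)
        then have *: "A t (w t + v t) = A t (w t) + A t (v t)" using elim by (intro A_add)
        have "g1 t = F t - A t (v t)" using elim(1) by (simp add: eq_diff_eq)
        then show ?case unfolding * by (simp add: F_def)
      qed
      show "w 0 + v 0 = u0" using w v0 by simp
    qed
  qed
  ultimately show ?thesis by blast
qed

text \<open>Uniqueness on (0, \<tau>) from the quantitative maximal regularity bound with source 0.
  The regularity it asks for holds because the derivative is - A d, which is in L^p. The bound kills
  the derivative, and integration gives d = 0 at every t.\<close>

lemma zero_until:
  assumes d: "Ep_bd T d C" "strong_sol X1 n1 T A f 0 d" and \<tau>: "0 < \<tau>" "\<tau> \<le> T"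
    and f: "AE t in lebesgue_on {0<..<\<tau>}. f t = 0" and t: "t \<in> {0..\<tau>}"
  shows "d t = 0"
proof -
  obtain g where g: "is_deriv T d g" "AE t in lebesgue_on {0<..<T}. g t + A t (d t) = f t" using d(2) by (rule strong_solD)
  have p1: "1 \<le> p" "0 < p" using p by auto
  have sub: "AE t in lebesgue_on {0<..<\<tau>}. P t" if "AE t in lebesgue_on {0<..<T}. P t" for P
    using that unfolding AE_lebesgue_on_iff[OF open_interval_in_lebesgue] by eventually_elim (use \<tau> in auto)
  have g0: "AE t in lebesgue_on {0<..<\<tau>}. g t + A t (d t) = 0" using sub[OF g(2)] f by eventually_elim simp
  have Ad: "in_Lp p norm UNIV 0 \<tau> (\<lambda>t. A t (d t))"
    using Lp_bd_in_Lp[OF X0.Lp_bd_subinterval[OF A_Lp[OF d(1)]], of 0 \<tau>] \<tau> by simp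
  have gp: "in_Lp p norm UNIV 0 \<tau> g"
  proof (rule X0.in_Lp_cong[OF p1(2) X0.in_Lp_uminus[OF p1(1) Ad]])
    show "AE t in lebesgue_on {0<..<\<tau>}. g t = - A t (d t)" using g0 by eventually_elim (simp add: eq_neg_iff_add_eq_0)
  qed
  have dL: "Lp_bd p n1 X1 0 \<tau> d C" using d(1) \<tau> unfolding Ep_bd_def by (auto intro: N1.Lp_bd_subinterval)
  have dp: "in_Lp p n1 X1 0 \<tau> d" "in_Lp p norm UNIV 0 \<tau> d" using Lp_bd_in_Lp[OF dL] Lp_bd_in_Lp[OF Lp_bd_n1_norm[OF dL]] by auto
  have gd: "is_deriv \<tau> d g" unfolding is_deriv_def
  proof
    show "in_Lp 1 norm UNIV 0 \<tau> g" by (rule X0.in_Lp_L1[OF p1(1) _ gp]) (use \<tau> in simp)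
    show "\<forall>t\<in>{0..\<tau>}. (g has_integral d t - d 0) {0..t}" using g(1) \<tau> unfolding is_deriv_def by auto
  qed
  have d0: "d 0 = 0" using d(2) by (simp add: strong_sol_def)
  have "strong_sol X1 n1 \<tau> A (\<lambda>t. 0) 0 d"
    unfolding strong_sol_def
    using X0.in_Lp_L1[OF p1(1) _ dp(2)] N1.in_Lp_L1[OF p1(1) _ dp(1)] X0.in_Lp_L1[OF p1(1) _ Ad] \<tau> d0 gd g0
    by (auto simp: AE_lebesgue_on_iff)
  moreover have z: "Lp_bd p norm UNIV 0 \<tau> (\<lambda>t. 0::'a) 0" using p by (intro X0.Lp_bd_zero) auto
  ultimately have "max (Lp_norm p n1 0 \<tau> d) (Lp_norm p norm 0 \<tau> d + Lp_norm p norm 0 \<tau> g) \<le> M * Lp_norm p norm 0 \<tau> (\<lambda>t. 0::'a)"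
    using MR \<tau> Lp_bd_in_Lp[OF z] dp gd gp unfolding MR_bound_def by (meson greaterThanAtMost_iff)
  also have "\<dots> \<le> M * 0" using M p by (intro mult_left_mono Lp_bd_norm_le[OF z]) auto
  finally have "Lp_norm p norm 0 \<tau> g \<le> 0" using Lp_norm_nonneg[of p norm 0 \<tau> d] by auto
  then have "Lp_bd p norm UNIV 0 \<tau> g 0" using p by (intro Lp_bd_bound_mono[OF X0.in_Lp_Lp_bd[OF gp]]) auto
  then have "AE t in lebesgue_on {0<..<\<tau>}. norm (g t) = 0" using p by (intro Lp_le_0D[of p]) (auto simp: Lp_bd_def)
  then have "AE t in lebesgue_on {0<..<\<tau>}. g t = 0" by eventually_elim simp
  moreover have "(g has_integral d t - d 0) {0..t}" using g(1) \<tau> t unfolding is_deriv_def by auto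
  ultimately have "((\<lambda>t. 0) has_integral d t - d 0) {0..t}" by (rule has_integral_AE_cong) (use t in auto)
  then show "d t = 0" using d0 by (simp add: has_integral_0_eq)
qed

text \<open>The source is cut off at \<tau> and solved on all of (0, T) with the constant
  \<open>C2\<close>; by \<open>zero_until\<close> the two solutions agree up to \<tau>. The constant
  is thus the same for every \<tau>, as the Volterra argument requires.\<close>

lemma causal:
  assumes u: "Ep_bd T u C" "strong_sol X1 n1 T A h 0 u" and h: "NG.sm 0 T h"
    and \<tau>: "0 < \<tau>" "\<tau> \<le> T" and c: "Lp_bd 1 Ng Xg 0 \<tau> h c"
  shows "Lp_bd p n1 X1 0 \<tau> u (C2 * c)"
proof -
  define h' where "h' t = indicat_real {0<..<\<tau>} t *\<^sub>R h t" for t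
  have h'L: "Lp_bd 1 Ng Xg 0 T h' c" unfolding Lp_bd_def
  proof
    show sm: "NG.sm 0 T h'" unfolding h'_def
      by (intro NG.sm_scale_fun h measurable_restrict_space1 borel_measurable_indicator) simp
    have "(\<integral>\<^sup>+ t. ennreal (Ng (h' t) powr 1) \<partial>lebesgue_on {0<..<T}) = (\<integral>\<^sup>+ t. ennreal (Ng (h t) powr 1) \<partial>lebesgue_on {0<..<\<tau>})"
      using \<tau> by (subst (1 2) nn_integral_restrict_space) (auto intro!: nn_integral_cong simp: indicator_def h'_def Xg_0)
    also have "\<dots> \<le> ennreal (c powr 1)" using c unfolding Lp_bd_def by (auto dest: Lp_leD(4))
    finally show "Lp_le 1 (lebesgue_on {0<..<T}) (\<lambda>t. Ng (h' t)) c"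
      unfolding Lp_le_def using NG.sm_meas_N[OF sm] Lp_bd_0_le[OF c] Ng_nonneg by auto
  qed
  have z: "Lp_bd p norm UNIV 0 T (\<lambda>t. 0::'a) 0" using p by (intro X0.Lp_bd_zero) auto
  have "\<exists>v. Ep_bd T v (C2 * c) \<and> strong_sol X1 n1 T A h' 0 v" using solve[OF Xg_0(1) z h'L] by (simp add: Xg_0)
  then obtain v where v: "Ep_bd T v (C2 * c)" "strong_sol X1 n1 T A h' 0 v" by blast
  note d = strong_sol_diff[OF u v]
  have "u t - v t = 0" if "t \<in> {0..\<tau>}" for t
  proof (rule zero_until[OF d(1) _ \<tau> _ that])
    show "strong_sol X1 n1 T A (\<lambda>t. h t - h' t) 0 (\<lambda>t. u t - v t)" using d(2) by simp
    show "AE t in lebesgue_on {0<..<\<tau>}. h t - h' t = 0"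
      by (rule AE_I2) (auto simp: h'_def space_restrict_space)
  qed
  then have eq: "AE t in lebesgue_on {0<..<\<tau>}. u t = v t" by (intro AE_I2) (auto simp: space_restrict_space)
  have "Lp_bd p n1 X1 0 \<tau> v (C2 * c)"
    using v(1) \<tau> unfolding Ep_bd_def by (auto intro: N1.Lp_bd_subinterval)
  from N1.Lp_bd_cong_AE[OF this eq] show ?thesis using p by simp
qed

end

section \<open>The perturbed problem\<close>

locale perturbed_problem = mr_problem +
  fixes B :: "real \<Rightarrow> 'a \<Rightarrow> 'a" and b :: "real \<Rightarrow> real" and \<beta> :: real
  assumes B_lin: "\<And>t. t \<in> {0..T} \<Longrightarrow> bounded_lin_on X1 n1 Xg Ng (B t)"
    and B_meas: "\<And>x. x \<in> X1 \<Longrightarrow> NG.sm 0 T (\<lambda>t. B t x)"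
    and b: "Lp_le q (lebesgue_on {0<..<T}) (\<lambda>t. \<bar>b t\<bar>) \<beta>"
    and B_le: "AE t in lebesgue_on {0<..<T}. \<forall>x\<in>X1. Ng (B t x) \<le> b t * n1 x"
begin

lemma \<beta>: "0 \<le> \<beta>" using Lp_leD(1)[OF b] .

lemma B_in: "t \<in> {0..T} \<Longrightarrow> x \<in> X1 \<Longrightarrow> B t x \<in> Xg"
  and B_add: "t \<in> {0..T} \<Longrightarrow> x \<in> X1 \<Longrightarrow> y \<in> X1 \<Longrightarrow> B t (x + y) = B t x + B t y"
  and B_scale: "t \<in> {0..T} \<Longrightarrow> x \<in> X1 \<Longrightarrow> B t (c *\<^sub>R x) = c *\<^sub>R B t x"
  using B_lin[of t] unfolding bounded_lin_on_def by blast+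

lemma B_diff: "t \<in> {0..T} \<Longrightarrow> x \<in> X1 \<Longrightarrow> y \<in> X1 \<Longrightarrow> B t (x - y) = B t x - B t y"
  using B_add[of t x "- y"] B_scale[of t y "-1"] N1.S_scale[of y "-1"] by simp

lemma B_0: "t \<in> {0..T} \<Longrightarrow> B t 0 = 0"
  using B_scale[of t 0 0] N1.S_0 by simp

lemma B_le_abs: "AE t in lebesgue_on {0<..<T}. \<forall>x\<in>X1. Ng (B t x) \<le> \<bar>b t\<bar> * n1 x"
  using B_le
proof eventually_elim
  case (elim t)
  show ?case
  proof
    fix x assume x: "x \<in> X1"
    have "b t * n1 x \<le> \<bar>b t\<bar> * n1 x" using N1.N_nonneg[OF x] by (intro mult_right_mono) auto
    then show "Ng (B t x) \<le> \<bar>b t\<bar> * n1 x" using elim x by force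
  qed
qed

text \<open>On a simple function the composition is a finite sum of indicators times t \<mapsto> B t
  y, measurable by assumption; the passage to the limit is controlled by |b t| times the distance in
  \<open>X1\<close>.\<close>

lemma B_sm: assumes u: "N1.sm 0 T u" shows "NG.sm 0 T (\<lambda>t. B t (u t))"
proof -
  obtain s where s: "\<And>n. simple_fun (s n)" "\<And>n. range (s n) \<subseteq> X1"
     "AE t in lebesgue_on {0<..<T}. (\<lambda>n::nat. n1 (s n t - u t)) \<longlonglongrightarrow> 0"
    using u unfolding N1.sm_iff by auto
  have sX: "s n t \<in> X1" for n t using s(2)[of n] by auto
  show ?thesis
  proof (rule NG.sm_lim[where f="\<lambda>n t. B t (s n t)"])
    show "AE t in lebesgue_on {0<..<T}. B t (u t) \<in> Xg"
      using N1.sm_inS[OF u] AE_space by eventually_elim (rule B_in, auto simp: space_restrict_space)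
    show "AE t in lebesgue_on {0<..<T}. (\<lambda>n. Ng (B t (s n t) - B t (u t))) \<longlonglongrightarrow> 0"
      using N1.sm_inS[OF u] AE_space s(3) B_le_abs
    proof eventually_elim
      case (elim t)
      then have t: "t \<in> {0..T}" by (simp add: space_restrict_space)
      show ?case
      proof (rule Lim_null_comparison)
        show "(\<lambda>n. \<bar>b t\<bar> * n1 (s n t - u t)) \<longlonglongrightarrow> 0" using tendsto_mult_right_zero[OF elim(3)] .
        have "norm (Ng (B t (s n t) - B t (u t))) \<le> \<bar>b t\<bar> * n1 (s n t - u t)" for n
          using elim(4) N1.S_diff[OF sX elim(1), of n t] B_diff[OF t sX elim(1), of n t] Ng_nonneg by (auto simp: abs_of_nonneg)
        then show "\<forall>\<^sub>F n in sequentially. norm (Ng (B t (s n t) - B t (u t))) \<le> \<bar>b t\<bar> * n1 (s n t - u t)" by simp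
      qed
    qed
    fix n
    have eq: "B t (s n t) = (\<Sum>y\<in>range (s n). indicat_real (s n -` {y}) t *\<^sub>R B t y)" for t
    proof -
      have "(\<Sum>y\<in>range (s n). indicat_real (s n -` {y}) t *\<^sub>R B t y) = (\<Sum>y\<in>range (s n). if y = s n t then B t y else 0)"
        by (rule sum.cong) (auto simp: indicator_def)
      then show ?thesis using s(1)[of n] by (simp add: simple_fun_def)
    qed
    show "NG.sm 0 T (\<lambda>t. B t (s n t))" unfolding eq
    proof (intro NG.sm_sum NG.sm_scale_fun B_meas)
      fix y assume "y \<in> range (s n)"
      then show "y \<in> X1" using sX by auto
      show "indicat_real (s n -` {y}) \<in> borel_measurable (lebesgue_on {0<..<T})"
        using s(1)[of n] by (intro measurable_restrict_space1 borel_measurable_indicator) (auto simp: simple_fun_def)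
    qed
  qed
qed

lemma B_L1:
  assumes u: "N1.sm 0 T u" and \<tau>: "\<tau> \<le> T" and L: "Lp_le 1 (lebesgue_on {0<..<\<tau>}) (\<lambda>t. \<bar>b t\<bar> * n1 (u t)) c"
  shows "Lp_bd 1 Ng Xg 0 \<tau> (\<lambda>t. B t (u t)) c"
proof (rule NG.Lp_bd_le[OF L])
  show "NG.sm 0 \<tau> (\<lambda>t. B t (u t))" by (rule NG.sm_subinterval[OF B_sm[OF u]]) (use \<tau> in auto)
  have "AE t in lebesgue_on {0<..<T}. Ng (B t (u t)) \<le> \<bar>b t\<bar> * n1 (u t)"
    using N1.sm_inS[OF u] B_le_abs by eventually_elim auto
  then show "AE t in lebesgue_on {0<..<\<tau>}. Ng (B t (u t)) \<le> \<bar>b t\<bar> * n1 (u t)"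
    unfolding AE_lebesgue_on_iff[OF open_interval_in_lebesgue] by eventually_elim (use \<tau> in auto)
qed simp

lemma B_Lp:
  assumes u: "Lp_bd p n1 X1 0 T u U"
  shows "Lp_bd 1 Ng Xg 0 T (\<lambda>t. B t (u t)) (\<beta> * U)"
proof (rule B_L1)
  have q1: "1/p + 1/q = 1" using p by (auto simp: q_def field_simps)
  show "Lp_le 1 (lebesgue_on {0<..<T}) (\<lambda>t. \<bar>b t\<bar> * n1 (u t)) (\<beta> * U)"
    using Lp_le_Hoelder[OF p q q1 _ b, of "\<lambda>t. n1 (u t)" U] u by (simp add: Lp_bd_def mult.commute)
qed (use u in \<open>auto simp: Lp_bd_def\<close>)

text \<open>The price of returning from the weighted norm of \<open>Volterra_iteration\<close>, with
  C = C2, to the plain one.\<close>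

definition \<Gamma> where "\<Gamma> = 2 ^ (nat \<lceil>(4 * C2 * \<beta>) powr q\<rceil> + 1)"

text \<open>Stated for arbitrary sequences because it serves twice: for the iterates in the
  existence proof and for a constant sequence in the uniqueness proof. Causality supplies the
  Volterra step, and the result is expressed by the L^p(X1) bound \<open>U\<close> of the first
  term.\<close>

lemma contraction:
  assumes u: "\<And>n. Ep_bd T (u n) (c n)" and sol: "\<And>n. strong_sol X1 n1 T A (\<lambda>t. - B t (u n t)) 0 (u (Suc n))"
    and u0: "Lp_bd p n1 X1 0 T (u 0) U"
  shows "Lp_bd p n1 X1 0 T (u n) ((1/2) ^ n * \<Gamma> * U)"
proof -
  have sm: "N1.sm 0 T (u n)" for n using u[of n] by (simp add: Ep_bd_def Lp_bd_def)
  define a where "a n = (if n = 0 then U else c n)" for n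
  have "Lp_le p (lebesgue_on {0<..<T}) (\<lambda>t. n1 (u n t)) ((1/2) ^ n * 2 ^ (nat \<lceil>(4 * C2 * \<beta>) powr q\<rceil> + 1) * a 0)"
  proof (rule Volterra_iteration[OF p q_def T C2(2) b, of "\<lambda>n t. n1 (u n t)"])
    show "Lp_le p (lebesgue_on {0<..<T}) (\<lambda>t. n1 (u n t)) (a n)" for n
      using u[of n] u0 by (auto simp: Ep_bd_def Lp_bd_def a_def)
    fix n \<tau> c assume \<tau>: "0 < \<tau>" "\<tau> \<le> T" and L: "Lp_le 1 (lebesgue_on {0<..<\<tau>}) (\<lambda>t. \<bar>b t\<bar> * n1 (u n t)) c"
    have "Lp_bd 1 Ng Xg 0 \<tau> (\<lambda>t. - B t (u n t)) c" by (rule NG.Lp_bd_minus[OF B_L1[OF sm \<tau>(2) L]]) simp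
    moreover have "NG.sm 0 T (\<lambda>t. - B t (u n t))" using NG.sm_scale[OF B_sm[OF sm[of n]], of "-1"] by simp
    ultimately have "Lp_bd p n1 X1 0 \<tau> (u (Suc n)) (C2 * c)" by (intro causal[OF u sol _ \<tau>])
    then show "Lp_le p (lebesgue_on {0<..<\<tau>}) (\<lambda>t. n1 (u (Suc n) t)) (C2 * c)" by (simp add: Lp_bd_def)
  qed
  then show ?thesis using sm[of n] by (simp add: Lp_bd_def \<Gamma>_def a_def)
qed

text \<open>\<open>B u\<close> is integrable into X0, so it may be moved to the right-hand side, and
  the integrability clause of \<open>strong_sol\<close> holds for A u and A u + B u alike.\<close>

lemma strong_sol_iff:
  assumes u: "Ep_bd T u C"
  shows "strong_sol X1 n1 T (\<lambda>t x. A t x + B t x) f u0 u \<longleftrightarrow> strong_sol X1 n1 T A (\<lambda>t. f t - B t (u t)) u0 u"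
proof -
  have uL: "Lp_bd p n1 X1 0 T u C" using u by (simp add: Ep_bd_def)
  have A1: "in_Lp 1 norm UNIV 0 T (\<lambda>t. A t (u t))" using Lp_bd_in_Lp[OF X0.Lp_bd_imp_L1[OF A_Lp[OF u]]] p T by simp
  have "in_Lp 1 norm UNIV 0 T (\<lambda>t. B t (u t))" using Lp_bd_in_Lp[OF L1_Ng_norm[OF B_Lp[OF uL]]] .
  then have "in_Lp 1 norm UNIV 0 T (\<lambda>t. A t (u t) + B t (u t))" by (intro X0.in_Lp_add A1) auto
  moreover have "x + (y + z) = w \<longleftrightarrow> x + y = w - z" for x y z w :: 'a by (simp add: eq_diff_eq add.assoc)
  ultimately show ?thesis unfolding strong_sol_def using A1 by simp
qed

text \<open>The difference d solves the unperturbed problem with source - B d, so the constant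
  sequence d satisfies the contraction estimate for every n and d = 0 almost everywhere. Then the
  source vanishes, and \<open>zero_until\<close> gives equality at every time.\<close>

lemma unique:
  assumes u: "Ep_bd T u C" "strong_sol X1 n1 T (\<lambda>t x. A t x + B t x) f u0 u"
    and v: "Ep_bd T v D" "strong_sol X1 n1 T (\<lambda>t x. A t x + B t x) f u0 v" and t: "t \<in> {0..T}"
  shows "v t = u t"
proof -
  define d where "d t = v t - u t" for t
  note uv = u(2)[unfolded strong_sol_iff[OF u(1)]] v(2)[unfolded strong_sol_iff[OF v(1)]]
  have d: "Ep_bd T d (D + C)" "strong_sol X1 n1 T A (\<lambda>t. f t - B t (v t) - (f t - B t (u t))) 0 d"
    using strong_sol_diff[OF v(1) uv(2) u(1) uv(1)] by (simp_all add: d_def[abs_def])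
  have dX: "AE t in lebesgue_on {0<..<T}. d t \<in> X1" by (rule Ep_AE_X1[OF d(1)])
  have sol: "strong_sol X1 n1 T A (\<lambda>t. - B t (d t)) 0 d"
  proof (rule strong_sol_cong[OF d(2)])
    show "AE t in lebesgue_on {0<..<T}. f t - B t (v t) - (f t - B t (u t)) = - B t (d t)"
      using Ep_AE_X1[OF u(1)] Ep_AE_X1[OF v(1)] AE_space
      by eventually_elim (simp add: d_def B_diff space_restrict_space)
  qed
  have U: "Lp_bd p n1 X1 0 T d (D + C)" using d(1) by (simp add: Ep_bd_def)
  have "Lp_bd p n1 X1 0 T d ((1/2) ^ n * \<Gamma> * (D + C))" for n
    by (rule contraction[of "\<lambda>n. d" "\<lambda>n. D + C"]) (use d sol U in auto)
  then have "Lp_le p (lebesgue_on {0<..<T}) (\<lambda>t. n1 (d t)) ((1/2) ^ n * \<Gamma> * (D + C))" for n by (simp add: Lp_bd_def)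
  moreover have "(\<lambda>n. (1/2) ^ n * \<Gamma> * (D + C)) \<longlonglongrightarrow> 0 * \<Gamma> * (D + C)"
    by (intro tendsto_intros LIMSEQ_realpow_zero) auto
  moreover have "(\<lambda>t. n1 (d t)) \<in> borel_measurable (lebesgue_on {0<..<T})"
    using U by (auto simp: Lp_bd_def dest: Lp_leD(2))
  ultimately have "Lp_le p (lebesgue_on {0<..<T}) (\<lambda>t. n1 (d t)) (0 * \<Gamma> * (D + C))"
    using Lp_le_lim[of p _ "\<lambda>n t. n1 (d t)" "\<lambda>n. (1/2) ^ n * \<Gamma> * (D + C)"] p by simp
  then have "AE t in lebesgue_on {0<..<T}. n1 (d t) = 0" using p by (intro Lp_le_0D[of p]) auto
  with dX have "AE t in lebesgue_on {0<..<T}. d t = 0" by eventually_elim (rule n1_eq_0)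
  with AE_space have "AE t in lebesgue_on {0<..<T}. - B t (d t) = 0"
    by eventually_elim (simp add: B_0 space_restrict_space)
  then have "d t = 0" using T t by (intro zero_until[OF d(1) sol]) auto
  then show ?thesis by (simp add: d_def)
qed

text \<open>With D the size of the data, the series of iterates has L^p(X1) norm at most 2 \<Gamma>
  C2 D; times \<beta> this is the additional L^1 source in the last application of
  \<open>solve\<close>.\<close>

definition C3 where "C3 = C2 * (1 + 2 * \<beta> * \<Gamma> * C2)"

text \<open>The Neumann series W of the iterates is not differentiated. Instead V solves the
  unperturbed problem with B W moved to the right-hand side, and V = W almost everywhere follows by
  comparing V with the partial sums. As an output of \<open>solve\<close>, V is a strong solution
  with an E_p bound.\<close>

lemma solve_perturbed:
  assumes u0: "u0 \<in> Xg" and g: "Lp_bd p norm UNIV 0 T g \<gamma>" and h: "Lp_bd 1 Ng Xg 0 T h c"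
  shows "\<exists>u. Ep_bd T u (C3 * (Ng u0 + \<gamma> + c)) \<and> strong_sol X1 n1 T (\<lambda>t x. A t x + B t x) (\<lambda>t. g t + h t) u0 u"
proof -
  define D where "D = Ng u0 + \<gamma> + c"
  have D: "0 \<le> D" using Lp_bd_0_le[OF h] Lp_bd_0_le[OF g] Ng_nonneg[of u0] by (auto simp: D_def)
  have z: "Lp_bd p norm UNIV 0 T (\<lambda>t. 0::'a) 0" using p by (intro X0.Lp_bd_zero) auto
  obtain w0 where w0: "Ep_bd T w0 (C2 * D)" "strong_sol X1 n1 T A (\<lambda>t. g t + h t) u0 w0"
    using solve[OF u0 g h] unfolding D_def by blast
  \<comment> \<open>The E_p bound is demanded for every admissible c, so that the small L^1 bounds
    produced afterwards by \<open>contraction\<close> can be inserted for iterates already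
    chosen.\<close>
  define Q where "Q u v \<longleftrightarrow> strong_sol X1 n1 T A (\<lambda>t. - B t (u t)) 0 v \<and>
     (\<forall>c. Lp_bd 1 Ng Xg 0 T (\<lambda>t. B t (u t)) c \<longrightarrow> Ep_bd T v (C2 * c))" for u v
  have exQ: "\<exists>v. Q u v" if "Ep_bd T u C" for u C
  proof -
    have L: "Lp_bd 1 Ng Xg 0 T (\<lambda>t. B t (u t)) (\<beta> * C)" using that by (intro B_Lp) (simp add: Ep_bd_def)
    define k where "k = Lp_norm 1 Ng 0 T (\<lambda>t. B t (u t))"
    have "Lp_bd 1 Ng Xg 0 T (\<lambda>t. B t (u t)) k" unfolding k_def by (rule NG.in_Lp_Lp_bd[OF Lp_bd_in_Lp[OF L]]) simp
    from NG.Lp_bd_minus[OF this] have "Lp_bd 1 Ng Xg 0 T (\<lambda>t. - B t (u t)) k" by simp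
    from solve[OF Xg_0(1) z this] obtain v where v: "Ep_bd T v (C2 * k)" "strong_sol X1 n1 T A (\<lambda>t. - B t (u t)) 0 v"
      by (auto simp: Xg_0)
    have "Ep_bd T v (C2 * c)" if "Lp_bd 1 Ng Xg 0 T (\<lambda>t. B t (u t)) c" for c
      using C2(2) Lp_bd_norm_le[OF that] by (intro Ep_bd_mono[OF v(1)] mult_left_mono) (auto simp: k_def)
    then show ?thesis using v unfolding Q_def by blast
  qed
  define us where "us = rec_nat w0 (\<lambda>n u. SOME v. Q u v)"
  have us0: "us 0 = w0" and usS: "us (Suc n) = (SOME v. Q (us n) v)" for n by (simp_all add: us_def)
  have ex: "\<exists>C. Ep_bd T (us n) C" for n
  proof (induction n)
    case 0 then show ?case using w0 us0 by auto
  next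
    case (Suc n)
    then obtain C where C: "Ep_bd T (us n) C" by blast
    have "Q (us n) (us (Suc n))" unfolding usS using exQ[OF C] by (rule someI_ex)
    moreover have "Lp_bd 1 Ng Xg 0 T (\<lambda>t. B t (us n t)) (\<beta> * C)" using C by (intro B_Lp) (simp add: Ep_bd_def)
    ultimately show ?case unfolding Q_def by blast
  qed
  then have "\<exists>k. \<forall>n. Ep_bd T (us n) (k n)" by (intro choice allI)
  then obtain k where k: "\<And>n. Ep_bd T (us n) (k n)" by blast
  have Q: "Q (us n) (us (Suc n))" for n unfolding usS using exQ[OF k] by (rule someI_ex)
  have U0: "Lp_bd p n1 X1 0 T (us 0) (C2 * D)" using w0 by (simp add: us0 Ep_bd_def)
  have L: "Lp_bd p n1 X1 0 T (us n) ((1/2) ^ n * \<Gamma> * (C2 * D))" for n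
    by (rule contraction[of us k]) (use Q k U0 in \<open>auto simp: Q_def\<close>)
  define e where "e n = (1/2) ^ n * \<Gamma> * (C2 * D)" for n
  have L: "Lp_bd p n1 X1 0 T (us n) (e n)" for n using L unfolding e_def .
  have geo: "(\<lambda>n. (1/2::real) ^ n) sums 2" using geometric_sums[of "1/2::real"] by simp
  have e: "e sums (2 * \<Gamma> * (C2 * D))" unfolding e_def[abs_def] by (intro sums_mult2 geo)
  have E: "Ep_bd T (us (Suc n)) (C2 * (\<beta> * e n))" for n using Q[of n] B_Lp[OF L[of n]] unfolding Q_def by blast
  \<comment> \<open>Index shift: the E_p bound of iterate n + 1 comes from the L^p(X1) bound of
    iterate n.\<close>
  define c' where "c' n = (case n of 0 \<Rightarrow> C2 * D | Suc n \<Rightarrow> C2 * (\<beta> * e n))" for n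
  have c': "Ep_bd T (us n) (c' n)" for n using E w0 us0 by (cases n) (auto simp: c'_def)
  have "summable (\<lambda>n. c' (Suc n))" using e by (auto simp: c'_def intro!: summable_mult sums_summable)
  then have sc: "summable c'" by (simp add: summable_Suc_iff)
  define W where "W t = (\<Sum>n. us n t)" for t
  define S where "S n t = (\<Sum>i<n. us i t)" for n t
  have W: "Ep_bd T W (suminf c')" "AE t in lebesgue_on {0<..<T}. W t \<in> X1 \<and> (\<forall>n. us n t \<in> X1) \<and> (\<lambda>n. n1 (S n t - W t)) \<longlonglongrightarrow> 0"
    using Ep_suminf[OF c' sc] unfolding W_def S_def by auto
  have tail: "Lp_bd p n1 X1 0 T (\<lambda>t. W t - S n t) (\<Sum>i. e (i + n))" for n
  proof (rule N1.Lp_bd_suminf[where f="\<lambda>i. us (i + n)"])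
    show "Lp_bd p n1 X1 0 T (us (i + n)) (e (i + n))" for i by (rule L)
    show "summable (\<lambda>i. e (i + n))" using e by (intro summable_ignore_initial_segment) (rule sums_summable)
    show "AE t in lebesgue_on {0<..<T}. W t - S n t \<in> X1"
      using W(2) by eventually_elim (auto simp: S_def intro!: N1.S_diff N1.S_sum)
    show "AE t in lebesgue_on {0<..<T}. (\<lambda>m. n1 ((\<Sum>i<m. us (i + n) t) - (W t - S n t))) \<longlonglongrightarrow> 0"
      using W(2)
    proof eventually_elim
      case (elim t)
      have "S (m + n) t = S n t + (\<Sum>i<m. us (i + n) t)" for m
        unfolding S_def by (induction m) (auto simp: add.assoc)
      then have eq: "(\<Sum>i<m. us (i + n) t) - (W t - S n t) = S (m + n) t - W t" for m by (simp add: algebra_simps)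
      have "(\<lambda>m. n1 (S m t - W t)) \<longlonglongrightarrow> 0" using elim by blast
      then show ?case unfolding eq by (rule LIMSEQ_ignore_initial_segment)
    qed
  qed (use p in auto)
  have WL: "Lp_bd p n1 X1 0 T W (2 * \<Gamma> * (C2 * D))"
    using tail[of 0] e by (simp add: S_def sums_iff)
  have BW: "Lp_bd 1 Ng Xg 0 T (\<lambda>t. B t (W t)) (\<beta> * (2 * \<Gamma> * (C2 * D)))" by (rule B_Lp[OF WL])
  obtain V where V: "Ep_bd T V (C2 * (Ng u0 + \<gamma> + (c + \<beta> * (2 * \<Gamma> * (C2 * D)))))"
      "strong_sol X1 n1 T A (\<lambda>t. g t + (h t - B t (W t))) u0 V"
    using solve[OF u0 g NG.Lp_bd_diff[OF h BW]] by auto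
  have bound: "C2 * (Ng u0 + \<gamma> + (c + \<beta> * (2 * \<Gamma> * (C2 * D)))) = C3 * D"
    by (simp add: C3_def D_def algebra_simps)
  have Sx: "\<exists>C. Ep_bd T (S n) C" for n
  proof (induction n)
    case 0 then show ?case using Ep_bd_0[of 0] by (auto simp: S_def)
  next
    case (Suc n)
    then obtain C where "Ep_bd T (S n) C" by blast
    from Ep_bd_add[OF this c'[of n]] show ?case by (auto simp: S_def)
  qed
  have Ssol: "strong_sol X1 n1 T A (\<lambda>t. g t + h t - B t (S n t)) u0 (S (Suc n))" for n
  proof (induction n)
    case 0
    have "S (Suc 0) = w0" by (auto simp: S_def us0)
    moreover have "AE t in lebesgue_on {0<..<T}. g t + h t = g t + h t - B t (S 0 t)"
      using AE_space by eventually_elim (simp add: S_def B_0 space_restrict_space)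
    ultimately show ?case using strong_sol_cong[OF w0(2)] by simp
  next
    case (Suc n)
    obtain C where C: "Ep_bd T (S (Suc n)) C" using Sx by blast
    have "strong_sol X1 n1 T A (\<lambda>t. - B t (us n t)) 0 (us (Suc n))" using Q unfolding Q_def by blast
    from strong_sol_add[OF C Suc.IH c' this]
    have *: "strong_sol X1 n1 T A (\<lambda>t. g t + h t - B t (S n t) + - B t (us n t)) u0 (S (Suc (Suc n)))"
      by (simp add: S_def[abs_def])
    show ?case
    proof (rule strong_sol_cong[OF *])
      show "AE t in lebesgue_on {0<..<T}. g t + h t - B t (S n t) + - B t (us n t) = g t + h t - B t (S (Suc n) t)"
        using W(2) AE_space
      proof eventually_elim
        case (elim t)
        then have "t \<in> {0..T}" by (simp add: space_restrict_space)
        moreover have "S n t \<in> X1" using elim by (auto simp: S_def intro!: N1.S_sum)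
        ultimately have "B t (S (Suc n) t) = B t (S n t) + B t (us n t)" using elim by (simp add: S_def B_add)
        then show ?case by (simp add: algebra_simps)
      qed
    qed
  qed
  \<comment> \<open>V and S (Suc n) have perturbation sources - B W and - B (S n), so their
    difference is driven by - B (W - S n), whose L^1 norm is at most \<beta> times a tail of e. The
    second summand passes from S (Suc n) to W.\<close>
  have close: "Lp_bd p n1 X1 0 T (\<lambda>t. V t - W t) (C2 * (\<beta> * (\<Sum>i. e (i + n))) + (\<Sum>i. e (i + Suc n)))" for n
  proof -
    obtain C where C: "Ep_bd T (S (Suc n)) C" using Sx by blast
    note d = strong_sol_diff[OF V C Ssol]
    have sm: "N1.sm 0 T (\<lambda>t. W t - S n t)" using tail[of n] by (simp add: Lp_bd_def)
    have "strong_sol X1 n1 T A (\<lambda>t. - B t (W t - S n t)) 0 (\<lambda>t. V t - S (Suc n) t)"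
    proof (rule strong_sol_cong)
      show "strong_sol X1 n1 T A (\<lambda>t. g t + (h t - B t (W t)) - (g t + h t - B t (S n t))) 0 (\<lambda>t. V t - S (Suc n) t)"
        using d(2) by simp
      show "AE t in lebesgue_on {0<..<T}. g t + (h t - B t (W t)) - (g t + h t - B t (S n t)) = - B t (W t - S n t)"
        using W(2) AE_space
      proof eventually_elim
        case (elim t)
        then have "t \<in> {0..T}" by (simp add: space_restrict_space)
        moreover have "S n t \<in> X1" using elim by (auto simp: S_def intro!: N1.S_sum)
        ultimately show ?case using elim by (simp add: B_diff)
      qed
    qed
    moreover have "Lp_bd 1 Ng Xg 0 T (\<lambda>t. - B t (W t - S n t)) (\<beta> * (\<Sum>i. e (i + n)))"
      by (rule NG.Lp_bd_minus[OF B_Lp[OF tail]]) simp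
    moreover have "NG.sm 0 T (\<lambda>t. - B t (W t - S n t))" using NG.sm_scale[OF B_sm[OF sm], of "-1"] by simp
    ultimately have "Lp_bd p n1 X1 0 T (\<lambda>t. V t - S (Suc n) t) (C2 * (\<beta> * (\<Sum>i. e (i + n))))"
      using T by (intro causal[OF d(1)]) auto
    from N1.Lp_bd_diff[OF this tail[of "Suc n"]] show ?thesis using p by simp
  qed
  have "(\<lambda>n. \<Sum>i. e (i + n)) \<longlonglongrightarrow> 0" using e by (intro suminf_exist_split2 sums_summable)
  moreover from LIMSEQ_ignore_initial_segment[OF this, of 1] have "(\<lambda>n. \<Sum>i. e (i + Suc n)) \<longlonglongrightarrow> 0" by simp
  ultimately have "(\<lambda>n. C2 * (\<beta> * (\<Sum>i. e (i + n))) + (\<Sum>i. e (i + Suc n))) \<longlonglongrightarrow> C2 * (\<beta> * 0) + 0"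
    by (intro tendsto_intros)
  then have "Lp_le p (lebesgue_on {0<..<T}) (\<lambda>t. n1 (V t - W t)) (C2 * (\<beta> * 0) + 0)"
    using Lp_le_lim[of p _ "\<lambda>n t. n1 (V t - W t)" "\<lambda>n. C2 * (\<beta> * (\<Sum>i. e (i + n))) + (\<Sum>i. e (i + Suc n))"
      "C2 * (\<beta> * 0) + 0" "\<lambda>t. n1 (V t - W t)"] p close Lp_leD(2) unfolding Lp_bd_def by fastforce
  then have "AE t in lebesgue_on {0<..<T}. n1 (V t - W t) = 0" using p by (intro Lp_le_0D[of p]) auto
  with Ep_AE_X1[OF V(1)] W(2) have eq: "AE t in lebesgue_on {0<..<T}. V t = W t"
    by eventually_elim (use n1_eq_0 N1.S_diff in force)
  have "strong_sol X1 n1 T A (\<lambda>t. g t + h t - B t (V t)) u0 V"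
  proof (rule strong_sol_cong[OF V(2)])
    show "AE t in lebesgue_on {0<..<T}. g t + (h t - B t (W t)) = g t + h t - B t (V t)"
      using eq by eventually_elim simp
  qed
  then have "strong_sol X1 n1 T (\<lambda>t x. A t x + B t x) (\<lambda>t. g t + h t) u0 V" by (simp add: strong_sol_iff[OF V(1)])
  moreover have "Ep_bd T V (C3 * D)" using V(1) unfolding bound .
  ultimately show ?thesis unfolding D_def by blast
qed

end

section \<open>Dependence of the constant and passage to the infimum over decompositions\<close>

lemma Ep_norm_cong:
  assumes "\<And>t. t \<in> {0..T} \<Longrightarrow> u t = v t"
  shows "Ep_norm X1 n1 p T u = Ep_norm X1 n1 p T v"
proof -
  have "Lp_int p n1 0 T u = Lp_int p n1 0 T v"
    unfolding Lp_int_def using assms by (intro nn_integral_cong) (auto simp: indicator_def)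
  then show ?thesis unfolding Ep_norm_def Lp_norm_def using assms by simp
qed

lemma nat_ceiling_mono: "x \<le> y \<Longrightarrow> nat \<lceil>x\<rceil> \<le> nat \<lceil>y\<rceil>" for x y :: real
  by (intro nat_mono ceiling_mono)

theorem theorem4p3:
  fixes X1 :: "'a::banach set" and n1 :: "'a \<Rightarrow> real"
    and A0 :: "'a \<Rightarrow> 'a" and p :: real
  assumes p: "1 < p"
    and X1: "embedded_banach X1 n1"
    and A0_closed: "closed_op X1 A0"
    and A0_dom: "graph_norm_equiv X1 n1 A0"
    and A0_analytic: "neg_generates_analytic X1 A0"
  shows "\<exists>\<Phi> :: real \<Rightarrow> real \<Rightarrow> real \<Rightarrow> real \<Rightarrow> real.
    (\<forall>\<beta> \<beta>' T T' c c' m m'. \<beta> \<le> \<beta>' \<longrightarrow> T \<le> T' \<longrightarrow> c \<le> c' \<longrightarrow> m \<le> m' \<longrightarrow>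
        \<Phi> \<beta> T c m \<le> \<Phi> \<beta>' T' c' m') \<and>
    (\<forall>T (A :: real \<Rightarrow> 'a \<Rightarrow> 'a) (B :: real \<Rightarrow> 'a \<Rightarrow> 'a) (b :: real \<Rightarrow> real) CA.
       0 < T \<longrightarrow>
       (\<forall>t\<in>{0..T}. bounded_lin_on X1 n1 UNIV norm (A t)) \<longrightarrow>
       (\<forall>x\<in>X1. strongly_meas norm UNIV 0 T (\<lambda>t. A t x)) \<longrightarrow>
       max_reg X1 n1 p T A \<longrightarrow>
       (\<forall>u. in_Ep X1 n1 p T u \<longrightarrow>
          in_Lp p norm UNIV 0 T (\<lambda>t. A t (u t)) \<and>
          Lp_norm p norm 0 T (\<lambda>t. A t (u t)) \<le> CA * Ep_norm X1 n1 p T u) \<longrightarrow>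
       (\<forall>t\<in>{0..T}. bounded_lin_on X1 n1 (interp_space X1 n1 (1 - 1/p) p)
                                     (interp_norm X1 n1 (1 - 1/p) p) (B t)) \<longrightarrow>
       (\<forall>x\<in>X1. strongly_meas (interp_norm X1 n1 (1 - 1/p) p)
                   (interp_space X1 n1 (1 - 1/p) p) 0 T (\<lambda>t. B t x)) \<longrightarrow>
       in_Lp (p / (p - 1)) abs UNIV 0 T b \<longrightarrow>
       (AE t in lebesgue. t \<in> {0<..<T} \<longrightarrow>
          (\<forall>x\<in>X1. interp_norm X1 n1 (1 - 1/p) p (B t x) \<le> b t * n1 x)) \<longrightarrow>
       (\<forall>u0 \<in> interp_space X1 n1 (1 - 1/p) p. \<forall>f. in_Fp X1 n1 p T f \<longrightarrow>
          (\<exists>u. in_Ep X1 n1 p T u \<and> strong_sol X1 n1 T (\<lambda>t x. A t x + B t x) f u0 u \<and>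
             (\<forall>v. in_Ep X1 n1 p T v \<and> strong_sol X1 n1 T (\<lambda>t x. A t x + B t x) f u0 v
                  \<longrightarrow> (\<forall>t\<in>{0..T}. v t = u t)) \<and>
             Ep_norm X1 n1 p T u \<le>
               \<Phi> (Lp_norm (p / (p - 1)) abs 0 T b) T CA (MR_const X1 n1 p T A) *
                 (interp_norm X1 n1 (1 - 1/p) p u0 + Fp_norm X1 n1 p T f))))"
proof -
  interpret C: couple X1 n1 p using p X1 by unfold_locales
  interpret R: nspace "UNIV :: real set" abs by unfold_locales (auto simp: abs_mult abs_triangle_ineq)
  let ?N = "interp_norm X1 n1 (1 - 1/p) p" and ?X = "interp_space X1 n1 (1 - 1/p) p"
  define q where "q = p / (p - 1)"
  have q: "1 < q" "C.q = q" using C.q by (simp_all add: q_def C.q_def)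
  \<comment> \<open>\<open>k\<close> and \<open>G\<close> are \<open>C2\<close> and \<Gamma> with
    positive parts in the arguments, which makes them monotone on all reals. The outer 2 in \<Phi>
    passes from \<open>Ep_bd\<close> to \<open>Ep_norm\<close>.\<close>
  define k where "k c m = 400 * C.c0 + 3 * q * max 0 m * (1 + 400 * C.c0 + 800 * C.c0 * max 0 c)" for c m
  define G where "G \<beta> y = (2::real) ^ (nat \<lceil>(4 * y * max 0 \<beta>) powr q\<rceil> + 1)" for \<beta> y
  define \<Phi> where "\<Phi> \<beta> (T::real) c m = 2 * (k c m * (1 + 2 * max 0 \<beta> * G \<beta> (k c m) * k c m))" for \<beta> T c m
  have c0: "1 \<le> C.c0" by (rule C.c0)
  have k0: "0 \<le> k c m" for c m using c0 q unfolding k_def by (intro add_nonneg_nonneg mult_nonneg_nonneg) auto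
  have mono: "\<Phi> \<beta> T c m \<le> \<Phi> \<beta>' T' c' m'" if le: "\<beta> \<le> \<beta>'" "T \<le> T'" "c \<le> c'" "m \<le> m'" for \<beta> \<beta>' T T' c c' m m'
  proof -
    have kk: "k c m \<le> k c' m'" unfolding k_def using c0 q le by (intro add_mono mult_mono) auto
    have bb: "max 0 \<beta> \<le> max 0 \<beta>'" using le by auto
    have "(4 * k c m * max 0 \<beta>) powr q \<le> (4 * k c' m' * max 0 \<beta>') powr q"
      using kk bb k0[of c m] k0[of c' m'] q by (intro powr_mono2 mult_mono mult_nonneg_nonneg) auto
    then have gg: "G \<beta> (k c m) \<le> G \<beta>' (k c' m')"
      unfolding G_def by (intro power_increasing add_mono nat_ceiling_mono) auto
    show ?thesis unfolding \<Phi>_def using kk bb gg k0[of c m] k0[of c' m']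
      by (intro mult_left_mono mult_mono add_mono mult_nonneg_nonneg add_nonneg_nonneg) (auto simp: G_def)
  qed
  have main: "\<exists>u. in_Ep X1 n1 p T u \<and> strong_sol X1 n1 T (\<lambda>t x. A t x + B t x) f u0 u \<and>
             (\<forall>v. in_Ep X1 n1 p T v \<and> strong_sol X1 n1 T (\<lambda>t x. A t x + B t x) f u0 v
                  \<longrightarrow> (\<forall>t\<in>{0..T}. v t = u t)) \<and>
             Ep_norm X1 n1 p T u \<le>
               \<Phi> (Lp_norm (p / (p - 1)) abs 0 T b) T CA (MR_const X1 n1 p T A) * (?N u0 + Fp_norm X1 n1 p T f)"
    if T: "0 < T" and A: "\<forall>t\<in>{0..T}. bounded_lin_on X1 n1 UNIV norm (A t)" and mr: "max_reg X1 n1 p T A"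
      and CA: "\<forall>u. in_Ep X1 n1 p T u \<longrightarrow> in_Lp p norm UNIV 0 T (\<lambda>t. A t (u t)) \<and>
          Lp_norm p norm 0 T (\<lambda>t. A t (u t)) \<le> CA * Ep_norm X1 n1 p T u"
      and B: "\<forall>t\<in>{0..T}. bounded_lin_on X1 n1 ?X ?N (B t)" "\<forall>x\<in>X1. strongly_meas ?N ?X 0 T (\<lambda>t. B t x)"
      and b: "in_Lp (p / (p - 1)) abs UNIV 0 T b"
      and Bb: "AE t in lebesgue. t \<in> {0<..<T} \<longrightarrow> (\<forall>x\<in>X1. ?N (B t x) \<le> b t * n1 x)"
      and u0: "u0 \<in> ?X" and f: "in_Fp X1 n1 p T f"
    for T A B CA u0 f and b :: "real \<Rightarrow> real"
  proof -
    define \<beta> where "\<beta> = Lp_norm (p / (p - 1)) abs 0 T b"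
    define M where "M = max 0 (MR_const X1 n1 p T A)"
    interpret P: perturbed_problem X1 n1 p T A "max 0 CA" M B b \<beta>
    proof unfold_locales
      show "MR_bound X1 n1 p T A M" unfolding M_def by (rule MR_bound_MR_const[OF mr])
      show "Lp_bd p norm UNIV 0 T (\<lambda>t. A t (u t)) (2 * max 0 CA * D)" if u: "C.Ep_bd T u D" for u D
      proof -
        have in_Lp: "in_Lp p norm UNIV 0 T (\<lambda>t. A t (u t))" and
          le: "Lp_norm p norm 0 T (\<lambda>t. A t (u t)) \<le> CA * Ep_norm X1 n1 p T u"
          using CA C.Ep_bd_in_Ep[OF u] by auto
        have "CA * Ep_norm X1 n1 p T u \<le> max 0 CA * (2 * D)"
          using C.Ep_bd_norm_le[OF u T] C.Ep_norm_nonneg[OF u T] by (intro mult_mono) auto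
        then show ?thesis using le p by (intro Lp_bd_bound_mono[OF X0.in_Lp_Lp_bd[OF in_Lp]]) auto
      qed
      show "Lp_le C.q (lebesgue_on {0<..<T}) (\<lambda>t. \<bar>b t\<bar>) \<beta>"
        using R.in_Lp_Lp_bd[OF b] q unfolding Lp_bd_def \<beta>_def q_def by simp
      show "AE t in lebesgue_on {0<..<T}. \<forall>x\<in>X1. ?N (B t x) \<le> b t * n1 x" using Bb by (simp add: AE_lebesgue_on_iff)
    qed (use T A B mr in \<open>auto simp: M_def\<close>)
    have \<Phi>_eq: "\<Phi> \<beta> T CA (MR_const X1 n1 p T A) = 2 * P.C3"
    proof -
      have k: "k CA (MR_const X1 n1 p T A) = P.C2" unfolding P.C2_def k_def q unfolding M_def ..
      have "max 0 \<beta> = \<beta>" using P.\<beta> by simp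
      then show ?thesis unfolding \<Phi>_def k P.C3_def P.\<Gamma>_def G_def q by simp
    qed
    have C3: "0 < P.C3" using P.C2 P.\<beta> unfolding P.C3_def P.\<Gamma>_def
      by (intro mult_pos_pos add_pos_nonneg mult_nonneg_nonneg) auto
    have sol: "\<exists>u. C.Ep_bd T u (P.C3 * (?N u0 + Lp_norm p norm 0 T g + Lp_norm 1 ?N 0 T h)) \<and>
        strong_sol X1 n1 T (\<lambda>t x. A t x + B t x) f u0 u" if "Fp_decomp X1 n1 p T f g h" for g h
    proof -
      have "Lp_bd p norm UNIV 0 T g (Lp_norm p norm 0 T g)"
        using that p unfolding Fp_decomp_def by (intro X0.in_Lp_Lp_bd) auto
      moreover have "Lp_bd 1 ?N ?X 0 T h (Lp_norm 1 ?N 0 T h)"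
        using that unfolding Fp_decomp_def by (intro C.NG.in_Lp_Lp_bd) auto
      ultimately obtain u where u: "C.Ep_bd T u (P.C3 * (?N u0 + Lp_norm p norm 0 T g + Lp_norm 1 ?N 0 T h))"
          "strong_sol X1 n1 T (\<lambda>t x. A t x + B t x) (\<lambda>t. g t + h t) u0 u"
        using P.solve_perturbed[OF u0] by blast
      have "AE t in lebesgue_on {0<..<T}. g t + h t = f t"
        using that unfolding Fp_decomp_def by (auto simp: AE_lebesgue_on_iff elim!: eventually_mono)
      from u(1) strong_sol_cong[OF u(2) this] show ?thesis by blast
    qed
    obtain g0 h0 where gh0: "Fp_decomp X1 n1 p T f g0 h0" using f by (auto simp: in_Fp_def)
    obtain u D where u: "C.Ep_bd T u D" "strong_sol X1 n1 T (\<lambda>t x. A t x + B t x) f u0 u"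
      using sol[OF gh0] by blast
    have uniq: "v t = u t" if v: "in_Ep X1 n1 p T v" "strong_sol X1 n1 T (\<lambda>t x. A t x + B t x) f u0 v" and "t \<in> {0..T}" for v t
      using C.in_Ep_Ep_bd[OF T v(1)] P.unique[OF u _ v(2)] that by blast
    \<comment> \<open>u was built from one decomposition of f. By uniqueness it is also the solution
      built from any other, so the estimate holds for all of them; in this rearranged form the
      infimum can be taken on the right.\<close>
    have est: "Ep_norm X1 n1 p T u / (2 * P.C3) - ?N u0 \<le> Lp_norm p norm 0 T g + Lp_norm 1 ?N 0 T h"
      if gh: "Fp_decomp X1 n1 p T f g h" for g h
    proof -
      obtain w where w: "C.Ep_bd T w (P.C3 * (?N u0 + Lp_norm p norm 0 T g + Lp_norm 1 ?N 0 T h))"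
        "strong_sol X1 n1 T (\<lambda>t x. A t x + B t x) f u0 w" using sol[OF gh] by blast
      have "Ep_norm X1 n1 p T u = Ep_norm X1 n1 p T w"
        by (rule Ep_norm_cong) (use uniq[OF C.Ep_bd_in_Ep[OF w(1)] w(2)] in auto)
      also have "\<dots> \<le> 2 * (P.C3 * (?N u0 + Lp_norm p norm 0 T g + Lp_norm 1 ?N 0 T h))"
        by (rule C.Ep_bd_norm_le[OF w(1) T])
      finally show ?thesis using C3 by (simp add: field_simps)
    qed
    have "Ep_norm X1 n1 p T u / (2 * P.C3) - ?N u0 \<le> Fp_norm X1 n1 p T f"
      unfolding Fp_norm_def by (rule cInf_greatest) (use est gh0 in auto)
    then have "Ep_norm X1 n1 p T u / (2 * P.C3) \<le> ?N u0 + Fp_norm X1 n1 p T f" by simp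
    then have "Ep_norm X1 n1 p T u \<le> (2 * P.C3) * (?N u0 + Fp_norm X1 n1 p T f)" using C3 by (simp add: field_simps)
    then show ?thesis unfolding \<beta>_def[symmetric] \<Phi>_eq using u C.Ep_bd_in_Ep[OF u(1)] uniq by blast
  qed
  show ?thesis
  proof (rule exI[of _ \<Phi>], rule conjI)
    show "\<forall>\<beta> \<beta>' T T' c c' m m'. \<beta> \<le> \<beta>' \<longrightarrow> T \<le> T' \<longrightarrow> c \<le> c' \<longrightarrow> m \<le> m' \<longrightarrow> \<Phi> \<beta> T c m \<le> \<Phi> \<beta>' T' c' m'"
      using mono by blast
  qed (intro allI impI ballI, rule main)
qed

end
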